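(* Let $\mathcal{H}=(H_n,d_i,s_j)$ be a simplicial cocommutative Hopf algebra over $\kappa$ with Moore complex of length two. Consider $$NH_2\xrightarrow{\partial_2}NH_1\xrightarrow{\partial_1}H_0 .$$ Then we have the actions - of $H_0$ on $NH_1$, given by $n\vartriangleright_\rho m=s_0(n)\vartriangleright_{ad}m$ for all $n\in H_0$, $m\in NH_1$; - of $H_0$ on $NH_2$, given by $n\vartriangleright_\rho l=s_1s_0(n)\vartriangleright_{ad}l$ for all $n\in H_0$, $l\in NH_2$; and the Peiffer lifting $\{\ ,\ \}$, taking pairs of elements of $NH_1$ to $NH_2$, given by $$\{x,y\}=\sum_{(x)(y)}\big(s_1(x')\vartriangleright_{ad}s_1(y')\big)\,S\big(s_0(x'')\vartriangleright_{ad}s_1(y'')\big)\qquad (x,y\in NH_1),$$ and these data make $NH_2\xrightarrow{\partial_2}NH_1\xrightarrow{\partial_1}H_0$ into a 2-crossed module of cocommutative Hopf algebras.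
   Context: All Hopf algebras are cocommutative over an arbitrary field $\kappa$, with coproduct $\delta(x)=\sum_{(x)}x'\otimes x''$ (iterated: $x',x'',x''',\dots$), counit $\epsilon$, antipode $S$. The zero object is $\kappa$; the zero morphism $A\to B$ is $x\mapsto\epsilon(x)1_B$. Adjoint action: $x\vartriangleright_{ad}y=\sum_{(x)}x'\,y\,S(x'')$. For a Hopf algebra map $f\colon A\to B$, $\mathrm{HKer}(f)=\{x\in A:\sum_{(x)}x'\otimes f(x'')=x\otimes 1_B\}$. A simplicial (cocommutative) Hopf algebra is a simplicial object in cocommutative Hopf algebras, with faces $d_i\colon H_n\to H_{n-1}$ and degeneracies $s_j\colon H_n\to H_{n+1}$ ($0\le i,j\le n$). Its Moore complex is $NH_0=H_0$, $NH_n=\bigcap_{i=0}^{n-1}\mathrm{HKer}(d_i)\subset H_n$ for $n\ge1$, with $\partial_n\colon NH_n\to NH_{n-1}$ the restriction of $d_n$. It has length $n$ if $NH_i$ is the zero object $\kappa$ for all $i>n$. An $H$-module bialgebra $I$ is a bialgebra with an $H$-module structure $\vartriangleright_\rho\colon H\otimes I\to I$ such that $x\vartriangleright_\rho 1=\epsilon(x)1$, $x\vartriangleright_\rho(uv)=\sum(x'\vartriangleright_\rho u)(x''\vartriangleright_\rho v)$, $\delta(x\vartriangleright_\rho v)=\sum(x'\vartriangleright_\rho v')\otimes(x''\vartriangleright_\rho v'')$, $\epsilon(x\vartriangleright_\rho v)=\epsilon(x)\epsilon(v)$. A crossed module is a Hopf algebra map $\partial\colon I\to H$ with an $H$-module bialgebra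 structure on $I$ such that $\partial(x\vartriangleright_\rho v)=x\vartriangleright_{ad}\partial(v)$ and $\partial(u)\vartriangleright_\rho v=u\vartriangleright_{ad}v$ for $x\in H$, $u,v\in I$. A 2-crossed module of Hopf algebras is a chain complex $K\xrightarrow{\partial_2}I\xrightarrow{\partial_1}H$ of Hopf algebras ($\partial_1\partial_2$ is the zero morphism) with actions $\vartriangleright_\rho$ of $H$ on $I$ and $K$, and on itself by the adjoint action, together with a bilinear map (Peiffer lifting) $\{\ ,\ \}$ from pairs of elements of $I$ to $K$ which is $H$-equivariant, i.e. $a\vartriangleright_\rho\{x,y\}=\sum_{(a)}\{a'\vartriangleright_\rho x,a''\vartriangleright_\rho y\}$, such that for all $x,y,z\in I$, $k,l\in K$: 1) it is a complex of $H$-module bialgebras: $\partial_2(a\vartriangleright_\rho k)=a\vartriangleright_\rho\partial_2(k)$ and $\partial_1(a\vartriangleright_\rho x)=a\vartriangleright_{ad}\partial_1(x)$ for $a\in H$; 2) $\partial_2\{x,y\}=\sum_{(x)(y)}(x'\vartriangleright_{ad}y')\,\big(\partial_1(x'')\vartriangleright_\rho S(y'')\big)$; 3) $\{\partial_2(k),\partial_2(l)\}=\sum_{(l)}(k\vartriangleright_{ad}l')\,S(l'')$; 4) $\{x,yz\}=\sum_{(x)(y)}\{x',y'\}\,\big((\partial_1(x'')\vartriangleright_\rho y'')\vartriangleright'_\rho\{x''',z\}\big)$; 5) $\{xy,z\}=\sum_{(x)(y)(z)}\{x',y'\vartriangleright_{ad}z'\}\,\big(\partial_1(x'')\vartriangleright_\rho\{y'',z''\}\big)$;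 6) $\sum_{(k)(x)}\{\partial_2(k'),x'\}\{x'',\partial_2(k'')\}=\sum_{(k)}k'\,\big(\partial_1(x)\vartriangleright_\rho S(k'')\big)$; where in 4) the action of $I$ on $K$ is $x\vartriangleright'_\rho k=\sum_{(k)}k'\,\{\partial_2(S(k'')),x\}$, such that $(\partial_2\colon K\to I,\vartriangleright'_\rho)$ becomes a crossed module. *)

theory Defs
  imports "HOL.Vector_Spaces" "HOL-Algebra.Group" "HOL-Library.Poly_Mapping"
begin

text \<open>
  The ground field is a type \<open>'k\<close> of class \<open>field\<close>.  The underlying vector space of an algebra is a
  subspace \<open>carrier A\<close> of an ambient vector space, whose addition is that of the type class
  \<open>ab_group_add\<close> and whose scalar multiplication is \<open>smul A\<close>.  Any family of vector spaces can be
  presented in this form over a single type, namely inside its direct sum.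

  The tensor product \<open>A \<otimes> B\<close> is the free vector space on \<open>carrier A \<times> carrier B\<close> modulo the
  relations of bilinearity.  Hence a tensor is an equivalence class of formal sums of pairs.
\<close>

record (overloaded) ('k, 'a) bialgebra = "'a monoid" +
  smul :: "'k \<Rightarrow> 'a \<Rightarrow> 'a"
  comult :: "'a \<Rightarrow> ('a \<times> 'a \<Rightarrow>\<^sub>0 'k) set"
  counit :: "'a \<Rightarrow> 'k"

record (overloaded) ('k, 'a) hopf = "('k, 'a) bialgebra" +
  antipode :: "'a \<Rightarrow> 'a"


section \<open>Tensors and Sweedler sums\<close>

definition fscale :: "'k::field \<Rightarrow> ('x \<Rightarrow>\<^sub>0 'k) \<Rightarrow> ('x \<Rightarrow>\<^sub>0 'k)" where
  "fscale c = Poly_Mapping.map (\<lambda>a. c * a)"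

abbreviation basis :: "'x \<Rightarrow> ('x \<Rightarrow>\<^sub>0 'k::field)" where
  "basis x \<equiv> Poly_Mapping.single x 1"

definition tensor_relations ::
  "('k::field, 'a::ab_group_add, 'm) bialgebra_scheme \<Rightarrow>
   ('k, 'b::ab_group_add, 'n) bialgebra_scheme \<Rightarrow> ('a \<times> 'b \<Rightarrow>\<^sub>0 'k) set" where
  "tensor_relations A B = module.span fscale
     ({basis (a + a', b) - basis (a, b) - basis (a', b) | a a' b.
         a \<in> carrier A \<and> a' \<in> carrier A \<and> b \<in> carrier B} \<union>
      {basis (a, b + b') - basis (a, b) - basis (a, b') | a b b'.
         a \<in> carrier A \<and> b \<in> carrier B \<and> b' \<in> carrier B} \<union>
      {basis (smul A c a, b) - fscale c (basis (a, b)) | c a b.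
         a \<in> carrier A \<and> b \<in> carrier B} \<union>
      {basis (a, smul B c b) - fscale c (basis (a, b)) | c a b.
         a \<in> carrier A \<and> b \<in> carrier B})"

definition tensor_class ::
  "('k::field, 'a::ab_group_add, 'm) bialgebra_scheme \<Rightarrow>
   ('k, 'b::ab_group_add, 'n) bialgebra_scheme \<Rightarrow> ('a \<times> 'b \<Rightarrow>\<^sub>0 'k) \<Rightarrow> ('a \<times> 'b \<Rightarrow>\<^sub>0 'k) set" where
  "tensor_class A B p =
     {q. Poly_Mapping.keys q \<subseteq> carrier A \<times> carrier B \<and> q - p \<in> tensor_relations A B}"

definition tensor_space ::
  "('k::field, 'a::ab_group_add, 'm) bialgebra_scheme \<Rightarrow>
   ('k, 'b::ab_group_add, 'n) bialgebra_scheme \<Rightarrow> ('a \<times> 'b \<Rightarrow>\<^sub>0 'k) set set" where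
  "tensor_space A B =
     tensor_class A B ` {p. Poly_Mapping.keys p \<subseteq> carrier A \<times> carrier B}"

text \<open>The threefold tensor power of \<open>A\<close>, needed for coassociativity only.\<close>

definition tensor3_relations ::
  "('k::field, 'a::ab_group_add, 'm) bialgebra_scheme \<Rightarrow> ('a \<times> 'a \<times> 'a \<Rightarrow>\<^sub>0 'k) set" where
  "tensor3_relations A = module.span fscale
     ({basis (a + a', b, c) - basis (a, b, c) - basis (a', b, c) | a a' b c.
         {a, a', b, c} \<subseteq> carrier A} \<union>
      {basis (a, b + b', c) - basis (a, b, c) - basis (a, b', c) | a b b' c.
         {a, b, b', c} \<subseteq> carrier A} \<union>
      {basis (a, b, c + c') - basis (a, b, c) - basis (a, b, c') | a b c c'.
         {a, b, c, c'} \<subseteq> carrier A} \<union>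
      {basis (smul A r a, b, c) - fscale r (basis (a, b, c)) | r a b c.
         {a, b, c} \<subseteq> carrier A} \<union>
      {basis (a, smul A r b, c) - fscale r (basis (a, b, c)) | r a b c.
         {a, b, c} \<subseteq> carrier A} \<union>
      {basis (a, b, smul A r c) - fscale r (basis (a, b, c)) | r a b c.
         {a, b, c} \<subseteq> carrier A})"

definition tensor3_class ::
  "('k::field, 'a::ab_group_add, 'm) bialgebra_scheme \<Rightarrow>
   ('a \<times> 'a \<times> 'a \<Rightarrow>\<^sub>0 'k) \<Rightarrow> ('a \<times> 'a \<times> 'a \<Rightarrow>\<^sub>0 'k) set" where
  "tensor3_class A p =
     {q. Poly_Mapping.keys q \<subseteq> carrier A \<times> carrier A \<times> carrier A \<and> q - p \<in> tensor3_relations A}"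

text \<open>
  \<open>sweedler A s x f\<close> is the sum of \<open>f x' x''\<close> over the coproduct of \<open>x\<close>, in a vector space with
  scalar multiplication \<open>s\<close>.  It does not depend on the chosen representative of the coproduct when
  \<open>f\<close> is bilinear on \<open>carrier A\<close>.  A tensor such as the sum of all \<open>x' \<otimes> f x''\<close> is obtained as the
  class of a Sweedler sum of basis vectors (so \<open>s = fscale\<close>), which is independent of the choice modulo
  the tensor relations.  Iterated coproducts are nested Sweedler sums.
\<close>

definition sweedler ::
  "('k::field, 'a::ab_group_add, 'm) bialgebra_scheme \<Rightarrow> ('k \<Rightarrow> 'b::ab_group_add \<Rightarrow> 'b) \<Rightarrow>
   'a \<Rightarrow> ('a \<Rightarrow> 'a \<Rightarrow> 'b) \<Rightarrow> 'b" where
  "sweedler A s x f =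
     (let p = (SOME p. p \<in> comult A x)
      in \<Sum>(u, v)\<in>Poly_Mapping.keys p. s (Poly_Mapping.lookup p (u, v)) (f u v))"


section \<open>Cocommutative Hopf algebras\<close>

definition linear_map ::
  "('k::field, 'a::ab_group_add, 'm) bialgebra_scheme \<Rightarrow>
   ('k, 'b::ab_group_add, 'n) bialgebra_scheme \<Rightarrow> ('a \<Rightarrow> 'b) \<Rightarrow> bool" where
  "linear_map A B f \<longleftrightarrow>
     f \<in> carrier A \<rightarrow> carrier B \<and>
     (\<forall>x\<in>carrier A. \<forall>y\<in>carrier A. f (x + y) = f x + f y) \<and>
     (\<forall>c. \<forall>x\<in>carrier A. f (smul A c x) = smul B c (f x))"

definition bilinear_map ::
  "('k::field, 'a::ab_group_add, 'm) bialgebra_scheme \<Rightarrow>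
   ('k, 'b::ab_group_add, 'n) bialgebra_scheme \<Rightarrow>
   ('k, 'c::ab_group_add, 'o) bialgebra_scheme \<Rightarrow> ('a \<Rightarrow> 'b \<Rightarrow> 'c) \<Rightarrow> bool" where
  "bilinear_map A B C f \<longleftrightarrow>
     (\<forall>x\<in>carrier A. linear_map B C (\<lambda>y. f x y)) \<and>
     (\<forall>y\<in>carrier B. linear_map A C (\<lambda>x. f x y))"

locale bialgebra = monoid A
  for A :: "('k::field, 'a::ab_group_add, 'm) bialgebra_scheme" (structure) +
  assumes vector_space_smul: "vector_space (smul A)"
    and subspace_carrier: "module.subspace (smul A) (carrier A)"
    and bilinear_mult: "bilinear_map A A A (mult A)"
    and comult_closed: "x \<in> carrier A \<Longrightarrow> comult A x \<in> tensor_space A A"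
    and comult_add: "\<lbrakk>x \<in> carrier A; y \<in> carrier A; p \<in> comult A x; q \<in> comult A y\<rbrakk> \<Longrightarrow>
          p + q \<in> comult A (x + y)"
    and comult_smul: "\<lbrakk>x \<in> carrier A; p \<in> comult A x\<rbrakk> \<Longrightarrow> fscale c p \<in> comult A (smul A c x)"
    and counit_add: "\<lbrakk>x \<in> carrier A; y \<in> carrier A\<rbrakk> \<Longrightarrow>
          counit A (x + y) = counit A x + counit A y"
    and counit_smul: "x \<in> carrier A \<Longrightarrow> counit A (smul A c x) = c * counit A x"
    and coassoc: "x \<in> carrier A \<Longrightarrow>
          tensor3_class A
            (sweedler A fscale x (\<lambda>x' x''. sweedler A fscale x' (\<lambda>u v. basis (u, v, x'')))) =
          tensor3_class A
            (sweedler A fscale x (\<lambda>x' x''. sweedler A fscale x'' (\<lambda>u v. basis (x', u, v))))"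
    and counit_left: "x \<in> carrier A \<Longrightarrow>
          sweedler A (smul A) x (\<lambda>x' x''. smul A (counit A x') x'') = x"
    and counit_right: "x \<in> carrier A \<Longrightarrow>
          sweedler A (smul A) x (\<lambda>x' x''. smul A (counit A x'') x') = x"
    and comult_one: "comult A \<one> = tensor_class A A (basis (\<one>, \<one>))"
    and comult_mult: "\<lbrakk>x \<in> carrier A; y \<in> carrier A\<rbrakk> \<Longrightarrow>
          comult A (x \<otimes> y) = tensor_class A A
            (sweedler A fscale x (\<lambda>x' x''. sweedler A fscale y (\<lambda>y' y''.
               basis (x' \<otimes> y', x'' \<otimes> y''))))"
    and counit_one: "counit A \<one> = 1"
    and counit_mult: "\<lbrakk>x \<in> carrier A; y \<in> carrier A\<rbrakk> \<Longrightarrow>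
          counit A (x \<otimes> y) = counit A x * counit A y"

locale cocommutative_hopf_algebra = bialgebra A
  for A :: "('k::field, 'a::ab_group_add, 'm) hopf_scheme" (structure) +
  assumes linear_antipode: "linear_map A A (antipode A)"
    and antipode_left: "x \<in> carrier A \<Longrightarrow>
          sweedler A (smul A) x (\<lambda>x' x''. antipode A x' \<otimes> x'') = smul A (counit A x) \<one>"
    and antipode_right: "x \<in> carrier A \<Longrightarrow>
          sweedler A (smul A) x (\<lambda>x' x''. x' \<otimes> antipode A x'') = smul A (counit A x) \<one>"
    and cocommutative: "x \<in> carrier A \<Longrightarrow>
          comult A x = tensor_class A A (sweedler A fscale x (\<lambda>x' x''. basis (x'', x')))"

text \<open>Compatibility of a Hopf algebra map with the antipodes is automatic.\<close>

definition hopf_map ::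
  "('k::field, 'a::ab_group_add, 'm) hopf_scheme \<Rightarrow>
   ('k, 'b::ab_group_add, 'n) hopf_scheme \<Rightarrow> ('a \<Rightarrow> 'b) \<Rightarrow> bool" where
  "hopf_map A B f \<longleftrightarrow>
     linear_map A B f \<and> f \<in> hom A B \<and> f \<one>\<^bsub>A\<^esub> = \<one>\<^bsub>B\<^esub> \<and>
     (\<forall>x\<in>carrier A. comult B (f x) =
        tensor_class B B (sweedler A fscale x (\<lambda>x' x''. basis (f x', f x'')))) \<and>
     (\<forall>x\<in>carrier A. counit B (f x) = counit A x)"

definition ad ::
  "('k::field, 'a::ab_group_add, 'm) hopf_scheme \<Rightarrow> 'a \<Rightarrow> 'a \<Rightarrow> 'a" where
  "ad A x y = sweedler A (smul A) x (\<lambda>x' x''. x' \<otimes>\<^bsub>A\<^esub> y \<otimes>\<^bsub>A\<^esub> antipode A x'')"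

definition HKer ::
  "('k::field, 'a::ab_group_add, 'm) hopf_scheme \<Rightarrow>
   ('k, 'b::ab_group_add, 'n) hopf_scheme \<Rightarrow> ('a \<Rightarrow> 'b) \<Rightarrow> 'a set" where
  "HKer A B f =
     {x \<in> carrier A.
        tensor_class A B (sweedler A fscale x (\<lambda>x' x''. basis (x', f x''))) =
        tensor_class A B (basis (x, \<one>\<^bsub>B\<^esub>))}"

text \<open>
  The structure inherited by a subspace \<open>N\<close> of \<open>A\<close>.  An element of \<open>A \<otimes> A\<close> that comes from
  \<open>N \<otimes> N\<close> is turned into an element of \<open>N \<otimes> N\<close> by keeping the representatives supported on \<open>N \<times> N\<close>.
\<close>

definition restrict_hopf ::
  "('k::field, 'a::ab_group_add) hopf \<Rightarrow> 'a set \<Rightarrow> ('k, 'a) hopf" where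
  "restrict_hopf A N =
     A\<lparr>carrier := N, comult := (\<lambda>x. {p \<in> comult A x. Poly_Mapping.keys p \<subseteq> N \<times> N})\<rparr>"

text \<open>The zero object is the ground field, embedded into \<open>A\<close> by the unit map.\<close>

definition is_zero_object :: "('k::field, 'a::ab_group_add, 'm) hopf_scheme \<Rightarrow> bool" where
  "is_zero_object A \<longleftrightarrow> carrier A = range (\<lambda>c. smul A c \<one>\<^bsub>A\<^esub>)"


section \<open>Simplicial Hopf algebras and the Moore complex\<close>

text \<open>
  \<open>d n i\<close> is the face \<open>d\<^sub>i\<close> from \<open>H n\<close> to \<open>H (n - 1)\<close> and \<open>s n j\<close> the degeneracy \<open>s\<^sub>j\<close> from \<open>H n\<close>
  to \<open>H (n + 1)\<close>.
\<close>

locale simplicial_hopf_algebra =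
  fixes H :: "nat \<Rightarrow> ('k::field, 'a::ab_group_add) hopf"
    and d :: "nat \<Rightarrow> nat \<Rightarrow> 'a \<Rightarrow> 'a"
    and s :: "nat \<Rightarrow> nat \<Rightarrow> 'a \<Rightarrow> 'a"
  assumes hopf: "cocommutative_hopf_algebra (H n)"
    and face: "i \<le> Suc n \<Longrightarrow> hopf_map (H (Suc n)) (H n) (d (Suc n) i)"
    and degeneracy: "j \<le> n \<Longrightarrow> hopf_map (H n) (H (Suc n)) (s n j)"
    and face_face: "\<lbrakk>i \<le> j; j \<le> Suc n; x \<in> carrier (H (Suc (Suc n)))\<rbrakk> \<Longrightarrow>
          d (Suc n) i (d (Suc (Suc n)) (Suc j) x) = d (Suc n) j (d (Suc (Suc n)) i x)"
    and degeneracy_degeneracy: "\<lbrakk>i \<le> j; j \<le> n; x \<in> carrier (H n)\<rbrakk> \<Longrightarrow>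
          s (Suc n) i (s n j x) = s (Suc n) (Suc j) (s n i x)"
    and face_degeneracy_less: "\<lbrakk>i \<le> j; j \<le> n; x \<in> carrier (H (Suc n))\<rbrakk> \<Longrightarrow>
          d (Suc (Suc n)) i (s (Suc n) (Suc j) x) = s n j (d (Suc n) i x)"
    and face_degeneracy_same: "\<lbrakk>j \<le> n; x \<in> carrier (H n)\<rbrakk> \<Longrightarrow> d (Suc n) j (s n j x) = x"
    and face_degeneracy_Suc: "\<lbrakk>j \<le> n; x \<in> carrier (H n)\<rbrakk> \<Longrightarrow> d (Suc n) (Suc j) (s n j x) = x"
    and face_degeneracy_greater: "\<lbrakk>j < i; i \<le> Suc n; x \<in> carrier (H (Suc n))\<rbrakk> \<Longrightarrow>
          d (Suc (Suc n)) (Suc i) (s (Suc n) j x) = s n j (d (Suc n) i x)"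

definition moore ::
  "(nat \<Rightarrow> ('k::field, 'a::ab_group_add) hopf) \<Rightarrow> (nat \<Rightarrow> nat \<Rightarrow> 'a \<Rightarrow> 'a) \<Rightarrow> nat \<Rightarrow> ('k, 'a) hopf"
  where
  "moore H d n =
     (if n = 0 then H 0
      else restrict_hopf (H n) (\<Inter>i\<in>{..<n}. HKer (H n) (H (n - 1)) (d n i)))"

definition moore_length ::
  "(nat \<Rightarrow> ('k::field, 'a::ab_group_add) hopf) \<Rightarrow> (nat \<Rightarrow> nat \<Rightarrow> 'a \<Rightarrow> 'a) \<Rightarrow> nat \<Rightarrow> bool" where
  "moore_length H d n \<longleftrightarrow> (\<forall>i>n. is_zero_object (moore H d i))"


section \<open>Crossed modules and 2-crossed modules\<close>

locale module_bialgebra = H: bialgebra H + I: bialgebra I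
  for H :: "('k::field, 'h::ab_group_add, 'm) bialgebra_scheme"
    and I :: "('k, 'i::ab_group_add, 'n) bialgebra_scheme" +
  fixes act :: "'h \<Rightarrow> 'i \<Rightarrow> 'i"
  assumes bilinear_act: "bilinear_map H I I act"
    and act_one_left: "v \<in> carrier I \<Longrightarrow> act \<one>\<^bsub>H\<^esub> v = v"
    and act_mult_left: "\<lbrakk>x \<in> carrier H; y \<in> carrier H; v \<in> carrier I\<rbrakk> \<Longrightarrow>
          act (x \<otimes>\<^bsub>H\<^esub> y) v = act x (act y v)"
    and act_one: "x \<in> carrier H \<Longrightarrow> act x \<one>\<^bsub>I\<^esub> = smul I (counit H x) \<one>\<^bsub>I\<^esub>"
    and act_mult: "\<lbrakk>x \<in> carrier H; u \<in> carrier I; v \<in> carrier I\<rbrakk> \<Longrightarrow>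
          act x (u \<otimes>\<^bsub>I\<^esub> v) = sweedler H (smul I) x (\<lambda>x' x''. act x' u \<otimes>\<^bsub>I\<^esub> act x'' v)"
    and comult_act: "\<lbrakk>x \<in> carrier H; v \<in> carrier I\<rbrakk> \<Longrightarrow>
          comult I (act x v) = tensor_class I I
            (sweedler H fscale x (\<lambda>x' x''. sweedler I fscale v (\<lambda>v' v''.
               basis (act x' v', act x'' v''))))"
    and counit_act: "\<lbrakk>x \<in> carrier H; v \<in> carrier I\<rbrakk> \<Longrightarrow>
          counit I (act x v) = counit H x * counit I v"

locale hopf_crossed_module =
  I: cocommutative_hopf_algebra I + H: cocommutative_hopf_algebra H + module_bialgebra H I act
  for I :: "('k::field, 'i::ab_group_add, 'n) hopf_scheme"
    and H :: "('k, 'h::ab_group_add, 'm) hopf_scheme"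
    and bd :: "'i \<Rightarrow> 'h"
    and act :: "'h \<Rightarrow> 'i \<Rightarrow> 'i" +
  assumes hopf_map_bd: "hopf_map I H bd"
    and bd_act: "\<lbrakk>x \<in> carrier H; v \<in> carrier I\<rbrakk> \<Longrightarrow> bd (act x v) = ad H x (bd v)"
    and act_bd: "\<lbrakk>u \<in> carrier I; v \<in> carrier I\<rbrakk> \<Longrightarrow> act (bd u) v = ad I u v"

definition lifting_act ::
  "('k::field, 'c::ab_group_add, 'p) hopf_scheme \<Rightarrow> ('c \<Rightarrow> 'i) \<Rightarrow> ('i \<Rightarrow> 'i \<Rightarrow> 'c) \<Rightarrow>
   'i \<Rightarrow> 'c \<Rightarrow> 'c" where
  "lifting_act K bd2 pl x k =
     sweedler K (smul K) k (\<lambda>k' k''. k' \<otimes>\<^bsub>K\<^esub> pl (bd2 (antipode K k'')) x)"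

locale hopf_two_crossed_module =
  K: cocommutative_hopf_algebra K +
  I: cocommutative_hopf_algebra I +
  H: cocommutative_hopf_algebra H +
  HK: module_bialgebra H K actK +
  HI: module_bialgebra H I actI +
  HH: module_bialgebra H H "ad H"
  for K :: "('k::field, 'c::ab_group_add, 'p) hopf_scheme"
    and I :: "('k, 'i::ab_group_add, 'n) hopf_scheme"
    and H :: "('k, 'h::ab_group_add, 'm) hopf_scheme"
    and bd2 :: "'c \<Rightarrow> 'i"
    and bd1 :: "'i \<Rightarrow> 'h"
    and actK :: "'h \<Rightarrow> 'c \<Rightarrow> 'c"
    and actI :: "'h \<Rightarrow> 'i \<Rightarrow> 'i" +
  fixes pl :: "'i \<Rightarrow> 'i \<Rightarrow> 'c"
  assumes hopf_map_bd2: "hopf_map K I bd2"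
    and hopf_map_bd1: "hopf_map I H bd1"
    and complex: "k \<in> carrier K \<Longrightarrow> bd1 (bd2 k) = smul H (counit K k) \<one>\<^bsub>H\<^esub>"
    and bilinear_lifting: "bilinear_map I I K pl"
    and lifting_equivariant: "\<lbrakk>a \<in> carrier H; x \<in> carrier I; y \<in> carrier I\<rbrakk> \<Longrightarrow>
          actK a (pl x y) = sweedler H (smul K) a (\<lambda>a' a''. pl (actI a' x) (actI a'' y))"
    and bd2_equivariant: "\<lbrakk>a \<in> carrier H; k \<in> carrier K\<rbrakk> \<Longrightarrow> bd2 (actK a k) = actI a (bd2 k)"
    and bd1_equivariant: "\<lbrakk>a \<in> carrier H; x \<in> carrier I\<rbrakk> \<Longrightarrow> bd1 (actI a x) = ad H a (bd1 x)"
    and bd2_lifting: "\<lbrakk>x \<in> carrier I; y \<in> carrier I\<rbrakk> \<Longrightarrow>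
          bd2 (pl x y) =
            sweedler I (smul I) x (\<lambda>x' x''. sweedler I (smul I) y (\<lambda>y' y''.
              ad I x' y' \<otimes>\<^bsub>I\<^esub> actI (bd1 x'') (antipode I y'')))"
    and lifting_bd2_bd2: "\<lbrakk>k \<in> carrier K; l \<in> carrier K\<rbrakk> \<Longrightarrow>
          pl (bd2 k) (bd2 l) =
            sweedler K (smul K) l (\<lambda>l' l''. ad K k l' \<otimes>\<^bsub>K\<^esub> antipode K l'')"
    and lifting_mult_right: "\<lbrakk>x \<in> carrier I; y \<in> carrier I; z \<in> carrier I\<rbrakk> \<Longrightarrow>
          pl x (y \<otimes>\<^bsub>I\<^esub> z) =
            sweedler I (smul K) x (\<lambda>x' w. sweedler I (smul K) w (\<lambda>x'' x'''.
              sweedler I (smul K) y (\<lambda>y' y''.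
                pl x' y' \<otimes>\<^bsub>K\<^esub> lifting_act K bd2 pl (actI (bd1 x'') y'') (pl x''' z))))"
    and lifting_mult_left: "\<lbrakk>x \<in> carrier I; y \<in> carrier I; z \<in> carrier I\<rbrakk> \<Longrightarrow>
          pl (x \<otimes>\<^bsub>I\<^esub> y) z =
            sweedler I (smul K) x (\<lambda>x' x''. sweedler I (smul K) y (\<lambda>y' y''.
              sweedler I (smul K) z (\<lambda>z' z''.
                pl x' (ad I y' z') \<otimes>\<^bsub>K\<^esub> actK (bd1 x'') (pl y'' z''))))"
    and lifting_bd2_lifting: "\<lbrakk>k \<in> carrier K; x \<in> carrier I\<rbrakk> \<Longrightarrow>
          sweedler K (smul K) k (\<lambda>k' k''. sweedler I (smul K) x (\<lambda>x' x''.
            pl (bd2 k') x' \<otimes>\<^bsub>K\<^esub> pl x'' (bd2 k''))) =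
          sweedler K (smul K) k (\<lambda>k' k''. k' \<otimes>\<^bsub>K\<^esub> actK (bd1 x) (antipode K k''))"
    and crossed_module_bd2: "hopf_crossed_module K I bd2 (lifting_act K bd2 pl)"

end

theory Submission
  imports Defs
begin

text \<open>
  A cocommutative Hopf algebra \<open>A\<close> is a group object in the category of cocommutative coalgebras:
  for every cocommutative coalgebra \<open>C\<close>, the coalgebra maps from \<open>C\<close> to \<open>A\<close>, called the points of
  \<open>A\<close> over \<open>C\<close> below, form a group under convolution, in which the inverse of \<open>f\<close> is \<open>S \<circ> f\<close>
  (\<open>group_conv\<close>, \<open>inv_conv\<close>).  Hopf maps induce group homomorphisms, the adjoint action induces
  conjugation (\<open>csum_ad\<close>) and Hopf kernels become kernels (\<open>coalg_map_HKer\<close>).  A simplicial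
  cocommutative Hopf algebra thus yields a simplicial group for every \<open>C\<close>, and if the Moore complex
  has length two, an element of degree three in the kernels of the first three faces is trivial.

  For such a simplicial group the theorem is a classical computation.  Elements of \<open>G 3\<close> commute if
  each of the first three faces kills one of them (\<open>commute_3\<close>).  Taking products of degeneracies and
  applying the last face, one sees that in \<open>G 2\<close> the intersection of the kernels of two faces
  commutes with the kernel of the third one (\<open>commute_01_2\<close>, \<open>commute_02_1\<close>, \<open>commute_12_0\<close>).
  All axioms of the lifting follow from these three relations and the simplicial identities.

  The passage back to Hopf algebras rests on generic points.  Over a field, \<open>A\<close> has a basis, and the
  structure constants of the coproduct in this basis define a coalgebra with a point whose values
  span \<open>A\<close> (\<open>presentation\<close>).  Two or three such points become points over one coalgebra, the
  tensor product, and stay independent (\<open>generic_points2\<close>, \<open>generic_points3\<close>).  Hence multilinear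
  maps that agree at all points are equal.  The two sides of each axiom are multilinear, and
  at points their Sweedler sums are words in the convolution groups (\<open>csum_conv2\<close>, \<open>csum_conv3\<close>,
  \<open>split_first\<close>, \<open>split_second\<close>); so each axiom is a group identity.  The same argument shows that
  adjoint actions are module bialgebras (\<open>module_bialgebra_act\<close>), and, with membership in a subspace
  in place of equality, that the Moore complex is closed under the actions and the lifting.

  Beneath this lie two facts of linear algebra.  Tensors are separated by pairs of functionals
  (\<open>tensor_relations_iff\<close>), which reduces identities between classes of tensors to identities of
  scalars.  A Hopf kernel is stable under contraction of the coproduct with functionals
  (\<open>HKer_stable\<close>), and therefore the coproduct of an element of the Moore complex can be represented
  inside the Moore complex (\<open>comult_restricts\<close>); so its terms are Hopf algebras.
\<close>

section \<open>Formal sums and their linear extension\<close>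

lemma lookup_fscale [simp]: "Poly_Mapping.lookup (fscale c p) x = c * Poly_Mapping.lookup p x"
  by (simp add: fscale_def Poly_Mapping.map.rep_eq when_def)

lemma keys_fscale: "Poly_Mapping.keys (fscale c p) \<subseteq> Poly_Mapping.keys p"
  by (auto simp: in_keys_iff)

lemma vector_space_fscale: "vector_space (fscale :: 'k::field \<Rightarrow> ('x \<Rightarrow>\<^sub>0 'k) \<Rightarrow> _)"
  by unfold_locales (auto intro!: poly_mapping_eqI simp: lookup_add algebra_simps)

lemma vector_space_mult: "vector_space ((*) :: 'k::field \<Rightarrow> 'k \<Rightarrow> 'k)"
  by unfold_locales (auto simp: algebra_simps)

definition lsum :: "('k::field \<Rightarrow> 'v::ab_group_add \<Rightarrow> 'v) \<Rightarrow> ('x \<Rightarrow>\<^sub>0 'k) \<Rightarrow> ('x \<Rightarrow> 'v) \<Rightarrow> 'v" where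
  "lsum s p f = (\<Sum>x\<in>Poly_Mapping.keys p. s (Poly_Mapping.lookup p x) (f x))"

lemma lsum_cong:
  assumes "p = q" "\<And>x. x \<in> Poly_Mapping.keys q \<Longrightarrow> f x = g x"
  shows "lsum s p f = lsum s q g"
  using assms by (simp add: lsum_def)

context vector_space begin

lemma lsum_superset:
  assumes "finite F" "Poly_Mapping.keys p \<subseteq> F"
  shows "lsum scale p f = (\<Sum>x\<in>F. scale (Poly_Mapping.lookup p x) (f x))"
  unfolding lsum_def by (rule sum.mono_neutral_left[OF assms]) (auto simp: in_keys_iff)

lemma lsum_add: "lsum scale (p + q) f = lsum scale p f + lsum scale q f"
proof -
  let ?F = "Poly_Mapping.keys p \<union> Poly_Mapping.keys q"
  have "lsum scale r f = (\<Sum>x\<in>?F. scale (Poly_Mapping.lookup r x) (f x))"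
    if "Poly_Mapping.keys r \<subseteq> ?F" for r
    using that by (intro lsum_superset) auto
  then show ?thesis
    by (simp add: Poly_Mapping.keys_add lookup_add scale_left_distrib sum.distrib)
qed

lemma lsum_fscale: "lsum scale (fscale c p) f = scale c (lsum scale p f)"
proof -
  have "lsum scale (fscale c p) f =
      (\<Sum>x\<in>Poly_Mapping.keys p. scale (Poly_Mapping.lookup (fscale c p) x) (f x))"
    by (rule lsum_superset) (auto simp: keys_fscale)
  then show ?thesis by (simp add: lsum_def scale_sum_right)
qed

lemma lsum_zero [simp]: "lsum scale 0 f = 0"
  by (simp add: lsum_def)

lemma lsum_basis [simp]: "lsum scale (basis x) f = f x"
  by (simp add: lsum_def)

lemma lsum_diff: "lsum scale (p - q) f = lsum scale p f - lsum scale q f"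
  using lsum_add[of "p - q" q f] by (simp add: algebra_simps)

lemma lsum_sum: "lsum scale (sum p X) f = (\<Sum>x\<in>X. lsum scale (p x) f)"
  by (induction X rule: infinite_finite_induct) (simp_all add: lsum_add)

lemma lsum_body_add: "lsum scale p (\<lambda>x. f x + g x) = lsum scale p f + lsum scale p g"
  by (simp add: lsum_def scale_right_distrib sum.distrib)

lemma lsum_body_diff: "lsum scale p (\<lambda>x. f x - g x) = lsum scale p f - lsum scale p g"
  by (simp add: lsum_def scale_right_diff_distrib sum_subtractf)

lemma lsum_body_scale: "lsum scale p (\<lambda>x. scale c (f x)) = scale c (lsum scale p f)"
  by (simp add: lsum_def scale_sum_right mult.commute)

lemma lsum_bind: "lsum scale (lsum fscale p g) f = lsum scale p (\<lambda>x. lsum scale (g x) f)"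
  by (simp add: lsum_def[of fscale] lsum_sum lsum_fscale lsum_def[of scale p])

lemma lsum_swap: "lsum scale p (\<lambda>x. lsum scale q (f x)) = lsum scale q (\<lambda>y. lsum scale p (\<lambda>x. f x y))"
  unfolding lsum_def scale_sum_right
  by (subst sum.swap) (simp add: mult.commute)

lemma lsum_in_subspace:
  assumes "subspace W" "\<And>x. x \<in> Poly_Mapping.keys p \<Longrightarrow> f x \<in> W"
  shows "lsum scale p f \<in> W"
  unfolding lsum_def by (intro subspace_sum subspace_scale assms)

end

lemma lsum_basis_eq: "lsum fscale p basis = p"
proof (rule poly_mapping_eqI)
  fix x
  have "Poly_Mapping.lookup (lsum fscale p basis) x =
    (\<Sum>y\<in>Poly_Mapping.keys p. if y = x then Poly_Mapping.lookup p y else 0)"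
    unfolding lsum_def lookup_sum by (intro sum.cong) (auto simp: lookup_single when_def)
  then show "Poly_Mapping.lookup (lsum fscale p basis) x = Poly_Mapping.lookup p x"
    by (simp add: in_keys_iff)
qed

lemma keys_lsum:
  assumes "\<And>x. x \<in> Poly_Mapping.keys p \<Longrightarrow> Poly_Mapping.keys (g x) \<subseteq> Y"
  shows "Poly_Mapping.keys (lsum fscale p g) \<subseteq> Y"
proof -
  interpret F: vector_space "fscale :: 'b \<Rightarrow> ('c \<Rightarrow>\<^sub>0 'b) \<Rightarrow> _" by (rule vector_space_fscale)
  have "F.subspace {q. Poly_Mapping.keys q \<subseteq> Y}"
    unfolding F.subspace_def
    by (auto dest!: subsetD[OF Poly_Mapping.keys_add] subsetD[OF keys_fscale])
  from F.lsum_in_subspace[OF this, of p g] assms show ?thesis by auto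
qed

text \<open>Linearity on a carrier only: nothing is known about operations outside the carriers.\<close>

definition linear_on :: "('k::field, 'a::ab_group_add, 'm) bialgebra_scheme \<Rightarrow>
    ('k \<Rightarrow> 'v::ab_group_add \<Rightarrow> 'v) \<Rightarrow> ('a \<Rightarrow> 'v) \<Rightarrow> bool" where
  "linear_on A s f \<longleftrightarrow>
     (\<forall>x\<in>carrier A. \<forall>y\<in>carrier A. f (x + y) = f x + f y) \<and>
     (\<forall>c. \<forall>x\<in>carrier A. f (smul A c x) = s c (f x))"

definition bilinear_on :: "('k::field, 'a::ab_group_add, 'm) bialgebra_scheme \<Rightarrow>
    ('k, 'b::ab_group_add, 'n) bialgebra_scheme \<Rightarrow>
    ('k \<Rightarrow> 'v::ab_group_add \<Rightarrow> 'v) \<Rightarrow> ('a \<Rightarrow> 'b \<Rightarrow> 'v) \<Rightarrow> bool" where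
  "bilinear_on A B s f \<longleftrightarrow>
     (\<forall>b\<in>carrier B. linear_on A s (\<lambda>a. f a b)) \<and> (\<forall>a\<in>carrier A. linear_on B s (f a))"

lemma linear_map_iff: "linear_map A B f \<longleftrightarrow> f \<in> carrier A \<rightarrow> carrier B \<and> linear_on A (smul B) f"
  by (simp add: linear_map_def linear_on_def)

definition subspace_of :: "('k::field, 'a::ab_group_add, 'm) bialgebra_scheme \<Rightarrow> bool" where
  "subspace_of A \<longleftrightarrow> vector_space (smul A) \<and> module.subspace (smul A) (carrier A)"

lemma subspace_ofD:
  assumes "subspace_of A"
  shows "vector_space (smul A)" "module.subspace (smul A) (carrier A)"
    "0 \<in> carrier A" "x \<in> carrier A \<Longrightarrow> y \<in> carrier A \<Longrightarrow> x + y \<in> carrier A"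
    "x \<in> carrier A \<Longrightarrow> y \<in> carrier A \<Longrightarrow> x - y \<in> carrier A"
    "x \<in> carrier A \<Longrightarrow> smul A c x \<in> carrier A"
proof -
  show V: "vector_space (smul A)" and S: "module.subspace (smul A) (carrier A)"
    using assms by (auto simp: subspace_of_def)
  interpret vector_space "smul A" by fact
  show "0 \<in> carrier A" "x \<in> carrier A \<Longrightarrow> y \<in> carrier A \<Longrightarrow> x + y \<in> carrier A"
    "x \<in> carrier A \<Longrightarrow> y \<in> carrier A \<Longrightarrow> x - y \<in> carrier A"
    "x \<in> carrier A \<Longrightarrow> smul A c x \<in> carrier A"
    using S by (auto intro: subspace_0 subspace_add subspace_diff subspace_scale)
qed

lemma lsum_closed:
  assumes "subspace_of A" "\<And>x. x \<in> Poly_Mapping.keys p \<Longrightarrow> f x \<in> carrier A"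
  shows "lsum (smul A) p f \<in> carrier A"
  using vector_space.lsum_in_subspace[OF subspace_ofD(1,2)[OF assms(1)]] assms(2) .

text \<open>
  A map that is linear up to a subspace \<open>T\<close> commutes with linear combinations up to \<open>T\<close>.  The case
  \<open>T = {0}\<close> is ordinary linearity, and taking the tensor relations for \<open>T\<close> allows to expand tensors.
\<close>

lemma linear_mod_lsum:
  assumes A: "subspace_of A" and s: "vector_space s" and T: "module.subspace s T"
    and add: "\<And>x y. x \<in> carrier A \<Longrightarrow> y \<in> carrier A \<Longrightarrow> h (x + y) - h x - h y \<in> T"
    and scl: "\<And>c x. x \<in> carrier A \<Longrightarrow> h (smul A c x) - s c (h x) \<in> T"
    and f: "\<And>x. x \<in> Poly_Mapping.keys p \<Longrightarrow> f x \<in> carrier A"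
  shows "h (lsum (smul A) p f) - lsum s p (\<lambda>x. h (f x)) \<in> T"
proof -
  interpret A: vector_space "smul A" using A by (rule subspace_ofD)
  interpret s: vector_space s by fact
  have h0: "h 0 \<in> T"
    using scl[of 0 0] subspace_ofD(3)[OF A] by simp
  have "finite X \<Longrightarrow> X \<subseteq> Poly_Mapping.keys p \<Longrightarrow>
      h (\<Sum>x\<in>X. smul A (Poly_Mapping.lookup p x) (f x)) -
      (\<Sum>x\<in>X. s (Poly_Mapping.lookup p x) (h (f x))) \<in> T \<and>
      (\<Sum>x\<in>X. smul A (Poly_Mapping.lookup p x) (f x)) \<in> carrier A" for X
  proof (induction X rule: finite_induct)
    case empty
    then show ?case using h0 subspace_ofD(3)[OF A] by simp
  next
    case (insert x X)
    let ?u = "smul A (Poly_Mapping.lookup p x) (f x)"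
    let ?v = "\<Sum>x\<in>X. smul A (Poly_Mapping.lookup p x) (f x)"
    let ?w = "\<Sum>x\<in>X. s (Poly_Mapping.lookup p x) (h (f x))"
    have u: "?u \<in> carrier A" and v: "?v \<in> carrier A" and IH: "h ?v - ?w \<in> T"
      using insert f subspace_ofD[OF A] by auto
    have "(h (?u + ?v) - h ?u - h ?v) +
        (h ?u - s (Poly_Mapping.lookup p x) (h (f x))) + (h ?v - ?w) \<in> T"
      using add[OF u v] scl[of "f x"] f insert.prems IH by (intro s.subspace_add[OF T]) auto
    then show ?case using insert.hyps u v subspace_ofD[OF A] by (simp add: algebra_simps)
  qed
  then show ?thesis by (simp add: lsum_def)
qed

lemma linear_on_lsum:
  assumes A: "subspace_of A" and s: "vector_space s" and h: "linear_on A s h"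
    and f: "\<And>x. x \<in> Poly_Mapping.keys p \<Longrightarrow> f x \<in> carrier A"
  shows "h (lsum (smul A) p f) = lsum s p (\<lambda>x. h (f x))"
proof -
  interpret s: vector_space s by fact
  have "h (lsum (smul A) p f) - lsum s p (\<lambda>x. h (f x)) \<in> {0}"
    using h by (intro linear_mod_lsum[OF A s _ _ _ f]) (auto simp: linear_on_def)
  then show ?thesis by simp
qed

lemma lookup_lsum:
  "Poly_Mapping.lookup (lsum fscale p g) y = lsum (*) p (\<lambda>x. Poly_Mapping.lookup (g x) y)"
  by (simp add: lsum_def lookup_sum)

section \<open>Coordinates\<close>

text \<open>
  Coordinates are taken on the whole ambient space, so that each coordinate is a functional defined
  everywhere.  The basis extends a basis \<open>E\<close> of \<open>U\<close>, which extends a basis \<open>D\<close> of \<open>N\<close>.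
\<close>

lemma (in vector_space) coordinates_exist:
  assumes N: "subspace N" and U: "subspace U" and NU: "N \<subseteq> U"
  obtains R :: "'b \<Rightarrow> ('b \<Rightarrow>\<^sub>0 'a)" and D E where
    "\<And>x y. R (x + y) = R x + R y" "\<And>c x. R (scale c x) = fscale c (R x)"
    "D \<subseteq> N" "D \<subseteq> E" "E \<subseteq> U" "\<And>e. e \<in> E \<Longrightarrow> R e = basis e"
    "\<And>x. x \<in> N \<Longrightarrow> Poly_Mapping.keys (R x) \<subseteq> D"
    "\<And>x. x \<in> U \<Longrightarrow> Poly_Mapping.keys (R x) \<subseteq> E"
    "\<And>x. lsum scale (R x) (\<lambda>e. e) = x"
proof -
  obtain D where D: "D \<subseteq> N" "independent D" "N \<subseteq> span D"
    using maximal_independent_subset by blast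
  obtain E where E: "D \<subseteq> E" "E \<subseteq> U" "independent E" "U \<subseteq> span E"
    using maximal_independent_subset_extend[of D U] D NU by (metis order_trans)
  define B where "B = extend_basis E"
  have B: "E \<subseteq> B" "independent B" "span B = UNIV"
    unfolding B_def using E(3) by (simp_all add: extend_basis_superset independent_extend_basis)
  define R where "R x = Abs_poly_mapping (representation B x)" for x
  have lk: "Poly_Mapping.lookup (R x) = representation B x" for x
    using finite_representation[of B x] by (simp add: R_def)
  have supp: "Poly_Mapping.keys (R x) \<subseteq> F" if "F \<subseteq> B" "x \<in> span F" for F x
  proof -
    have "representation B x = representation F x"
      using representation_extend[OF B(2) that(2) that(1)] .
    then show ?thesis using representation_ne_zero[of F x] by (auto simp: in_keys_iff lk)
  qed
  show ?thesis
  proof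
    show "R (x + y) = R x + R y" for x y
      using B by (intro poly_mapping_eqI) (simp add: lk lookup_add representation_add)
    show "R (scale c x) = fscale c (R x)" for c x
      using B by (intro poly_mapping_eqI) (simp add: lk representation_scale)
    show "R e = basis e" if "e \<in> E" for e
      using B that by (intro poly_mapping_eqI)
        (auto simp: lk representation_basis lookup_single when_def)
    show "D \<subseteq> N" "D \<subseteq> E" "E \<subseteq> U" by fact+
    show "x \<in> N \<Longrightarrow> Poly_Mapping.keys (R x) \<subseteq> D" "x \<in> U \<Longrightarrow> Poly_Mapping.keys (R x) \<subseteq> E" for x
      using supp[of D x] supp[of E x] D E B by blast+
    show "lsum scale (R x) (\<lambda>e. e) = x" for x
    proof -
      have "Poly_Mapping.keys (R x) = {b. representation B x b \<noteq> 0}"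
        by (auto simp: in_keys_iff lk)
      then show ?thesis
        using B sum_nonzero_representation_eq[of B x] by (simp add: lsum_def lk)
    qed
  qed
qed

section \<open>Tensors are detected by pairs of functionals\<close>

text \<open>
  Functionals live on the ambient space.  Over a field this loses nothing, since functionals on a
  subspace extend.
\<close>

definition functional :: "('k::field \<Rightarrow> 'v::ab_group_add \<Rightarrow> 'v) \<Rightarrow> ('v \<Rightarrow> 'k) \<Rightarrow> bool" where
  "functional s \<phi> \<longleftrightarrow> (\<forall>x y. \<phi> (x + y) = \<phi> x + \<phi> y) \<and> (\<forall>c x. \<phi> (s c x) = c * \<phi> x)"

definition pairing :: "('a \<Rightarrow> 'k::field) \<Rightarrow> ('b \<Rightarrow> 'k) \<Rightarrow> ('a \<times> 'b \<Rightarrow>\<^sub>0 'k) \<Rightarrow> 'k" where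
  "pairing \<phi> \<psi> p = lsum (*) p (\<lambda>(a, b). \<phi> a * \<psi> b)"

definition pairing3 :: "('a \<Rightarrow> 'k::field) \<Rightarrow> ('a \<Rightarrow> 'k) \<Rightarrow> ('a \<Rightarrow> 'k) \<Rightarrow> ('a \<times> 'a \<times> 'a \<Rightarrow>\<^sub>0 'k) \<Rightarrow> 'k" where
  "pairing3 \<phi> \<psi> \<chi> p = lsum (*) p (\<lambda>(a, b, c). \<phi> a * \<psi> b * \<chi> c)"

lemma pairing_diff: "pairing \<phi> \<psi> (p - q) = pairing \<phi> \<psi> p - pairing \<phi> \<psi> q"
  by (simp add: pairing_def vector_space.lsum_diff[OF vector_space_mult])

lemma pairing3_diff: "pairing3 \<phi> \<psi> \<chi> (p - q) = pairing3 \<phi> \<psi> \<chi> p - pairing3 \<phi> \<psi> \<chi> q"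
  by (simp add: pairing3_def vector_space.lsum_diff[OF vector_space_mult])

lemma functional_bilinear:
  assumes "functional (smul A) \<phi>" "functional (smul B) \<psi>"
  shows "bilinear_on A B (*) (\<lambda>a b. \<phi> a * \<psi> b)"
  using assms by (simp add: functional_def bilinear_on_def linear_on_def algebra_simps)

lemma subspace_tensor_relations:
  fixes A :: "('k::field, 'a::ab_group_add, 'm) bialgebra_scheme"
    and B :: "('k, 'b::ab_group_add, 'n) bialgebra_scheme"
  shows "module.subspace fscale (tensor_relations A B)"
proof -
  interpret F: vector_space "fscale :: 'k \<Rightarrow> ('a \<times> 'b \<Rightarrow>\<^sub>0 'k) \<Rightarrow> _" by (rule vector_space_fscale)
  show ?thesis unfolding tensor_relations_def by (rule F.subspace_span)
qed

lemma subspace_tensor3_relations: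
  fixes A :: "('k::field, 'a::ab_group_add, 'm) bialgebra_scheme"
  shows "module.subspace fscale (tensor3_relations A)"
proof -
  interpret F: vector_space "fscale :: 'k \<Rightarrow> ('a \<times> 'a \<times> 'a \<Rightarrow>\<^sub>0 'k) \<Rightarrow> _" by (rule vector_space_fscale)
  show ?thesis unfolding tensor3_relations_def by (rule F.subspace_span)
qed

lemma lsum_tensor_relation:
  fixes f :: "'a::ab_group_add \<Rightarrow> 'b::ab_group_add \<Rightarrow> 'v::ab_group_add"
    and A :: "('k::field, 'a, 'm) bialgebra_scheme"
  assumes s: "vector_space s" and f: "bilinear_on A B s f" and r: "r \<in> tensor_relations A B"
  shows "lsum s r (\<lambda>(a, b). f a b) = 0"
proof -
  interpret s: vector_space s by fact
  interpret F: vector_space "fscale :: 'k \<Rightarrow> ('a \<times> 'b \<Rightarrow>\<^sub>0 'k) \<Rightarrow> _" by (rule vector_space_fscale)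
  let ?Z = "{r. lsum s r (\<lambda>(a, b). f a b) = 0}"
  have "F.subspace ?Z"
    by (auto simp: F.subspace_def s.lsum_add s.lsum_fscale)
  then have "tensor_relations A B \<subseteq> ?Z"
    unfolding tensor_relations_def
    by (intro F.span_minimal)
      (use f in \<open>auto simp: s.lsum_diff s.lsum_fscale bilinear_on_def linear_on_def\<close>)
  with r show ?thesis by auto
qed

lemma lsum_tensor3_relation:
  fixes f :: "'a::ab_group_add \<Rightarrow> 'a \<Rightarrow> 'a \<Rightarrow> 'v::ab_group_add"
    and A :: "('k::field, 'a, 'm) bialgebra_scheme"
  assumes s: "vector_space s" and r: "r \<in> tensor3_relations A"
    and f: "\<And>a b. a \<in> carrier A \<Longrightarrow> b \<in> carrier A \<Longrightarrow> linear_on A s (\<lambda>x. f x a b)"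
      "\<And>a b. a \<in> carrier A \<Longrightarrow> b \<in> carrier A \<Longrightarrow> linear_on A s (\<lambda>x. f a x b)"
      "\<And>a b. a \<in> carrier A \<Longrightarrow> b \<in> carrier A \<Longrightarrow> linear_on A s (\<lambda>x. f a b x)"
  shows "lsum s r (\<lambda>(a, b, c). f a b c) = 0"
proof -
  interpret s: vector_space s by fact
  interpret F: vector_space "fscale :: 'k \<Rightarrow> ('a \<times> 'a \<times> 'a \<Rightarrow>\<^sub>0 'k) \<Rightarrow> _"
    by (rule vector_space_fscale)
  let ?Z = "{r. lsum s r (\<lambda>(a, b, c). f a b c) = 0}"
  have "F.subspace ?Z"
    by (auto simp: F.subspace_def s.lsum_add s.lsum_fscale)
  then have "tensor3_relations A \<subseteq> ?Z"
    unfolding tensor3_relations_def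
    by (intro F.span_minimal)
      (use f in \<open>auto simp: s.lsum_diff s.lsum_fscale linear_on_def\<close>)
  with r show ?thesis by auto
qed

lemma tensor_relations_gens:
  fixes A :: "('k::field, 'a::ab_group_add, 'm) bialgebra_scheme"
    and B :: "('k, 'b::ab_group_add, 'n) bialgebra_scheme"
  shows
  "a \<in> carrier A \<Longrightarrow> a' \<in> carrier A \<Longrightarrow> b \<in> carrier B \<Longrightarrow>
     basis (a + a', b) - basis (a, b) - basis (a', b) \<in> tensor_relations A B"
  "a \<in> carrier A \<Longrightarrow> b \<in> carrier B \<Longrightarrow> b' \<in> carrier B \<Longrightarrow>
     basis (a, b + b') - basis (a, b) - basis (a, b') \<in> tensor_relations A B"
  "a \<in> carrier A \<Longrightarrow> b \<in> carrier B \<Longrightarrow>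
     basis (smul A c a, b) - fscale c (basis (a, b)) \<in> tensor_relations A B"
  "a \<in> carrier A \<Longrightarrow> b \<in> carrier B \<Longrightarrow>
     basis (a, smul B c b) - fscale c (basis (a, b)) \<in> tensor_relations A B"
proof -
  interpret F: vector_space "fscale :: 'k \<Rightarrow> ('a \<times> 'b \<Rightarrow>\<^sub>0 'k) \<Rightarrow> _" by (rule vector_space_fscale)
  show
  "a \<in> carrier A \<Longrightarrow> a' \<in> carrier A \<Longrightarrow> b \<in> carrier B \<Longrightarrow>
     basis (a + a', b) - basis (a, b) - basis (a', b) \<in> tensor_relations A B"
  "a \<in> carrier A \<Longrightarrow> b \<in> carrier B \<Longrightarrow> b' \<in> carrier B \<Longrightarrow>
     basis (a, b + b') - basis (a, b) - basis (a, b') \<in> tensor_relations A B"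
  "a \<in> carrier A \<Longrightarrow> b \<in> carrier B \<Longrightarrow>
     basis (smul A c a, b) - fscale c (basis (a, b)) \<in> tensor_relations A B"
  "a \<in> carrier A \<Longrightarrow> b \<in> carrier B \<Longrightarrow>
     basis (a, smul B c b) - fscale c (basis (a, b)) \<in> tensor_relations A B"
    unfolding tensor_relations_def
    apply -
    apply (rule F.span_base, rule UnI1, rule UnI1, rule UnI1, rule CollectI, intro exI, rule conjI[OF refl], simp)
    apply (rule F.span_base, rule UnI1, rule UnI1, rule UnI2, rule CollectI, intro exI, rule conjI[OF refl], simp)
    apply (rule F.span_base, rule UnI1, rule UnI2, rule CollectI, intro exI, rule conjI[OF refl], simp)
    apply (rule F.span_base, rule UnI2, rule CollectI, intro exI, rule conjI[OF refl], simp)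
    done
qed

lemma tensor3_relations_gens:
  fixes A :: "('k::field, 'a::ab_group_add, 'm) bialgebra_scheme"
  assumes "a \<in> carrier A" "b \<in> carrier A" "c \<in> carrier A"
  shows
  "a' \<in> carrier A \<Longrightarrow> basis (a + a', b, c) - basis (a, b, c) - basis (a', b, c) \<in> tensor3_relations A"
  "b' \<in> carrier A \<Longrightarrow> basis (a, b + b', c) - basis (a, b, c) - basis (a, b', c) \<in> tensor3_relations A"
  "c' \<in> carrier A \<Longrightarrow> basis (a, b, c + c') - basis (a, b, c) - basis (a, b, c') \<in> tensor3_relations A"
  "basis (smul A r a, b, c) - fscale r (basis (a, b, c)) \<in> tensor3_relations A"
  "basis (a, smul A r b, c) - fscale r (basis (a, b, c)) \<in> tensor3_relations A"
  "basis (a, b, smul A r c) - fscale r (basis (a, b, c)) \<in> tensor3_relations A"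
proof -
  interpret F: vector_space "fscale :: 'k \<Rightarrow> ('a \<times> 'a \<times> 'a \<Rightarrow>\<^sub>0 'k) \<Rightarrow> _" by (rule vector_space_fscale)
  show
  "a' \<in> carrier A \<Longrightarrow> basis (a + a', b, c) - basis (a, b, c) - basis (a', b, c) \<in> tensor3_relations A"
  "b' \<in> carrier A \<Longrightarrow> basis (a, b + b', c) - basis (a, b, c) - basis (a, b', c) \<in> tensor3_relations A"
  "c' \<in> carrier A \<Longrightarrow> basis (a, b, c + c') - basis (a, b, c) - basis (a, b, c') \<in> tensor3_relations A"
  "basis (smul A r a, b, c) - fscale r (basis (a, b, c)) \<in> tensor3_relations A"
  "basis (a, smul A r b, c) - fscale r (basis (a, b, c)) \<in> tensor3_relations A"
  "basis (a, b, smul A r c) - fscale r (basis (a, b, c)) \<in> tensor3_relations A"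
    unfolding tensor3_relations_def
    apply -
    apply (rule F.span_base, rule UnI1, rule UnI1, rule UnI1, rule UnI1, rule UnI1, rule CollectI, intro exI, rule conjI[OF refl], use assms in simp)
    apply (rule F.span_base, rule UnI1, rule UnI1, rule UnI1, rule UnI1, rule UnI2, rule CollectI, intro exI, rule conjI[OF refl], use assms in simp)
    apply (rule F.span_base, rule UnI1, rule UnI1, rule UnI1, rule UnI2, rule CollectI, intro exI, rule conjI[OF refl], use assms in simp)
    apply (rule F.span_base, rule UnI1, rule UnI1, rule UnI2, rule CollectI, intro exI, rule conjI[OF refl], use assms in simp)
    apply (rule F.span_base, rule UnI1, rule UnI2, rule CollectI, intro exI, rule conjI[OF refl], use assms in simp)
    apply (rule F.span_base, rule UnI2, rule CollectI, intro exI, rule conjI[OF refl], use assms in simp)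
    done
qed

text \<open>
  Expanding both factors in coordinates rewrites a tensor, modulo the relations, into a combination
  of pairs of basis vectors whose coefficients are values of functionals.
\<close>

lemma tensor_relations_iff:
  fixes A :: "('k::field, 'a::ab_group_add, 'm) bialgebra_scheme"
    and B :: "('k, 'b::ab_group_add, 'n) bialgebra_scheme"
  assumes A: "subspace_of A" and B: "subspace_of B"
    and r: "Poly_Mapping.keys r \<subseteq> carrier A \<times> carrier B"
  shows "r \<in> tensor_relations A B \<longleftrightarrow>
    (\<forall>\<phi> \<psi>. functional (smul A) \<phi> \<longrightarrow> functional (smul B) \<psi> \<longrightarrow> pairing \<phi> \<psi> r = 0)"
proof (intro iffI allI impI)
  fix \<phi> \<psi> assume "functional (smul A) \<phi>" "functional (smul B) \<psi>" "r \<in> tensor_relations A B"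
  then show "pairing \<phi> \<psi> r = 0"
    unfolding pairing_def
    by (intro lsum_tensor_relation[OF vector_space_mult functional_bilinear])
next
  assume *: "\<forall>\<phi> \<psi>. functional (smul A) \<phi> \<longrightarrow> functional (smul B) \<psi> \<longrightarrow> pairing \<phi> \<psi> r = 0"
  interpret F: vector_space "fscale :: 'k \<Rightarrow> ('a \<times> 'b \<Rightarrow>\<^sub>0 'k) \<Rightarrow> _" by (rule vector_space_fscale)
  interpret A: vector_space "smul A" using A by (rule subspace_ofD)
  interpret B: vector_space "smul B" using B by (rule subspace_ofD)
  let ?T = "tensor_relations A B"
  note T = subspace_tensor_relations[of A B]
  obtain R :: "'a \<Rightarrow> ('a \<Rightarrow>\<^sub>0 'k)" and E where R: "\<And>x y. R (x + y) = R x + R y"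
    "\<And>c x. R (smul A c x) = fscale c (R x)" "E \<subseteq> carrier A"
    "\<And>x. x \<in> carrier A \<Longrightarrow> Poly_Mapping.keys (R x) \<subseteq> E" "\<And>x. lsum (smul A) (R x) (\<lambda>e. e) = x"
    using A.coordinates_exist[OF subspace_ofD(2)[OF A] subspace_ofD(2)[OF A]] by (metis order_refl)
  obtain Q :: "'b \<Rightarrow> ('b \<Rightarrow>\<^sub>0 'k)" and D where Q: "\<And>x y. Q (x + y) = Q x + Q y"
    "\<And>c x. Q (smul B c x) = fscale c (Q x)" "D \<subseteq> carrier B"
    "\<And>x. x \<in> carrier B \<Longrightarrow> Poly_Mapping.keys (Q x) \<subseteq> D" "\<And>x. lsum (smul B) (Q x) (\<lambda>e. e) = x"
    using B.coordinates_exist[OF subspace_ofD(2)[OF B] subspace_ofD(2)[OF B]] by (metis order_refl)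
  \<comment> \<open>The normal form of \<open>a \<otimes> b\<close> with respect to the two bases.\<close>
  define N where "N = (\<lambda>(a, b). lsum fscale (R a) (\<lambda>e. lsum fscale (Q b) (\<lambda>e'. basis (e, e'))))"
  have lookup_basis_pair: "Poly_Mapping.lookup (basis (e, e') :: 'a \<times> 'b \<Rightarrow>\<^sub>0 'k) (u, v) =
      Poly_Mapping.lookup (basis e) u * Poly_Mapping.lookup (basis e') v" for e e' u v
    by (auto simp: lookup_single when_def)
  interpret K: vector_space "(*) :: 'k \<Rightarrow> 'k \<Rightarrow> 'k" by (rule vector_space_mult)
  have coeff: "lsum (*) p (\<lambda>y. Poly_Mapping.lookup (basis y) x) = Poly_Mapping.lookup p x"
    for p :: "'z \<Rightarrow>\<^sub>0 'k" and x
    by (simp add: lookup_lsum[symmetric] lsum_basis_eq)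
  have lookN: "Poly_Mapping.lookup (N (a, b)) (u, v) =
      Poly_Mapping.lookup (R a) u * Poly_Mapping.lookup (Q b) v" for a b u v
    by (simp add: N_def lookup_lsum lookup_basis_pair K.lsum_body_scale coeff
        mult.commute[of _ "Poly_Mapping.lookup (Q b) v"])
  have "lsum fscale r N = 0"
  proof (rule poly_mapping_eqI)
    fix x :: "'a \<times> 'b"
    obtain u v where x: "x = (u, v)" by (cases x)
    have "Poly_Mapping.lookup (lsum fscale r N) x =
        pairing (\<lambda>a. Poly_Mapping.lookup (R a) u) (\<lambda>b. Poly_Mapping.lookup (Q b) v) r"
      unfolding pairing_def x lookup_lsum by (rule lsum_cong) (auto simp: lookN)
    also have "\<dots> = 0"
      using * by (simp add: functional_def R Q lookup_add)
    finally show "Poly_Mapping.lookup (lsum fscale r N) x = Poly_Mapping.lookup 0 x" by simp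
  qed
  moreover have "lsum fscale r (\<lambda>x. basis x - N x) \<in> ?T"
  proof (rule F.lsum_in_subspace[OF T])
    fix x assume "x \<in> Poly_Mapping.keys r"
    then obtain a b where x: "x = (a, b)" and a: "a \<in> carrier A" and b: "b \<in> carrier B" using r by auto
    have Ra: "e \<in> carrier A" if "e \<in> Poly_Mapping.keys (R a)" for e using R(3,4) a that by blast
    have Qb: "e \<in> carrier B" if "e \<in> Poly_Mapping.keys (Q b)" for e using Q(3,4) b that by blast
    have 1: "basis (lsum (smul A) (R a) (\<lambda>e. e), b) - lsum fscale (R a) (\<lambda>e. basis (e, b)) \<in> ?T"
      by (rule linear_mod_lsum[OF A vector_space_fscale T, where h = "\<lambda>x. basis (x, b)"])
        (simp_all add: tensor_relations_gens b Ra)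
    have "basis (e, lsum (smul B) (Q b) (\<lambda>e. e)) - lsum fscale (Q b) (\<lambda>e'. basis (e, e')) \<in> ?T"
      if "e \<in> Poly_Mapping.keys (R a)" for e
      by (rule linear_mod_lsum[OF B vector_space_fscale T, where h = "\<lambda>x. basis (e, x)"])
        (simp_all add: tensor_relations_gens Ra that Qb)
    then have "lsum fscale (R a) (\<lambda>e. basis (e, b) - lsum fscale (Q b) (\<lambda>e'. basis (e, e'))) \<in> ?T"
      using Q(5) by (intro F.lsum_in_subspace[OF T]) auto
    then have 2: "lsum fscale (R a) (\<lambda>e. basis (e, b)) - N (a, b) \<in> ?T"
      by (simp add: F.lsum_body_diff N_def)
    show "basis x - N x \<in> ?T"
      using F.subspace_add[OF T 1 2] R(5) by (simp add: x)
  qed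
  ultimately show "r \<in> ?T"
    by (simp add: F.lsum_body_diff lsum_basis_eq)
qed

text \<open>The same expansion with three factors; it is needed for coassociativity of sub-Hopf-algebras.\<close>

lemma tensor3_relations_iff:
  fixes A :: "('k::field, 'a::ab_group_add, 'm) bialgebra_scheme"
  assumes A: "subspace_of A"
    and r: "Poly_Mapping.keys r \<subseteq> carrier A \<times> carrier A \<times> carrier A"
  shows "r \<in> tensor3_relations A \<longleftrightarrow>
    (\<forall>\<phi> \<psi> \<chi>. functional (smul A) \<phi> \<longrightarrow> functional (smul A) \<psi> \<longrightarrow> functional (smul A) \<chi> \<longrightarrow>
      pairing3 \<phi> \<psi> \<chi> r = 0)"
proof (intro iffI allI impI)
  fix \<phi> \<psi> \<chi>
  assume "functional (smul A) \<phi>" "functional (smul A) \<psi>" "functional (smul A) \<chi>"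
    "r \<in> tensor3_relations A"
  then show "pairing3 \<phi> \<psi> \<chi> r = 0"
    unfolding pairing3_def
    by (intro lsum_tensor3_relation[OF vector_space_mult])
      (auto simp: functional_def linear_on_def algebra_simps)
next
  assume *: "\<forall>\<phi> \<psi> \<chi>. functional (smul A) \<phi> \<longrightarrow> functional (smul A) \<psi> \<longrightarrow> functional (smul A) \<chi> \<longrightarrow>
      pairing3 \<phi> \<psi> \<chi> r = 0"
  interpret F: vector_space "fscale :: 'k \<Rightarrow> ('a \<times> 'a \<times> 'a \<Rightarrow>\<^sub>0 'k) \<Rightarrow> _"
    by (rule vector_space_fscale)
  interpret A: vector_space "smul A" using A by (rule subspace_ofD)
  interpret K: vector_space "(*) :: 'k \<Rightarrow> 'k \<Rightarrow> 'k" by (rule vector_space_mult)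
  let ?T = "tensor3_relations A"
  note T = subspace_tensor3_relations[of A]
  obtain R :: "'a \<Rightarrow> ('a \<Rightarrow>\<^sub>0 'k)" and E where R: "\<And>x y. R (x + y) = R x + R y"
    "\<And>c x. R (smul A c x) = fscale c (R x)" "E \<subseteq> carrier A"
    "\<And>x. x \<in> carrier A \<Longrightarrow> Poly_Mapping.keys (R x) \<subseteq> E" "\<And>x. lsum (smul A) (R x) (\<lambda>e. e) = x"
    using A.coordinates_exist[OF subspace_ofD(2)[OF A] subspace_ofD(2)[OF A]] by (metis order_refl)
  have Rk: "e \<in> carrier A" if "x \<in> carrier A" "e \<in> Poly_Mapping.keys (R x)" for x e
    using R(3,4) that by blast
  define N where "N = (\<lambda>(a, b, c). lsum fscale (R a) (\<lambda>e. lsum fscale (R b) (\<lambda>e'.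
    lsum fscale (R c) (\<lambda>e''. basis (e, e', e'')))))"
  have lookup_basis_triple: "Poly_Mapping.lookup (basis (e, e', e'') :: 'a \<times> 'a \<times> 'a \<Rightarrow>\<^sub>0 'k) (u, v, w) =
      Poly_Mapping.lookup (basis e) u * (Poly_Mapping.lookup (basis e') v * Poly_Mapping.lookup (basis e'') w)"
    for e e' e'' u v w
    by (auto simp: lookup_single when_def)
  have coeff: "lsum (*) p (\<lambda>y. Poly_Mapping.lookup (basis y) x) = Poly_Mapping.lookup p x"
    for p :: "'z \<Rightarrow>\<^sub>0 'k" and x
    by (simp add: lookup_lsum[symmetric] lsum_basis_eq)
  have pull: "lsum (*) p (\<lambda>x. f x * c) = lsum (*) p f * c" for p :: "'z \<Rightarrow>\<^sub>0 'k" and f c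
    using K.lsum_body_scale[of p c f] by (simp add: mult.commute)
  have lookN: "Poly_Mapping.lookup (N (a, b, c)) (u, v, w) =
      Poly_Mapping.lookup (R a) u * Poly_Mapping.lookup (R b) v * Poly_Mapping.lookup (R c) w"
    for a b c u v w
    by (simp add: N_def lookup_lsum lookup_basis_triple K.lsum_body_scale coeff pull)
  have "lsum fscale r N = 0"
  proof (rule poly_mapping_eqI)
    fix x :: "'a \<times> 'a \<times> 'a"
    obtain u v w where x: "x = (u, v, w)" by (cases x)
    have "Poly_Mapping.lookup (lsum fscale r N) x =
        pairing3 (\<lambda>a. Poly_Mapping.lookup (R a) u) (\<lambda>b. Poly_Mapping.lookup (R b) v)
          (\<lambda>b. Poly_Mapping.lookup (R b) w) r"
      unfolding pairing3_def x lookup_lsum by (rule lsum_cong) (auto simp: lookN)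
    also have "\<dots> = 0"
      using * by (simp add: functional_def R lookup_add)
    finally show "Poly_Mapping.lookup (lsum fscale r N) x = Poly_Mapping.lookup 0 x" by simp
  qed
  moreover have "lsum fscale r (\<lambda>x. basis x - N x) \<in> ?T"
  proof (rule F.lsum_in_subspace[OF T])
    fix x assume "x \<in> Poly_Mapping.keys r"
    then obtain a b c where x: "x = (a, b, c)"
      and a: "a \<in> carrier A" and b: "b \<in> carrier A" and c: "c \<in> carrier A" using r by auto
    have 1: "basis (lsum (smul A) (R a) (\<lambda>e. e), b, c) - lsum fscale (R a) (\<lambda>e. basis (e, b, c)) \<in> ?T"
      by (rule linear_mod_lsum[OF A vector_space_fscale T, where h = "\<lambda>x. basis (x, b, c)"])
        (simp_all add: tensor3_relations_gens b c Rk[OF a])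
    have "basis (e, lsum (smul A) (R b) (\<lambda>e. e), c) - lsum fscale (R b) (\<lambda>e'. basis (e, e', c)) \<in> ?T"
      if "e \<in> Poly_Mapping.keys (R a)" for e
      by (rule linear_mod_lsum[OF A vector_space_fscale T, where h = "\<lambda>x. basis (e, x, c)"])
        (simp_all add: tensor3_relations_gens Rk[OF a that] Rk[OF b] c)
    then have 2: "lsum fscale (R a) (\<lambda>e. basis (e, b, c) - lsum fscale (R b) (\<lambda>e'. basis (e, e', c))) \<in> ?T"
      using R(5) by (intro F.lsum_in_subspace[OF T]) auto
    have "basis (e, e', lsum (smul A) (R c) (\<lambda>e. e)) - lsum fscale (R c) (\<lambda>e''. basis (e, e', e'')) \<in> ?T"
      if "e \<in> Poly_Mapping.keys (R a)" "e' \<in> Poly_Mapping.keys (R b)" for e e'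
      by (rule linear_mod_lsum[OF A vector_space_fscale T, where h = "\<lambda>x. basis (e, e', x)"])
        (simp_all add: tensor3_relations_gens Rk[OF a that(1)] Rk[OF b that(2)] Rk[OF c])
    then have 3: "lsum fscale (R a) (\<lambda>e. lsum fscale (R b) (\<lambda>e'. basis (e, e', c) -
        lsum fscale (R c) (\<lambda>e''. basis (e, e', e'')))) \<in> ?T"
      using R(5) by (intro F.lsum_in_subspace[OF T]) auto
    show "basis x - N x \<in> ?T"
      using F.subspace_add[OF T F.subspace_add[OF T 1 2] 3] R(5)
      by (simp add: x N_def F.lsum_body_diff)
  qed
  ultimately show "r \<in> ?T"
    by (simp add: F.lsum_body_diff lsum_basis_eq)
qed

lemma tensor_class_iff:
  assumes "subspace_of A" "subspace_of B" "Poly_Mapping.keys p \<subseteq> carrier A \<times> carrier B"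
  shows "q \<in> tensor_class A B p \<longleftrightarrow> Poly_Mapping.keys q \<subseteq> carrier A \<times> carrier B \<and>
    (\<forall>\<phi> \<psi>. functional (smul A) \<phi> \<longrightarrow> functional (smul B) \<psi> \<longrightarrow> pairing \<phi> \<psi> q = pairing \<phi> \<psi> p)"
proof (cases "Poly_Mapping.keys q \<subseteq> carrier A \<times> carrier B")
  case True
  have "Poly_Mapping.keys (q - p) \<subseteq> carrier A \<times> carrier B"
    using True assms(3) by (intro order_trans[OF keys_diff]) simp
  from tensor_relations_iff[OF assms(1,2) this] True show ?thesis
    by (simp add: tensor_class_def pairing_diff)
qed (simp add: tensor_class_def)

lemma tensor_class_eq_iff:
  assumes "subspace_of A" "subspace_of B" "Poly_Mapping.keys p \<subseteq> carrier A \<times> carrier B"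
    "Poly_Mapping.keys q \<subseteq> carrier A \<times> carrier B"
  shows "tensor_class A B q = tensor_class A B p \<longleftrightarrow>
    (\<forall>\<phi> \<psi>. functional (smul A) \<phi> \<longrightarrow> functional (smul B) \<psi> \<longrightarrow> pairing \<phi> \<psi> q = pairing \<phi> \<psi> p)"
    (is "?L \<longleftrightarrow> ?R")
proof
  assume ?L
  moreover have "q \<in> tensor_class A B q"
    using tensor_class_iff[OF assms(1,2,4)] assms(4) by blast
  ultimately have "q \<in> tensor_class A B p" by blast
  then show ?R unfolding tensor_class_iff[OF assms(1,2,3)] by blast
next
  assume R: ?R
  show ?L
    by (rule Set.set_eqI, unfold tensor_class_iff[OF assms(1,2,3)] tensor_class_iff[OF assms(1,2,4)])
      (use R in auto)
qed

lemma tensor3_class_eq_iff: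
  assumes A: "subspace_of A" and p: "Poly_Mapping.keys p \<subseteq> carrier A \<times> carrier A \<times> carrier A"
    and q: "Poly_Mapping.keys q \<subseteq> carrier A \<times> carrier A \<times> carrier A"
  shows "tensor3_class A q = tensor3_class A p \<longleftrightarrow>
    (\<forall>\<phi> \<psi> \<chi>. functional (smul A) \<phi> \<longrightarrow> functional (smul A) \<psi> \<longrightarrow> functional (smul A) \<chi> \<longrightarrow>
      pairing3 \<phi> \<psi> \<chi> q = pairing3 \<phi> \<psi> \<chi> p)"
    (is "?L \<longleftrightarrow> ?R")
proof -
  have iff: "r \<in> tensor3_class A p' \<longleftrightarrow>
      Poly_Mapping.keys r \<subseteq> carrier A \<times> carrier A \<times> carrier A \<and>
    (\<forall>\<phi> \<psi> \<chi>. functional (smul A) \<phi> \<longrightarrow> functional (smul A) \<psi> \<longrightarrow> functional (smul A) \<chi> \<longrightarrow>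
      pairing3 \<phi> \<psi> \<chi> r = pairing3 \<phi> \<psi> \<chi> p')"
    if p': "Poly_Mapping.keys p' \<subseteq> carrier A \<times> carrier A \<times> carrier A" for r p'
  proof (cases "Poly_Mapping.keys r \<subseteq> carrier A \<times> carrier A \<times> carrier A")
    case True
    have "Poly_Mapping.keys (r - p') \<subseteq> carrier A \<times> carrier A \<times> carrier A"
      using True p' by (intro order_trans[OF keys_diff]) simp
    from tensor3_relations_iff[OF A this] True show ?thesis
      by (simp add: tensor3_class_def pairing3_diff)
  qed (simp add: tensor3_class_def)
  show ?thesis
  proof
    assume ?L
    moreover have "q \<in> tensor3_class A q" using iff[OF q] q by blast
    ultimately have "q \<in> tensor3_class A p" by blast
    then show ?R unfolding iff[OF p] by blast
  next
    assume R: ?R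
    show ?L by (rule Set.set_eqI, unfold iff[OF p] iff[OF q]) (use R in auto)
  qed
qed

section \<open>Sweedler sums\<close>

abbreviation comult_rep :: "('k::field, 'a::ab_group_add, 'm) bialgebra_scheme \<Rightarrow> 'a \<Rightarrow> ('a \<times> 'a \<Rightarrow>\<^sub>0 'k)" where
  "comult_rep A x \<equiv> (SOME p. p \<in> comult A x)"

lemma sweedler_lsum: "sweedler A s x f = lsum s (comult_rep A x) (\<lambda>(u, v). f u v)"
  by (simp add: sweedler_def lsum_def Let_def case_prod_unfold)

lemma tensor_class_self:
  fixes A :: "('k::field, 'a::ab_group_add, 'm) bialgebra_scheme"
    and B :: "('k, 'b::ab_group_add, 'n) bialgebra_scheme"
  assumes "Poly_Mapping.keys p \<subseteq> carrier A \<times> carrier B"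
  shows "p \<in> tensor_class A B p"
proof -
  interpret F: vector_space "fscale :: 'k \<Rightarrow> ('a \<times> 'b \<Rightarrow>\<^sub>0 'k) \<Rightarrow> _" by (rule vector_space_fscale)
  show ?thesis using assms F.subspace_0[OF subspace_tensor_relations[of A B]] by (simp add: tensor_class_def)
qed

lemma tensor_class_diff:
  fixes A :: "('k::field, 'a::ab_group_add, 'm) bialgebra_scheme"
    and B :: "('k, 'b::ab_group_add, 'n) bialgebra_scheme"
  assumes "p \<in> tensor_class A B r" "q \<in> tensor_class A B r"
  shows "p - q \<in> tensor_relations A B"
proof -
  interpret F: vector_space "fscale :: 'k \<Rightarrow> ('a \<times> 'b \<Rightarrow>\<^sub>0 'k) \<Rightarrow> _" by (rule vector_space_fscale)
  show ?thesis
    using assms F.subspace_diff[OF subspace_tensor_relations[of A B], of "p - r" "q - r"]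
    by (simp add: tensor_class_def)
qed

lemma subspace_of_bialgebra: "bialgebra A \<Longrightarrow> subspace_of A"
  by (simp add: subspace_of_def bialgebra.vector_space_smul bialgebra.subspace_carrier)

lemma bilinear_onD:
  assumes "bilinear_on A B s f"
  shows "a \<in> carrier A \<Longrightarrow> a' \<in> carrier A \<Longrightarrow> b \<in> carrier B \<Longrightarrow> f (a + a') b = f a b + f a' b"
    "a \<in> carrier A \<Longrightarrow> b \<in> carrier B \<Longrightarrow> b' \<in> carrier B \<Longrightarrow> f a (b + b') = f a b + f a b'"
    "a \<in> carrier A \<Longrightarrow> b \<in> carrier B \<Longrightarrow> f (smul A c a) b = s c (f a b)"
    "a \<in> carrier A \<Longrightarrow> b \<in> carrier B \<Longrightarrow> f a (smul B c b) = s c (f a b)"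
  using assms by (auto simp: bilinear_on_def linear_on_def)

context bialgebra begin

lemma subspace_of: "subspace_of A"
  by (rule subspace_of_bialgebra) unfold_locales

lemmas carrier_add = subspace_ofD(4)[OF subspace_of]
lemmas carrier_smul = subspace_ofD(6)[OF subspace_of]

lemma comult_class:
  assumes "x \<in> carrier A"
  obtains r where "Poly_Mapping.keys r \<subseteq> carrier A \<times> carrier A" "comult A x = tensor_class A A r"
  using comult_closed[OF assms] by (auto simp: tensor_space_def)

lemma comult_rep:
  assumes "x \<in> carrier A"
  shows "comult_rep A x \<in> comult A x"
  by (rule comult_class[OF assms]) (metis someI tensor_class_self)

lemma comult_keys:
  assumes "x \<in> carrier A" "p \<in> comult A x"
  shows "Poly_Mapping.keys p \<subseteq> carrier A \<times> carrier A"
  using assms(2) by (rule_tac comult_class[OF assms(1)]) (auto simp: tensor_class_def)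

lemma comult_rep_keys:
  assumes "x \<in> carrier A" "(u, v) \<in> Poly_Mapping.keys (comult_rep A x)"
  shows "u \<in> carrier A" "v \<in> carrier A"
  using comult_keys[OF assms(1) comult_rep[OF assms(1)]] assms(2) by auto

text \<open>
  A bilinear map kills the tensor relations, so a Sweedler sum with bilinear body may be computed from
  any representative of the coproduct.
\<close>

lemma sweedler_eq_lsum:
  assumes x: "x \<in> carrier A" and p: "p \<in> comult A x" and s: "vector_space s"
    and f: "bilinear_on A A s f"
  shows "sweedler A s x f = lsum s p (\<lambda>(u, v). f u v)"
proof -
  interpret s: vector_space s by fact
  obtain r where r: "comult A x = tensor_class A A r" using comult_class[OF x] by metis
  have "comult_rep A x - p \<in> tensor_relations A A"
    using comult_rep[OF x] p unfolding r by (rule tensor_class_diff)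
  from lsum_tensor_relation[OF s f this] show ?thesis
    by (simp add: sweedler_lsum s.lsum_diff)
qed

lemma sweedler_functionals:
  assumes "x \<in> carrier A" "p \<in> comult A x" "functional (smul A) \<phi>" "functional (smul A) \<psi>"
  shows "sweedler A (*) x (\<lambda>u v. \<phi> u * \<psi> v) = pairing \<phi> \<psi> p"
  using sweedler_eq_lsum[OF assms(1,2) vector_space_mult functional_bilinear[of A _ A]] assms(3,4)
  by (simp add: pairing_def)

text \<open>
  Since functionals separate tensors, a coproduct is determined by its contractions with pairs of
  functionals.  Identities between coproducts are proved in this form.
\<close>

lemma mem_comult_iff:
  assumes x: "x \<in> carrier A"
  shows "p \<in> comult A x \<longleftrightarrow> Poly_Mapping.keys p \<subseteq> carrier A \<times> carrier A \<and>
    (\<forall>\<phi> \<psi>. functional (smul A) \<phi> \<longrightarrow> functional (smul A) \<psi> \<longrightarrow>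
      pairing \<phi> \<psi> p = sweedler A (*) x (\<lambda>u v. \<phi> u * \<psi> v))"
proof -
  obtain r where r: "Poly_Mapping.keys r \<subseteq> carrier A \<times> carrier A" "comult A x = tensor_class A A r"
    using comult_class[OF x] by metis
  have rr: "r \<in> comult A x" using r by (simp add: tensor_class_self)
  show ?thesis
    unfolding r(2) tensor_class_iff[OF subspace_of subspace_of r(1)]
    using sweedler_functionals[OF x rr] by auto
qed

lemma comult_eq_class:
  assumes "x \<in> carrier A" "p \<in> comult A x"
  shows "comult A x = tensor_class A A p"
proof (rule Set.set_eqI)
  fix q
  have "Poly_Mapping.keys p \<subseteq> carrier A \<times> carrier A" by (rule comult_keys[OF assms])
  from tensor_class_iff[OF subspace_of subspace_of this]
  show "q \<in> comult A x \<longleftrightarrow> q \<in> tensor_class A A p"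
    unfolding mem_comult_iff[OF assms(1)]
    using sweedler_functionals[OF assms] by auto
qed

lemma sweedler_cong:
  assumes "x \<in> carrier A" "\<And>u v. u \<in> carrier A \<Longrightarrow> v \<in> carrier A \<Longrightarrow> f u v = g u v"
  shows "sweedler A s x f = sweedler A s x g"
  unfolding sweedler_lsum using comult_rep_keys[OF assms(1)] assms(2) by (auto intro!: lsum_cong)

lemma sweedler_closed:
  assumes "x \<in> carrier A" "subspace_of B"
    "\<And>u v. u \<in> carrier A \<Longrightarrow> v \<in> carrier A \<Longrightarrow> f u v \<in> carrier B"
  shows "sweedler A (smul B) x f \<in> carrier B"
  unfolding sweedler_lsum using comult_rep_keys[OF assms(1)] assms(3)
  by (auto intro!: lsum_closed[OF assms(2)])

lemma linear_on_sweedler: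
  assumes s: "vector_space s" and f: "bilinear_on A A s f"
  shows "linear_on A s (\<lambda>x. sweedler A s x f)"
proof -
  interpret s: vector_space s by fact
  show ?thesis
    unfolding linear_on_def
  proof (intro conjI ballI allI)
    fix x y assume x: "x \<in> carrier A" and y: "y \<in> carrier A"
    show "sweedler A s (x + y) f = sweedler A s x f + sweedler A s y f"
      using sweedler_eq_lsum[OF carrier_add[OF x y] comult_add[OF x y comult_rep[OF x] comult_rep[OF y]] s f]
      by (simp add: s.lsum_add sweedler_lsum)
  next
    fix c x assume x: "x \<in> carrier A"
    show "sweedler A s (smul A c x) f = s c (sweedler A s x f)"
      using sweedler_eq_lsum[OF carrier_smul[OF x] comult_smul[OF x comult_rep[OF x]] s f]
      by (simp add: s.lsum_fscale sweedler_lsum)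
  qed
qed

lemma linear_on_sweedler_body:
  assumes s: "vector_space s" and x: "x \<in> carrier A"
    and f: "\<And>u v. u \<in> carrier A \<Longrightarrow> v \<in> carrier A \<Longrightarrow> linear_on B s (f u v)"
  shows "linear_on B s (\<lambda>y. sweedler A s x (\<lambda>u v. f u v y))"
proof -
  interpret s: vector_space s by fact
  show ?thesis
    unfolding linear_on_def sweedler_lsum
  proof (intro conjI ballI allI)
    fix y z assume yz: "y \<in> carrier B" "z \<in> carrier B"
    have "lsum s (comult_rep A x) (\<lambda>(u, v). f u v (y + z)) =
        lsum s (comult_rep A x) (\<lambda>w. (case w of (u, v) \<Rightarrow> f u v y) + (case w of (u, v) \<Rightarrow> f u v z))"
      using f comult_rep_keys[OF x] yz by (intro lsum_cong) (auto simp: linear_on_def)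
    then show "lsum s (comult_rep A x) (\<lambda>(u, v). f u v (y + z)) =
        lsum s (comult_rep A x) (\<lambda>(u, v). f u v y) + lsum s (comult_rep A x) (\<lambda>(u, v). f u v z)"
      by (simp add: s.lsum_body_add)
  next
    fix c y assume y: "y \<in> carrier B"
    have "lsum s (comult_rep A x) (\<lambda>(u, v). f u v (smul B c y)) =
        lsum s (comult_rep A x) (\<lambda>w. s c (case w of (u, v) \<Rightarrow> f u v y))"
      using f comult_rep_keys[OF x] y by (intro lsum_cong) (auto simp: linear_on_def)
    then show "lsum s (comult_rep A x) (\<lambda>(u, v). f u v (smul B c y)) =
        s c (lsum s (comult_rep A x) (\<lambda>(u, v). f u v y))"
      by (simp add: s.lsum_body_scale)
  qed
qed

lemma linear_on_of_sweedler:
  assumes "subspace_of B" "vector_space s" "linear_on B s h" "x \<in> carrier A"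
    "\<And>u v. u \<in> carrier A \<Longrightarrow> v \<in> carrier A \<Longrightarrow> f u v \<in> carrier B"
  shows "h (sweedler A (smul B) x f) = sweedler A s x (\<lambda>u v. h (f u v))"
proof -
  have "h (lsum (smul B) (comult_rep A x) (\<lambda>(u, v). f u v)) =
      lsum s (comult_rep A x) (\<lambda>w. h (case w of (u, v) \<Rightarrow> f u v))"
    using comult_rep_keys[OF assms(4)] assms(5)
    by (intro linear_on_lsum[OF assms(1,2,3)]) auto
  then show ?thesis by (simp add: sweedler_lsum case_prod_unfold)
qed

text \<open>The two sides of coassociativity differ by relations, which a trilinear map kills.\<close>

lemma sweedler_coassoc:
  assumes x: "x \<in> carrier A" and s: "vector_space s"
    and f: "\<And>a b. a \<in> carrier A \<Longrightarrow> b \<in> carrier A \<Longrightarrow> linear_on A s (\<lambda>x. f x a b)"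
      "\<And>a b. a \<in> carrier A \<Longrightarrow> b \<in> carrier A \<Longrightarrow> linear_on A s (\<lambda>x. f a x b)"
      "\<And>a b. a \<in> carrier A \<Longrightarrow> b \<in> carrier A \<Longrightarrow> linear_on A s (\<lambda>x. f a b x)"
  shows "sweedler A s x (\<lambda>x' x''. sweedler A s x' (\<lambda>u v. f u v x'')) =
    sweedler A s x (\<lambda>x' x''. sweedler A s x'' (\<lambda>u v. f x' u v))"
proof -
  interpret s: vector_space s by fact
  interpret F: vector_space "fscale :: 'k \<Rightarrow> ('a \<times> 'a \<times> 'a \<Rightarrow>\<^sub>0 'k) \<Rightarrow> _" by (rule vector_space_fscale)
  let ?p = "sweedler A fscale x (\<lambda>x' x''. sweedler A fscale x' (\<lambda>u v. basis (u, v, x'')))"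
  let ?q = "sweedler A fscale x (\<lambda>x' x''. sweedler A fscale x'' (\<lambda>u v. basis (x', u, v)))"
  have "Poly_Mapping.keys ?p \<subseteq> carrier A \<times> carrier A \<times> carrier A"
    unfolding sweedler_lsum
  proof (rule keys_lsum)
    fix y assume y: "y \<in> Poly_Mapping.keys (comult_rep A x)"
    obtain x' x'' where xx: "y = (x', x'')" by (cases y)
    have k: "x' \<in> carrier A" "x'' \<in> carrier A" using comult_rep_keys[OF x] y xx by auto
    show "Poly_Mapping.keys (case y of (x', x'') \<Rightarrow>
        lsum fscale (comult_rep A x') (\<lambda>(u, v). basis (u, v, x''))) \<subseteq> carrier A \<times> carrier A \<times> carrier A"
      unfolding xx prod.case using comult_rep_keys[OF k(1)] k(2) by (intro keys_lsum) auto
  qed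
  then have "?p \<in> tensor3_class A ?p"
    using F.subspace_0[OF subspace_tensor3_relations[of A]] by (simp add: tensor3_class_def)
  then have "?p - ?q \<in> tensor3_relations A"
    unfolding coassoc[OF x] by (simp add: tensor3_class_def)
  from lsum_tensor3_relation[OF s this f] show ?thesis
    by (simp add: s.lsum_diff) (simp add: sweedler_lsum s.lsum_bind case_prod_unfold)
qed

lemma linear_on_counit: "linear_on A (*) (counit A)"
  by (simp add: linear_on_def counit_add counit_smul)

lemma sweedler_counit:
  assumes x: "x \<in> carrier A" and s: "vector_space s" and h: "linear_on A s h"
  shows "sweedler A s x (\<lambda>x' x''. s (counit A x') (h x'')) = h x"
    "sweedler A s x (\<lambda>x' x''. s (counit A x'') (h x')) = h x"
proof -
  have *: "s (counit A u) (h v) = h (smul A (counit A u) v)" if "v \<in> carrier A" for u v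
    using h that by (simp add: linear_on_def)
  have "sweedler A s x (\<lambda>x' x''. s (counit A x') (h x'')) =
      h (sweedler A (smul A) x (\<lambda>x' x''. smul A (counit A x') x''))"
    using carrier_smul by (subst linear_on_of_sweedler[OF subspace_of s h x]) (auto intro!: sweedler_cong simp: x *)
  then show "sweedler A s x (\<lambda>x' x''. s (counit A x') (h x'')) = h x"
    by (simp add: counit_left[OF x])
  have "sweedler A s x (\<lambda>x' x''. s (counit A x'') (h x')) =
      h (sweedler A (smul A) x (\<lambda>x' x''. smul A (counit A x'') x'))"
    using carrier_smul by (subst linear_on_of_sweedler[OF subspace_of s h x]) (auto intro!: sweedler_cong simp: x *)
  then show "sweedler A s x (\<lambda>x' x''. s (counit A x'') (h x')) = h x"
    by (simp add: counit_right[OF x])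
qed

end

lemma (in cocommutative_hopf_algebra) sweedler_cocomm:
  assumes x: "x \<in> carrier A" and s: "vector_space s" and f: "bilinear_on A A s f"
  shows "sweedler A s x f = sweedler A s x (\<lambda>u v. f v u)"
proof -
  interpret s: vector_space s by fact
  let ?p = "sweedler A fscale x (\<lambda>x' x''. basis (x'', x'))"
  have "Poly_Mapping.keys ?p \<subseteq> carrier A \<times> carrier A"
    unfolding sweedler_lsum using comult_rep_keys[OF x] by (intro keys_lsum) auto
  then have "?p \<in> comult A x" unfolding cocommutative[OF x] by (rule tensor_class_self)
  from sweedler_eq_lsum[OF x this s f] show ?thesis
    unfolding sweedler_lsum by (simp add: s.lsum_bind case_prod_unfold)
qed

section \<open>Coalgebras given by structure constants\<close>

definition csum :: "('b \<Rightarrow> ('b \<times> 'b \<Rightarrow>\<^sub>0 'k::field)) \<Rightarrow> ('k \<Rightarrow> 'v::ab_group_add \<Rightarrow> 'v) \<Rightarrow> 'b \<Rightarrow> ('b \<Rightarrow> 'b \<Rightarrow> 'v) \<Rightarrow> 'v" where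
  "csum \<Delta> s b f = lsum s (\<Delta> b) (\<lambda>(u, v). f u v)"

text \<open>
  A coalgebra with a basis indexed by the type \<open>'b\<close>: \<open>\<Delta> b\<close> is the coproduct of the basis vector \<open>b\<close>.
  As formal sums over \<open>'b \<times> 'b\<close> represent tensors uniquely, the axioms are equations between formal
  sums, and no bilinearity has to be checked for the maps that are summed.
\<close>

locale cocomm_coalgebra =
  fixes \<Delta> :: "'b \<Rightarrow> ('b \<times> 'b \<Rightarrow>\<^sub>0 'k::field)" and \<epsilon> :: "'b \<Rightarrow> 'k"
  assumes coassoc: "csum \<Delta> fscale b (\<lambda>u w. csum \<Delta> fscale u (\<lambda>p q. basis (p, q, w))) =
      csum \<Delta> fscale b (\<lambda>p w. csum \<Delta> fscale w (\<lambda>q r. basis (p, q, r)))"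
    and cocomm: "csum \<Delta> fscale b (\<lambda>u v. basis (v, u)) = \<Delta> b"
    and counit: "csum \<Delta> fscale b (\<lambda>u v. fscale (\<epsilon> u) (basis v)) = basis b"

lemma csum_bind:
  assumes "vector_space s"
  shows "lsum s (csum \<Delta> fscale b g) f = csum \<Delta> s b (\<lambda>u v. lsum s (g u v) f)"
  using vector_space.lsum_bind[OF assms] by (simp add: csum_def case_prod_unfold)

lemma csum_cong:
  assumes "\<And>u v. f u v = g u v" shows "csum \<Delta> s b f = csum \<Delta> s b g"
  using assms by (auto simp: csum_def intro!: lsum_cong)

lemma csum_scale:
  assumes "vector_space s"
  shows "csum \<Delta> s b (\<lambda>u v. s c (f u v)) = s c (csum \<Delta> s b f)"
  using vector_space.lsum_body_scale[OF assms, of "\<Delta> b" c "\<lambda>(u, v). f u v"]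
  by (simp add: csum_def case_prod_unfold)

lemma csum_swap:
  assumes "vector_space s"
  shows "csum \<Delta> s a (\<lambda>u v. csum \<Delta>' s b (\<lambda>p q. f u v p q)) =
    csum \<Delta>' s b (\<lambda>p q. csum \<Delta> s a (\<lambda>u v. f u v p q))"
  using vector_space.lsum_swap[OF assms, of "\<Delta> a" "\<Delta>' b" "\<lambda>(u, v) (p, q). f u v p q"]
  by (simp add: csum_def case_prod_unfold)

lemma csum_closed:
  assumes "subspace_of A" "\<And>u v. f u v \<in> carrier A"
  shows "csum \<Delta> (smul A) b f \<in> carrier A"
  unfolding csum_def using assms(2) by (intro lsum_closed[OF assms(1)]) auto

lemma linear_on_csum:
  assumes "subspace_of A" "vector_space s" "linear_on A s h" "\<And>u v. f u v \<in> carrier A"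
  shows "h (csum \<Delta> (smul A) b f) = csum \<Delta> s b (\<lambda>u v. h (f u v))"
  using linear_on_lsum[OF assms(1,2,3), of "\<Delta> b" "\<lambda>(u, v). f u v"] assms(4)
  by (simp add: csum_def case_prod_unfold)

lemma csum_lsum:
  assumes "vector_space s"
  shows "csum \<Delta> s b (\<lambda>u v. lsum s p (f u v)) = lsum s p (\<lambda>x. csum \<Delta> s b (\<lambda>u v. f u v x))"
  using vector_space.lsum_swap[OF assms, of "\<Delta> b" p "\<lambda>(u, v). f u v"]
  by (simp add: csum_def case_prod_unfold)

context cocomm_coalgebra begin

lemma csum_coassoc:
  assumes s: "vector_space s"
  shows "csum \<Delta> s b (\<lambda>u w. csum \<Delta> s u (\<lambda>p q. f p q w)) = csum \<Delta> s b (\<lambda>p w. csum \<Delta> s w (\<lambda>q r. f p q r))"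
  using arg_cong[OF coassoc[of b], of "\<lambda>p. lsum s p (\<lambda>(x, y, z). f x y z)"]
  by (simp add: csum_bind[OF s] vector_space.lsum_basis[OF s])

lemma csum_cocomm:
  assumes s: "vector_space s"
  shows "csum \<Delta> s b f = csum \<Delta> s b (\<lambda>u v. f v u)"
  using arg_cong[OF cocomm[of b], of "\<lambda>p. lsum s p (\<lambda>(x, y). f x y)"]
  by (simp add: csum_bind[OF s] vector_space.lsum_basis[OF s]) (simp add: csum_def)

lemma csum_counit:
  assumes s: "vector_space s"
  shows "csum \<Delta> s b (\<lambda>u v. s (\<epsilon> u) (f v)) = f b" "csum \<Delta> s b (\<lambda>u v. s (\<epsilon> v) (f u)) = f b"
proof -
  show *: "csum \<Delta> s b (\<lambda>u v. s (\<epsilon> u) (f v)) = f b"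
    using arg_cong[OF counit[of b], of "\<lambda>p. lsum s p f"]
    by (simp add: csum_bind[OF s] vector_space.lsum_basis[OF s] vector_space.lsum_fscale[OF s])
  show "csum \<Delta> s b (\<lambda>u v. s (\<epsilon> v) (f u)) = f b"
    using csum_cocomm[OF s, of b "\<lambda>u v. s (\<epsilon> v) (f u)"] * by simp
qed

text \<open>
  Coassociativity brings the second and the third of four Sweedler factors together, and
  cocommutativity exchanges them.
\<close>

lemma csum_middle_swap:
  assumes s: "vector_space s"
  shows "csum \<Delta> s b (\<lambda>u v. csum \<Delta> s u (\<lambda>p q. csum \<Delta> s v (\<lambda>r t. f p q r t))) =
    csum \<Delta> s b (\<lambda>u v. csum \<Delta> s u (\<lambda>p q. csum \<Delta> s v (\<lambda>r t. f p r q t)))"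
proof -
  have *: "csum \<Delta> s w (\<lambda>q v. csum \<Delta> s v (\<lambda>r t. f p q r t)) = csum \<Delta> s w (\<lambda>q v. csum \<Delta> s v (\<lambda>r t. f p r q t))"
    for p w
    by (subst (1 2) csum_coassoc[OF s, symmetric]) (subst csum_cocomm[OF s], rule refl)
  show ?thesis
    by (subst (1 2) csum_coassoc[OF s]) (simp add: *)
qed

end

text \<open>A point of \<open>A\<close>: a coalgebra map into \<open>A\<close>, given by its values on the basis \<open>'b\<close>.\<close>

definition coalg_map :: "('b \<Rightarrow> ('b \<times> 'b \<Rightarrow>\<^sub>0 'k::field)) \<Rightarrow> ('b \<Rightarrow> 'k) \<Rightarrow>
    ('k, 'a::ab_group_add, 'm) bialgebra_scheme \<Rightarrow> ('b \<Rightarrow> 'a) \<Rightarrow> bool" where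
  "coalg_map \<Delta> \<epsilon> A g \<longleftrightarrow> (\<forall>b. g b \<in> carrier A \<and> counit A (g b) = \<epsilon> b \<and>
     csum \<Delta> fscale b (\<lambda>u v. basis (g u, g v)) \<in> comult A (g b))"

lemma coalg_mapD:
  assumes "coalg_map \<Delta> \<epsilon> A g"
  shows "g b \<in> carrier A" "counit A (g b) = \<epsilon> b"
    "csum \<Delta> fscale b (\<lambda>u v. basis (g u, g v)) \<in> comult A (g b)"
  using assms by (auto simp: coalg_map_def)

context bialgebra begin

lemma coalg_map_iff:
  "coalg_map \<Delta> \<epsilon> A g \<longleftrightarrow> (\<forall>b. g b \<in> carrier A \<and> counit A (g b) = \<epsilon> b \<and>
     (\<forall>\<phi> \<psi>. functional (smul A) \<phi> \<longrightarrow> functional (smul A) \<psi> \<longrightarrow>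
       csum \<Delta> (*) b (\<lambda>u v. \<phi> (g u) * \<psi> (g v)) = sweedler A (*) (g b) (\<lambda>u v. \<phi> u * \<psi> v)))"
proof -
  have pair: "pairing \<phi> \<psi> (csum \<Delta> fscale b (\<lambda>u v. basis (g u, g v))) =
      csum \<Delta> (*) b (\<lambda>u v. \<phi> (g u) * \<psi> (g v))" for \<phi> \<psi> b
    by (simp add: pairing_def csum_bind[OF vector_space_mult] vector_space.lsum_basis[OF vector_space_mult])
  have keys: "Poly_Mapping.keys (csum \<Delta> fscale b (\<lambda>u v. basis (g u, g v))) \<subseteq> carrier A \<times> carrier A"
    if "\<forall>b. g b \<in> carrier A" for b
    unfolding csum_def using that by (intro keys_lsum) auto
  have "coalg_map \<Delta> \<epsilon> A g \<longleftrightarrow> (\<forall>b. g b \<in> carrier A) \<and> (\<forall>b. counit A (g b) = \<epsilon> b \<and>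
     csum \<Delta> fscale b (\<lambda>u v. basis (g u, g v)) \<in> comult A (g b))"
    by (auto simp: coalg_map_def)
  also have "\<dots> \<longleftrightarrow> (\<forall>b. g b \<in> carrier A) \<and> (\<forall>b. counit A (g b) = \<epsilon> b \<and>
     (\<forall>\<phi> \<psi>. functional (smul A) \<phi> \<longrightarrow> functional (smul A) \<psi> \<longrightarrow>
       csum \<Delta> (*) b (\<lambda>u v. \<phi> (g u) * \<psi> (g v)) = sweedler A (*) (g b) (\<lambda>u v. \<phi> u * \<psi> v)))"
    by (rule conj_cong[OF refl]) (simp add: mem_comult_iff keys pair)
  finally show ?thesis by auto
qed

lemma sweedler_coalg_map:
  assumes "coalg_map \<Delta> \<epsilon> A g" "vector_space s" "bilinear_on A A s f"
  shows "sweedler A s (g b) f = csum \<Delta> s b (\<lambda>u v. f (g u) (g v))"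
  using sweedler_eq_lsum[OF coalg_mapD(1)[OF assms(1)] coalg_mapD(3)[OF assms(1)] assms(2,3)]
  by (simp add: csum_bind[OF assms(2)] vector_space.lsum_basis[OF assms(2)])

end

lemma bilinear_onI:
  assumes "\<And>b. b \<in> carrier B \<Longrightarrow> linear_on A s (\<lambda>a. f a b)"
    "\<And>a. a \<in> carrier A \<Longrightarrow> linear_on B s (\<lambda>b. f a b)"
  shows "bilinear_on A B s f"
  using assms by (simp add: bilinear_on_def)

lemma lsum_bilinear:
  assumes s: "vector_space s" and A: "subspace_of A" and B: "subspace_of B"
    and f: "bilinear_on A B s f"
    and g: "\<And>x. x \<in> Poly_Mapping.keys p \<Longrightarrow> g x \<in> carrier A"
    and h: "\<And>x. x \<in> Poly_Mapping.keys q \<Longrightarrow> h x \<in> carrier B"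
  shows "f (lsum (smul A) p g) (lsum (smul B) q h) = lsum s p (\<lambda>x. lsum s q (\<lambda>y. f (g x) (h y)))"
proof -
  have "lsum (smul B) q h \<in> carrier B" by (rule lsum_closed[OF B h])
  then have "f (lsum (smul A) p g) (lsum (smul B) q h) = lsum s p (\<lambda>x. f (g x) (lsum (smul B) q h))"
    using f by (intro linear_on_lsum[OF A s _ g]) (auto simp: bilinear_on_def)
  also have "\<dots> = lsum s p (\<lambda>x. lsum s q (\<lambda>y. f (g x) (h y)))"
    using f g by (intro lsum_cong refl linear_on_lsum[OF B s _ h]) (auto simp: bilinear_on_def)
  finally show ?thesis .
qed

text \<open>
  The representative of a coproduct whose entries are basis vectors: expand both factors of any
  representative in coordinates \<open>R\<close>.
\<close>

definition coord_tensor :: "('a \<Rightarrow> ('a \<Rightarrow>\<^sub>0 'k::field)) \<Rightarrow> 'a \<Rightarrow> 'a \<Rightarrow> ('a \<times> 'a \<Rightarrow>\<^sub>0 'k)" where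
  "coord_tensor R a b = lsum fscale (R a) (\<lambda>e. lsum fscale (R b) (\<lambda>e'. basis (e, e')))"

lemma keys_coord_tensor:
  "Poly_Mapping.keys (R a) \<subseteq> E \<Longrightarrow> Poly_Mapping.keys (R b) \<subseteq> E \<Longrightarrow>
    Poly_Mapping.keys (coord_tensor R a b) \<subseteq> E \<times> E"
  unfolding coord_tensor_def by (intro keys_lsum) auto

lemma bilinear_coord_tensor:
  fixes A :: "('k::field, 'a::ab_group_add, 'm) bialgebra_scheme"
  assumes "\<And>x y. R (x + y) = R x + R y" "\<And>c x. R (smul A c x) = fscale c (R x)"
  shows "bilinear_on A A fscale (coord_tensor R)"
proof -
  interpret F2: vector_space "fscale :: 'k \<Rightarrow> ('a \<times> 'a \<Rightarrow>\<^sub>0 'k) \<Rightarrow> _" by (rule vector_space_fscale)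
  show ?thesis
    unfolding bilinear_on_def coord_tensor_def
    by (auto simp: linear_on_def assms F2.lsum_add F2.lsum_fscale F2.lsum_body_add F2.lsum_body_scale)
qed

lemma (in bialgebra) keys_coord_comult:
  assumes R: "\<And>x. x \<in> carrier A \<Longrightarrow> Poly_Mapping.keys (R x) \<subseteq> E" and x: "x \<in> carrier A"
  shows "Poly_Mapping.keys (sweedler A fscale x (coord_tensor R)) \<subseteq> E \<times> E"
  unfolding sweedler_lsum
proof (rule keys_lsum)
  fix y assume "y \<in> Poly_Mapping.keys (comult_rep A x)"
  moreover obtain u v where "y = (u, v)" by (cases y)
  ultimately show "Poly_Mapping.keys (case y of (u, v) \<Rightarrow> coord_tensor R u v) \<subseteq> E \<times> E"
    using comult_rep_keys[OF x] keys_coord_tensor[of R u E v] R by auto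
qed

lemma (in bialgebra) lsum_coord_comult:
  assumes R: "\<And>x. x \<in> carrier A \<Longrightarrow> Poly_Mapping.keys (R x) \<subseteq> carrier A"
    "\<And>x. lsum (smul A) (R x) (\<lambda>e. e) = x"
    and s: "vector_space s" and f: "bilinear_on A A s f" and x: "x \<in> carrier A"
  shows "lsum s (sweedler A fscale x (coord_tensor R)) (\<lambda>(u, v). f u v) = sweedler A s x f"
proof -
  have *: "lsum s (coord_tensor R a b) (\<lambda>(u, v). f u v) = f a b"
    if ab: "a \<in> carrier A" "b \<in> carrier A" for a b
  proof -
    have "f a b = f (lsum (smul A) (R a) (\<lambda>e. e)) (lsum (smul A) (R b) (\<lambda>e. e))"
      by (simp add: R)
    also have "\<dots> = lsum s (R a) (\<lambda>x. lsum s (R b) (\<lambda>y. f x y))"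
      using R(1) ab by (intro lsum_bilinear[OF s subspace_of subspace_of f]) auto
    finally show ?thesis
      by (simp add: coord_tensor_def vector_space.lsum_bind[OF s] vector_space.lsum_basis[OF s])
  qed
  have "lsum s (sweedler A fscale x (coord_tensor R)) (\<lambda>(u, v). f u v) =
      sweedler A s x (\<lambda>a b. lsum s (coord_tensor R a b) (\<lambda>(u, v). f u v))"
    by (simp add: sweedler_lsum vector_space.lsum_bind[OF s] case_prod_unfold)
  also have "\<dots> = sweedler A s x f"
    by (intro sweedler_cong x *)
  finally show ?thesis .
qed

lemma (in bialgebra) coord_comult:
  assumes R: "\<And>x. x \<in> carrier A \<Longrightarrow> Poly_Mapping.keys (R x) \<subseteq> carrier A"
    "\<And>x. lsum (smul A) (R x) (\<lambda>e. e) = x" and x: "x \<in> carrier A"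
  shows "sweedler A fscale x (coord_tensor R) \<in> comult A x"
  unfolding mem_comult_iff[OF x] pairing_def
proof (intro conjI allI impI)
  show "Poly_Mapping.keys (sweedler A fscale x (coord_tensor R)) \<subseteq> carrier A \<times> carrier A"
    by (rule keys_coord_comult[OF R(1) x])
qed (rule lsum_coord_comult[OF R vector_space_mult functional_bilinear x])

text \<open>
  The structure constants of the coproduct in a basis \<open>E\<close> define the coalgebra.  Vectors outside \<open>E\<close>
  are made group-like and are sent to \<open>1\<close>; this harmless addition allows the structure constants to be
  defined on a whole type.
\<close>

theorem (in cocommutative_hopf_algebra) presentation:
  obtains \<Delta> :: "'a \<Rightarrow> ('a \<times> 'a \<Rightarrow>\<^sub>0 'k)" and \<epsilon> \<iota> where
    "cocomm_coalgebra \<Delta> \<epsilon>" "coalg_map \<Delta> \<epsilon> A \<iota>"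
    "\<forall>x\<in>carrier A. \<exists>p. x = lsum (smul A) p \<iota>"
proof -
  interpret V: vector_space "smul A" by (rule vector_space_smul)
  note fs = vector_space_fscale
  interpret F1: vector_space "fscale :: 'k \<Rightarrow> ('a \<Rightarrow>\<^sub>0 'k) \<Rightarrow> _" by (rule fs)
  interpret F2: vector_space "fscale :: 'k \<Rightarrow> ('a \<times> 'a \<Rightarrow>\<^sub>0 'k) \<Rightarrow> _" by (rule fs)
  interpret F3: vector_space "fscale :: 'k \<Rightarrow> ('a \<times> 'a \<times> 'a \<Rightarrow>\<^sub>0 'k) \<Rightarrow> _" by (rule fs)
  obtain R :: "'a \<Rightarrow> ('a \<Rightarrow>\<^sub>0 'k)" and E where R: "\<And>x y. R (x + y) = R x + R y"
    "\<And>c x. R (smul A c x) = fscale c (R x)" "E \<subseteq> carrier A" "\<And>e. e \<in> E \<Longrightarrow> R e = basis e"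
    "\<And>x. x \<in> carrier A \<Longrightarrow> Poly_Mapping.keys (R x) \<subseteq> E" "\<And>x. lsum (smul A) (R x) (\<lambda>e. e) = x"
    using V.coordinates_exist[OF subspace_carrier subspace_carrier] by (metis order_refl)
  have RA: "Poly_Mapping.keys (R x) \<subseteq> carrier A" if "x \<in> carrier A" for x
    using R(3,5) that by blast
  let ?P = "coord_tensor R"
  note P_bil = bilinear_coord_tensor[of R A, OF R(1,2)]
  have P_basis: "?P a b = basis (a, b)" if "a \<in> E" "b \<in> E" for a b
    using that by (simp add: coord_tensor_def R)
  define N where "N x = sweedler A fscale x ?P" for x
  have N_expand: "lsum s (N x) (\<lambda>(u, v). f u v) = sweedler A s x f"
    if s: "vector_space s" and f: "bilinear_on A A s f" and x: "x \<in> carrier A"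
    for s :: "'k \<Rightarrow> 'z::ab_group_add \<Rightarrow> 'z" and f x
    unfolding N_def by (rule lsum_coord_comult[OF RA R(6) s f x])
  have N_keys: "Poly_Mapping.keys (N x) \<subseteq> E \<times> E" if "x \<in> carrier A" for x
    unfolding N_def by (rule keys_coord_comult[OF R(5) that])
  have N_comult: "N x \<in> comult A x" if x: "x \<in> carrier A" for x
    unfolding N_def by (rule coord_comult[OF RA R(6) that])
  define \<Delta> where "\<Delta> b = (if b \<in> E then N b else basis (b, b))" for b
  define \<epsilon> where "\<epsilon> b = (if b \<in> E then counit A b else 1)" for b
  define \<iota> where "\<iota> b = (if b \<in> E then b else \<one>)" for b
  have csumE: "csum \<Delta> s b f = lsum s (N b) (\<lambda>(u, v). f u v)" if "b \<in> E"
    for s :: "'k \<Rightarrow> 'z::ab_group_add \<Rightarrow> 'z" and b f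
    using that by (simp add: csum_def \<Delta>_def)
  have csum0: "csum \<Delta> s b f = f b b" if "b \<notin> E" "vector_space s"
    for s :: "'k \<Rightarrow> 'z::ab_group_add \<Rightarrow> 'z" and b f
    using that by (simp add: csum_def \<Delta>_def vector_space.lsum_basis)
  have N_in: "u \<in> E" "v \<in> E" if "(u, v) \<in> Poly_Mapping.keys (N b)" "b \<in> E" for u v b
    using N_keys[of b] R(3) that by auto
  have N_cong: "lsum s (N b) (\<lambda>(u, v). f u v) = lsum s (N b) (\<lambda>(u, v). g u v)"
    if "b \<in> E" "\<And>u v. u \<in> E \<Longrightarrow> v \<in> E \<Longrightarrow> f u v = g u v"
    for s :: "'k \<Rightarrow> 'z::ab_group_add \<Rightarrow> 'z" and b f g
    using N_in[OF _ that(1)] that(2) by (auto intro!: lsum_cong)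
  have EA: "b \<in> carrier A" if "b \<in> E" for b using R(3) that by blast
  \<comment> \<open>On \<open>E\<close>, each coalgebra axiom is an axiom of \<open>A\<close> evaluated on a multilinear map built from \<open>R\<close>.\<close>
  have "cocomm_coalgebra \<Delta> \<epsilon>"
  proof
    fix b
    show "csum \<Delta> fscale b (\<lambda>u v. fscale (\<epsilon> u) (basis v)) = basis b"
    proof (cases "b \<in> E")
      case True
      have bil: "bilinear_on A A fscale (\<lambda>u v. fscale (counit A u) (R v))"
        unfolding bilinear_on_def linear_on_def
        by (auto simp: R counit_add counit_smul F1.scale_left_distrib F1.scale_right_distrib mult.commute)
      have "csum \<Delta> fscale b (\<lambda>u v. fscale (\<epsilon> u) (basis v)) = lsum fscale (N b) (\<lambda>(u, v). fscale (counit A u) (R v))"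
        unfolding csumE[OF True] by (rule N_cong[OF True]) (simp add: \<epsilon>_def R(4))
      also have "\<dots> = sweedler A fscale b (\<lambda>u v. fscale (counit A u) (R v))"
        by (rule N_expand[OF fs bil EA[OF True]])
      also have "\<dots> = R b"
        by (rule sweedler_counit[OF EA[OF True] fs]) (simp add: linear_on_def R)
      finally show ?thesis using True by (simp add: R)
    qed (simp add: csum0[OF _ fs] \<epsilon>_def)
    show "csum \<Delta> fscale b (\<lambda>u v. basis (v, u)) = \<Delta> b"
    proof (cases "b \<in> E")
      case True
      have bil: "bilinear_on A A fscale (\<lambda>u v. ?P v u)"
        using P_bil by (auto simp: bilinear_on_def)
      have "csum \<Delta> fscale b (\<lambda>u v. basis (v, u)) = lsum fscale (N b) (\<lambda>(u, v). ?P v u)"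
        unfolding csumE[OF True] by (rule N_cong[OF True]) (simp add: P_basis)
      also have "\<dots> = sweedler A fscale b (\<lambda>u v. ?P v u)"
        by (rule N_expand[OF fs bil EA[OF True]])
      also have "\<dots> = N b"
        unfolding N_def by (rule sweedler_cocomm[OF EA[OF True] fs P_bil, symmetric])
      finally show ?thesis using True by (simp add: \<Delta>_def)
    qed (simp add: csum0[OF _ fs] \<Delta>_def)
    show "csum \<Delta> fscale b (\<lambda>u w. csum \<Delta> fscale u (\<lambda>p q. basis (p, q, w))) =
      csum \<Delta> fscale b (\<lambda>p w. csum \<Delta> fscale w (\<lambda>q r. basis (p, q, r)))"
    proof (cases "b \<in> E")
      case True
      \<comment> \<open>The multilinear extension of the triples of basis vectors.\<close>
      define T where "T x y z = lsum fscale (R x) (\<lambda>e. lsum fscale (R y) (\<lambda>e'. lsum fscale (R z) (\<lambda>e''. basis (e, e', e''))))"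
        for x y z
      have T_lin: "linear_on A fscale (\<lambda>x. T x a c)" "linear_on A fscale (\<lambda>x. T a x c)"
        "linear_on A fscale (\<lambda>x. T a c x)" for a c
        by (auto simp: T_def linear_on_def R F3.lsum_add F3.lsum_fscale F3.lsum_body_add F3.lsum_body_scale)
      have T_basis: "T x y z = basis (x, y, z)" if "x \<in> E" "y \<in> E" "z \<in> E" for x y z
        using that by (simp add: T_def R)
      have bil1: "bilinear_on A A fscale (\<lambda>u v. T u v c)" and bil2: "bilinear_on A A fscale (\<lambda>u v. T c u v)" for c
        using T_lin by (auto simp: bilinear_on_def)
      have L: "bilinear_on A A fscale (\<lambda>u w. sweedler A fscale u (\<lambda>p q. T p q w))"
        by (intro bilinear_onI linear_on_sweedler[OF fs bil1] linear_on_sweedler_body[OF fs _ T_lin(3)])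
      have L': "bilinear_on A A fscale (\<lambda>p w. sweedler A fscale w (\<lambda>q r. T p q r))"
        by (intro bilinear_onI linear_on_sweedler[OF fs bil2] linear_on_sweedler_body[OF fs _ T_lin(1)])
      have in1: "csum \<Delta> fscale u (\<lambda>p q. basis (p, q, w)) = sweedler A fscale u (\<lambda>p q. T p q w)"
        if "u \<in> E" "w \<in> E" for u w
        unfolding csumE[OF that(1)] N_expand[OF fs bil1 EA[OF that(1)], symmetric]
        by (rule N_cong[OF that(1)]) (simp add: T_basis that)
      have in2: "csum \<Delta> fscale u (\<lambda>p q. basis (w, p, q)) = sweedler A fscale u (\<lambda>p q. T w p q)"
        if "u \<in> E" "w \<in> E" for u w
        unfolding csumE[OF that(1)] N_expand[OF fs bil2 EA[OF that(1)], symmetric]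
        by (rule N_cong[OF that(1)]) (simp add: T_basis that)
      have "csum \<Delta> fscale b (\<lambda>u w. csum \<Delta> fscale u (\<lambda>p q. basis (p, q, w))) =
          sweedler A fscale b (\<lambda>u w. sweedler A fscale u (\<lambda>p q. T p q w))"
        unfolding csumE[OF True] N_expand[OF fs L EA[OF True], symmetric]
        by (rule N_cong[OF True]) (simp add: in1)
      also have "\<dots> = sweedler A fscale b (\<lambda>p w. sweedler A fscale w (\<lambda>q r. T p q r))"
        by (rule sweedler_coassoc[OF EA[OF True] fs T_lin])
      also have "\<dots> = csum \<Delta> fscale b (\<lambda>p w. csum \<Delta> fscale w (\<lambda>q r. basis (p, q, r)))"
        unfolding csumE[OF True] N_expand[OF fs L' EA[OF True], symmetric]
        by (rule N_cong[OF True]) (simp add: in2)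
      finally show ?thesis .
    qed (simp add: csum0[OF _ fs])
  qed
  moreover have "coalg_map \<Delta> \<epsilon> A \<iota>"
    unfolding coalg_map_def
  proof (intro allI conjI)
    fix b
    show "\<iota> b \<in> carrier A" using EA by (simp add: \<iota>_def)
    show "counit A (\<iota> b) = \<epsilon> b" by (simp add: \<iota>_def \<epsilon>_def counit_one)
    show "csum \<Delta> fscale b (\<lambda>u v. basis (\<iota> u, \<iota> v)) \<in> comult A (\<iota> b)"
    proof (cases "b \<in> E")
      case True
      have "csum \<Delta> fscale b (\<lambda>u v. basis (\<iota> u, \<iota> v)) = lsum fscale (N b) (\<lambda>(u, v). basis (u, v))"
        unfolding csumE[OF True]
        by (rule N_cong[OF True]) (simp add: \<iota>_def)
      moreover have "lsum fscale (N b) (\<lambda>(u, v). basis (u, v)) = N b"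
        using lsum_basis_eq[of "N b"] by (simp add: case_prod_unfold)
      ultimately show ?thesis
        using N_comult[OF EA[OF True]] True by (simp add: \<iota>_def)
    next
      case False
      then show ?thesis
        by (simp add: csum0[OF _ fs] \<iota>_def comult_one tensor_class_self)
    qed
  qed
  moreover have "\<exists>p. x = lsum (smul A) p \<iota>" if "x \<in> carrier A" for x
  proof
    show "x = lsum (smul A) (R x) \<iota>"
      using R(5)[OF that] by (subst R(6)[symmetric]) (auto intro!: lsum_cong simp: \<iota>_def)
  qed
  ultimately show ?thesis using that by blast
qed

section \<open>Tensor products and generic points\<close>

lemma vector_space_scale:
  assumes "vector_space s"
  shows "s a (s b x) = s (a * b) x" "s 1 x = x"
  using assms by (auto simp: vector_space_def)

definition tensor_comult :: "('b \<Rightarrow> ('b \<times> 'b \<Rightarrow>\<^sub>0 'k::field)) \<Rightarrow> ('c \<Rightarrow> ('c \<times> 'c \<Rightarrow>\<^sub>0 'k)) \<Rightarrow>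
    'b \<times> 'c \<Rightarrow> (('b \<times> 'c) \<times> ('b \<times> 'c) \<Rightarrow>\<^sub>0 'k)" where
  "tensor_comult \<Delta> \<Delta>' = (\<lambda>(a, b). csum \<Delta> fscale a (\<lambda>a' a''. csum \<Delta>' fscale b (\<lambda>b' b''. basis ((a', b'), (a'', b'')))))"

definition tensor_counit :: "('b \<Rightarrow> 'k::field) \<Rightarrow> ('c \<Rightarrow> 'k) \<Rightarrow> 'b \<times> 'c \<Rightarrow> 'k" where
  "tensor_counit \<epsilon> \<epsilon>' = (\<lambda>(a, b). \<epsilon> a * \<epsilon>' b)"

lemma csum_tensor:
  assumes s: "vector_space s"
  shows "csum (tensor_comult \<Delta> \<Delta>') s (a, b) f =
    csum \<Delta> s a (\<lambda>a' a''. csum \<Delta>' s b (\<lambda>b' b''. f (a', b') (a'', b'')))"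
proof -
  have "csum (tensor_comult \<Delta> \<Delta>') s (a, b) f = lsum s (tensor_comult \<Delta> \<Delta>' (a, b)) (\<lambda>(u, v). f u v)"
    by (simp only: csum_def)
  then show ?thesis
    by (simp add: tensor_comult_def csum_bind[OF s] vector_space.lsum_basis[OF s])
qed

lemma tensor_coalgebra:
  fixes \<Delta> :: "'b \<Rightarrow> ('b \<times> 'b \<Rightarrow>\<^sub>0 'k::field)" and \<Delta>' :: "'c \<Rightarrow> ('c \<times> 'c \<Rightarrow>\<^sub>0 'k)"
  assumes "cocomm_coalgebra \<Delta> \<epsilon>" "cocomm_coalgebra \<Delta>' \<epsilon>'"
  shows "cocomm_coalgebra (tensor_comult \<Delta> \<Delta>') (tensor_counit \<epsilon> \<epsilon>')"
proof -
  interpret C: cocomm_coalgebra \<Delta> \<epsilon> by fact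
  interpret D: cocomm_coalgebra \<Delta>' \<epsilon>' by fact
  note fs = vector_space_fscale
  show ?thesis
  proof
    fix x :: "'b \<times> 'c"
    obtain a b where x: "x = (a, b)" by (cases x)
    show "csum (tensor_comult \<Delta> \<Delta>') fscale x (\<lambda>u v. fscale (tensor_counit \<epsilon> \<epsilon>' u) (basis v)) = basis x"
    proof -
      have "csum \<Delta> fscale a (\<lambda>a' a''. csum \<Delta>' fscale b (\<lambda>b' b''. fscale (\<epsilon> a' * \<epsilon>' b') (basis (a'', b'')))) =
        csum \<Delta> fscale a (\<lambda>a' a''. fscale (\<epsilon> a') (csum \<Delta>' fscale b (\<lambda>b' b''. fscale (\<epsilon>' b') (basis (a'', b'')))))"
        by (simp add: csum_scale[OF fs, symmetric] vector_space_scale(1)[OF fs])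
      then show ?thesis
        by (simp add: x csum_tensor[OF fs] tensor_counit_def D.csum_counit(1)[OF fs] C.csum_counit(1)[OF fs])
    qed
    show "csum (tensor_comult \<Delta> \<Delta>') fscale x (\<lambda>u v. basis (v, u)) = tensor_comult \<Delta> \<Delta>' x"
    proof -
      have "tensor_comult \<Delta> \<Delta>' (a, b) =
          csum \<Delta> fscale a (\<lambda>u v. csum \<Delta>' fscale b (\<lambda>u' v'. basis ((u, u'), (v, v'))))"
        by (simp add: tensor_comult_def)
      also have "\<dots> = csum \<Delta> fscale a (\<lambda>u v. csum \<Delta>' fscale b (\<lambda>u' v'. basis ((v, v'), (u, u'))))"
        by (subst C.csum_cocomm[OF fs], subst D.csum_cocomm[OF fs], rule refl)
      finally show ?thesis by (simp add: x csum_tensor[OF fs])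
    qed
    show "csum (tensor_comult \<Delta> \<Delta>') fscale x (\<lambda>u w. csum (tensor_comult \<Delta> \<Delta>') fscale u (\<lambda>p q. basis (p, q, w))) =
      csum (tensor_comult \<Delta> \<Delta>') fscale x (\<lambda>p w. csum (tensor_comult \<Delta> \<Delta>') fscale w (\<lambda>q r. basis (p, q, r)))"
    proof -
      have "csum (tensor_comult \<Delta> \<Delta>') fscale x (\<lambda>u w. csum (tensor_comult \<Delta> \<Delta>') fscale u (\<lambda>p q. basis (p, q, w))) =
        csum \<Delta> fscale a (\<lambda>u w. csum \<Delta>' fscale b (\<lambda>u' w'. csum \<Delta> fscale u (\<lambda>p q. csum \<Delta>' fscale u' (\<lambda>p' q'.
          basis ((p, p'), (q, q'), (w, w'))))))"
        by (simp add: x csum_tensor[OF fs])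
      also have "\<dots> = csum \<Delta> fscale a (\<lambda>u w. csum \<Delta> fscale u (\<lambda>p q. csum \<Delta>' fscale b (\<lambda>u' w'.
          csum \<Delta>' fscale u' (\<lambda>p' q'. basis ((p, p'), (q, q'), (w, w'))))))"
        by (subst csum_swap[OF fs, of \<Delta>']) (rule refl)
      also have "\<dots> = csum \<Delta> fscale a (\<lambda>u w. csum \<Delta> fscale w (\<lambda>p q. csum \<Delta>' fscale b (\<lambda>u' w'.
          csum \<Delta>' fscale w' (\<lambda>p' q'. basis ((u, u'), (p, p'), (q, q'))))))"
        by (subst C.csum_coassoc[OF fs], subst D.csum_coassoc[OF fs]) (rule refl)
      also have "\<dots> = csum \<Delta> fscale a (\<lambda>u w. csum \<Delta>' fscale b (\<lambda>u' w'. csum \<Delta> fscale w (\<lambda>p q. csum \<Delta>' fscale w' (\<lambda>p' q'.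
          basis ((u, u'), (p, p'), (q, q'))))))"
        by (subst csum_swap[OF fs, of \<Delta> _ \<Delta>']) (rule refl)
      also have "\<dots> = csum (tensor_comult \<Delta> \<Delta>') fscale x (\<lambda>p w. csum (tensor_comult \<Delta> \<Delta>') fscale w (\<lambda>q r. basis (p, q, r)))"
        by (simp add: x csum_tensor[OF fs])
      finally show ?thesis .
    qed
  qed
qed

text \<open>A point over one factor is a point over a tensor product: compose with the counit of the other factor.\<close>

lemma (in bialgebra) coalg_map_project:
  assumes D: "cocomm_coalgebra \<Delta>' \<epsilon>'" and f: "coalg_map \<Delta> \<epsilon> A f"
  shows "coalg_map (tensor_comult \<Delta> \<Delta>') (tensor_counit \<epsilon> \<epsilon>') A (\<lambda>(a, b). smul A (\<epsilon>' b) (f a))"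
    "coalg_map (tensor_comult \<Delta>' \<Delta>) (tensor_counit \<epsilon>' \<epsilon>) A (\<lambda>(b, a). smul A (\<epsilon>' b) (f a))"
proof -
  note ms = vector_space_mult
  note fA = coalg_mapD(1)[OF f]
  have lin: "linear_on A (*) (\<lambda>x. sweedler A (*) x (\<lambda>u v. \<phi> u * \<psi> v))"
    if "functional (smul A) \<phi>" "functional (smul A) \<psi>" for \<phi> \<psi>
    using that by (intro linear_on_sweedler ms functional_bilinear)
  have ctr: "csum \<Delta>' (*) b (\<lambda>b' b''. \<epsilon>' b' * x * (\<epsilon>' b'' * y)) = \<epsilon>' b * (x * y)" for b x y
  proof -
    have "csum \<Delta>' (*) b (\<lambda>b' b''. \<epsilon>' b' * x * (\<epsilon>' b'' * y)) = csum \<Delta>' (*) b (\<lambda>b' b''. \<epsilon>' b' * (\<epsilon>' b'' * (x * y)))"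
      by (rule csum_cong) (simp add: mult_ac)
    then show ?thesis using cocomm_coalgebra.csum_counit(1)[OF D ms] by simp
  qed
  have *: "csum \<Delta> (*) a (\<lambda>a' a''. \<epsilon>' b * (\<phi> (f a') * \<psi> (f a''))) =
      sweedler A (*) (smul A (\<epsilon>' b) (f a)) (\<lambda>u v. \<phi> u * \<psi> v)"
    if "functional (smul A) \<phi>" "functional (smul A) \<psi>" for \<phi> \<psi> a b
    using lin[OF that] fA sweedler_coalg_map[OF f ms functional_bilinear[OF that]]
    by (simp add: linear_on_def csum_scale[OF ms])
  show "coalg_map (tensor_comult \<Delta> \<Delta>') (tensor_counit \<epsilon> \<epsilon>') A (\<lambda>(a, b). smul A (\<epsilon>' b) (f a))"
    unfolding coalg_map_iff using fA
    by (auto simp: carrier_smul counit_smul coalg_mapD(2)[OF f] tensor_counit_def csum_tensor[OF ms]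
      functional_def[of _ \<phi> for \<phi>] ctr * mult.commute)
  show "coalg_map (tensor_comult \<Delta>' \<Delta>) (tensor_counit \<epsilon>' \<epsilon>) A (\<lambda>(b, a). smul A (\<epsilon>' b) (f a))"
    unfolding coalg_map_iff using fA
    by (auto simp: carrier_smul counit_smul coalg_mapD(2)[OF f] tensor_counit_def csum_tensor[OF ms]
      functional_def[of _ \<phi> for \<phi>] ctr * csum_swap[OF ms, of \<Delta>' _ \<Delta>])
qed

text \<open>
  Points that come from different factors of a tensor product are independent: the counits remove
  the second copy of each factor, and what remains is the bilinear map at unrelated values.
\<close>

lemma csum_project:
  assumes C: "cocomm_coalgebra \<Delta> \<epsilon>" and D: "cocomm_coalgebra \<Delta>' \<epsilon>'" and s: "vector_space s"
    and f: "\<And>a. f a \<in> carrier A" and g: "\<And>b. g b \<in> carrier B" and \<Phi>: "bilinear_on A B s \<Phi>"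
    and A: "subspace_of A" and B: "subspace_of B"
  shows "csum (tensor_comult \<Delta> \<Delta>') s (a, b)
      (\<lambda>u v. \<Phi> (case u of (a, b) \<Rightarrow> smul A (\<epsilon>' b) (f a)) (case v of (a, b) \<Rightarrow> smul B (\<epsilon> a) (g b))) =
    \<Phi> (f a) (g b)"
proof -
  have 1: "\<Phi> (smul A c (f x)) (smul B d (g y)) = s d (s c (\<Phi> (f x) (g y)))" for c d x y
    using \<Phi> f g subspace_ofD(6)[OF A] subspace_ofD(6)[OF B]
    by (simp add: bilinear_onD(3,4)[OF \<Phi>])
  show ?thesis
    by (simp add: csum_tensor[OF s] 1 csum_scale[OF s] cocomm_coalgebra.csum_counit[OF C s]
      cocomm_coalgebra.csum_counit[OF D s])
qed

text \<open>
  The values of the presenting points span, and over the tensor product of their coalgebras they are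
  independent.  The subspace \<open>W\<close> is \<open>{0}\<close> for identities, and the carrier of a
  sub-Hopf-algebra for closure under an operation.
\<close>

theorem generic_points2:
  fixes A :: "('k::field, 'a::ab_group_add, 'm) hopf_scheme"
    and B :: "('k, 'b::ab_group_add, 'n) hopf_scheme"
  assumes A: "cocommutative_hopf_algebra A" and B: "cocommutative_hopf_algebra B"
    and s: "vector_space s" and W: "module.subspace s W" and \<Phi>: "bilinear_on A B s \<Phi>"
    and *: "\<And>(\<Delta> :: 'a \<times> 'b \<Rightarrow> _) \<epsilon> f g c. cocomm_coalgebra \<Delta> \<epsilon> \<Longrightarrow> coalg_map \<Delta> \<epsilon> A f \<Longrightarrow>
      coalg_map \<Delta> \<epsilon> B g \<Longrightarrow> csum \<Delta> s c (\<lambda>u v. \<Phi> (f u) (g v)) \<in> W"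
    and x: "x \<in> carrier A" and y: "y \<in> carrier B"
  shows "\<Phi> x y \<in> W"
proof -
  interpret A: cocommutative_hopf_algebra A by fact
  interpret B: cocommutative_hopf_algebra B by fact
  interpret s: vector_space s by fact
  obtain \<Delta> :: "'a \<Rightarrow> _" and \<epsilon> f where f: "cocomm_coalgebra \<Delta> \<epsilon>" "coalg_map \<Delta> \<epsilon> A f"
    "\<forall>x\<in>carrier A. \<exists>p. x = lsum (smul A) p f" by (rule A.presentation)
  obtain \<Delta>' :: "'b \<Rightarrow> _" and \<epsilon>' g where g: "cocomm_coalgebra \<Delta>' \<epsilon>'" "coalg_map \<Delta>' \<epsilon>' B g"
    "\<forall>x\<in>carrier B. \<exists>p. x = lsum (smul B) p g" by (rule B.presentation)
  obtain p where p: "x = lsum (smul A) p f" using f(3) x by blast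
  obtain q where q: "y = lsum (smul B) q g" using g(3) y by blast
  have W2: "\<Phi> (f a) (g b) \<in> W" for a b
    using *[OF tensor_coalgebra[OF f(1) g(1)] A.coalg_map_project(1)[OF g(1) f(2)]
        B.coalg_map_project(2)[OF f(1) g(2)], of "(a, b)"]
    unfolding csum_project[OF f(1) g(1) s coalg_mapD(1)[OF f(2)] coalg_mapD(1)[OF g(2)] \<Phi>
        A.subspace_of B.subspace_of] .
  have "\<Phi> x y = lsum s p (\<lambda>a. lsum s q (\<lambda>b. \<Phi> (f a) (g b)))"
    unfolding p q using coalg_mapD(1)[OF f(2)] coalg_mapD(1)[OF g(2)]
    by (intro lsum_bilinear[OF s A.subspace_of B.subspace_of \<Phi>])
  also have "\<dots> \<in> W" by (intro s.lsum_in_subspace[OF W] W2)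
  finally show ?thesis .
qed

text \<open>The triple tensor product is bracketed to the right, so the last two points are lifted twice.\<close>

theorem generic_points3:
  fixes A :: "('k::field, 'a::ab_group_add, 'm) hopf_scheme"
    and B :: "('k, 'b::ab_group_add, 'n) hopf_scheme"
    and D :: "('k, 'c::ab_group_add, 'o) hopf_scheme"
  assumes A: "cocommutative_hopf_algebra A" and B: "cocommutative_hopf_algebra B"
    and D: "cocommutative_hopf_algebra D"
    and s: "vector_space s" and W: "module.subspace s W"
    and \<Phi>: "\<And>y z. y \<in> carrier B \<Longrightarrow> z \<in> carrier D \<Longrightarrow> linear_on A s (\<lambda>x. \<Phi> x y z)"
      "\<And>x z. x \<in> carrier A \<Longrightarrow> z \<in> carrier D \<Longrightarrow> linear_on B s (\<lambda>y. \<Phi> x y z)"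
      "\<And>x y. x \<in> carrier A \<Longrightarrow> y \<in> carrier B \<Longrightarrow> linear_on D s (\<lambda>z. \<Phi> x y z)"
    and *: "\<And>(\<Delta> :: 'a \<times> 'b \<times> 'c \<Rightarrow> _) \<epsilon> f g h c. cocomm_coalgebra \<Delta> \<epsilon> \<Longrightarrow> coalg_map \<Delta> \<epsilon> A f \<Longrightarrow>
      coalg_map \<Delta> \<epsilon> B g \<Longrightarrow> coalg_map \<Delta> \<epsilon> D h \<Longrightarrow>
      csum \<Delta> s c (\<lambda>u w. csum \<Delta> s w (\<lambda>v t. \<Phi> (f u) (g v) (h t))) \<in> W"
    and x: "x \<in> carrier A" and y: "y \<in> carrier B" and z: "z \<in> carrier D"
  shows "\<Phi> x y z \<in> W"
proof -
  interpret A: cocommutative_hopf_algebra A by fact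
  interpret B: cocommutative_hopf_algebra B by fact
  interpret D: cocommutative_hopf_algebra D by fact
  interpret s: vector_space s by fact
  obtain \<Delta> :: "'a \<Rightarrow> _" and \<epsilon> f where f: "cocomm_coalgebra \<Delta> \<epsilon>" "coalg_map \<Delta> \<epsilon> A f"
    "\<forall>x\<in>carrier A. \<exists>p. x = lsum (smul A) p f" by (rule A.presentation)
  obtain \<Delta>' :: "'b \<Rightarrow> _" and \<epsilon>' g where g: "cocomm_coalgebra \<Delta>' \<epsilon>'" "coalg_map \<Delta>' \<epsilon>' B g"
    "\<forall>x\<in>carrier B. \<exists>p. x = lsum (smul B) p g" by (rule B.presentation)
  obtain \<Delta>'' :: "'c \<Rightarrow> _" and \<epsilon>'' h where h: "cocomm_coalgebra \<Delta>'' \<epsilon>''" "coalg_map \<Delta>'' \<epsilon>'' D h"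
    "\<forall>x\<in>carrier D. \<exists>p. x = lsum (smul D) p h" by (rule D.presentation)
  note fc = coalg_mapD(1)[OF f(2)] and gc = coalg_mapD(1)[OF g(2)] and hc = coalg_mapD(1)[OF h(2)]
  obtain p where p: "x = lsum (smul A) p f" using f(3) x by blast
  obtain q where q: "y = lsum (smul B) q g" using g(3) y by blast
  obtain r where r: "z = lsum (smul D) r h" using h(3) z by blast
  note gh = tensor_coalgebra[OF g(1) h(1)]
  have W3: "\<Phi> (f a) (g b) (h c) \<in> W" for a b c
  proof -
    define T where "T = tensor_comult \<Delta>' \<Delta>''"
    define e where "e = tensor_counit \<epsilon>' \<epsilon>''"
    define F where "F = (\<lambda>(a, b). smul A (e b) (f a))"
    define G where "G = (\<lambda>(b, c). smul B (\<epsilon>'' c) (g b))"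
    \<comment> \<open>\<open>F\<close>, \<open>G'\<close>, \<open>H'\<close> are the three points over the triple tensor product, \<open>G\<close> and \<open>H\<close> those over \<open>T\<close>.\<close>
    define G' where "G' = (\<lambda>(a, b). smul B (\<epsilon> a) (G b))"
    define H where "H = (\<lambda>(b, c). smul D (\<epsilon>' b) (h c))"
    define H' where "H' = (\<lambda>(a, b). smul D (\<epsilon> a) (H b))"
    have G: "coalg_map T e B G" and H: "coalg_map T e D H"
      unfolding T_def e_def G_def H_def
      by (rule B.coalg_map_project(1)[OF h(1) g(2)] D.coalg_map_project(2)[OF g(1) h(2)])+
    have T: "cocomm_coalgebra T e" using gh by (simp add: T_def e_def)
    interpret T: cocomm_coalgebra T e by fact
    interpret C: cocomm_coalgebra \<Delta> \<epsilon> by (rule f(1))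
    \<comment> \<open>The hypothesis at the three lifted points; the counits are then removed in two steps.\<close>
    have "csum (tensor_comult \<Delta> T) s (a, (b, c)) (\<lambda>u w. csum (tensor_comult \<Delta> T) s w
        (\<lambda>v t. \<Phi> (F u) (G' v) (H' t))) \<in> W"
      unfolding F_def G'_def H'_def
      by (rule *[OF tensor_coalgebra[OF f(1) T] A.coalg_map_project(1)[OF T f(2)]
         B.coalg_map_project(2)[OF f(1) G] D.coalg_map_project(2)[OF f(1) H]])
    also have "csum (tensor_comult \<Delta> T) s (a, (b, c)) (\<lambda>u w. csum (tensor_comult \<Delta> T) s w
        (\<lambda>v t. \<Phi> (F u) (G' v) (H' t))) = csum T s (b, c) (\<lambda>v t. \<Phi> (f a) (G v) (H t))"
    proof -
      have 1: "\<Phi> (smul A k (f a)) (smul B l (G u)) (smul D m (H v)) = s m (s l (s k (\<Phi> (f a) (G u) (H v))))"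
        for k l m a u v
        using \<Phi> fc coalg_mapD(1)[OF G] coalg_mapD(1)[OF H] A.carrier_smul B.carrier_smul D.carrier_smul
        by (simp add: linear_on_def)
      show ?thesis
        by (simp add: csum_tensor[OF s] F_def G'_def H'_def 1 csum_scale[OF s] C.csum_counit[OF s] T.csum_counit[OF s]
          del: s.scale_scale)
    qed
    also have "\<dots> = \<Phi> (f a) (g b) (h c)"
      unfolding T_def G_def H_def using \<Phi> fc
      by (intro csum_project[OF g(1) h(1) s gc hc _ B.subspace_of D.subspace_of] bilinear_onI) auto
    finally show ?thesis .
  qed
  have "\<Phi> x y z = lsum s p (\<lambda>a. \<Phi> (f a) y z)"
    unfolding p by (rule linear_on_lsum[OF A.subspace_of s \<Phi>(1)[OF y z] fc])
  also have "\<dots> = lsum s p (\<lambda>a. lsum s q (\<lambda>b. lsum s r (\<lambda>c. \<Phi> (f a) (g b) (h c))))"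
    unfolding q r using fc gc hc \<Phi>
    by (intro lsum_cong refl lsum_bilinear[OF s B.subspace_of D.subspace_of] bilinear_onI) auto
  also have "\<dots> \<in> W" by (intro s.lsum_in_subspace[OF W] W3)
  finally show ?thesis .
qed

section \<open>The convolution group\<close>

context bialgebra begin

lemma mult_bilinear: "bilinear_on A A (smul A) (mult A)"
  using bilinear_mult by (simp add: bilinear_map_def linear_map_iff bilinear_on_def)

lemma linear_on_mult:
  assumes "linear_on X (smul A) f" "\<And>x. x \<in> carrier X \<Longrightarrow> f x \<in> carrier A" "c \<in> carrier A"
  shows "linear_on X (smul A) (\<lambda>x. f x \<otimes> c)" "linear_on X (smul A) (\<lambda>x. c \<otimes> f x)"
  using assms by (auto simp: linear_on_def bilinear_onD[OF mult_bilinear])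

lemma sweedler_mult:
  assumes x: "x \<in> carrier A" and y: "y \<in> carrier A" and s: "vector_space s" and f: "bilinear_on A A s f"
  shows "sweedler A s (x \<otimes> y) f =
    sweedler A s x (\<lambda>x' x''. sweedler A s y (\<lambda>y' y''. f (x' \<otimes> y') (x'' \<otimes> y'')))"
proof -
  let ?p = "sweedler A fscale x (\<lambda>x' x''. sweedler A fscale y (\<lambda>y' y''. basis (x' \<otimes> y', x'' \<otimes> y'')))"
  have "Poly_Mapping.keys ?p \<subseteq> carrier A \<times> carrier A"
    unfolding sweedler_lsum
  proof (rule keys_lsum)
    fix z assume z: "z \<in> Poly_Mapping.keys (comult_rep A x)"
    obtain u v where uv: "z = (u, v)" by (cases z)
    show "Poly_Mapping.keys (case z of (x', x'') \<Rightarrow>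
        lsum fscale (comult_rep A y) (\<lambda>(y', y''). basis (x' \<otimes> y', x'' \<otimes> y''))) \<subseteq> carrier A \<times> carrier A"
      unfolding uv prod.case using comult_rep_keys[OF x] z uv comult_rep_keys[OF y]
      by (intro keys_lsum) auto
  qed
  then have "?p \<in> comult A (x \<otimes> y)" unfolding comult_mult[OF x y] by (rule tensor_class_self)
  from sweedler_eq_lsum[OF m_closed[OF x y] this s f] show ?thesis
    unfolding sweedler_lsum
    by (simp add: vector_space.lsum_bind[OF s] vector_space.lsum_basis[OF s] case_prod_unfold)
qed

lemma sweedler_one:
  assumes s: "vector_space s" and f: "bilinear_on A A s f"
  shows "sweedler A s \<one> f = f \<one> \<one>"
proof -
  have "basis (\<one>, \<one>) \<in> comult A \<one>" by (simp add: comult_one tensor_class_self)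
  from sweedler_eq_lsum[OF one_closed this s f] show ?thesis
    by (simp add: vector_space.lsum_basis[OF s])
qed

end

context cocommutative_hopf_algebra begin

lemma antipode_linear: "linear_on A (smul A) (antipode A)"
  using linear_antipode by (simp add: linear_map_iff)

lemma antipode_closed: "x \<in> carrier A \<Longrightarrow> antipode A x \<in> carrier A"
  using linear_antipode by (auto simp: linear_map_def)

lemma ad_bilinear_body:
  assumes "y \<in> carrier A"
  shows "bilinear_on A A (smul A) (\<lambda>u v. u \<otimes> y \<otimes> antipode A v)"
  using assms antipode_linear antipode_closed bilinear_onD[OF mult_bilinear]
  by (auto intro!: bilinear_onI simp: linear_on_def)

end

lemma csum_bilinear:
  assumes A: "subspace_of A" and B: "subspace_of B" and s: "vector_space s" and f: "bilinear_on A B s f"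
  shows "\<lbrakk>\<And>u v. g u v \<in> carrier A; y \<in> carrier B\<rbrakk> \<Longrightarrow>
      f (csum \<Delta> (smul A) b g) y = csum \<Delta> s b (\<lambda>u v. f (g u v) y)"
    "\<lbrakk>\<And>u v. h u v \<in> carrier B; x \<in> carrier A\<rbrakk> \<Longrightarrow>
      f x (csum \<Delta> (smul B) b h) = csum \<Delta> s b (\<lambda>u v. f x (h u v))"
  using f by (auto intro!: linear_on_csum[OF A s] linear_on_csum[OF B s] simp: bilinear_on_def)

definition conv :: "('b \<Rightarrow> ('b \<times> 'b \<Rightarrow>\<^sub>0 'k::field)) \<Rightarrow> ('k, 'a::ab_group_add, 'm) bialgebra_scheme \<Rightarrow>
    ('b \<Rightarrow> 'a) \<Rightarrow> ('b \<Rightarrow> 'a) \<Rightarrow> 'b \<Rightarrow> 'a" where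
  "conv \<Delta> A f g = (\<lambda>b. csum \<Delta> (smul A) b (\<lambda>u v. f u \<otimes>\<^bsub>A\<^esub> g v))"

definition conv_group :: "('b \<Rightarrow> ('b \<times> 'b \<Rightarrow>\<^sub>0 'k::field)) \<Rightarrow> ('b \<Rightarrow> 'k) \<Rightarrow>
    ('k, 'a::ab_group_add, 'm) bialgebra_scheme \<Rightarrow> ('b \<Rightarrow> 'a) monoid" where
  "conv_group \<Delta> \<epsilon> A = \<lparr>carrier = {g. coalg_map \<Delta> \<epsilon> A g}, monoid.mult = conv \<Delta> A,
     one = (\<lambda>b. smul A (\<epsilon> b) \<one>\<^bsub>A\<^esub>)\<rparr>"

lemma conv_group_simps [simp]:
  "g \<in> carrier (conv_group \<Delta> \<epsilon> A) \<longleftrightarrow> coalg_map \<Delta> \<epsilon> A g"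
  "mult (conv_group \<Delta> \<epsilon> A) = conv \<Delta> A"
  "one (conv_group \<Delta> \<epsilon> A) = (\<lambda>b. smul A (\<epsilon> b) \<one>\<^bsub>A\<^esub>)"
  by (auto simp: conv_group_def)

locale convolution = C: cocomm_coalgebra \<Delta> \<epsilon> + A: cocommutative_hopf_algebra A
  for \<Delta> :: "'b \<Rightarrow> ('b \<times> 'b \<Rightarrow>\<^sub>0 'k::field)" and \<epsilon>
    and A :: "('k, 'a::ab_group_add, 'm) hopf_scheme" (structure)
begin

lemma ms: "vector_space ((*) :: 'k \<Rightarrow> 'k \<Rightarrow> 'k)" by (rule vector_space_mult)

text \<open>
  The coproduct is multiplicative, and the two middle factors of the resulting fourfold coproduct
  may be exchanged; here cocommutativity of the coalgebra enters.
\<close>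

lemma conv_closed:
  assumes f: "coalg_map \<Delta> \<epsilon> A f" and g: "coalg_map \<Delta> \<epsilon> A g"
  shows "coalg_map \<Delta> \<epsilon> A (conv \<Delta> A f g)"
proof -
  note fA = coalg_mapD(1)[OF f] and gA = coalg_mapD(1)[OF g]
  have cl: "conv \<Delta> A f g b \<in> carrier A" for b
    unfolding conv_def using fA gA by (intro csum_closed[OF A.subspace_of]) auto
  show ?thesis
    unfolding A.coalg_map_iff
  proof (intro allI conjI impI cl)
    fix b
    have "counit A (conv \<Delta> A f g b) = csum \<Delta> (*) b (\<lambda>u v. counit A (f u \<otimes> g v))"
      unfolding conv_def using fA gA
      by (intro linear_on_csum[OF A.subspace_of ms A.linear_on_counit]) auto
    then show "counit A (conv \<Delta> A f g b) = \<epsilon> b"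
      using C.csum_counit(1)[OF ms]
      by (simp add: A.counit_mult fA gA coalg_mapD(2)[OF f] coalg_mapD(2)[OF g])
  next
    fix b \<phi> \<psi> assume \<phi>: "functional (smul A) \<phi>" and \<psi>: "functional (smul A) \<psi>"
    let ?\<beta> = "\<lambda>x y. \<phi> x * \<psi> y"
    have \<beta>: "bilinear_on A A (*) ?\<beta>" using functional_bilinear[OF \<phi> \<psi>] .
    have "csum \<Delta> (*) b (\<lambda>u v. ?\<beta> (conv \<Delta> A f g u) (conv \<Delta> A f g v)) =
      csum \<Delta> (*) b (\<lambda>u v. csum \<Delta> (*) u (\<lambda>p q. csum \<Delta> (*) v (\<lambda>r t. ?\<beta> (f p \<otimes> g q) (f r \<otimes> g t))))"
    proof (rule csum_cong)
      fix u v
      have "?\<beta> (conv \<Delta> A f g u) (conv \<Delta> A f g v) =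
          csum \<Delta> (*) u (\<lambda>p q. ?\<beta> (f p \<otimes> g q) (conv \<Delta> A f g v))"
        using cl fA gA by (subst conv_def, intro csum_bilinear(1)[OF A.subspace_of A.subspace_of ms \<beta>]) auto
      also have "\<dots> = csum \<Delta> (*) u (\<lambda>p q. csum \<Delta> (*) v (\<lambda>r t. ?\<beta> (f p \<otimes> g q) (f r \<otimes> g t)))"
        unfolding conv_def using fA gA
        by (intro csum_cong csum_bilinear(2)[OF A.subspace_of A.subspace_of ms \<beta>]) auto
      finally show "?\<beta> (conv \<Delta> A f g u) (conv \<Delta> A f g v) =
        csum \<Delta> (*) u (\<lambda>p q. csum \<Delta> (*) v (\<lambda>r t. ?\<beta> (f p \<otimes> g q) (f r \<otimes> g t)))" .
    qed
    also have "\<dots> = csum \<Delta> (*) b (\<lambda>u v. csum \<Delta> (*) u (\<lambda>p q. csum \<Delta> (*) v (\<lambda>r t. ?\<beta> (f p \<otimes> g r) (f q \<otimes> g t))))"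
      by (rule C.csum_middle_swap[OF ms])
    also have "\<dots> = csum \<Delta> (*) b (\<lambda>u v. sweedler A (*) (f u \<otimes> g v) ?\<beta>)"
    proof (rule csum_cong)
      fix u v
      have "sweedler A (*) (f u \<otimes> g v) ?\<beta> =
        sweedler A (*) (f u) (\<lambda>x' x''. sweedler A (*) (g v) (\<lambda>y' y''. ?\<beta> (x' \<otimes> y') (x'' \<otimes> y'')))"
        by (rule A.sweedler_mult[OF fA gA ms \<beta>])
      also have "\<dots> = sweedler A (*) (f u) (\<lambda>x' x''. csum \<Delta> (*) v (\<lambda>r t. ?\<beta> (x' \<otimes> g r) (x'' \<otimes> g t)))"
        using fA bilinear_onD[OF \<beta>] bilinear_onD[OF A.mult_bilinear]
        by (intro A.sweedler_cong A.sweedler_coalg_map[OF g ms] bilinear_onI)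
          (auto simp: linear_on_def A.carrier_add A.carrier_smul)
      also have "\<dots> = csum \<Delta> (*) v (\<lambda>r t. sweedler A (*) (f u) (\<lambda>x' x''. ?\<beta> (x' \<otimes> g r) (x'' \<otimes> g t)))"
        by (simp add: sweedler_lsum csum_lsum[OF ms, symmetric] case_prod_unfold)
      also have "\<dots> = csum \<Delta> (*) v (\<lambda>r t. csum \<Delta> (*) u (\<lambda>p q. ?\<beta> (f p \<otimes> g r) (f q \<otimes> g t)))"
        using gA bilinear_onD[OF \<beta>] bilinear_onD[OF A.mult_bilinear]
        by (intro csum_cong A.sweedler_coalg_map[OF f ms] bilinear_onI)
          (auto simp: linear_on_def A.carrier_add A.carrier_smul)
      finally show "csum \<Delta> (*) u (\<lambda>p q. csum \<Delta> (*) v (\<lambda>r t. ?\<beta> (f p \<otimes> g r) (f q \<otimes> g t))) =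
          sweedler A (*) (f u \<otimes> g v) ?\<beta>"
        by (simp add: csum_swap[OF ms, of \<Delta> u])
    qed
    also have "\<dots> = sweedler A (*) (conv \<Delta> A f g b) ?\<beta>"
      unfolding conv_def using fA gA
      by (intro linear_on_csum[OF A.subspace_of ms A.linear_on_sweedler[OF ms \<beta>], symmetric]) auto
    finally show "csum \<Delta> (*) b (\<lambda>u v. ?\<beta> (conv \<Delta> A f g u) (conv \<Delta> A f g v)) =
      sweedler A (*) (conv \<Delta> A f g b) ?\<beta>" .
  qed
qed

lemma conv_assoc:
  assumes f: "\<And>b. f b \<in> carrier A" and g: "\<And>b. g b \<in> carrier A" and h: "\<And>b. h b \<in> carrier A"
  shows "conv \<Delta> A (conv \<Delta> A f g) h = conv \<Delta> A f (conv \<Delta> A g h)"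
proof
  fix b
  note V = A.vector_space_smul
  have "conv \<Delta> A (conv \<Delta> A f g) h b = csum \<Delta> (smul A) b (\<lambda>u w. csum \<Delta> (smul A) u (\<lambda>p q. f p \<otimes> g q \<otimes> h w))"
    using f g h by (simp add: conv_def csum_bilinear(1)[OF A.subspace_of A.subspace_of V A.mult_bilinear])
  also have "\<dots> = csum \<Delta> (smul A) b (\<lambda>p w. csum \<Delta> (smul A) w (\<lambda>q t. f p \<otimes> g q \<otimes> h t))"
    by (rule C.csum_coassoc[OF V])
  also have "\<dots> = conv \<Delta> A f (conv \<Delta> A g h) b"
    using f g h
    by (simp add: conv_def A.m_assoc csum_bilinear(2)[OF A.subspace_of A.subspace_of V A.mult_bilinear])
  finally show "conv \<Delta> A (conv \<Delta> A f g) h b = conv \<Delta> A f (conv \<Delta> A g h) b" .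
qed

lemma unit_coalg_map: "coalg_map \<Delta> \<epsilon> A (\<lambda>b. smul A (\<epsilon> b) \<one>)"
  unfolding A.coalg_map_iff
proof (intro allI conjI impI)
  fix b
  show "smul A (\<epsilon> b) \<one> \<in> carrier A" "counit A (smul A (\<epsilon> b) \<one>) = \<epsilon> b"
    by (auto simp: A.carrier_smul A.counit_smul A.counit_one)
  fix \<phi> \<psi> assume \<phi>: "functional (smul A) \<phi>" and \<psi>: "functional (smul A) \<psi>"
  note \<beta> = functional_bilinear[OF \<phi> \<psi>]
  have "csum \<Delta> (*) b (\<lambda>u v. \<phi> (smul A (\<epsilon> u) \<one>) * \<psi> (smul A (\<epsilon> v) \<one>)) =
    csum \<Delta> (*) b (\<lambda>u v. \<epsilon> u * (\<epsilon> v * (\<phi> \<one> * \<psi> \<one>)))"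
    using \<phi> \<psi> by (intro csum_cong) (auto simp: functional_def)
  also have "\<dots> = \<epsilon> b * sweedler A (*) \<one> (\<lambda>u v. \<phi> u * \<psi> v)"
    by (simp add: C.csum_counit(1)[OF ms] A.sweedler_one[OF ms \<beta>])
  also have "\<dots> = sweedler A (*) (smul A (\<epsilon> b) \<one>) (\<lambda>u v. \<phi> u * \<psi> v)"
    using A.linear_on_sweedler[OF ms \<beta>] by (simp add: linear_on_def)
  finally show "csum \<Delta> (*) b (\<lambda>u v. \<phi> (smul A (\<epsilon> u) \<one>) * \<psi> (smul A (\<epsilon> v) \<one>)) =
    sweedler A (*) (smul A (\<epsilon> b) \<one>) (\<lambda>u v. \<phi> u * \<psi> v)" .
qed

lemma conv_one:
  assumes f: "\<And>b. f b \<in> carrier A"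
  shows "conv \<Delta> A (\<lambda>b. smul A (\<epsilon> b) \<one>) f = f" "conv \<Delta> A f (\<lambda>b. smul A (\<epsilon> b) \<one>) = f"
  using f C.csum_counit[OF A.vector_space_smul]
  by (auto simp: conv_def bilinear_onD[OF A.mult_bilinear])

lemma conv_antipode:
  assumes f: "coalg_map \<Delta> \<epsilon> A f"
  shows "conv \<Delta> A (\<lambda>b. antipode A (f b)) f = (\<lambda>b. smul A (\<epsilon> b) \<one>)"
    "conv \<Delta> A f (\<lambda>b. antipode A (f b)) = (\<lambda>b. smul A (\<epsilon> b) \<one>)"
proof -
  note fA = coalg_mapD(1)[OF f]
  note S = A.antipode_linear A.antipode_closed
  have "bilinear_on A A (smul A) (\<lambda>x y. antipode A x \<otimes> y)"
    using S by (intro bilinear_onI A.linear_on_mult) (auto simp: linear_on_def)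
  then show "conv \<Delta> A (\<lambda>b. antipode A (f b)) f = (\<lambda>b. smul A (\<epsilon> b) \<one>)"
    using A.antipode_left[OF fA] A.sweedler_coalg_map[OF f A.vector_space_smul]
    by (auto simp: conv_def coalg_mapD(2)[OF f])
  have "bilinear_on A A (smul A) (\<lambda>x y. x \<otimes> antipode A y)"
    using S by (intro bilinear_onI A.linear_on_mult) (auto simp: linear_on_def)
  then show "conv \<Delta> A f (\<lambda>b. antipode A (f b)) = (\<lambda>b. smul A (\<epsilon> b) \<one>)"
    using A.antipode_right[OF fA] A.sweedler_coalg_map[OF f A.vector_space_smul]
    by (auto simp: conv_def coalg_mapD(2)[OF f])
qed

text \<open>
  The two sides of \<open>\<Delta> (S x) = S x' \<otimes> S x''\<close> are convolution inverses of the coproduct, hence equal.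
  Tested on a bilinear form, this becomes the following chain.
\<close>

lemma antipode_coalg_map:
  assumes g: "coalg_map \<Delta> \<epsilon> A g"
  shows "coalg_map \<Delta> \<epsilon> A (\<lambda>b. antipode A (g b))"
  unfolding A.coalg_map_iff
proof (intro allI conjI impI)
  note gA = coalg_mapD(1)[OF g]
  define S where "S b = antipode A (g b)" for b
  have SA: "S b \<in> carrier A" for b using gA by (simp add: S_def A.antipode_closed)
  have conv1: "csum \<Delta> (smul A) b (\<lambda>u v. S u \<otimes> g v) = smul A (\<epsilon> b) \<one>"
    and conv2: "csum \<Delta> (smul A) b (\<lambda>u v. g u \<otimes> S v) = smul A (\<epsilon> b) \<one>" for b
    using conv_antipode[OF g] by (auto simp: conv_def S_def fun_eq_iff)
  fix b
  show "antipode A (g b) \<in> carrier A" using SA by (simp add: S_def)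
  have "counit A (csum \<Delta> (smul A) b (\<lambda>u v. S u \<otimes> g v)) = csum \<Delta> (*) b (\<lambda>u v. counit A (S u \<otimes> g v))"
    using gA SA by (intro linear_on_csum[OF A.subspace_of ms A.linear_on_counit]) auto
  also have "\<dots> = csum \<Delta> (*) b (\<lambda>u v. \<epsilon> v * counit A (S u))"
    using gA SA by (intro csum_cong) (simp add: A.counit_mult coalg_mapD(2)[OF g])
  also have "\<dots> = counit A (S b)" by (rule C.csum_counit(2)[OF ms])
  finally show "counit A (antipode A (g b)) = \<epsilon> b"
    unfolding conv1 by (simp add: A.counit_smul A.counit_one S_def)
  fix \<phi> \<psi> assume \<phi>: "functional (smul A) \<phi>" and \<psi>: "functional (smul A) \<psi>"
  let ?\<beta> = "\<lambda>x y. \<phi> x * \<psi> y"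
  have \<beta>: "bilinear_on A A (*) ?\<beta>" using functional_bilinear[OF \<phi> \<psi>] .
  have \<beta>r: "bilinear_on A A (*) (\<lambda>x y. ?\<beta> (x \<otimes> y1) (y \<otimes> y2))"
    and \<beta>l: "bilinear_on A A (*) (\<lambda>x y. ?\<beta> (y1 \<otimes> x) (y2 \<otimes> y))"
    if "y1 \<in> carrier A" "y2 \<in> carrier A" for y1 y2
    using that bilinear_onD[OF \<beta>] bilinear_onD[OF A.mult_bilinear]
    by (auto intro!: bilinear_onI simp: linear_on_def A.carrier_add A.carrier_smul)
  let ?E = "\<lambda>x y1 y2. sweedler A (*) x (\<lambda>x' x''. ?\<beta> (x' \<otimes> y1) (x'' \<otimes> y2))"
  have E: "bilinear_on A A (*) (?E x)" if "x \<in> carrier A" for x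
    using \<beta>l that by (intro bilinear_onI A.linear_on_sweedler_body[OF ms]) (auto simp: bilinear_on_def)
  have E1: "?E x \<one> \<one> = sweedler A (*) x ?\<beta>" if "x \<in> carrier A" for x
    using that by (intro A.sweedler_cong) auto
  \<comment> \<open>Inserting \<open>g * S = \<epsilon>\<close> into both arguments of a bilinear form at once.\<close>
  have cancel: "csum \<Delta> (*) v (\<lambda>p q. csum \<Delta> (*) p (\<lambda>p1 p2. csum \<Delta> (*) q (\<lambda>q1 q2.
      \<gamma> (g p1 \<otimes> S q1) (g p2 \<otimes> S q2)))) = \<epsilon> v * \<gamma> \<one> \<one>"
    if \<gamma>: "bilinear_on A A (*) \<gamma>" for \<gamma> v
  proof -
    have "csum \<Delta> (*) v (\<lambda>p q. csum \<Delta> (*) p (\<lambda>p1 p2. csum \<Delta> (*) q (\<lambda>q1 q2.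
        \<gamma> (g p1 \<otimes> S q1) (g p2 \<otimes> S q2)))) =
      csum \<Delta> (*) v (\<lambda>p q. csum \<Delta> (*) p (\<lambda>p1 p2. csum \<Delta> (*) q (\<lambda>q1 q2.
        \<gamma> (g p1 \<otimes> S p2) (g q1 \<otimes> S q2))))"
      by (rule C.csum_middle_swap[OF ms])
    also have "\<dots> = csum \<Delta> (*) v (\<lambda>p q. \<gamma> (csum \<Delta> (smul A) p (\<lambda>p1 p2. g p1 \<otimes> S p2))
        (csum \<Delta> (smul A) q (\<lambda>q1 q2. g q1 \<otimes> S q2)))"
      using gA SA by (simp add: csum_bilinear(1)[OF A.subspace_of A.subspace_of ms \<gamma>] csum_closed[OF A.subspace_of])
        (simp add: csum_bilinear(2)[OF A.subspace_of A.subspace_of ms \<gamma>])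
    also have "\<dots> = csum \<Delta> (*) v (\<lambda>p q. \<epsilon> p * (\<epsilon> q * \<gamma> \<one> \<one>))"
      by (simp add: conv2 bilinear_onD[OF \<gamma>] A.carrier_smul mult.left_commute)
    finally show ?thesis by (simp add: C.csum_counit(1)[OF ms])
  qed
  \<comment> \<open>From \<open>\<Delta> S\<close> pass to \<open>\<Delta> S * (\<Delta> g * (S \<otimes> S))\<close>, reassociate, and cancel \<open>\<Delta> S * \<Delta> g\<close>.\<close>
  have "sweedler A (*) (S b) ?\<beta> = csum \<Delta> (*) b (\<lambda>u v. \<epsilon> v * sweedler A (*) (S u) ?\<beta>)"
    by (rule C.csum_counit(2)[OF ms, symmetric])
  also have "\<dots> = csum \<Delta> (*) b (\<lambda>u v. csum \<Delta> (*) v (\<lambda>p q. csum \<Delta> (*) p (\<lambda>p1 p2. csum \<Delta> (*) q (\<lambda>q1 q2.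
      ?E (S u) (g p1 \<otimes> S q1) (g p2 \<otimes> S q2)))))"
    using cancel[OF E[OF SA]] E1[OF SA] by simp
  also have "\<dots> = csum \<Delta> (*) b (\<lambda>u v. csum \<Delta> (*) v (\<lambda>p q. csum \<Delta> (*) q (\<lambda>q1 q2.
      ?E (S u \<otimes> g p) (S q1) (S q2))))"
  proof (intro csum_cong)
    fix u v p q
    have "csum \<Delta> (*) p (\<lambda>p1 p2. ?E (S u) (g p1 \<otimes> S q1) (g p2 \<otimes> S q2)) = ?E (S u \<otimes> g p) (S q1) (S q2)"
      for q1 q2
    proof -
      have "?E (S u \<otimes> g p) (S q1) (S q2) = sweedler A (*) (S u) (\<lambda>x' x''. sweedler A (*) (g p)
          (\<lambda>y' y''. ?\<beta> (x' \<otimes> y' \<otimes> S q1) (x'' \<otimes> y'' \<otimes> S q2)))"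
        by (rule A.sweedler_mult[OF SA gA ms \<beta>r[OF SA SA]])
      also have "\<dots> = sweedler A (*) (S u) (\<lambda>x' x''. csum \<Delta> (*) p
          (\<lambda>p1 p2. ?\<beta> (x' \<otimes> g p1 \<otimes> S q1) (x'' \<otimes> g p2 \<otimes> S q2)))"
        using SA gA bilinear_onD[OF \<beta>r[OF SA SA]] bilinear_onD[OF A.mult_bilinear]
        by (intro A.sweedler_cong A.sweedler_coalg_map[OF g ms] bilinear_onI)
          (auto simp: linear_on_def A.carrier_add A.carrier_smul)
      also have "\<dots> = csum \<Delta> (*) p (\<lambda>p1 p2. sweedler A (*) (S u)
          (\<lambda>x' x''. ?\<beta> (x' \<otimes> g p1 \<otimes> S q1) (x'' \<otimes> g p2 \<otimes> S q2)))"
        by (simp add: sweedler_lsum csum_lsum[OF ms, symmetric] case_prod_unfold)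
      also have "\<dots> = csum \<Delta> (*) p (\<lambda>p1 p2. ?E (S u) (g p1 \<otimes> S q1) (g p2 \<otimes> S q2))"
        using SA gA by (intro csum_cong A.sweedler_cong) (auto simp: A.m_assoc)
      finally show ?thesis by simp
    qed
    then show "csum \<Delta> (*) p (\<lambda>p1 p2. csum \<Delta> (*) q (\<lambda>q1 q2. ?E (S u) (g p1 \<otimes> S q1) (g p2 \<otimes> S q2))) =
      csum \<Delta> (*) q (\<lambda>q1 q2. ?E (S u \<otimes> g p) (S q1) (S q2))"
      by (simp add: csum_swap[OF ms, of \<Delta> p])
  qed
  also have "\<dots> = csum \<Delta> (*) b (\<lambda>w q. csum \<Delta> (*) w (\<lambda>u p. csum \<Delta> (*) q (\<lambda>q1 q2.
      ?E (S u \<otimes> g p) (S q1) (S q2))))"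
    by (rule C.csum_coassoc[OF ms, symmetric])
  also have "\<dots> = csum \<Delta> (*) b (\<lambda>w q. csum \<Delta> (*) q (\<lambda>q1 q2. \<epsilon> w * ?\<beta> (S q1) (S q2)))"
  proof (rule csum_cong)
    fix w q
    have "csum \<Delta> (*) w (\<lambda>u p. ?E (S u \<otimes> g p) (S q1) (S q2)) = \<epsilon> w * ?\<beta> (S q1) (S q2)" for q1 q2
    proof -
      have lin: "linear_on A (*) (\<lambda>x. ?E x (S q1) (S q2))"
        by (rule A.linear_on_sweedler[OF ms \<beta>r[OF SA SA]])
      have "csum \<Delta> (*) w (\<lambda>u p. ?E (S u \<otimes> g p) (S q1) (S q2)) = ?E (smul A (\<epsilon> w) \<one>) (S q1) (S q2)"
        unfolding conv1[symmetric] using SA gA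
        by (intro linear_on_csum[OF A.subspace_of ms lin, symmetric]) auto
      also have "\<dots> = \<epsilon> w * ?E \<one> (S q1) (S q2)"
        using lin by (simp add: linear_on_def)
      also have "?E \<one> (S q1) (S q2) = ?\<beta> (S q1) (S q2)"
        using A.sweedler_one[OF ms \<beta>r[OF SA SA]] SA by simp
      finally show ?thesis .
    qed
    then show "csum \<Delta> (*) w (\<lambda>u p. csum \<Delta> (*) q (\<lambda>q1 q2. ?E (S u \<otimes> g p) (S q1) (S q2))) =
      csum \<Delta> (*) q (\<lambda>q1 q2. \<epsilon> w * ?\<beta> (S q1) (S q2))"
      by (simp add: csum_swap[OF ms, of \<Delta> w])
  qed
  also have "\<dots> = csum \<Delta> (*) b (\<lambda>q1 q2. ?\<beta> (S q1) (S q2))"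
    by (simp add: csum_scale[OF ms] C.csum_counit(1)[OF ms])
  finally show "csum \<Delta> (*) b (\<lambda>u v. \<phi> (antipode A (g u)) * \<psi> (antipode A (g v))) =
      sweedler A (*) (antipode A (g b)) ?\<beta>"
    by (simp add: S_def)
qed

theorem group_conv: "group (conv_group \<Delta> \<epsilon> A)"
proof (rule groupI)
  show "\<And>f g. f \<in> carrier (conv_group \<Delta> \<epsilon> A) \<Longrightarrow> g \<in> carrier (conv_group \<Delta> \<epsilon> A) \<Longrightarrow>
    f \<otimes>\<^bsub>conv_group \<Delta> \<epsilon> A\<^esub> g \<in> carrier (conv_group \<Delta> \<epsilon> A)"
    by (simp add: conv_closed)
  show "\<one>\<^bsub>conv_group \<Delta> \<epsilon> A\<^esub> \<in> carrier (conv_group \<Delta> \<epsilon> A)"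
    by (simp add: unit_coalg_map)
  show "\<exists>g\<in>carrier (conv_group \<Delta> \<epsilon> A). g \<otimes>\<^bsub>conv_group \<Delta> \<epsilon> A\<^esub> f = \<one>\<^bsub>conv_group \<Delta> \<epsilon> A\<^esub>"
    if "f \<in> carrier (conv_group \<Delta> \<epsilon> A)" for f
    using that antipode_coalg_map[of f] conv_antipode(1)[of f]
    by (intro bexI[of _ "\<lambda>b. antipode A (f b)"]) auto
qed (auto simp: conv_assoc conv_one coalg_mapD(1))

lemma inv_conv:
  assumes "coalg_map \<Delta> \<epsilon> A f"
  shows "inv\<^bsub>conv_group \<Delta> \<epsilon> A\<^esub> f = (\<lambda>b. antipode A (f b))"
  using assms antipode_coalg_map[OF assms] conv_antipode(1)[OF assms]
  by (intro group.inv_equality[OF group_conv]) auto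

text \<open>
  Cocommutativity moves the second Sweedler factor of the acting element past the argument.  This
  turns the adjoint action of points into conjugation in the convolution group.
\<close>

lemma csum_ad:
  assumes f: "coalg_map \<Delta> \<epsilon> A f" and g: "coalg_map \<Delta> \<epsilon> A g"
  shows "csum \<Delta> (smul A) b (\<lambda>u v. ad A (f u) (g v)) =
    (f \<otimes>\<^bsub>conv_group \<Delta> \<epsilon> A\<^esub> g \<otimes>\<^bsub>conv_group \<Delta> \<epsilon> A\<^esub> inv\<^bsub>conv_group \<Delta> \<epsilon> A\<^esub> f) b"
proof -
  note V = A.vector_space_smul
  note fA = coalg_mapD(1)[OF f] and gA = coalg_mapD(1)[OF g]
  let ?S = "antipode A"
  have "csum \<Delta> (smul A) b (\<lambda>u v. ad A (f u) (g v)) =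
      csum \<Delta> (smul A) b (\<lambda>u v. csum \<Delta> (smul A) u (\<lambda>p q. f p \<otimes> g v \<otimes> ?S (f q)))"
    unfolding ad_def by (intro csum_cong A.sweedler_coalg_map[OF f V A.ad_bilinear_body] gA)
  also have "\<dots> = csum \<Delta> (smul A) b (\<lambda>p w. csum \<Delta> (smul A) w (\<lambda>q v. f p \<otimes> g v \<otimes> ?S (f q)))"
    by (rule C.csum_coassoc[OF V])
  also have "\<dots> = csum \<Delta> (smul A) b (\<lambda>p w. csum \<Delta> (smul A) w (\<lambda>q v. f p \<otimes> g q \<otimes> ?S (f v)))"
    by (rule csum_cong, rule C.csum_cocomm[OF V])
  also have "\<dots> = csum \<Delta> (smul A) b (\<lambda>u v. csum \<Delta> (smul A) u (\<lambda>p q. f p \<otimes> g q \<otimes> ?S (f v)))"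
    by (rule C.csum_coassoc[OF V, symmetric])
  also have "\<dots> = conv \<Delta> A (conv \<Delta> A f g) (\<lambda>b. ?S (f b)) b"
    using fA gA A.antipode_closed
    by (simp add: conv_def csum_bilinear(1)[OF A.subspace_of A.subspace_of V A.mult_bilinear])
  finally show ?thesis by (simp add: inv_conv[OF f])
qed

end

section \<open>Hopf maps\<close>

lemma hopf_mapD:
  assumes "hopf_map A B f"
  shows "x \<in> carrier A \<Longrightarrow> f x \<in> carrier B" "linear_on A (smul B) f"
    "x \<in> carrier A \<Longrightarrow> y \<in> carrier A \<Longrightarrow> f (x \<otimes>\<^bsub>A\<^esub> y) = f x \<otimes>\<^bsub>B\<^esub> f y" "f \<one>\<^bsub>A\<^esub> = \<one>\<^bsub>B\<^esub>"
    "x \<in> carrier A \<Longrightarrow> counit B (f x) = counit A x"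
  using assms by (auto simp: hopf_map_def linear_map_iff hom_def)

lemma sweedler_hopf_map:
  assumes A: "bialgebra A" and B: "bialgebra B" and f: "hopf_map A B f" and x: "x \<in> carrier A"
    and s: "vector_space s" and \<beta>: "bilinear_on B B s \<beta>"
  shows "sweedler B s (f x) \<beta> = sweedler A s x (\<lambda>u v. \<beta> (f u) (f v))"
proof -
  interpret A: bialgebra A by fact
  interpret B: bialgebra B by fact
  let ?p = "sweedler A fscale x (\<lambda>x' x''. basis (f x', f x''))"
  have "Poly_Mapping.keys ?p \<subseteq> carrier B \<times> carrier B"
    unfolding sweedler_lsum using A.comult_rep_keys[OF x] hopf_mapD(1)[OF f] by (intro keys_lsum) auto
  then have "?p \<in> comult B (f x)"
    using f x by (auto simp: hopf_map_def intro: tensor_class_self)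
  from B.sweedler_eq_lsum[OF hopf_mapD(1)[OF f x] this s \<beta>] show ?thesis
    unfolding sweedler_lsum
    by (simp add: vector_space.lsum_bind[OF s] vector_space.lsum_basis[OF s] case_prod_unfold)
qed

lemma coalg_map_hopf_map:
  assumes A: "bialgebra A" and B: "bialgebra B" and f: "hopf_map A B f" and g: "coalg_map \<Delta> \<epsilon> A g"
  shows "coalg_map \<Delta> \<epsilon> B (\<lambda>b. f (g b))"
proof -
  interpret A: bialgebra A by fact
  interpret B: bialgebra B by fact
  note ms = vector_space_mult
  note gA = coalg_mapD(1)[OF g]
  show ?thesis
    unfolding B.coalg_map_iff
  proof (intro allI conjI impI)
    fix b
    show "f (g b) \<in> carrier B" "counit B (f (g b)) = \<epsilon> b"
      using hopf_mapD[OF f] gA coalg_mapD(2)[OF g] by auto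
    fix \<phi> \<psi> assume \<phi>: "functional (smul B) \<phi>" and \<psi>: "functional (smul B) \<psi>"
    have "bilinear_on A A (*) (\<lambda>u v. \<phi> (f u) * \<psi> (f v))"
      using \<phi> \<psi> hopf_mapD(2)[OF f]
      by (auto simp: functional_def bilinear_on_def linear_on_def algebra_simps)
    then show "csum \<Delta> (*) b (\<lambda>u v. \<phi> (f (g u)) * \<psi> (f (g v))) = sweedler B (*) (f (g b)) (\<lambda>u v. \<phi> u * \<psi> v)"
      by (simp add: sweedler_hopf_map[OF A B f gA ms functional_bilinear[OF \<phi> \<psi>]]
        A.sweedler_coalg_map[OF g ms])
  qed
qed

lemma hopf_map_conv_hom:
  assumes A: "cocommutative_hopf_algebra A" and B: "cocommutative_hopf_algebra B" and f: "hopf_map A B f"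
  shows "(\<lambda>g b. f (g b)) \<in> hom (conv_group \<Delta> \<epsilon> A) (conv_group \<Delta> \<epsilon> B)"
proof -
  interpret A: cocommutative_hopf_algebra A by fact
  interpret B: cocommutative_hopf_algebra B by fact
  have "(\<lambda>b. f (conv \<Delta> A g h b)) = conv \<Delta> B (\<lambda>b. f (g b)) (\<lambda>b. f (h b))"
    if g: "coalg_map \<Delta> \<epsilon> A g" and h: "coalg_map \<Delta> \<epsilon> A h" for g h
    using coalg_mapD(1)[OF g] coalg_mapD(1)[OF h]
    by (simp add: conv_def hopf_mapD(3)[OF f]
      linear_on_csum[OF A.subspace_of B.vector_space_smul hopf_mapD(2)[OF f]])
  then show ?thesis
    using coalg_map_hopf_map[OF A.bialgebra_axioms B.bialgebra_axioms f] by (auto simp: hom_def)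
qed

text \<open>Group homomorphisms preserve inverses; apply this to the presenting point and extend linearly.\<close>

lemma hopf_map_antipode:
  fixes A :: "('k::field, 'a::ab_group_add, 'm) hopf_scheme"
    and B :: "('k, 'b::ab_group_add, 'n) hopf_scheme"
  assumes A: "cocommutative_hopf_algebra A" and B: "cocommutative_hopf_algebra B" and f: "hopf_map A B f"
    and x: "x \<in> carrier A"
  shows "f (antipode A x) = antipode B (f x)"
proof -
  interpret A: cocommutative_hopf_algebra A by fact
  interpret B: cocommutative_hopf_algebra B by fact
  obtain \<Delta> :: "'a \<Rightarrow> _" and \<epsilon> g where g: "cocomm_coalgebra \<Delta> \<epsilon>" "coalg_map \<Delta> \<epsilon> A g"
    "\<forall>x\<in>carrier A. \<exists>p. x = lsum (smul A) p g" by (rule A.presentation)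
  interpret CA: convolution \<Delta> \<epsilon> A using g(1) A by (simp add: convolution_def)
  interpret CB: convolution \<Delta> \<epsilon> B using g(1) B by (simp add: convolution_def)
  note gA = coalg_mapD(1)[OF g(2)]
  interpret group_hom "conv_group \<Delta> \<epsilon> A" "conv_group \<Delta> \<epsilon> B" "\<lambda>g b. f (g b)"
    by (intro group_hom.intro group_hom_axioms.intro CA.group_conv CB.group_conv hopf_map_conv_hom[OF A B f])
  have *: "f (antipode A (g b)) = antipode B (f (g b))" for b
    using hom_inv[of g] g(2)
    by (simp add: CA.inv_conv CB.inv_conv coalg_map_hopf_map[OF A.bialgebra_axioms B.bialgebra_axioms f] fun_eq_iff)
  obtain p where p: "x = lsum (smul A) p g" using g(3) x by blast
  have "linear_on A (smul B) (\<lambda>x. f (antipode A x))" "linear_on A (smul B) (\<lambda>x. antipode B (f x))"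
    using A.antipode_linear A.antipode_closed B.antipode_linear hopf_mapD(1,2)[OF f]
    by (auto simp: linear_on_def)
  from linear_on_lsum[OF A.subspace_of B.vector_space_smul this(1), of p g]
    linear_on_lsum[OF A.subspace_of B.vector_space_smul this(2), of p g] gA
  show ?thesis by (simp add: p *)
qed

lemma hopf_map_ad:
  assumes A: "cocommutative_hopf_algebra A" and B: "cocommutative_hopf_algebra B" and f: "hopf_map A B f"
    and x: "x \<in> carrier A" and y: "y \<in> carrier A"
  shows "f (ad A x y) = ad B (f x) (f y)"
proof -
  interpret A: cocommutative_hopf_algebra A by fact
  interpret B: cocommutative_hopf_algebra B by fact
  note SA = A.antipode_closed and SB = B.antipode_closed and SBl = B.antipode_linear
  have bil: "bilinear_on B B (smul B) (\<lambda>u v. u \<otimes>\<^bsub>B\<^esub> f y \<otimes>\<^bsub>B\<^esub> antipode B v)"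
    using hopf_mapD(1)[OF f y] SBl SB bilinear_onD[OF B.mult_bilinear]
    by (auto intro!: bilinear_onI simp: linear_on_def)
  have "f (ad A x y) = sweedler A (smul B) x (\<lambda>u v. f (u \<otimes>\<^bsub>A\<^esub> y \<otimes>\<^bsub>A\<^esub> antipode A v))"
    unfolding ad_def using y SA
    by (intro A.linear_on_of_sweedler[OF A.subspace_of B.vector_space_smul hopf_mapD(2)[OF f] x]) auto
  also have "\<dots> = sweedler A (smul B) x (\<lambda>u v. f u \<otimes>\<^bsub>B\<^esub> f y \<otimes>\<^bsub>B\<^esub> antipode B (f v))"
    using y SA by (intro A.sweedler_cong[OF x]) (simp add: hopf_mapD(3)[OF f] hopf_map_antipode[OF A B f])
  also have "\<dots> = ad B (f x) (f y)"
    unfolding ad_def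
    by (rule sweedler_hopf_map[OF A.bialgebra_axioms B.bialgebra_axioms f x B.vector_space_smul bil, symmetric])
  finally show ?thesis .
qed

section \<open>Simplicial groups with Moore complex of length two\<close>

lemma (in group) cancel_left [simp]:
  assumes "x \<in> carrier G" "y \<in> carrier G"
  shows "x \<otimes> (inv x \<otimes> y) = y" "inv x \<otimes> (x \<otimes> y) = y"
  using assms by (simp_all add: m_assoc[symmetric])

lemmas (in group) word_simps = m_assoc inv_mult_group

text \<open>The last assumption is the length condition, that the Moore term in degree three is trivial.\<close>

locale simplicial_group_length_two =
  fixes G :: "nat \<Rightarrow> 'g monoid" and d s :: "nat \<Rightarrow> nat \<Rightarrow> 'g \<Rightarrow> 'g"
  assumes group: "group (G n)"
    and face: "i \<le> Suc n \<Longrightarrow> d (Suc n) i \<in> hom (G (Suc n)) (G n)"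
    and degeneracy: "j \<le> n \<Longrightarrow> s n j \<in> hom (G n) (G (Suc n))"
    and face_face: "\<lbrakk>i \<le> j; j \<le> Suc n; x \<in> carrier (G (Suc (Suc n)))\<rbrakk> \<Longrightarrow>
          d (Suc n) i (d (Suc (Suc n)) (Suc j) x) = d (Suc n) j (d (Suc (Suc n)) i x)"
    and degeneracy_degeneracy: "\<lbrakk>i \<le> j; j \<le> n; x \<in> carrier (G n)\<rbrakk> \<Longrightarrow>
          s (Suc n) i (s n j x) = s (Suc n) (Suc j) (s n i x)"
    and face_degeneracy_less: "\<lbrakk>i \<le> j; j \<le> n; x \<in> carrier (G (Suc n))\<rbrakk> \<Longrightarrow>
          d (Suc (Suc n)) i (s (Suc n) (Suc j) x) = s n j (d (Suc n) i x)"
    and face_degeneracy_same: "\<lbrakk>j \<le> n; x \<in> carrier (G n)\<rbrakk> \<Longrightarrow> d (Suc n) j (s n j x) = x"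
    and face_degeneracy_Suc: "\<lbrakk>j \<le> n; x \<in> carrier (G n)\<rbrakk> \<Longrightarrow> d (Suc n) (Suc j) (s n j x) = x"
    and face_degeneracy_greater: "\<lbrakk>j < i; i \<le> Suc n; x \<in> carrier (G (Suc n))\<rbrakk> \<Longrightarrow>
          d (Suc (Suc n)) (Suc i) (s (Suc n) j x) = s n j (d (Suc n) i x)"
    and moore3_trivial: "\<lbrakk>x \<in> carrier (G 3); d 3 0 x = \<one>\<^bsub>G 2\<^esub>; d 3 1 x = \<one>\<^bsub>G 2\<^esub>; d 3 2 x = \<one>\<^bsub>G 2\<^esub>\<rbrakk> \<Longrightarrow>
          x = \<one>\<^bsub>G 3\<^esub>"
begin

declare One_nat_def [simp del]

sublocale G0: group "G 0" by (rule group)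
sublocale G1: group "G 1" by (rule group)
sublocale G2: group "G 2" by (rule group)
sublocale G3: group "G 3" by (rule group)

lemma homs:
  "d 1 0 \<in> hom (G 1) (G 0)" "d 1 1 \<in> hom (G 1) (G 0)"
  "d 2 0 \<in> hom (G 2) (G 1)" "d 2 1 \<in> hom (G 2) (G 1)" "d 2 2 \<in> hom (G 2) (G 1)"
  "d 3 0 \<in> hom (G 3) (G 2)" "d 3 1 \<in> hom (G 3) (G 2)" "d 3 2 \<in> hom (G 3) (G 2)" "d 3 3 \<in> hom (G 3) (G 2)"
  "s 0 0 \<in> hom (G 0) (G 1)" "s 1 0 \<in> hom (G 1) (G 2)" "s 1 1 \<in> hom (G 1) (G 2)"
  "s 2 0 \<in> hom (G 2) (G 3)" "s 2 1 \<in> hom (G 2) (G 3)" "s 2 2 \<in> hom (G 2) (G 3)"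
  using face[of _ 0] face[of _ 1] face[of _ 2] degeneracy[of _ 0] degeneracy[of _ 1] degeneracy[of _ 2]
  by (simp_all add: eval_nat_numeral One_nat_def)

lemma hom_rules:
  assumes "f \<in> hom (G m) (G n)"
  shows "x \<in> carrier (G m) \<Longrightarrow> f x \<in> carrier (G n)"
    "x \<in> carrier (G m) \<Longrightarrow> y \<in> carrier (G m) \<Longrightarrow> f (x \<otimes>\<^bsub>G m\<^esub> y) = f x \<otimes>\<^bsub>G n\<^esub> f y"
    "x \<in> carrier (G m) \<Longrightarrow> f (inv\<^bsub>G m\<^esub> x) = inv\<^bsub>G n\<^esub> (f x)"
    "f \<one>\<^bsub>G m\<^esub> = \<one>\<^bsub>G n\<^esub>"
proof -
  interpret group_hom "G m" "G n" f
    using assms by (intro group_hom.intro group_hom_axioms.intro group)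
  show "x \<in> carrier (G m) \<Longrightarrow> f x \<in> carrier (G n)"
    "x \<in> carrier (G m) \<Longrightarrow> y \<in> carrier (G m) \<Longrightarrow> f (x \<otimes>\<^bsub>G m\<^esub> y) = f x \<otimes>\<^bsub>G n\<^esub> f y"
    "x \<in> carrier (G m) \<Longrightarrow> f (inv\<^bsub>G m\<^esub> x) = inv\<^bsub>G n\<^esub> (f x)"
    "f \<one>\<^bsub>G m\<^esub> = \<one>\<^bsub>G n\<^esub>"
    by auto
qed

lemmas hom_simps [simp] =
  homs(1)[THEN hom_rules(1)] homs(1)[THEN hom_rules(2)] homs(1)[THEN hom_rules(3)] homs(1)[THEN hom_rules(4)]
  homs(2)[THEN hom_rules(1)] homs(2)[THEN hom_rules(2)] homs(2)[THEN hom_rules(3)] homs(2)[THEN hom_rules(4)]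
  homs(3)[THEN hom_rules(1)] homs(3)[THEN hom_rules(2)] homs(3)[THEN hom_rules(3)] homs(3)[THEN hom_rules(4)]
  homs(4)[THEN hom_rules(1)] homs(4)[THEN hom_rules(2)] homs(4)[THEN hom_rules(3)] homs(4)[THEN hom_rules(4)]
  homs(5)[THEN hom_rules(1)] homs(5)[THEN hom_rules(2)] homs(5)[THEN hom_rules(3)] homs(5)[THEN hom_rules(4)]
  homs(6)[THEN hom_rules(1)] homs(6)[THEN hom_rules(2)] homs(6)[THEN hom_rules(3)] homs(6)[THEN hom_rules(4)]
  homs(7)[THEN hom_rules(1)] homs(7)[THEN hom_rules(2)] homs(7)[THEN hom_rules(3)] homs(7)[THEN hom_rules(4)]
  homs(8)[THEN hom_rules(1)] homs(8)[THEN hom_rules(2)] homs(8)[THEN hom_rules(3)] homs(8)[THEN hom_rules(4)]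
  homs(9)[THEN hom_rules(1)] homs(9)[THEN hom_rules(2)] homs(9)[THEN hom_rules(3)] homs(9)[THEN hom_rules(4)]
  homs(10)[THEN hom_rules(1)] homs(10)[THEN hom_rules(2)] homs(10)[THEN hom_rules(3)] homs(10)[THEN hom_rules(4)]
  homs(11)[THEN hom_rules(1)] homs(11)[THEN hom_rules(2)] homs(11)[THEN hom_rules(3)] homs(11)[THEN hom_rules(4)]
  homs(12)[THEN hom_rules(1)] homs(12)[THEN hom_rules(2)] homs(12)[THEN hom_rules(3)] homs(12)[THEN hom_rules(4)]
  homs(13)[THEN hom_rules(1)] homs(13)[THEN hom_rules(2)] homs(13)[THEN hom_rules(3)] homs(13)[THEN hom_rules(4)]
  homs(14)[THEN hom_rules(1)] homs(14)[THEN hom_rules(2)] homs(14)[THEN hom_rules(3)] homs(14)[THEN hom_rules(4)]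
  homs(15)[THEN hom_rules(1)] homs(15)[THEN hom_rules(2)] homs(15)[THEN hom_rules(3)] homs(15)[THEN hom_rules(4)]

lemma identities_3 [simp]:
  assumes "w \<in> carrier (G 2)"
  shows "d 3 0 (s 2 0 w) = w" "d 3 1 (s 2 0 w) = w" "d 3 2 (s 2 0 w) = s 1 0 (d 2 1 w)" "d 3 3 (s 2 0 w) = s 1 0 (d 2 2 w)"
    "d 3 0 (s 2 1 w) = s 1 0 (d 2 0 w)" "d 3 1 (s 2 1 w) = w" "d 3 2 (s 2 1 w) = w" "d 3 3 (s 2 1 w) = s 1 1 (d 2 2 w)"
    "d 3 0 (s 2 2 w) = s 1 1 (d 2 0 w)" "d 3 1 (s 2 2 w) = s 1 1 (d 2 1 w)" "d 3 2 (s 2 2 w) = w" "d 3 3 (s 2 2 w) = w"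
  using assms face_degeneracy_same[of _ 2 w] face_degeneracy_Suc[of 0 2 w] face_degeneracy_Suc[of 1 2 w]
    face_degeneracy_Suc[of 2 2 w] face_degeneracy_greater[of 0 1 1 w] face_degeneracy_greater[of 0 2 1 w]
    face_degeneracy_greater[of 1 2 1 w]
    face_degeneracy_less[of 0 0 1 w] face_degeneracy_less[of 0 1 1 w] face_degeneracy_less[of 1 1 1 w]
  by (simp_all add: eval_nat_numeral One_nat_def)

lemma identities_2 [simp]:
  assumes "x \<in> carrier (G 1)"
  shows "d 2 0 (s 1 0 x) = x" "d 2 1 (s 1 0 x) = x" "d 2 2 (s 1 0 x) = s 0 0 (d 1 1 x)"
    "d 2 0 (s 1 1 x) = s 0 0 (d 1 0 x)" "d 2 1 (s 1 1 x) = x" "d 2 2 (s 1 1 x) = x"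
  using assms face_degeneracy_same[of _ 1 x] face_degeneracy_Suc[of 0 1 x] face_degeneracy_Suc[of 1 1 x]
    face_degeneracy_greater[of 0 1 0 x] face_degeneracy_less[of 0 0 0 x]
  by (simp_all add: eval_nat_numeral One_nat_def)

lemma identities_1 [simp]:
  assumes "a \<in> carrier (G 0)"
  shows "d 1 0 (s 0 0 a) = a" "d 1 1 (s 0 0 a) = a" "s 1 0 (s 0 0 a) = s 1 1 (s 0 0 a)"
  using assms face_degeneracy_same[of _ 0 a] face_degeneracy_Suc[of 0 0 a] degeneracy_degeneracy[of 0 0 0 a]
  by (simp_all add: eval_nat_numeral One_nat_def)

lemma face_face_2:
  assumes "k \<in> carrier (G 2)"
  shows "d 1 0 (d 2 1 k) = d 1 0 (d 2 0 k)" "d 1 0 (d 2 2 k) = d 1 1 (d 2 0 k)" "d 1 1 (d 2 2 k) = d 1 1 (d 2 1 k)"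
  using assms face_face[of 0 0 0 k] face_face[of 0 1 0 k] face_face[of 1 1 0 k]
  by (simp_all add: eval_nat_numeral One_nat_def)

text \<open>
  Two elements of \<open>G 3\<close> commute as soon as each of the first three faces kills one of them, since
  their commutator then lies in the trivial Moore term.  Applied to suitable combinations of
  degeneracies, this makes elements of \<open>G 2\<close> commute when their kernels jointly cover the three faces.
\<close>

lemma commute_3:
  assumes f: "f \<in> carrier (G 3)" and g: "g \<in> carrier (G 3)"
    and "d 3 0 f = \<one>\<^bsub>G 2\<^esub> \<or> d 3 0 g = \<one>\<^bsub>G 2\<^esub>" "d 3 1 f = \<one>\<^bsub>G 2\<^esub> \<or> d 3 1 g = \<one>\<^bsub>G 2\<^esub>"
      "d 3 2 f = \<one>\<^bsub>G 2\<^esub> \<or> d 3 2 g = \<one>\<^bsub>G 2\<^esub>"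
  shows "f \<otimes>\<^bsub>G 3\<^esub> g = g \<otimes>\<^bsub>G 3\<^esub> f"
proof -
  have "f \<otimes>\<^bsub>G 3\<^esub> g \<otimes>\<^bsub>G 3\<^esub> inv\<^bsub>G 3\<^esub> (g \<otimes>\<^bsub>G 3\<^esub> f) = \<one>\<^bsub>G 3\<^esub>"
    using assms by (intro moore3_trivial) auto
  then show ?thesis
    using f g by (metis G3.inv_closed G3.inv_equality G3.inv_inv G3.m_closed)
qed

text \<open>
  In each of the next three lemmas the two elements of \<open>G 3\<close> are products of degeneracies of the
  given elements of \<open>G 2\<close>.  The last face sends them back to the given elements, and the kernel
  conditions on the latter make each of the first three faces kill one of the two.
\<close>

lemma commute_01_2:
  assumes k: "k \<in> carrier (G 2)" "d 2 0 k = \<one>\<^bsub>G 1\<^esub>" "d 2 1 k = \<one>\<^bsub>G 1\<^esub>"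
    and w: "w \<in> carrier (G 2)" "d 2 2 w = \<one>\<^bsub>G 1\<^esub>"
  shows "k \<otimes>\<^bsub>G 2\<^esub> w = w \<otimes>\<^bsub>G 2\<^esub> k"
proof -
  let ?f = "s 2 2 k" and ?g = "inv\<^bsub>G 3\<^esub> (s 2 1 w) \<otimes>\<^bsub>G 3\<^esub> s 2 2 w"
  have "?f \<otimes>\<^bsub>G 3\<^esub> ?g = ?g \<otimes>\<^bsub>G 3\<^esub> ?f"
    using k w by (intro commute_3) auto
  then have "d 3 3 (?f \<otimes>\<^bsub>G 3\<^esub> ?g) = d 3 3 (?g \<otimes>\<^bsub>G 3\<^esub> ?f)" by simp
  then show ?thesis using k w by simp
qed

lemma commute_02_1:
  assumes a: "a \<in> carrier (G 2)" "d 2 0 a = \<one>\<^bsub>G 1\<^esub>" "d 2 2 a = \<one>\<^bsub>G 1\<^esub>"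
    and b: "b \<in> carrier (G 2)" "d 2 1 b = \<one>\<^bsub>G 1\<^esub>"
  shows "a \<otimes>\<^bsub>G 2\<^esub> b = b \<otimes>\<^bsub>G 2\<^esub> a"
proof -
  let ?f = "inv\<^bsub>G 3\<^esub> (s 2 1 a) \<otimes>\<^bsub>G 3\<^esub> s 2 2 a" and ?g = "s 2 2 b"
  have "?f \<otimes>\<^bsub>G 3\<^esub> ?g = ?g \<otimes>\<^bsub>G 3\<^esub> ?f"
    using a b by (intro commute_3) auto
  then have "d 3 3 (?f \<otimes>\<^bsub>G 3\<^esub> ?g) = d 3 3 (?g \<otimes>\<^bsub>G 3\<^esub> ?f)" by simp
  then show ?thesis using a b by simp
qed

lemma commute_12_0:
  assumes a: "a \<in> carrier (G 2)" "d 2 1 a = \<one>\<^bsub>G 1\<^esub>" "d 2 2 a = \<one>\<^bsub>G 1\<^esub>"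
    and b: "b \<in> carrier (G 2)" "d 2 0 b = \<one>\<^bsub>G 1\<^esub>"
  shows "a \<otimes>\<^bsub>G 2\<^esub> b = b \<otimes>\<^bsub>G 2\<^esub> a"
proof -
  let ?f = "s 2 2 a \<otimes>\<^bsub>G 3\<^esub> (inv\<^bsub>G 3\<^esub> (s 2 1 a) \<otimes>\<^bsub>G 3\<^esub> s 2 0 a)" and ?g = "s 2 2 b"
  have "?f \<otimes>\<^bsub>G 3\<^esub> ?g = ?g \<otimes>\<^bsub>G 3\<^esub> ?f"
    using a b by (intro commute_3) auto
  then have "d 3 3 (?f \<otimes>\<^bsub>G 3\<^esub> ?g) = d 3 3 (?g \<otimes>\<^bsub>G 3\<^esub> ?f)" by simp
  then show ?thesis using a b by simp
qed

definition peiffer :: "'g \<Rightarrow> 'g \<Rightarrow> 'g" where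
  "peiffer x y = s 1 1 x \<otimes>\<^bsub>G 2\<^esub> s 1 1 y \<otimes>\<^bsub>G 2\<^esub> inv\<^bsub>G 2\<^esub> (s 1 1 x) \<otimes>\<^bsub>G 2\<^esub>
     inv\<^bsub>G 2\<^esub> (s 1 0 x \<otimes>\<^bsub>G 2\<^esub> s 1 1 y \<otimes>\<^bsub>G 2\<^esub> inv\<^bsub>G 2\<^esub> (s 1 0 x))"

definition N1 :: "'g set" where "N1 = {x \<in> carrier (G 1). d 1 0 x = \<one>\<^bsub>G 0\<^esub>}"
definition N2 :: "'g set" where "N2 = {k \<in> carrier (G 2). d 2 0 k = \<one>\<^bsub>G 1\<^esub> \<and> d 2 1 k = \<one>\<^bsub>G 1\<^esub>}"

lemma N1_D: "x \<in> N1 \<Longrightarrow> x \<in> carrier (G 1)" "x \<in> N1 \<Longrightarrow> d 1 0 x = \<one>\<^bsub>G 0\<^esub>"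
  by (auto simp: N1_def)

lemma N2_D: "k \<in> N2 \<Longrightarrow> k \<in> carrier (G 2)" "k \<in> N2 \<Longrightarrow> d 2 0 k = \<one>\<^bsub>G 1\<^esub>" "k \<in> N2 \<Longrightarrow> d 2 1 k = \<one>\<^bsub>G 1\<^esub>"
  by (auto simp: N2_def)

lemma d2_N2: "k \<in> N2 \<Longrightarrow> d 2 2 k \<in> N1"
  by (simp add: N1_def N2_def face_face_2)

lemma N1_closed: "x \<in> N1 \<Longrightarrow> y \<in> N1 \<Longrightarrow> x \<otimes>\<^bsub>G 1\<^esub> y \<in> N1" "x \<in> N1 \<Longrightarrow> inv\<^bsub>G 1\<^esub> x \<in> N1"
  by (auto simp: N1_def)

lemma N2_closed: "k \<in> N2 \<Longrightarrow> l \<in> N2 \<Longrightarrow> k \<otimes>\<^bsub>G 2\<^esub> l \<in> N2" "k \<in> N2 \<Longrightarrow> inv\<^bsub>G 2\<^esub> k \<in> N2"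
  by (auto simp: N2_def)

lemma conj_N1: "a \<in> carrier (G 0) \<Longrightarrow> x \<in> N1 \<Longrightarrow> s 0 0 a \<otimes>\<^bsub>G 1\<^esub> x \<otimes>\<^bsub>G 1\<^esub> inv\<^bsub>G 1\<^esub> (s 0 0 a) \<in> N1"
  by (auto simp: N1_def)

lemma conj_N2: "x \<in> carrier (G 1) \<Longrightarrow> k \<in> N2 \<Longrightarrow> s 1 1 x \<otimes>\<^bsub>G 2\<^esub> k \<otimes>\<^bsub>G 2\<^esub> inv\<^bsub>G 2\<^esub> (s 1 1 x) \<in> N2"
  by (auto simp: N2_def)

lemma peiffer_N2: "x \<in> N1 \<Longrightarrow> y \<in> N1 \<Longrightarrow> peiffer x y \<in> N2"
  by (auto simp: N1_def N2_def peiffer_def G1.word_simps)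

lemma d2_peiffer:
  "x \<in> N1 \<Longrightarrow> y \<in> N1 \<Longrightarrow> d 2 2 (peiffer x y) = x \<otimes>\<^bsub>G 1\<^esub> y \<otimes>\<^bsub>G 1\<^esub> inv\<^bsub>G 1\<^esub> x \<otimes>\<^bsub>G 1\<^esub>
     (s 0 0 (d 1 1 x) \<otimes>\<^bsub>G 1\<^esub> inv\<^bsub>G 1\<^esub> y \<otimes>\<^bsub>G 1\<^esub> inv\<^bsub>G 1\<^esub> (s 0 0 (d 1 1 x)))"
  by (auto simp: N1_def peiffer_def G1.word_simps)

lemma peiffer_equivariant:
  assumes a: "a \<in> carrier (G 0)" and x: "x \<in> N1" and y: "y \<in> N1"
  shows "peiffer (s 0 0 a \<otimes>\<^bsub>G 1\<^esub> x \<otimes>\<^bsub>G 1\<^esub> inv\<^bsub>G 1\<^esub> (s 0 0 a)) (s 0 0 a \<otimes>\<^bsub>G 1\<^esub> y \<otimes>\<^bsub>G 1\<^esub> inv\<^bsub>G 1\<^esub> (s 0 0 a)) =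
    s 1 1 (s 0 0 a) \<otimes>\<^bsub>G 2\<^esub> peiffer x y \<otimes>\<^bsub>G 2\<^esub> inv\<^bsub>G 2\<^esub> (s 1 1 (s 0 0 a))"
  using a N1_D(1)[OF x] N1_D(1)[OF y] by (simp add: peiffer_def G2.word_simps)

text \<open>
  An element of \<open>N2\<close> commutes with the kernel of the last face, so conjugating it by an element of
  \<open>G 2\<close> only depends on the last face of that element.
\<close>

lemma conj_cong:
  assumes k: "k \<in> N2" and w: "w \<in> carrier (G 2)" "w' \<in> carrier (G 2)" "d 2 2 w = d 2 2 w'"
  shows "w \<otimes>\<^bsub>G 2\<^esub> k \<otimes>\<^bsub>G 2\<^esub> inv\<^bsub>G 2\<^esub> w = w' \<otimes>\<^bsub>G 2\<^esub> k \<otimes>\<^bsub>G 2\<^esub> inv\<^bsub>G 2\<^esub> w'"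
proof -
  note kG = N2_D[OF k]
  let ?v = "inv\<^bsub>G 2\<^esub> w' \<otimes>\<^bsub>G 2\<^esub> w"
  have "k \<otimes>\<^bsub>G 2\<^esub> ?v = ?v \<otimes>\<^bsub>G 2\<^esub> k"
    using kG w by (intro commute_01_2) auto
  then have "w' \<otimes>\<^bsub>G 2\<^esub> (?v \<otimes>\<^bsub>G 2\<^esub> k) \<otimes>\<^bsub>G 2\<^esub> inv\<^bsub>G 2\<^esub> w = w' \<otimes>\<^bsub>G 2\<^esub> (k \<otimes>\<^bsub>G 2\<^esub> ?v) \<otimes>\<^bsub>G 2\<^esub> inv\<^bsub>G 2\<^esub> w"
    by simp
  then show ?thesis using kG w by (simp add: G2.word_simps)
qed

text \<open>This holds as \<open>s\<^sub>1 d\<^sub>2 k\<close> and \<open>k\<close> have the same last face.\<close>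

lemma conj_d2:
  assumes "k \<in> N2" "l \<in> N2"
  shows "s 1 1 (d 2 2 k) \<otimes>\<^bsub>G 2\<^esub> l \<otimes>\<^bsub>G 2\<^esub> inv\<^bsub>G 2\<^esub> (s 1 1 (d 2 2 k)) = k \<otimes>\<^bsub>G 2\<^esub> l \<otimes>\<^bsub>G 2\<^esub> inv\<^bsub>G 2\<^esub> k"
  using assms by (intro conj_cong) (auto dest: N2_D)

text \<open>
  Write \<open>s\<^sub>1 d\<^sub>2 k = k a\<close> and \<open>s\<^sub>0 d\<^sub>2 k = k a b\<close>.  Then \<open>a\<close> lies in the kernels of \<open>d\<^sub>0\<close> and
  \<open>d\<^sub>2\<close>, hence commutes with \<open>b\<close> and its conjugates, which lie in the kernel of \<open>d\<^sub>1\<close>; and \<open>k b\<close> lies in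
  the kernels of \<open>d\<^sub>1\<close> and \<open>d\<^sub>2\<close>, hence commutes with \<open>s\<^sub>1 y\<close>, which lies in the kernel of \<open>d\<^sub>0\<close>.  First
  \<open>a\<close> and then \<open>b\<close> cancel.
\<close>

lemma peiffer_d2_left:
  assumes k: "k \<in> N2" and y: "y \<in> N1"
  shows "peiffer (d 2 2 k) y = k \<otimes>\<^bsub>G 2\<^esub> (s 1 1 y \<otimes>\<^bsub>G 2\<^esub> inv\<^bsub>G 2\<^esub> k \<otimes>\<^bsub>G 2\<^esub> inv\<^bsub>G 2\<^esub> (s 1 1 y))"
proof -
  note kG = N2_D[OF k] and yG = N1_D[OF y]
  have dd: "d 2 2 k \<in> carrier (G 1)" "d 1 0 (d 2 2 k) = \<one>\<^bsub>G 0\<^esub>" "d 1 1 (d 2 2 k) = \<one>\<^bsub>G 0\<^esub>"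
    using kG by (auto simp: face_face_2)
  define a where "a = inv\<^bsub>G 2\<^esub> k \<otimes>\<^bsub>G 2\<^esub> s 1 1 (d 2 2 k)"
  define b where "b = inv\<^bsub>G 2\<^esub> (s 1 1 (d 2 2 k)) \<otimes>\<^bsub>G 2\<^esub> s 1 0 (d 2 2 k)"
  define Y where "Y = s 1 1 y"
  have a: "a \<in> carrier (G 2)" "d 2 0 a = \<one>\<^bsub>G 1\<^esub>" "d 2 2 a = \<one>\<^bsub>G 1\<^esub>"
    using kG dd by (auto simp: a_def)
  have b: "b \<in> carrier (G 2)" "d 2 1 b = \<one>\<^bsub>G 1\<^esub>" "d 2 2 b = inv\<^bsub>G 1\<^esub> (d 2 2 k)"
    using kG dd by (auto simp: b_def)
  have Y: "Y \<in> carrier (G 2)" "d 2 0 Y = \<one>\<^bsub>G 1\<^esub>"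
    using yG by (auto simp: Y_def)
  have s11: "s 1 1 (d 2 2 k) = k \<otimes>\<^bsub>G 2\<^esub> a" and s10: "s 1 0 (d 2 2 k) = k \<otimes>\<^bsub>G 2\<^esub> (a \<otimes>\<^bsub>G 2\<^esub> b)"
    using kG dd by (simp_all add: a_def b_def G2.word_simps)
  have ab: "a \<otimes>\<^bsub>G 2\<^esub> b = b \<otimes>\<^bsub>G 2\<^esub> a"
    by (rule commute_02_1[OF a b(1,2)])
  have aYb: "a \<otimes>\<^bsub>G 2\<^esub> (Y \<otimes>\<^bsub>G 2\<^esub> b \<otimes>\<^bsub>G 2\<^esub> inv\<^bsub>G 2\<^esub> Y) = (Y \<otimes>\<^bsub>G 2\<^esub> b \<otimes>\<^bsub>G 2\<^esub> inv\<^bsub>G 2\<^esub> Y) \<otimes>\<^bsub>G 2\<^esub> a"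
    using Y b by (intro commute_02_1[OF a]) auto
  have cY: "(k \<otimes>\<^bsub>G 2\<^esub> b) \<otimes>\<^bsub>G 2\<^esub> Y = Y \<otimes>\<^bsub>G 2\<^esub> (k \<otimes>\<^bsub>G 2\<^esub> b)"
    using kG b dd by (intro commute_12_0[OF _ _ _ Y]) auto
  have "peiffer (d 2 2 k) y = k \<otimes>\<^bsub>G 2\<^esub> (a \<otimes>\<^bsub>G 2\<^esub> (Y \<otimes>\<^bsub>G 2\<^esub> b \<otimes>\<^bsub>G 2\<^esub> inv\<^bsub>G 2\<^esub> Y)) \<otimes>\<^bsub>G 2\<^esub> inv\<^bsub>G 2\<^esub> (k \<otimes>\<^bsub>G 2\<^esub> (a \<otimes>\<^bsub>G 2\<^esub> b))"
    using a(1) b(1) Y(1) kG(1) by (simp add: peiffer_def s11 s10 Y_def[symmetric] G2.word_simps)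
  also have "\<dots> = k \<otimes>\<^bsub>G 2\<^esub> Y \<otimes>\<^bsub>G 2\<^esub> b \<otimes>\<^bsub>G 2\<^esub> inv\<^bsub>G 2\<^esub> ((k \<otimes>\<^bsub>G 2\<^esub> b) \<otimes>\<^bsub>G 2\<^esub> Y)"
    unfolding aYb ab using a(1) b(1) Y(1) kG(1) by (simp add: G2.word_simps)
  also have "\<dots> = k \<otimes>\<^bsub>G 2\<^esub> (Y \<otimes>\<^bsub>G 2\<^esub> inv\<^bsub>G 2\<^esub> k \<otimes>\<^bsub>G 2\<^esub> inv\<^bsub>G 2\<^esub> Y)"
    unfolding cY using b(1) Y(1) kG(1) by (simp add: G2.word_simps)
  finally show ?thesis by (simp add: Y_def)
qed

text \<open>For the action derived from the lifting, this says that it is conjugation through \<open>s\<^sub>1\<close>.\<close>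

lemma peiffer_lifting_act:
  assumes k: "k \<in> N2" and y: "y \<in> N1"
  shows "k \<otimes>\<^bsub>G 2\<^esub> peiffer (d 2 2 (inv\<^bsub>G 2\<^esub> k)) y = s 1 1 y \<otimes>\<^bsub>G 2\<^esub> k \<otimes>\<^bsub>G 2\<^esub> inv\<^bsub>G 2\<^esub> (s 1 1 y)"
  using N2_D(1)[OF k] N1_D(1)[OF y]
  by (simp add: peiffer_d2_left[OF N2_closed(2)[OF k] y] del: hom_simps(19))

lemma peiffer_d2_d2:
  assumes k: "k \<in> N2" and l: "l \<in> N2"
  shows "peiffer (d 2 2 k) (d 2 2 l) = k \<otimes>\<^bsub>G 2\<^esub> l \<otimes>\<^bsub>G 2\<^esub> inv\<^bsub>G 2\<^esub> k \<otimes>\<^bsub>G 2\<^esub> inv\<^bsub>G 2\<^esub> l"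
  using N2_D(1)[OF k] N2_D(1)[OF l]
  by (simp add: peiffer_d2_left[OF k d2_N2[OF l]] conj_d2[OF l N2_closed(2)[OF k]] G2.m_assoc)

text \<open>
  As words in a free group, the two sides agree up to conjugating \<open>{x, z}\<close> by \<open>s\<^sub>0 x s\<^sub>1 y (s\<^sub>0 x)\<^sup>-\<^sup>1\<close>,
  whose last face is that of \<open>s\<^sub>1\<close> of the acting element.
\<close>

lemma peiffer_mult_right:
  assumes x: "x \<in> N1" and y: "y \<in> N1" and z: "z \<in> N1"
  shows "peiffer x (y \<otimes>\<^bsub>G 1\<^esub> z) = peiffer x y \<otimes>\<^bsub>G 2\<^esub>
    (s 1 1 (s 0 0 (d 1 1 x) \<otimes>\<^bsub>G 1\<^esub> y \<otimes>\<^bsub>G 1\<^esub> inv\<^bsub>G 1\<^esub> (s 0 0 (d 1 1 x))) \<otimes>\<^bsub>G 2\<^esub> peiffer x z \<otimes>\<^bsub>G 2\<^esub>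
     inv\<^bsub>G 2\<^esub> (s 1 1 (s 0 0 (d 1 1 x) \<otimes>\<^bsub>G 1\<^esub> y \<otimes>\<^bsub>G 1\<^esub> inv\<^bsub>G 1\<^esub> (s 0 0 (d 1 1 x)))))"
proof -
  note xG = N1_D(1)[OF x] and yG = N1_D(1)[OF y] and zG = N1_D(1)[OF z]
  let ?w = "s 1 0 x \<otimes>\<^bsub>G 2\<^esub> s 1 1 y \<otimes>\<^bsub>G 2\<^esub> inv\<^bsub>G 2\<^esub> (s 1 0 x)"
  let ?w' = "s 1 1 (s 0 0 (d 1 1 x) \<otimes>\<^bsub>G 1\<^esub> y \<otimes>\<^bsub>G 1\<^esub> inv\<^bsub>G 1\<^esub> (s 0 0 (d 1 1 x)))"
  have "peiffer x (y \<otimes>\<^bsub>G 1\<^esub> z) = peiffer x y \<otimes>\<^bsub>G 2\<^esub> (?w \<otimes>\<^bsub>G 2\<^esub> peiffer x z \<otimes>\<^bsub>G 2\<^esub> inv\<^bsub>G 2\<^esub> ?w)"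
    using xG yG zG by (simp add: peiffer_def G2.word_simps)
  also have "?w \<otimes>\<^bsub>G 2\<^esub> peiffer x z \<otimes>\<^bsub>G 2\<^esub> inv\<^bsub>G 2\<^esub> ?w = ?w' \<otimes>\<^bsub>G 2\<^esub> peiffer x z \<otimes>\<^bsub>G 2\<^esub> inv\<^bsub>G 2\<^esub> ?w'"
    using xG yG by (intro conj_cong peiffer_N2 x z) simp_all
  finally show ?thesis .
qed

text \<open>Similarly, \<open>s\<^sub>0 x\<close> and \<open>s\<^sub>1 s\<^sub>0 d\<^sub>1 x\<close> have the same last face.\<close>

lemma peiffer_mult_left:
  assumes x: "x \<in> N1" and y: "y \<in> N1" and z: "z \<in> N1"
  shows "peiffer (x \<otimes>\<^bsub>G 1\<^esub> y) z = peiffer x (y \<otimes>\<^bsub>G 1\<^esub> z \<otimes>\<^bsub>G 1\<^esub> inv\<^bsub>G 1\<^esub> y) \<otimes>\<^bsub>G 2\<^esub>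
    (s 1 1 (s 0 0 (d 1 1 x)) \<otimes>\<^bsub>G 2\<^esub> peiffer y z \<otimes>\<^bsub>G 2\<^esub> inv\<^bsub>G 2\<^esub> (s 1 1 (s 0 0 (d 1 1 x))))"
proof -
  note xG = N1_D(1)[OF x] and yG = N1_D(1)[OF y] and zG = N1_D(1)[OF z]
  have "peiffer (x \<otimes>\<^bsub>G 1\<^esub> y) z = peiffer x (y \<otimes>\<^bsub>G 1\<^esub> z \<otimes>\<^bsub>G 1\<^esub> inv\<^bsub>G 1\<^esub> y) \<otimes>\<^bsub>G 2\<^esub>
      (s 1 0 x \<otimes>\<^bsub>G 2\<^esub> peiffer y z \<otimes>\<^bsub>G 2\<^esub> inv\<^bsub>G 2\<^esub> (s 1 0 x))"
    using xG yG zG by (simp add: peiffer_def G2.word_simps)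
  also have "s 1 0 x \<otimes>\<^bsub>G 2\<^esub> peiffer y z \<otimes>\<^bsub>G 2\<^esub> inv\<^bsub>G 2\<^esub> (s 1 0 x) =
      s 1 1 (s 0 0 (d 1 1 x)) \<otimes>\<^bsub>G 2\<^esub> peiffer y z \<otimes>\<^bsub>G 2\<^esub> inv\<^bsub>G 2\<^esub> (s 1 1 (s 0 0 (d 1 1 x)))"
    using xG by (intro conj_cong peiffer_N2 y z) simp_all
  finally show ?thesis .
qed

text \<open>
  Again write \<open>s\<^sub>1 d\<^sub>2 k = k a\<close>; here \<open>a\<close> commutes with \<open>(s\<^sub>1 x)\<^sup>-\<^sup>1 s\<^sub>0 x\<close>, which lies in the kernel
  of \<open>d\<^sub>1\<close>.
\<close>

lemma peiffer_d2_mixed: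
  assumes k: "k \<in> N2" and x: "x \<in> N1"
  shows "peiffer (d 2 2 k) x \<otimes>\<^bsub>G 2\<^esub> peiffer x (d 2 2 k) =
    k \<otimes>\<^bsub>G 2\<^esub> (s 1 1 (s 0 0 (d 1 1 x)) \<otimes>\<^bsub>G 2\<^esub> inv\<^bsub>G 2\<^esub> k \<otimes>\<^bsub>G 2\<^esub> inv\<^bsub>G 2\<^esub> (s 1 1 (s 0 0 (d 1 1 x))))"
proof -
  note kG = N2_D[OF k] and xG = N1_D[OF x]
  have dd: "d 2 2 k \<in> carrier (G 1)" "d 1 0 (d 2 2 k) = \<one>\<^bsub>G 0\<^esub>"
    using kG by (auto simp: face_face_2)
  define a where "a = inv\<^bsub>G 2\<^esub> k \<otimes>\<^bsub>G 2\<^esub> s 1 1 (d 2 2 k)"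
  have a: "a \<in> carrier (G 2)" "d 2 0 a = \<one>\<^bsub>G 1\<^esub>" "d 2 2 a = \<one>\<^bsub>G 1\<^esub>"
    using kG dd by (auto simp: a_def)
  have s11: "s 1 1 (d 2 2 k) = k \<otimes>\<^bsub>G 2\<^esub> a"
    using kG dd by (simp add: a_def)
  have ab: "a \<otimes>\<^bsub>G 2\<^esub> (inv\<^bsub>G 2\<^esub> (s 1 1 x) \<otimes>\<^bsub>G 2\<^esub> s 1 0 x) = (inv\<^bsub>G 2\<^esub> (s 1 1 x) \<otimes>\<^bsub>G 2\<^esub> s 1 0 x) \<otimes>\<^bsub>G 2\<^esub> a"
    using xG by (intro commute_02_1[OF a]) auto
  have "peiffer (d 2 2 k) x \<otimes>\<^bsub>G 2\<^esub> peiffer x (d 2 2 k) =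
     k \<otimes>\<^bsub>G 2\<^esub> s 1 1 x \<otimes>\<^bsub>G 2\<^esub> (a \<otimes>\<^bsub>G 2\<^esub> (inv\<^bsub>G 2\<^esub> (s 1 1 x) \<otimes>\<^bsub>G 2\<^esub> s 1 0 x)) \<otimes>\<^bsub>G 2\<^esub>
       inv\<^bsub>G 2\<^esub> (s 1 0 x \<otimes>\<^bsub>G 2\<^esub> (k \<otimes>\<^bsub>G 2\<^esub> a))"
    unfolding peiffer_d2_left[OF k x] using kG xG a(1) by (simp add: peiffer_def s11 G2.word_simps)
  also have "\<dots> = k \<otimes>\<^bsub>G 2\<^esub> (s 1 0 x \<otimes>\<^bsub>G 2\<^esub> inv\<^bsub>G 2\<^esub> k \<otimes>\<^bsub>G 2\<^esub> inv\<^bsub>G 2\<^esub> (s 1 0 x))"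
    unfolding ab using kG xG a(1) by (simp add: G2.word_simps)
  also have "s 1 0 x \<otimes>\<^bsub>G 2\<^esub> inv\<^bsub>G 2\<^esub> k \<otimes>\<^bsub>G 2\<^esub> inv\<^bsub>G 2\<^esub> (s 1 0 x) =
      s 1 1 (s 0 0 (d 1 1 x)) \<otimes>\<^bsub>G 2\<^esub> inv\<^bsub>G 2\<^esub> k \<otimes>\<^bsub>G 2\<^esub> inv\<^bsub>G 2\<^esub> (s 1 1 (s 0 0 (d 1 1 x)))"
    using xG by (intro conj_cong N2_closed(2) k) simp_all
  finally show ?thesis .
qed

end

section \<open>Hopf kernels are sub-Hopf-algebras\<close>

lemma restrict_hopf_simps [simp]:
  "carrier (restrict_hopf A N) = N" "mult (restrict_hopf A N) = mult A" "one (restrict_hopf A N) = one A"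
  "smul (restrict_hopf A N) = smul A" "counit (restrict_hopf A N) = counit A"
  "antipode (restrict_hopf A N) = antipode A"
  "comult (restrict_hopf A N) x = {p \<in> comult A x. Poly_Mapping.keys p \<subseteq> N \<times> N}"
  by (auto simp: restrict_hopf_def)

text \<open>
  The conditions that make a subspace \<open>N\<close> a sub-Hopf-algebra.  The last one says that \<open>N\<close> is stable
  under the action of all functionals, a form of \<open>\<Delta> N \<subseteq> N \<otimes> A\<close> that passes to intersections.
\<close>

locale sub_hopf_algebra = cocommutative_hopf_algebra A
  for A :: "('k::field, 'a::ab_group_add) hopf" (structure) +
  fixes N :: "'a set"
  assumes N_sub: "N \<subseteq> carrier A" and N_subspace: "module.subspace (smul A) N"
    and N_one: "\<one> \<in> N" and N_mult: "x \<in> N \<Longrightarrow> y \<in> N \<Longrightarrow> x \<otimes> y \<in> N"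
    and N_antipode: "x \<in> N \<Longrightarrow> antipode A x \<in> N"
    and N_stable: "x \<in> N \<Longrightarrow> functional (smul A) \<chi> \<Longrightarrow>
      sweedler A (smul A) x (\<lambda>u v. smul A (\<chi> v) u) \<in> N"
begin

text \<open>
  In coordinates adapted to \<open>N\<close>, stability forces the first entries of the coproduct of an element of
  \<open>N\<close> to be basis vectors of \<open>N\<close>; cocommutativity does the same for the second entries.
\<close>

lemma comult_restricts:
  assumes x: "x \<in> N"
  obtains p where "p \<in> comult A x" "Poly_Mapping.keys p \<subseteq> N \<times> N"
proof -
  interpret V: vector_space "smul A" by (rule vector_space_smul)
  note ms = vector_space_mult
  obtain R :: "'a \<Rightarrow> ('a \<Rightarrow>\<^sub>0 'k)" and D E where R: "\<And>x y. R (x + y) = R x + R y"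
    "\<And>c x. R (smul A c x) = fscale c (R x)" "D \<subseteq> N" "E \<subseteq> carrier A"
    "\<And>x. x \<in> N \<Longrightarrow> Poly_Mapping.keys (R x) \<subseteq> D" "\<And>x. x \<in> carrier A \<Longrightarrow> Poly_Mapping.keys (R x) \<subseteq> E"
    "\<And>x. lsum (smul A) (R x) (\<lambda>e. e) = x"
    by (rule V.coordinates_exist[OF N_subspace subspace_carrier N_sub]) (rule that; assumption)
  have xA: "x \<in> carrier A" using x N_sub by blast
  have RA: "Poly_Mapping.keys (R x) \<subseteq> carrier A" if "x \<in> carrier A" for x
    using R(4,6) that by blast
  let ?r = "\<lambda>e a. Poly_Mapping.lookup (R a) e"
  have r: "functional (smul A) (?r e)" for e
    by (simp add: functional_def R lookup_add)
  have rl: "linear_on A (*) (?r e)" for e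
    using r[of e] by (simp add: functional_def linear_on_def)
  let ?p = "sweedler A fscale x (coord_tensor R)"
  have p: "?p \<in> comult A x" by (rule coord_comult[OF RA R(7) xA])
  have lk: "Poly_Mapping.lookup ?p (e, e') = sweedler A (*) x (\<lambda>u v. ?r e u * ?r e' v)" for e e'
  proof -
    have "Poly_Mapping.lookup (coord_tensor R u v) (e, e') = ?r e u * ?r e' v" for u v
    proof -
      interpret K: vector_space "(*) :: 'k \<Rightarrow> 'k \<Rightarrow> 'k" by (rule ms)
      have "Poly_Mapping.lookup (basis (a, b) :: 'a \<times> 'a \<Rightarrow>\<^sub>0 'k) (e, e') =
          Poly_Mapping.lookup (basis a) e * Poly_Mapping.lookup (basis b) e'" for a b
        by (auto simp: lookup_single when_def)
      moreover have "lsum (*) q (\<lambda>y. Poly_Mapping.lookup (basis y) x) = Poly_Mapping.lookup q x"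
        for q :: "'a \<Rightarrow>\<^sub>0 'k" and x
        by (simp add: lookup_lsum[symmetric] lsum_basis_eq)
      ultimately show ?thesis
        by (simp add: coord_tensor_def lookup_lsum K.lsum_body_scale mult.commute[of _ "?r e' v"])
    qed
    then show ?thesis by (simp add: sweedler_lsum lookup_lsum case_prod_unfold)
  qed
  have D: "e \<in> D" if "sweedler A (*) x (\<lambda>u v. ?r e u * ?r e' v) \<noteq> 0" for e e'
  proof -
    let ?u = "sweedler A (smul A) x (\<lambda>u v. smul A (?r e' v) u)"
    have "?r e ?u = sweedler A (*) x (\<lambda>u v. ?r e (smul A (?r e' v) u))"
      using carrier_smul by (intro linear_on_of_sweedler[OF subspace_of ms rl xA])
    also have "\<dots> = sweedler A (*) x (\<lambda>u v. ?r e u * ?r e' v)"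
      by (simp add: R mult.commute)
    finally have "e \<in> Poly_Mapping.keys (R ?u)" using that by (simp add: in_keys_iff)
    then show ?thesis using R(5)[OF N_stable[OF x r]] by blast
  qed
  have "Poly_Mapping.keys ?p \<subseteq> N \<times> N"
  proof clarify
    fix e e' assume "(e, e') \<in> Poly_Mapping.keys ?p"
    then have *: "sweedler A (*) x (\<lambda>u v. ?r e u * ?r e' v) \<noteq> 0" by (simp add: in_keys_iff lk)
    moreover from * have "sweedler A (*) x (\<lambda>u v. ?r e' u * ?r e v) \<noteq> 0"
      using sweedler_cocomm[OF xA ms functional_bilinear[OF r r], of e e'] by (simp add: mult.commute)
    ultimately show "e \<in> N \<and> e' \<in> N" using D R(3) by blast
  qed
  with p show ?thesis by (rule that)
qed

abbreviation "M \<equiv> restrict_hopf A N"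

lemma subspace_M: "subspace_of M"
  using vector_space_smul N_subspace by (simp add: subspace_of_def)

lemma comult_rep_M:
  assumes "x \<in> N"
  shows "comult_rep M x \<in> comult A x" "Poly_Mapping.keys (comult_rep M x) \<subseteq> N \<times> N"
proof -
  obtain p where "p \<in> comult M x" by (rule comult_restricts[OF assms]) auto
  then have "comult_rep M x \<in> comult M x" by (rule someI)
  then show "comult_rep M x \<in> comult A x" "Poly_Mapping.keys (comult_rep M x) \<subseteq> N \<times> N" by auto
qed

text \<open>
  Functionals on the ambient space see no difference between \<open>N \<otimes> N\<close> and its image in \<open>A \<otimes> A\<close>.
\<close>

lemma comult_M_class:
  assumes x: "x \<in> N" and p: "p \<in> comult A x" "Poly_Mapping.keys p \<subseteq> N \<times> N"
  shows "comult M x = tensor_class M M p"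
proof (rule Set.set_eqI)
  fix q
  have xA: "x \<in> carrier A" using x N_sub by blast
  have *: "q \<in> tensor_class M M p \<longleftrightarrow> Poly_Mapping.keys q \<subseteq> N \<times> N \<and>
      (\<forall>\<phi> \<psi>. functional (smul A) \<phi> \<longrightarrow> functional (smul A) \<psi> \<longrightarrow> pairing \<phi> \<psi> q = pairing \<phi> \<psi> p)"
    using tensor_class_iff[OF subspace_M subspace_M, of p q] p(2) by simp
  have "N \<times> N \<subseteq> carrier A \<times> carrier A" using N_sub by blast
  then show "q \<in> comult M x \<longleftrightarrow> q \<in> tensor_class M M p"
    unfolding * using mem_comult_iff[OF xA, of q] sweedler_functionals[OF xA p(1)] by auto
qed

lemma sweedler_M:
  assumes x: "x \<in> N" and s: "vector_space s" and f: "bilinear_on A A s f"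
  shows "sweedler M s x f = sweedler A s x f"
  using sweedler_eq_lsum[OF _ comult_rep_M(1)[OF x] s f] x N_sub by (auto simp: sweedler_lsum)

lemma sweedler_M_cong:
  assumes "x \<in> N" "\<And>u v. u \<in> N \<Longrightarrow> v \<in> N \<Longrightarrow> f u v = g u v"
  shows "sweedler M s x f = sweedler M s x g"
  unfolding sweedler_lsum using comult_rep_M(2)[OF assms(1)] assms(2) by (auto intro!: lsum_cong)

lemma keys_sweedler_M:
  assumes "x \<in> N" "\<And>u v. u \<in> N \<Longrightarrow> v \<in> N \<Longrightarrow> Poly_Mapping.keys (f u v) \<subseteq> Y"
  shows "Poly_Mapping.keys (sweedler M fscale x f) \<subseteq> Y"
  unfolding sweedler_lsum
proof (rule keys_lsum)
  fix y assume "y \<in> Poly_Mapping.keys (comult_rep M x)"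
  moreover obtain u v where "y = (u, v)" by (cases y)
  ultimately show "Poly_Mapping.keys (case y of (u, v) \<Rightarrow> f u v) \<subseteq> Y"
    using comult_rep_M(2)[OF assms(1)] assms(2)[of u v] by auto
qed

lemma lsum_sweedler_M:
  assumes s: "vector_space s"
  shows "lsum s (sweedler M fscale x f) g = sweedler M s x (\<lambda>u v. lsum s (f u v) g)"
  by (simp add: sweedler_lsum vector_space.lsum_bind[OF s] case_prod_unfold)

text \<open>
  The identities between tensors, tested on functionals, become Sweedler sums with multilinear
  bodies defined on all of \<open>A\<close>; these have the same value for both coproducts.
\<close>

lemma bialgebra_M: "bialgebra M"
proof -
  note V = vector_space_smul and ms = vector_space_mult
  note NA = subsetD[OF N_sub]
  note fb = functional_bilinear[of A _ A]
  have bil_ext: "bilinear_on A A (*) (\<lambda>u w. sweedler A (*) u (\<lambda>p q. \<phi> p * \<psi> q * \<chi> w))"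
    "bilinear_on A A (*) (\<lambda>u w. sweedler A (*) w (\<lambda>p q. \<phi> u * \<psi> p * \<chi> q))"
    "bilinear_on A A (*) (\<lambda>p q. \<phi> p * \<psi> q * c)" "bilinear_on A A (*) (\<lambda>p q. c * \<phi> p * \<psi> q)"
    if "functional (smul A) \<phi>" "functional (smul A) \<psi>" "functional (smul A) \<chi>" for \<phi> \<psi> \<chi> c
  proof -
    show 1: "bilinear_on A A (*) (\<lambda>p q. \<phi> p * \<psi> q * c)" and 2: "bilinear_on A A (*) (\<lambda>p q. c * \<phi> p * \<psi> q)" for c
      using that by (auto simp: bilinear_on_def linear_on_def functional_def algebra_simps)
    have 3: "linear_on A (*) (\<lambda>w. \<phi> p * \<psi> q * \<chi> w)" "linear_on A (*) (\<lambda>w. \<phi> w * \<psi> p * \<chi> q)" for p q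
      using that by (auto simp: linear_on_def functional_def algebra_simps)
    have 4: "bilinear_on A A (*) (\<lambda>p q. \<phi> u * \<psi> p * \<chi> q)" for u
      using that by (auto simp: bilinear_on_def linear_on_def functional_def algebra_simps)
    show "bilinear_on A A (*) (\<lambda>u w. sweedler A (*) u (\<lambda>p q. \<phi> p * \<psi> q * \<chi> w))"
      by (intro bilinear_onI linear_on_sweedler[OF ms 1] linear_on_sweedler_body[OF ms] 3)
    show "bilinear_on A A (*) (\<lambda>u w. sweedler A (*) w (\<lambda>p q. \<phi> u * \<psi> p * \<chi> q))"
      by (intro bilinear_onI linear_on_sweedler[OF ms 4] linear_on_sweedler_body[OF ms] 3)
  qed
  show ?thesis
  proof (intro bialgebra.intro bialgebra_axioms.intro)
    show "monoid M" using NA N_one N_mult by unfold_locales (auto simp: m_assoc)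
    show "vector_space (smul M)" "module.subspace (smul M) (carrier M)"
      using V N_subspace by simp_all
    show "bilinear_map M M M (mult M)"
      using NA N_mult bilinear_onD[OF mult_bilinear] by (auto simp: bilinear_map_def linear_map_def)
    show "comult M x \<in> tensor_space M M" if "x \<in> carrier M" for x
    proof -
      have x: "x \<in> N" using that by simp
      obtain p where p: "p \<in> comult A x" "Poly_Mapping.keys p \<subseteq> N \<times> N" by (rule comult_restricts[OF x])
      show ?thesis
        unfolding comult_M_class[OF x p] tensor_space_def by (intro imageI) (simp add: p)
    qed
    show "p + q \<in> comult M (x + y)"
      if "x \<in> carrier M" "y \<in> carrier M" "p \<in> comult M x" "q \<in> comult M y" for x y p q
      using that NA comult_add[of x y p q] Poly_Mapping.keys_add[of p q] by auto
    show "fscale c p \<in> comult M (smul M c x)" if "x \<in> carrier M" "p \<in> comult M x" for c x p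
      using that NA comult_smul[of x p c] keys_fscale[of c p] by auto
    show "counit M (x + y) = counit M x + counit M y" if "x \<in> carrier M" "y \<in> carrier M" for x y
      using that NA by (simp add: counit_add)
    show "counit M (smul M c x) = c * counit M x" if "x \<in> carrier M" for c x
      using that NA by (simp add: counit_smul)
    show "counit M \<one>\<^bsub>M\<^esub> = 1" by (simp add: counit_one)
    show "counit M (x \<otimes>\<^bsub>M\<^esub> y) = counit M x * counit M y" if "x \<in> carrier M" "y \<in> carrier M" for x y
      using that NA by (simp add: counit_mult)
    show "comult M \<one>\<^bsub>M\<^esub> = tensor_class M M (basis (\<one>\<^bsub>M\<^esub>, \<one>\<^bsub>M\<^esub>))"
      using comult_M_class[OF N_one, of "basis (\<one>, \<one>)"] N_one by (simp add: comult_one tensor_class_self)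
    have "bilinear_on A A (smul A) (\<lambda>u v. smul A (counit A u) v)"
      "bilinear_on A A (smul A) (\<lambda>u v. smul A (counit A v) u)"
      using V by (auto simp: bilinear_on_def linear_on_def counit_add counit_smul vector_space_def mult.commute)
    then show "sweedler M (smul M) x (\<lambda>x' x''. smul M (counit M x') x'') = x"
      "sweedler M (smul M) x (\<lambda>x' x''. smul M (counit M x'') x') = x" if "x \<in> carrier M" for x
      using that NA by (simp_all add: sweedler_M[OF _ V] counit_left counit_right)
    show "comult M (x \<otimes>\<^bsub>M\<^esub> y) = tensor_class M M (sweedler M fscale x (\<lambda>x' x''. sweedler M fscale y
        (\<lambda>y' y''. basis (x' \<otimes>\<^bsub>M\<^esub> y', x'' \<otimes>\<^bsub>M\<^esub> y''))))" if "x \<in> carrier M" "y \<in> carrier M" for x y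
    proof -
      have x: "x \<in> N" and y: "y \<in> N" and xA: "x \<in> carrier A" and yA: "y \<in> carrier A" using that NA by auto
      let ?p = "sweedler M fscale x (\<lambda>x' x''. sweedler M fscale y (\<lambda>y' y''. basis (x' \<otimes> y', x'' \<otimes> y'')))"
      have k: "Poly_Mapping.keys ?p \<subseteq> N \<times> N"
        using N_mult by (intro keys_sweedler_M x y) auto
      have "?p \<in> comult A (x \<otimes> y)"
        unfolding mem_comult_iff[OF m_closed[OF xA yA]]
      proof (intro conjI allI impI)
        show "Poly_Mapping.keys ?p \<subseteq> carrier A \<times> carrier A" using k N_sub by blast
        fix \<phi> \<psi> assume \<phi>: "functional (smul A) \<phi>" and \<psi>: "functional (smul A) \<psi>"
        note \<beta> = fb[OF \<phi> \<psi>]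
        have b1: "bilinear_on A A (*) (\<lambda>y' y''. \<phi> (x' \<otimes> y') * \<psi> (x'' \<otimes> y''))"
          and b2: "bilinear_on A A (*) (\<lambda>y' y''. \<phi> (y' \<otimes> x') * \<psi> (y'' \<otimes> x''))"
          if "x' \<in> carrier A" "x'' \<in> carrier A" for x' x''
          using that bilinear_onD[OF \<beta>] bilinear_onD[OF mult_bilinear]
          by (auto intro!: bilinear_onI simp: linear_on_def carrier_add carrier_smul)
        have b3: "bilinear_on A A (*) (\<lambda>x' x''. sweedler A (*) y (\<lambda>y' y''. \<phi> (x' \<otimes> y') * \<psi> (x'' \<otimes> y'')))"
          using b2 by (intro bilinear_onI linear_on_sweedler_body[OF ms yA]) (auto simp: bilinear_on_def)
        have "pairing \<phi> \<psi> ?p = sweedler M (*) x (\<lambda>x' x''. sweedler M (*) y (\<lambda>y' y''. \<phi> (x' \<otimes> y') * \<psi> (x'' \<otimes> y'')))"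
          by (simp add: pairing_def lsum_sweedler_M[OF ms] vector_space.lsum_basis[OF ms])
        also have "\<dots> = sweedler M (*) x (\<lambda>x' x''. sweedler A (*) y (\<lambda>y' y''. \<phi> (x' \<otimes> y') * \<psi> (x'' \<otimes> y'')))"
          using NA by (intro sweedler_M_cong x sweedler_M[OF y ms b1]) auto
        also have "\<dots> = sweedler A (*) x (\<lambda>x' x''. sweedler A (*) y (\<lambda>y' y''. \<phi> (x' \<otimes> y') * \<psi> (x'' \<otimes> y'')))"
          by (rule sweedler_M[OF x ms b3])
        also have "\<dots> = sweedler A (*) (x \<otimes> y) (\<lambda>u v. \<phi> u * \<psi> v)"
          by (rule sweedler_mult[OF xA yA ms \<beta>, symmetric])
        finally show "pairing \<phi> \<psi> ?p = sweedler A (*) (x \<otimes> y) (\<lambda>u v. \<phi> u * \<psi> v)" .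
      qed
      from comult_M_class[OF N_mult[OF x y] this k] show ?thesis by simp
    qed
    show "tensor3_class M (sweedler M fscale x (\<lambda>x' x''. sweedler M fscale x' (\<lambda>u v. basis (u, v, x'')))) =
      tensor3_class M (sweedler M fscale x (\<lambda>x' x''. sweedler M fscale x'' (\<lambda>u v. basis (x', u, v))))"
      (is "tensor3_class M ?p = tensor3_class M ?q") if "x \<in> carrier M" for x
    proof -
      have x: "x \<in> N" and xA: "x \<in> carrier A" using that NA by auto
      have kp: "Poly_Mapping.keys ?p \<subseteq> carrier M \<times> carrier M \<times> carrier M"
        and kq: "Poly_Mapping.keys ?q \<subseteq> carrier M \<times> carrier M \<times> carrier M"
        by (intro keys_sweedler_M x; simp)+
      show ?thesis
        unfolding tensor3_class_eq_iff[OF subspace_M kq kp]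
      proof (intro allI impI)
        fix \<phi> \<psi> \<chi>
        assume *: "functional (smul M) \<phi>" "functional (smul M) \<psi>" "functional (smul M) \<chi>"
        then have f: "functional (smul A) \<phi>" "functional (smul A) \<psi>" "functional (smul A) \<chi>" by simp_all
        have "pairing3 \<phi> \<psi> \<chi> ?p = sweedler M (*) x (\<lambda>u w. sweedler M (*) u (\<lambda>p q. \<phi> p * \<psi> q * \<chi> w))"
          by (simp add: pairing3_def lsum_sweedler_M[OF ms] vector_space.lsum_basis[OF ms])
        also have "\<dots> = sweedler M (*) x (\<lambda>u w. sweedler A (*) u (\<lambda>p q. \<phi> p * \<psi> q * \<chi> w))"
          by (intro sweedler_M_cong x sweedler_M[OF _ ms bil_ext(3)[OF f]])
        also have "\<dots> = sweedler A (*) x (\<lambda>u w. sweedler A (*) u (\<lambda>p q. \<phi> p * \<psi> q * \<chi> w))"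
          by (rule sweedler_M[OF x ms bil_ext(1)[OF f]])
        also have "\<dots> = sweedler A (*) x (\<lambda>u w. sweedler A (*) w (\<lambda>p q. \<phi> u * \<psi> p * \<chi> q))"
          using f by (intro sweedler_coassoc[OF xA ms]) (auto simp: linear_on_def functional_def algebra_simps)
        also have "\<dots> = sweedler M (*) x (\<lambda>u w. sweedler A (*) w (\<lambda>p q. \<phi> u * \<psi> p * \<chi> q))"
          by (rule sweedler_M[OF x ms bil_ext(2)[OF f], symmetric])
        also have "\<dots> = sweedler M (*) x (\<lambda>u w. sweedler M (*) w (\<lambda>p q. \<phi> u * \<psi> p * \<chi> q))"
          by (intro sweedler_M_cong x sweedler_M[OF _ ms bil_ext(4)[OF f(2,3,1)], symmetric])
        also have "\<dots> = pairing3 \<phi> \<psi> \<chi> ?q"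
          by (simp add: pairing3_def lsum_sweedler_M[OF ms] vector_space.lsum_basis[OF ms])
        finally show "pairing3 \<phi> \<psi> \<chi> ?p = pairing3 \<phi> \<psi> \<chi> ?q" .
      qed
    qed
  qed
qed

theorem cocommutative_hopf_algebra_M: "cocommutative_hopf_algebra M"
proof (intro cocommutative_hopf_algebra.intro bialgebra_M cocommutative_hopf_algebra_axioms.intro)
  note V = vector_space_smul and ms = vector_space_mult
  note NA = subsetD[OF N_sub]
  note S = antipode_linear antipode_closed
  show "linear_map M M (antipode M)"
    using NA N_antipode antipode_linear by (auto simp: linear_map_def linear_on_def)
  have "bilinear_on A A (smul A) (\<lambda>x y. antipode A x \<otimes> y)" "bilinear_on A A (smul A) (\<lambda>x y. x \<otimes> antipode A y)"
    using S by (intro bilinear_onI linear_on_mult; auto simp: linear_on_def)+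
  then show "sweedler M (smul M) x (\<lambda>x' x''. antipode M x' \<otimes>\<^bsub>M\<^esub> x'') = smul M (counit M x) \<one>\<^bsub>M\<^esub>"
    "sweedler M (smul M) x (\<lambda>x' x''. x' \<otimes>\<^bsub>M\<^esub> antipode M x'') = smul M (counit M x) \<one>\<^bsub>M\<^esub>"
    if "x \<in> carrier M" for x
    using that NA by (simp_all add: sweedler_M[OF _ V] antipode_left antipode_right)
  show "comult M x = tensor_class M M (sweedler M fscale x (\<lambda>x' x''. basis (x'', x')))" if "x \<in> carrier M" for x
  proof -
    have x: "x \<in> N" and xA: "x \<in> carrier A" using that NA by auto
    let ?p = "sweedler M fscale x (\<lambda>x' x''. basis (x'', x'))"
    have k: "Poly_Mapping.keys ?p \<subseteq> N \<times> N" by (intro keys_sweedler_M x) auto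
    have "?p \<in> comult A x"
      unfolding mem_comult_iff[OF xA]
    proof (intro conjI allI impI)
      show "Poly_Mapping.keys ?p \<subseteq> carrier A \<times> carrier A" using k N_sub by blast
      fix \<phi> \<psi> assume \<phi>: "functional (smul A) \<phi>" and \<psi>: "functional (smul A) \<psi>"
      have "pairing \<phi> \<psi> ?p = sweedler M (*) x (\<lambda>u v. \<phi> v * \<psi> u)"
        by (simp add: pairing_def lsum_sweedler_M[OF ms] vector_space.lsum_basis[OF ms])
      also have "\<dots> = sweedler A (*) x (\<lambda>u v. \<phi> v * \<psi> u)"
        using functional_bilinear[OF \<phi> \<psi>] by (intro sweedler_M[OF x ms]) (auto simp: bilinear_on_def)
      also have "\<dots> = sweedler A (*) x (\<lambda>u v. \<phi> u * \<psi> v)"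
        by (rule sweedler_cocomm[OF xA ms functional_bilinear[OF \<phi> \<psi>], symmetric])
      finally show "pairing \<phi> \<psi> ?p = sweedler A (*) x (\<lambda>u v. \<phi> u * \<psi> v)" .
    qed
    from comult_M_class[OF x this k] show ?thesis .
  qed
qed

end

lemma sweedler_mult_const: "sweedler A (*) x (\<lambda>u v. f u v * c) = sweedler A (*) x f * c"
  by (simp add: sweedler_lsum lsum_def case_prod_unfold sum_distrib_right mult.assoc)

locale hopf_kernel = A: cocommutative_hopf_algebra A + B: cocommutative_hopf_algebra B
  for A :: "('k::field, 'a::ab_group_add) hopf" and B :: "('k, 'b::ab_group_add) hopf" +
  fixes f :: "'a \<Rightarrow> 'b"
  assumes hopf_map: "hopf_map A B f"
begin

lemmas f_closed = hopf_mapD(1)[OF hopf_map] and f_linear = hopf_mapD(2)[OF hopf_map]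
  and f_mult = hopf_mapD(3)[OF hopf_map] and f_one = hopf_mapD(4)[OF hopf_map]

lemma HKer_bilinear:
  assumes x: "x \<in> HKer A B f" and s: "vector_space s" and \<beta>: "bilinear_on A B s \<beta>"
  shows "sweedler A s x (\<lambda>u v. \<beta> u (f v)) = \<beta> x \<one>\<^bsub>B\<^esub>"
proof -
  have xA: "x \<in> carrier A" using x by (simp add: HKer_def)
  let ?p = "sweedler A fscale x (\<lambda>x' x''. basis (x', f x''))"
  have "Poly_Mapping.keys ?p \<subseteq> carrier A \<times> carrier B"
    unfolding sweedler_lsum using A.comult_rep_keys[OF xA] f_closed by (intro keys_lsum) auto
  then have "?p \<in> tensor_class A B ?p" by (rule tensor_class_self)
  moreover have "tensor_class A B ?p = tensor_class A B (basis (x, \<one>\<^bsub>B\<^esub>))"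
    using x by (simp add: HKer_def)
  ultimately have "?p - basis (x, \<one>\<^bsub>B\<^esub>) \<in> tensor_relations A B"
    using tensor_class_diff[of ?p A B "basis (x, \<one>\<^bsub>B\<^esub>)"] xA by (simp add: tensor_class_self)
  from lsum_tensor_relation[OF s \<beta> this] show ?thesis
    by (simp add: vector_space.lsum_diff[OF s] vector_space.lsum_basis[OF s])
      (simp add: sweedler_lsum vector_space.lsum_bind[OF s] vector_space.lsum_basis[OF s] case_prod_unfold)
qed

text \<open>The defining equation of the Hopf kernel, tested on pairs of functionals.\<close>

lemma HKerI:
  assumes x: "x \<in> carrier A"
    and *: "\<And>\<phi> \<psi>. functional (smul A) \<phi> \<Longrightarrow> functional (smul B) \<psi> \<Longrightarrow>
      sweedler A (*) x (\<lambda>u v. \<phi> u * \<psi> (f v)) = \<phi> x * \<psi> \<one>\<^bsub>B\<^esub>"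
  shows "x \<in> HKer A B f"
proof -
  note ms = vector_space_mult
  let ?p = "sweedler A fscale x (\<lambda>x' x''. basis (x', f x''))"
  have 1: "Poly_Mapping.keys ?p \<subseteq> carrier A \<times> carrier B"
    unfolding sweedler_lsum using A.comult_rep_keys[OF x] f_closed by (intro keys_lsum) auto
  have 2: "Poly_Mapping.keys (basis (x, \<one>\<^bsub>B\<^esub>) :: 'a \<times> 'b \<Rightarrow>\<^sub>0 'k) \<subseteq> carrier A \<times> carrier B"
    using x by simp
  have "pairing \<phi> \<psi> ?p = sweedler A (*) x (\<lambda>u v. \<phi> u * \<psi> (f v))" for \<phi> \<psi>
    by (simp add: pairing_def sweedler_lsum vector_space.lsum_bind[OF ms] vector_space.lsum_basis[OF ms] case_prod_unfold)
  then have "tensor_class A B ?p = tensor_class A B (basis (x, \<one>\<^bsub>B\<^esub>))"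
    unfolding tensor_class_eq_iff[OF A.subspace_of B.subspace_of 2 1]
    using * by (simp add: pairing_def vector_space.lsum_basis[OF ms])
  then show ?thesis using x by (simp add: HKer_def)
qed

text \<open>Contract the first factor of the defining equation with the counit.\<close>

lemma HKer_eval:
  assumes x: "x \<in> HKer A B f"
  shows "f x = smul B (counit A x) \<one>\<^bsub>B\<^esub>"
proof -
  note V = B.vector_space_smul
  have xA: "x \<in> carrier A" using x by (simp add: HKer_def)
  have "bilinear_on A B (smul B) (\<lambda>u v. smul B (counit A u) v)"
    using V by (auto simp: bilinear_on_def linear_on_def A.counit_add A.counit_smul vector_space_def mult.commute)
  from HKer_bilinear[OF x V this] show ?thesis
    by (simp add: A.sweedler_counit(1)[OF xA V f_linear])
qed

lemma bilinear_pullback: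
  assumes "functional (smul A) \<phi>" "functional (smul B) \<psi>"
  shows "bilinear_on A A (*) (\<lambda>u v. \<phi> u * \<psi> (f v))"
  using assms f_linear by (auto simp: bilinear_on_def linear_on_def functional_def algebra_simps)

text \<open>
  For a single element the right-hand condition is weaker than membership in the Hopf kernel.  For
  all values of a point together it is not, since the coproduct of a value is a combination of
  pairs of values.
\<close>

lemma coalg_map_HKer:
  assumes g: "coalg_map \<Delta> \<epsilon> A g" and C: "cocomm_coalgebra \<Delta> \<epsilon>"
  shows "(\<forall>b. g b \<in> HKer A B f) \<longleftrightarrow> (\<forall>b. f (g b) = smul B (\<epsilon> b) \<one>\<^bsub>B\<^esub>)"
proof (intro iffI allI)
  fix b assume "\<forall>b. g b \<in> HKer A B f"
  then show "f (g b) = smul B (\<epsilon> b) \<one>\<^bsub>B\<^esub>" using HKer_eval coalg_mapD(2)[OF g] by metis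
next
  fix b assume *: "\<forall>b. f (g b) = smul B (\<epsilon> b) \<one>\<^bsub>B\<^esub>"
  note ms = vector_space_mult
  show "g b \<in> HKer A B f"
  proof (rule HKerI[OF coalg_mapD(1)[OF g]])
    fix \<phi> \<psi> assume \<phi>: "functional (smul A) \<phi>" and \<psi>: "functional (smul B) \<psi>"
    have "sweedler A (*) (g b) (\<lambda>u v. \<phi> u * \<psi> (f v)) = csum \<Delta> (*) b (\<lambda>u v. \<epsilon> v * (\<phi> (g u) * \<psi> \<one>\<^bsub>B\<^esub>))"
      unfolding A.sweedler_coalg_map[OF g ms bilinear_pullback[OF \<phi> \<psi>]]
      using * \<psi> by (intro csum_cong) (simp add: functional_def)
    also have "\<dots> = \<phi> (g b) * \<psi> \<one>\<^bsub>B\<^esub>"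
      by (rule cocomm_coalgebra.csum_counit(2)[OF C ms])
    finally show "sweedler A (*) (g b) (\<lambda>u v. \<phi> u * \<psi> (f v)) = \<phi> (g b) * \<psi> \<one>\<^bsub>B\<^esub>" .
  qed
qed

lemma HKer_subspace: "module.subspace (smul A) (HKer A B f)"
proof -
  interpret V: vector_space "smul A" by (rule A.vector_space_smul)
  note ms = vector_space_mult
  note lin = A.linear_on_sweedler[OF ms bilinear_pullback]
  have eq: "sweedler A (*) x (\<lambda>u v. \<phi> u * \<psi> (f v)) = \<phi> x * \<psi> \<one>\<^bsub>B\<^esub>"
    if "x \<in> HKer A B f" "functional (smul A) \<phi>" "functional (smul B) \<psi>" for x \<phi> \<psi>
    by (rule HKer_bilinear[OF that(1) ms functional_bilinear[OF that(2,3)]])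
  have HA: "x \<in> carrier A" if "x \<in> HKer A B f" for x using that by (simp add: HKer_def)
  have one: "\<one>\<^bsub>A\<^esub> \<in> HKer A B f"
    by (rule HKerI) (simp_all add: A.sweedler_one[OF ms bilinear_pullback] f_one)
  have scale: "smul A c x \<in> HKer A B f" if "x \<in> HKer A B f" for c x
    using lin HA[OF that] eq[OF that]
    by (intro HKerI) (auto simp: A.carrier_smul linear_on_def functional_def[of "smul A"])
  have add: "x + y \<in> HKer A B f" if "x \<in> HKer A B f" "y \<in> HKer A B f" for x y
    using lin HA[OF that(1)] HA[OF that(2)] eq[OF that(1)] eq[OF that(2)]
    by (intro HKerI) (auto simp: A.carrier_add linear_on_def functional_def[of "smul A"] algebra_simps)
  have "0 \<in> HKer A B f" using scale[OF one, of 0] by simp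
  with scale add show ?thesis by (simp add: V.subspace_def)
qed

lemma HKer_one: "\<one>\<^bsub>A\<^esub> \<in> HKer A B f"
  by (rule HKerI) (simp_all add: A.sweedler_one[OF vector_space_mult bilinear_pullback] f_one)

lemma HKer_mult:
  assumes x: "x \<in> HKer A B f" and y: "y \<in> HKer A B f"
  shows "x \<otimes>\<^bsub>A\<^esub> y \<in> HKer A B f"
proof -
  note ms = vector_space_mult
  have xA: "x \<in> carrier A" and yA: "y \<in> carrier A" using x y by (simp_all add: HKer_def)
  show ?thesis
  proof (rule HKerI)
    fix \<phi> \<psi> assume \<phi>: "functional (smul A) \<phi>" and \<psi>: "functional (smul B) \<psi>"
    note \<beta> = bilinear_onD[OF functional_bilinear[OF \<phi> \<psi>]]
    have 1: "bilinear_on A B (*) (\<lambda>u v. \<phi> (x' \<otimes>\<^bsub>A\<^esub> u) * \<psi> (f x'' \<otimes>\<^bsub>B\<^esub> v))"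
      and 2: "bilinear_on A B (*) (\<lambda>u v. \<phi> (u \<otimes>\<^bsub>A\<^esub> x') * \<psi> (v \<otimes>\<^bsub>B\<^esub> \<one>\<^bsub>B\<^esub>))"
      if "x' \<in> carrier A" "x'' \<in> carrier A" for x' x''
      using that \<beta> bilinear_onD[OF A.mult_bilinear] bilinear_onD[OF B.mult_bilinear] f_closed
      by (auto intro!: bilinear_onI simp: linear_on_def A.carrier_add A.carrier_smul B.carrier_add B.carrier_smul)
    have "sweedler A (*) (x \<otimes>\<^bsub>A\<^esub> y) (\<lambda>u v. \<phi> u * \<psi> (f v)) =
      sweedler A (*) x (\<lambda>x' x''. sweedler A (*) y (\<lambda>y' y''. \<phi> (x' \<otimes>\<^bsub>A\<^esub> y') * \<psi> (f x'' \<otimes>\<^bsub>B\<^esub> f y'')))"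
      unfolding A.sweedler_mult[OF xA yA ms bilinear_pullback[OF \<phi> \<psi>]]
      using xA yA by (intro A.sweedler_cong) (simp_all add: f_mult)
    also have "\<dots> = sweedler A (*) x (\<lambda>x' x''. \<phi> (x' \<otimes>\<^bsub>A\<^esub> y) * \<psi> (f x'' \<otimes>\<^bsub>B\<^esub> \<one>\<^bsub>B\<^esub>))"
      by (intro A.sweedler_cong[OF xA] HKer_bilinear[OF y ms 1])
    also have "\<dots> = \<phi> (x \<otimes>\<^bsub>A\<^esub> y) * \<psi> (\<one>\<^bsub>B\<^esub> \<otimes>\<^bsub>B\<^esub> \<one>\<^bsub>B\<^esub>)"
      using HKer_bilinear[OF x ms 2[OF yA yA]] .
    finally show "sweedler A (*) (x \<otimes>\<^bsub>A\<^esub> y) (\<lambda>u v. \<phi> u * \<psi> (f v)) = \<phi> (x \<otimes>\<^bsub>A\<^esub> y) * \<psi> \<one>\<^bsub>B\<^esub>"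
      by simp
  qed (use xA yA in simp)
qed

text \<open>
  In \<open>x' \<otimes> f x'' \<otimes> \<chi> x'''\<close> the last two factors may be exchanged by cocommutativity, after which the
  condition that \<open>x\<close> is in the kernel applies to the last factor.
\<close>

lemma HKer_stable:
  assumes x: "x \<in> HKer A B f" and \<chi>: "functional (smul A) \<chi>"
  shows "sweedler A (smul A) x (\<lambda>u v. smul A (\<chi> v) u) \<in> HKer A B f"
proof -
  note ms = vector_space_mult
  have xA: "x \<in> carrier A" using x by (simp add: HKer_def)
  let ?u = "sweedler A (smul A) x (\<lambda>u v. smul A (\<chi> v) u)"
  show ?thesis
  proof (rule HKerI)
    show "?u \<in> carrier A" using xA A.carrier_smul by (intro A.sweedler_closed A.subspace_of) auto
    fix \<phi> \<psi> assume \<phi>: "functional (smul A) \<phi>" and \<psi>: "functional (smul B) \<psi>"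
    let ?g = "\<lambda>y. sweedler A (*) y (\<lambda>p q. \<phi> p * \<chi> q)"
    let ?E = "\<lambda>y. sweedler A (*) y (\<lambda>u v. \<phi> u * \<psi> (f v))"
    have E: "linear_on A (*) ?E" by (rule A.linear_on_sweedler[OF ms bilinear_pullback[OF \<phi> \<psi>]])
    have g: "linear_on A (*) ?g" by (rule A.linear_on_sweedler[OF ms functional_bilinear[OF \<phi> \<chi>]])
    have \<phi>l: "linear_on A (*) \<phi>" using \<phi> by (simp add: functional_def linear_on_def)
    have tri: "linear_on A (*) (\<lambda>x. \<phi> x * \<psi> (f a) * \<chi> b)" "linear_on A (*) (\<lambda>x. \<phi> a * \<psi> (f x) * \<chi> b)"
      "linear_on A (*) (\<lambda>x. \<phi> a * \<psi> (f b) * \<chi> x)" "linear_on A (*) (\<lambda>x. \<phi> a * \<psi> (f x) * \<chi> b)"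
      for a b
      using \<phi> \<psi> \<chi> f_linear by (auto simp: functional_def linear_on_def algebra_simps)
    have "?E ?u = sweedler A (*) x (\<lambda>u v. ?E (smul A (\<chi> v) u))"
      using A.carrier_smul by (intro A.linear_on_of_sweedler[OF A.subspace_of ms E xA])
    also have "\<dots> = sweedler A (*) x (\<lambda>u v. sweedler A (*) u (\<lambda>p q. \<phi> p * \<psi> (f q) * \<chi> v))"
    proof (rule A.sweedler_cong[OF xA])
      fix u v assume "u \<in> carrier A"
      then have "?E (smul A (\<chi> v) u) = \<chi> v * ?E u" using E unfolding linear_on_def by blast
      then show "?E (smul A (\<chi> v) u) = sweedler A (*) u (\<lambda>p q. \<phi> p * \<psi> (f q) * \<chi> v)"
        by (simp only: sweedler_mult_const mult.commute[of "\<chi> v"])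
    qed
    also have "\<dots> = sweedler A (*) x (\<lambda>u w. sweedler A (*) w (\<lambda>p q. \<phi> u * \<psi> (f p) * \<chi> q))"
      by (rule A.sweedler_coassoc[OF xA ms tri(1,2,3)])
    also have "\<dots> = sweedler A (*) x (\<lambda>u w. sweedler A (*) w (\<lambda>p q. \<phi> u * \<psi> (f q) * \<chi> p))"
      using tri by (intro A.sweedler_cong[OF xA] A.sweedler_cocomm[OF _ ms] bilinear_onI) auto
    also have "\<dots> = sweedler A (*) x (\<lambda>w v. sweedler A (*) w (\<lambda>p q. \<phi> p * \<psi> (f v) * \<chi> q))"
      using tri by (intro A.sweedler_coassoc[OF xA ms, symmetric]) auto
    also have "\<dots> = sweedler A (*) x (\<lambda>w v. ?g w * \<psi> (f v))"
    proof (rule A.sweedler_cong[OF xA])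
      fix w v
      have "\<phi> p * \<psi> (f v) * \<chi> q = \<phi> p * \<chi> q * \<psi> (f v)" for p q by (simp add: mult_ac)
      then show "sweedler A (*) w (\<lambda>p q. \<phi> p * \<psi> (f v) * \<chi> q) = ?g w * \<psi> (f v)"
        by (simp only: sweedler_mult_const)
    qed
    also have "\<dots> = ?g x * \<psi> \<one>\<^bsub>B\<^esub>"
      using g \<psi> by (intro HKer_bilinear[OF x ms])
        (auto simp: bilinear_on_def linear_on_def functional_def algebra_simps)
    also have "?g x = sweedler A (*) x (\<lambda>u v. \<phi> (smul A (\<chi> v) u))"
      using \<phi> by (intro A.sweedler_cong[OF xA]) (simp add: functional_def mult.commute)
    also have "\<dots> = \<phi> ?u"
      using A.carrier_smul by (intro A.linear_on_of_sweedler[OF A.subspace_of ms \<phi>l xA, symmetric])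
    finally show "?E ?u = \<phi> ?u * \<psi> \<one>\<^bsub>B\<^esub>" .
  qed
qed

end

text \<open>For the values of the presenting point this is \<open>antipode_coalg_map\<close>; both sides are linear.\<close>

lemma (in cocommutative_hopf_algebra) sweedler_antipode:
  assumes x: "x \<in> carrier A" and s: "vector_space s" and \<beta>: "bilinear_on A A s \<beta>"
  shows "sweedler A s (antipode A x) \<beta> = sweedler A s x (\<lambda>u v. \<beta> (antipode A u) (antipode A v))"
proof -
  obtain \<Delta> :: "'a \<Rightarrow> _" and \<epsilon> g where g: "cocomm_coalgebra \<Delta> \<epsilon>" "coalg_map \<Delta> \<epsilon> A g"
    "\<forall>x\<in>carrier A. \<exists>p. x = lsum (smul A) p g" by (rule presentation)
  interpret CA: convolution \<Delta> \<epsilon> A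
    using g(1) cocommutative_hopf_algebra_axioms by (simp add: convolution_def)
  note gA = coalg_mapD(1)[OF g(2)]
  note S = antipode_linear antipode_closed
  have S2: "bilinear_on A A s (\<lambda>u v. \<beta> (antipode A u) (antipode A v))"
    using \<beta> S by (auto simp: bilinear_on_def linear_on_def)
  have l1: "linear_on A s (\<lambda>x. sweedler A s (antipode A x) \<beta>)"
    using linear_on_sweedler[OF s \<beta>] S by (auto simp: linear_on_def)
  obtain p where p: "x = lsum (smul A) p g" using g(3) x by blast
  have "sweedler A s (antipode A x) \<beta> = lsum s p (\<lambda>b. sweedler A s (antipode A (g b)) \<beta>)"
    unfolding p by (rule linear_on_lsum[OF subspace_of s l1 gA])
  also have "\<dots> = lsum s p (\<lambda>b. sweedler A s (g b) (\<lambda>u v. \<beta> (antipode A u) (antipode A v)))"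
    by (simp add: sweedler_coalg_map[OF CA.antipode_coalg_map[OF g(2)] s \<beta>] sweedler_coalg_map[OF g(2) s S2])
  also have "\<dots> = sweedler A s x (\<lambda>u v. \<beta> (antipode A u) (antipode A v))"
    unfolding p by (rule linear_on_lsum[OF subspace_of s linear_on_sweedler[OF s S2] gA, symmetric])
  finally show ?thesis .
qed

lemma (in cocommutative_hopf_algebra) antipode_one: "antipode A \<one> = \<one>"
proof -
  have S: "antipode A \<one> \<in> carrier A" by (simp add: antipode_closed)
  have "bilinear_on A A (smul A) (\<lambda>x y. antipode A x \<otimes> y)"
    using linear_antipode by (intro bilinear_onI linear_on_mult) (auto simp: linear_map_iff linear_on_def)
  from sweedler_one[OF vector_space_smul this] antipode_left[OF one_closed] S show ?thesis
    by (simp add: counit_one vector_space_scale[OF vector_space_smul])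
qed

context hopf_kernel begin

lemma HKer_antipode:
  assumes x: "x \<in> HKer A B f"
  shows "antipode A x \<in> HKer A B f"
proof -
  note ms = vector_space_mult
  have xA: "x \<in> carrier A" using x by (simp add: HKer_def)
  show ?thesis
  proof (rule HKerI)
    fix \<phi> \<psi> assume \<phi>: "functional (smul A) \<phi>" and \<psi>: "functional (smul B) \<psi>"
    have 1: "bilinear_on A B (*) (\<lambda>u v. \<phi> (antipode A u) * \<psi> (antipode B v))"
      using \<phi> \<psi> A.linear_antipode B.linear_antipode
      by (auto simp: bilinear_on_def linear_on_def functional_def linear_map_def algebra_simps)
    have "sweedler A (*) (antipode A x) (\<lambda>u v. \<phi> u * \<psi> (f v)) =
      sweedler A (*) x (\<lambda>u v. \<phi> (antipode A u) * \<psi> (antipode B (f v)))"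
      unfolding A.sweedler_antipode[OF xA ms bilinear_pullback[OF \<phi> \<psi>]]
      by (intro A.sweedler_cong[OF xA])
        (simp add: hopf_map_antipode[OF A.cocommutative_hopf_algebra_axioms B.cocommutative_hopf_algebra_axioms hopf_map])
    also have "\<dots> = \<phi> (antipode A x) * \<psi> (antipode B \<one>\<^bsub>B\<^esub>)"
      by (rule HKer_bilinear[OF x ms 1])
    finally show "sweedler A (*) (antipode A x) (\<lambda>u v. \<phi> u * \<psi> (f v)) = \<phi> (antipode A x) * \<psi> \<one>\<^bsub>B\<^esub>"
      by (simp add: B.antipode_one)
  qed (rule A.antipode_closed[OF xA])
qed

end

lemma sub_hopf_algebra_HKers:
  assumes "I \<noteq> {}" and H: "\<And>i. i \<in> I \<Longrightarrow> hopf_kernel A B (f i)"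
  shows "sub_hopf_algebra A (\<Inter>i\<in>I. HKer A B (f i))"
proof -
  obtain j where j: "j \<in> I" using assms(1) by blast
  interpret J: hopf_kernel A B "f j" by (rule H[OF j])
  interpret V: vector_space "smul A" by (rule J.A.vector_space_smul)
  show ?thesis
  proof
    show "(\<Inter>i\<in>I. HKer A B (f i)) \<subseteq> carrier A" using j by (auto simp: HKer_def)
    show "module.subspace (smul A) (\<Inter>i\<in>I. HKer A B (f i))"
      using hopf_kernel.HKer_subspace[OF H] by (intro V.subspace_Inter) auto
  qed (use hopf_kernel.HKer_one[OF H] hopf_kernel.HKer_mult[OF H] hopf_kernel.HKer_antipode[OF H]
      hopf_kernel.HKer_stable[OF H] in auto)
qed

section \<open>Multilinear expressions at generic points\<close>

lemma bilinear_map_iff: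
  "bilinear_map A B E \<beta> \<longleftrightarrow> (\<forall>x\<in>carrier A. \<forall>y\<in>carrier B. \<beta> x y \<in> carrier E) \<and> bilinear_on A B (smul E) \<beta>"
  by (auto simp: bilinear_map_def linear_map_iff bilinear_on_def)

lemma bilinear_mapD:
  assumes "bilinear_map A B E \<beta>"
  shows "x \<in> carrier A \<Longrightarrow> y \<in> carrier B \<Longrightarrow> \<beta> x y \<in> carrier E" "bilinear_on A B (smul E) \<beta>"
  using assms by (auto simp: bilinear_map_iff)

definition trilinear_on :: "('k::field, 'a::ab_group_add, 'm) bialgebra_scheme \<Rightarrow>
    ('k, 'b::ab_group_add, 'n) bialgebra_scheme \<Rightarrow> ('k, 'c::ab_group_add, 'o) bialgebra_scheme \<Rightarrow>
    ('k \<Rightarrow> 'v::ab_group_add \<Rightarrow> 'v) \<Rightarrow> ('a \<Rightarrow> 'b \<Rightarrow> 'c \<Rightarrow> 'v) \<Rightarrow> bool" where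
  "trilinear_on X Y Z s \<Phi> \<longleftrightarrow>
     (\<forall>y\<in>carrier Y. \<forall>z\<in>carrier Z. linear_on X s (\<lambda>x. \<Phi> x y z)) \<and>
     (\<forall>x\<in>carrier X. \<forall>z\<in>carrier Z. linear_on Y s (\<lambda>y. \<Phi> x y z)) \<and>
     (\<forall>x\<in>carrier X. \<forall>y\<in>carrier Y. linear_on Z s (\<lambda>z. \<Phi> x y z))"

lemma linear_on_diff:
  assumes "vector_space s" "linear_on A s f" "linear_on A s g"
  shows "linear_on A s (\<lambda>x. f x - g x)"
proof -
  interpret vector_space s by fact
  show ?thesis using assms by (auto simp: linear_on_def algebra_simps)
qed

lemma csum_diff:
  assumes "vector_space s"
  shows "csum \<Delta> s b (\<lambda>u v. f u v - g u v) = csum \<Delta> s b f - csum \<Delta> s b g"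
  using vector_space.lsum_body_diff[OF assms, of "\<Delta> b" "\<lambda>(u, v). f u v" "\<lambda>(u, v). g u v"]
  by (simp add: csum_def case_prod_unfold)

text \<open>The case \<open>W = {0}\<close> for the difference of two multilinear maps.\<close>

lemma generic_points2_eq:
  fixes A :: "('k::field, 'a::ab_group_add, 'm) hopf_scheme"
    and B :: "('k, 'b::ab_group_add, 'n) hopf_scheme"
  assumes A: "cocommutative_hopf_algebra A" and B: "cocommutative_hopf_algebra B" and s: "vector_space s"
    and \<Phi>: "bilinear_on A B s \<Phi>" and \<Psi>: "bilinear_on A B s \<Psi>"
    and *: "\<And>(\<Delta> :: 'a \<times> 'b \<Rightarrow> _) \<epsilon> f g c. cocomm_coalgebra \<Delta> \<epsilon> \<Longrightarrow> coalg_map \<Delta> \<epsilon> A f \<Longrightarrow>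
      coalg_map \<Delta> \<epsilon> B g \<Longrightarrow> csum \<Delta> s c (\<lambda>u v. \<Phi> (f u) (g v)) = csum \<Delta> s c (\<lambda>u v. \<Psi> (f u) (g v))"
    and x: "x \<in> carrier A" and y: "y \<in> carrier B"
  shows "\<Phi> x y = \<Psi> x y"
proof -
  interpret s: vector_space s by fact
  have "\<Phi> x y - \<Psi> x y \<in> {0}"
  proof (rule generic_points2[OF A B s s.subspace_single_0 _ _ x y])
    show "bilinear_on A B s (\<lambda>x y. \<Phi> x y - \<Psi> x y)"
      using \<Phi> \<Psi> unfolding bilinear_on_def by (auto intro: linear_on_diff[OF s])
  qed (simp add: csum_diff[OF s] *)
  then show ?thesis by simp
qed

lemma generic_points3_eq:
  fixes A :: "('k::field, 'a::ab_group_add, 'm) hopf_scheme"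
    and B :: "('k, 'b::ab_group_add, 'n) hopf_scheme"
    and D :: "('k, 'c::ab_group_add, 'o) hopf_scheme"
  assumes A: "cocommutative_hopf_algebra A" and B: "cocommutative_hopf_algebra B"
    and D: "cocommutative_hopf_algebra D" and s: "vector_space s"
    and \<Phi>: "trilinear_on A B D s \<Phi>" and \<Psi>: "trilinear_on A B D s \<Psi>"
    and *: "\<And>(\<Delta> :: 'a \<times> 'b \<times> 'c \<Rightarrow> _) \<epsilon> f g h c. cocomm_coalgebra \<Delta> \<epsilon> \<Longrightarrow> coalg_map \<Delta> \<epsilon> A f \<Longrightarrow>
      coalg_map \<Delta> \<epsilon> B g \<Longrightarrow> coalg_map \<Delta> \<epsilon> D h \<Longrightarrow>
      csum \<Delta> s c (\<lambda>u w. csum \<Delta> s w (\<lambda>v t. \<Phi> (f u) (g v) (h t))) =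
      csum \<Delta> s c (\<lambda>u w. csum \<Delta> s w (\<lambda>v t. \<Psi> (f u) (g v) (h t)))"
    and x: "x \<in> carrier A" and y: "y \<in> carrier B" and z: "z \<in> carrier D"
  shows "\<Phi> x y z = \<Psi> x y z"
proof -
  interpret s: vector_space s by fact
  have "\<Phi> x y z - \<Psi> x y z \<in> {0}"
    by (rule generic_points3[where \<Phi> = "\<lambda>x y z. \<Phi> x y z - \<Psi> x y z", OF A B D s s.subspace_single_0 _ _ _ _ x y z])
      (use \<Phi> \<Psi> in \<open>auto simp: trilinear_on_def csum_diff[OF s] * intro!: linear_on_diff[OF s]\<close>)
  then show ?thesis by simp
qed

lemma trilinear_comp:
  assumes "bilinear_map X Y E \<alpha>" "bilinear_on E Z s \<beta>"
  shows "trilinear_on X Y Z s (\<lambda>x y z. \<beta> (\<alpha> x y) z)"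
  using assms by (auto simp: trilinear_on_def bilinear_map_iff bilinear_on_def linear_on_def)

lemma trilinear_comp':
  assumes "bilinear_map Y Z E \<alpha>" "bilinear_on X E s \<beta>"
  shows "trilinear_on X Y Z s (\<lambda>x y z. \<beta> x (\<alpha> y z))"
  using assms by (auto simp: trilinear_on_def bilinear_map_iff bilinear_on_def linear_on_def)

text \<open>
  A bilinear operation applied to two points over the same coalgebra, as the multiplication is in
  convolution.
\<close>

definition lift2 :: "('b \<Rightarrow> ('b \<times> 'b \<Rightarrow>\<^sub>0 'k::field)) \<Rightarrow> ('k \<Rightarrow> 'e::ab_group_add \<Rightarrow> 'e) \<Rightarrow> ('x \<Rightarrow> 'y \<Rightarrow> 'e) \<Rightarrow>
    ('b \<Rightarrow> 'x) \<Rightarrow> ('b \<Rightarrow> 'y) \<Rightarrow> 'b \<Rightarrow> 'e" where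
  "lift2 \<Delta> s \<beta> f g = (\<lambda>c. csum \<Delta> s c (\<lambda>u v. \<beta> (f u) (g v)))"

lemma lift2_closed:
  assumes "subspace_of E" "bilinear_map X Y E \<beta>" "\<And>b. f b \<in> carrier X" "\<And>b. g b \<in> carrier Y"
  shows "lift2 \<Delta> (smul E) \<beta> f g c \<in> carrier E"
  unfolding lift2_def using assms by (intro csum_closed) (auto simp: bilinear_map_iff)

context cocomm_coalgebra begin

lemma csum3_comp:
  assumes X: "\<And>b. f b \<in> carrier X" and Y: "\<And>b. g b \<in> carrier Y" and Z: "\<And>b. h b \<in> carrier Z"
    and E: "subspace_of E" "subspace_of Z" and s: "vector_space s"
    and \<alpha>: "bilinear_map X Y E \<alpha>" and \<beta>: "bilinear_on E Z s \<beta>"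
  shows "csum \<Delta> s c (\<lambda>u w. csum \<Delta> s w (\<lambda>v t. \<beta> (\<alpha> (f u) (g v)) (h t))) =
    lift2 \<Delta> s \<beta> (lift2 \<Delta> (smul E) \<alpha> f g) h c"
proof -
  have "csum \<Delta> s c (\<lambda>u w. csum \<Delta> s w (\<lambda>v t. \<beta> (\<alpha> (f u) (g v)) (h t))) =
      csum \<Delta> s c (\<lambda>w t. csum \<Delta> s w (\<lambda>u v. \<beta> (\<alpha> (f u) (g v)) (h t)))"
    by (rule csum_coassoc[OF s, symmetric])
  then show ?thesis
    using X Y Z by (simp add: lift2_def csum_bilinear(1)[OF E s \<beta>] bilinear_mapD(1)[OF \<alpha>])
qed

lemma csum3_comp':
  assumes X: "\<And>b. f b \<in> carrier X" and Y: "\<And>b. g b \<in> carrier Y" and Z: "\<And>b. h b \<in> carrier Z"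
    and E: "subspace_of X" "subspace_of E" and s: "vector_space s"
    and \<alpha>: "bilinear_map Y Z E \<alpha>" and \<beta>: "bilinear_on X E s \<beta>"
  shows "csum \<Delta> s c (\<lambda>u w. csum \<Delta> s w (\<lambda>v t. \<beta> (f u) (\<alpha> (g v) (h t)))) =
    lift2 \<Delta> s \<beta> f (lift2 \<Delta> (smul E) \<alpha> g h) c"
  using X Y Z by (simp add: lift2_def csum_bilinear(2)[OF E s \<beta>] bilinear_mapD(1)[OF \<alpha>])

end

text \<open>
  Several axioms split two or all three of their arguments and multiply two multilinear expressions in
  the parts.  Such expressions are convolution products of multilinear maps.
\<close>

definition conv2 :: "('k::field, 'a::ab_group_add, 'm) bialgebra_scheme \<Rightarrow>
    ('k, 'b::ab_group_add, 'n) bialgebra_scheme \<Rightarrow> ('k \<Rightarrow> 'v::ab_group_add \<Rightarrow> 'v) \<Rightarrow> ('e \<Rightarrow> 'f \<Rightarrow> 'v) \<Rightarrow>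
    ('a \<Rightarrow> 'b \<Rightarrow> 'e) \<Rightarrow> ('a \<Rightarrow> 'b \<Rightarrow> 'f) \<Rightarrow> 'a \<Rightarrow> 'b \<Rightarrow> 'v" where
  "conv2 X Y s \<mu> P Q x y = sweedler X s x (\<lambda>x' x''. sweedler Y s y (\<lambda>y' y''. \<mu> (P x' y') (Q x'' y'')))"

definition conv3 :: "('k::field, 'a::ab_group_add, 'm) bialgebra_scheme \<Rightarrow>
    ('k, 'b::ab_group_add, 'n) bialgebra_scheme \<Rightarrow> ('k, 'c::ab_group_add, 'o) bialgebra_scheme \<Rightarrow>
    ('k \<Rightarrow> 'v::ab_group_add \<Rightarrow> 'v) \<Rightarrow> ('e \<Rightarrow> 'f \<Rightarrow> 'v) \<Rightarrow>
    ('a \<Rightarrow> 'b \<Rightarrow> 'c \<Rightarrow> 'e) \<Rightarrow> ('a \<Rightarrow> 'b \<Rightarrow> 'c \<Rightarrow> 'f) \<Rightarrow> 'a \<Rightarrow> 'b \<Rightarrow> 'c \<Rightarrow> 'v" where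
  "conv3 X Y Z s \<mu> P Q x y z = sweedler X s x (\<lambda>x' x''. conv2 Y Z s \<mu> (P x') (Q x'') y z)"

lemma conv2_bilinear:
  assumes X: "bialgebra X" and Y: "bialgebra Y" and s: "vector_space s" and \<mu>: "bilinear_on E F s \<mu>"
    and P: "bilinear_map X Y E P" and Q: "bilinear_map X Y F Q"
  shows "bilinear_on X Y s (conv2 X Y s \<mu> P Q)"
proof -
  interpret X: bialgebra X by fact
  interpret Y: bialgebra Y by fact
  have lP: "linear_on X s (\<lambda>x'. \<mu> (P x' y') q)" "linear_on Y s (\<lambda>y'. \<mu> (P x y') q)"
    if "x \<in> carrier X" "y' \<in> carrier Y" "q \<in> carrier F" for x y' q
    using \<mu> P that by (auto simp: bilinear_map_iff bilinear_on_def linear_on_def)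
  have lQ: "linear_on X s (\<lambda>x'. \<mu> q (Q x' y'))" "linear_on Y s (\<lambda>y'. \<mu> q (Q x y'))"
    if "x \<in> carrier X" "y' \<in> carrier Y" "q \<in> carrier E" for x y' q
    using \<mu> Q that by (auto simp: bilinear_map_iff bilinear_on_def linear_on_def)
  note Pc = bilinear_mapD(1)[OF P] and Qc = bilinear_mapD(1)[OF Q]
  show ?thesis
    unfolding conv2_def
  proof (rule bilinear_onI)
    fix y assume y: "y \<in> carrier Y"
    show "linear_on X s (\<lambda>x. sweedler X s x (\<lambda>x' x''. sweedler Y s y (\<lambda>y' y''. \<mu> (P x' y') (Q x'' y''))))"
      by (intro X.linear_on_sweedler[OF s] bilinear_onI Y.linear_on_sweedler_body[OF s y]) (auto intro: lP(1) lQ(1) Pc Qc)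
  next
    fix x assume x: "x \<in> carrier X"
    show "linear_on Y s (\<lambda>y. sweedler X s x (\<lambda>x' x''. sweedler Y s y (\<lambda>y' y''. \<mu> (P x' y') (Q x'' y''))))"
      by (intro X.linear_on_sweedler_body[OF s x] Y.linear_on_sweedler[OF s] bilinear_onI) (auto intro: lP(2) lQ(2) Pc Qc)
  qed
qed

text \<open>
  At points, the coproducts of both arguments become coproducts in the coalgebra; exchanging the
  middle two of the four factors puts the factors of \<open>P\<close> together, and those of \<open>Q\<close>.
\<close>

lemma csum_conv2:
  assumes C: "cocomm_coalgebra \<Delta> \<epsilon>" and X: "bialgebra X" and Y: "bialgebra Y" and s: "vector_space s"
    and E: "subspace_of E" "subspace_of F" and \<mu>: "bilinear_on E F s \<mu>"
    and P: "bilinear_map X Y E P" and Q: "bilinear_map X Y F Q"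
    and f: "coalg_map \<Delta> \<epsilon> X f" and g: "coalg_map \<Delta> \<epsilon> Y g"
  shows "csum \<Delta> s c (\<lambda>u v. conv2 X Y s \<mu> P Q (f u) (g v)) =
    csum \<Delta> s c (\<lambda>u v. \<mu> (lift2 \<Delta> (smul E) P f g u) (lift2 \<Delta> (smul F) Q f g v))"
proof -
  interpret C: cocomm_coalgebra \<Delta> \<epsilon> by fact
  interpret X: bialgebra X by fact
  interpret Y: bialgebra Y by fact
  note fX = coalg_mapD(1)[OF f] and gY = coalg_mapD(1)[OF g]
  note Pc = bilinear_mapD(1)[OF P] and Qc = bilinear_mapD(1)[OF Q]
  note \<mu>D = bilinear_onD[OF \<mu>] and PD = bilinear_onD[OF bilinear_mapD(2)[OF P]]
    and QD = bilinear_onD[OF bilinear_mapD(2)[OF Q]]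
  have "conv2 X Y s \<mu> P Q (f u) (g v) = csum \<Delta> s u (\<lambda>p q. csum \<Delta> s v (\<lambda>r t. \<mu> (P (f p) (g r)) (Q (f q) (g t))))" for u v
  proof -
    have "conv2 X Y s \<mu> P Q (f u) (g v) =
        csum \<Delta> s u (\<lambda>p q. sweedler Y s (g v) (\<lambda>y' y''. \<mu> (P (f p) y') (Q (f q) y'')))"
      unfolding conv2_def
      by (intro X.sweedler_coalg_map[OF f s] bilinear_onI Y.linear_on_sweedler_body[OF s gY])
        (auto simp: linear_on_def \<mu>D PD QD Pc Qc)
    also have "\<dots> = csum \<Delta> s u (\<lambda>p q. csum \<Delta> s v (\<lambda>r t. \<mu> (P (f p) (g r)) (Q (f q) (g t))))"
      by (intro csum_cong Y.sweedler_coalg_map[OF g s] bilinear_onI)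
        (auto simp: linear_on_def \<mu>D PD QD Pc Qc fX)
    finally show ?thesis .
  qed
  then have "csum \<Delta> s c (\<lambda>u v. conv2 X Y s \<mu> P Q (f u) (g v)) =
    csum \<Delta> s c (\<lambda>u v. csum \<Delta> s u (\<lambda>p q. csum \<Delta> s v (\<lambda>r t. \<mu> (P (f p) (g q)) (Q (f r) (g t)))))"
    by (simp add: C.csum_middle_swap[OF s, of _ "\<lambda>p q r t. \<mu> (P (f p) (g q)) (Q (f r) (g t))"])
  also have "\<dots> = csum \<Delta> s c (\<lambda>u v. \<mu> (lift2 \<Delta> (smul E) P f g u) (lift2 \<Delta> (smul F) Q f g v))"
  proof (rule csum_cong)
    fix u v
    have "\<mu> (lift2 \<Delta> (smul E) P f g u) (lift2 \<Delta> (smul F) Q f g v) =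
        csum \<Delta> s u (\<lambda>p q. \<mu> (P (f p) (g q)) (lift2 \<Delta> (smul F) Q f g v))"
      using lift2_closed[OF E(2) Q fX gY] Pc fX gY
      by (subst lift2_def) (intro csum_bilinear(1)[OF E s \<mu>], auto)
    also have "\<dots> = csum \<Delta> s u (\<lambda>p q. csum \<Delta> s v (\<lambda>r t. \<mu> (P (f p) (g q)) (Q (f r) (g t))))"
      unfolding lift2_def using Pc Qc fX gY by (intro csum_cong csum_bilinear(2)[OF E s \<mu>]) auto
    finally show "csum \<Delta> s u (\<lambda>p q. csum \<Delta> s v (\<lambda>r t. \<mu> (P (f p) (g q)) (Q (f r) (g t)))) =
      \<mu> (lift2 \<Delta> (smul E) P f g u) (lift2 \<Delta> (smul F) Q f g v)" by simp
  qed
  finally show ?thesis .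
qed

lemma conv3_trilinear:
  assumes X: "bialgebra X" and Y: "bialgebra Y" and Z: "bialgebra Z" and s: "vector_space s"
    and \<mu>: "bilinear_on E F s \<mu>"
    and P: "trilinear_on X Y Z (smul E) P" "\<And>x y z. x \<in> carrier X \<Longrightarrow> y \<in> carrier Y \<Longrightarrow> z \<in> carrier Z \<Longrightarrow> P x y z \<in> carrier E"
    and Q: "trilinear_on X Y Z (smul F) Q" "\<And>x y z. x \<in> carrier X \<Longrightarrow> y \<in> carrier Y \<Longrightarrow> z \<in> carrier Z \<Longrightarrow> Q x y z \<in> carrier F"
  shows "trilinear_on X Y Z s (conv3 X Y Z s \<mu> P Q)"
proof -
  interpret X: bialgebra X by fact
  interpret Y: bialgebra Y by fact
  interpret Z: bialgebra Z by fact
  have PB: "bilinear_map Y Z E (P x)" and QB: "bilinear_map Y Z F (Q x)" if "x \<in> carrier X" for x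
    using P Q that by (auto simp: bilinear_map_iff bilinear_on_def trilinear_on_def)
  have c2: "bilinear_on Y Z s (conv2 Y Z s \<mu> (P x') (Q x''))" if "x' \<in> carrier X" "x'' \<in> carrier X" for x' x''
    by (rule conv2_bilinear[OF Y Z s \<mu> PB[OF that(1)] QB[OF that(2)]])
  have x: "bilinear_on X X s (\<lambda>x' x''. conv2 Y Z s \<mu> (P x') (Q x'') y z)" if "y \<in> carrier Y" "z \<in> carrier Z" for y z
    unfolding conv2_def using that P Q \<mu>
    by (intro bilinear_onI Y.linear_on_sweedler_body[OF s that(1)] Z.linear_on_sweedler_body[OF s that(2)])
      (auto simp: trilinear_on_def bilinear_on_def linear_on_def)
  show ?thesis
    unfolding trilinear_on_def conv3_def
    using c2 X.linear_on_sweedler[OF s x] unfolding bilinear_on_def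
    by (auto intro!: X.linear_on_sweedler_body[OF s])
qed

text \<open>The sum over the last two arguments is \<open>csum_conv2\<close>, with the first argument as a parameter.\<close>

lemma csum_conv3:
  assumes C: "cocomm_coalgebra \<Delta> \<epsilon>" and X: "bialgebra X" and Y: "bialgebra Y" and Z: "bialgebra Z"
    and s: "vector_space s" and E: "subspace_of E" "subspace_of F" and \<mu>: "bilinear_on E F s \<mu>"
    and P: "trilinear_on X Y Z (smul E) P" "\<And>x y z. x \<in> carrier X \<Longrightarrow> y \<in> carrier Y \<Longrightarrow> z \<in> carrier Z \<Longrightarrow> P x y z \<in> carrier E"
    and Q: "trilinear_on X Y Z (smul F) Q" "\<And>x y z. x \<in> carrier X \<Longrightarrow> y \<in> carrier Y \<Longrightarrow> z \<in> carrier Z \<Longrightarrow> Q x y z \<in> carrier F"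
    and f: "coalg_map \<Delta> \<epsilon> X f" and g: "coalg_map \<Delta> \<epsilon> Y g" and h: "coalg_map \<Delta> \<epsilon> Z h"
  shows "csum \<Delta> s c (\<lambda>u w. csum \<Delta> s w (\<lambda>v t. conv3 X Y Z s \<mu> P Q (f u) (g v) (h t))) =
    csum \<Delta> s c (\<lambda>u v. \<mu> (csum \<Delta> (smul E) u (\<lambda>p w. csum \<Delta> (smul E) w (\<lambda>q r. P (f p) (g q) (h r))))
      (csum \<Delta> (smul F) v (\<lambda>p w. csum \<Delta> (smul F) w (\<lambda>q r. Q (f p) (g q) (h r)))))"
proof -
  interpret C: cocomm_coalgebra \<Delta> \<epsilon> by fact
  interpret X: bialgebra X by fact
  interpret Y: bialgebra Y by fact
  interpret Z: bialgebra Z by fact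
  note fX = coalg_mapD(1)[OF f] and gY = coalg_mapD(1)[OF g] and hZ = coalg_mapD(1)[OF h]
  have PB: "bilinear_map Y Z E (P x)" and QB: "bilinear_map Y Z F (Q x)" if "x \<in> carrier X" for x
    using P Q that by (auto simp: bilinear_map_iff bilinear_on_def trilinear_on_def)
  have x: "bilinear_on X X s (\<lambda>x' x''. conv2 Y Z s \<mu> (P x') (Q x'') y z)" if "y \<in> carrier Y" "z \<in> carrier Z" for y z
    unfolding conv2_def using that P Q \<mu>
    by (intro bilinear_onI Y.linear_on_sweedler_body[OF s that(1)] Z.linear_on_sweedler_body[OF s that(2)])
      (auto simp: trilinear_on_def bilinear_on_def linear_on_def)
  let ?F = "\<lambda>p q w1 w2. \<mu> (lift2 \<Delta> (smul E) (P (f p)) g h w1) (lift2 \<Delta> (smul F) (Q (f q)) g h w2)"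
  have "csum \<Delta> s w (\<lambda>v t. conv3 X Y Z s \<mu> P Q (f u) (g v) (h t)) =
      csum \<Delta> s u (\<lambda>p q. csum \<Delta> s w (\<lambda>w1 w2. ?F p q w1 w2))" for u w
  proof -
    have "csum \<Delta> s w (\<lambda>v t. conv3 X Y Z s \<mu> P Q (f u) (g v) (h t)) =
      csum \<Delta> s w (\<lambda>v t. csum \<Delta> s u (\<lambda>p q. conv2 Y Z s \<mu> (P (f p)) (Q (f q)) (g v) (h t)))"
      unfolding conv3_def by (intro csum_cong X.sweedler_coalg_map[OF f s x] gY hZ)
    also have "\<dots> = csum \<Delta> s u (\<lambda>p q. csum \<Delta> s w (\<lambda>v t. conv2 Y Z s \<mu> (P (f p)) (Q (f q)) (g v) (h t)))"
      by (rule csum_swap[OF s])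
    also have "\<dots> = csum \<Delta> s u (\<lambda>p q. csum \<Delta> s w (\<lambda>w1 w2. ?F p q w1 w2))"
      by (intro csum_cong csum_conv2[OF C Y Z s E \<mu> PB[OF fX] QB[OF fX] g h])
    finally show ?thesis .
  qed
  then have "csum \<Delta> s c (\<lambda>u w. csum \<Delta> s w (\<lambda>v t. conv3 X Y Z s \<mu> P Q (f u) (g v) (h t))) =
      csum \<Delta> s c (\<lambda>u v. csum \<Delta> s u (\<lambda>p w1. csum \<Delta> s v (\<lambda>q w2. ?F p q w1 w2)))"
    by (simp add: C.csum_middle_swap[OF s, of _ "\<lambda>p w1 q w2. ?F p q w1 w2"])
  also have "\<dots> = csum \<Delta> s c (\<lambda>u v. \<mu> (csum \<Delta> (smul E) u (\<lambda>p w. lift2 \<Delta> (smul E) (P (f p)) g h w))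
      (csum \<Delta> (smul F) v (\<lambda>p w. lift2 \<Delta> (smul F) (Q (f p)) g h w)))"
  proof (rule csum_cong)
    fix u v
    have L: "lift2 \<Delta> (smul E) (P (f p)) g h w \<in> carrier E" "lift2 \<Delta> (smul F) (Q (f p)) g h w \<in> carrier F" for p w
      by (rule lift2_closed[OF E(1) PB[OF fX] gY hZ] lift2_closed[OF E(2) QB[OF fX] gY hZ])+
    have "\<mu> (csum \<Delta> (smul E) u (\<lambda>p w. lift2 \<Delta> (smul E) (P (f p)) g h w))
        (csum \<Delta> (smul F) v (\<lambda>p w. lift2 \<Delta> (smul F) (Q (f p)) g h w)) =
      csum \<Delta> s u (\<lambda>p w1. \<mu> (lift2 \<Delta> (smul E) (P (f p)) g h w1)
        (csum \<Delta> (smul F) v (\<lambda>p w. lift2 \<Delta> (smul F) (Q (f p)) g h w)))"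
      using L by (intro csum_bilinear(1)[OF E s \<mu>] csum_closed[OF E(2)])
    also have "\<dots> = csum \<Delta> s u (\<lambda>p w1. csum \<Delta> s v (\<lambda>q w2. ?F p q w1 w2))"
      using L by (intro csum_cong csum_bilinear(2)[OF E s \<mu>])
    finally show "csum \<Delta> s u (\<lambda>p w1. csum \<Delta> s v (\<lambda>q w2. ?F p q w1 w2)) =
      \<mu> (csum \<Delta> (smul E) u (\<lambda>p w. lift2 \<Delta> (smul E) (P (f p)) g h w))
        (csum \<Delta> (smul F) v (\<lambda>p w. lift2 \<Delta> (smul F) (Q (f p)) g h w))" by simp
  qed
  finally show ?thesis by (simp add: lift2_def)
qed

lemma bilinear_map_compose:
  assumes "bilinear_map X Y E \<beta>" "linear_map X' X f" "linear_map Y' Y g"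
  shows "bilinear_map X' Y' E (\<lambda>x y. \<beta> (f x) (g y))"
  using assms by (auto simp: bilinear_map_iff bilinear_on_def linear_on_def linear_map_iff Pi_iff)

lemma linear_map_id: "linear_map X X (\<lambda>x. x)"
  by (simp add: linear_map_def)

lemma linear_map_comp: "linear_map X Y f \<Longrightarrow> linear_map Y Z g \<Longrightarrow> linear_map X Z (\<lambda>x. g (f x))"
  by (auto simp: linear_map_def Pi_iff)

lemma linear_map_bilinear:
  assumes "linear_map E F f" "bilinear_map X Y E \<beta>"
  shows "bilinear_map X Y F (\<lambda>x y. f (\<beta> x y))"
  using assms by (auto simp: bilinear_map_iff bilinear_on_def linear_on_def linear_map_iff Pi_iff)

lemma bilinear_map_flip: "bilinear_map X Y E \<beta> \<Longrightarrow> bilinear_map Y X E (\<lambda>x y. \<beta> y x)"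
  by (auto simp: bilinear_map_def)

lemma hopf_map_linear: "hopf_map A B f \<Longrightarrow> linear_map A B f"
  by (simp add: hopf_map_def)

lemma (in bialgebra) mult_bilinear_map: "bilinear_map A A A (mult A)"
  by (simp add: bilinear_map_iff mult_bilinear)

lemma (in cocommutative_hopf_algebra) ad_bilinear: "bilinear_map A A A (ad A)"
proof -
  note V = vector_space_smul
  have "linear_on A (smul A) (\<lambda>y. u \<otimes> y \<otimes> antipode A v)" if "u \<in> carrier A" "v \<in> carrier A" for u v
    using that antipode_closed bilinear_onD[OF mult_bilinear] by (auto simp: linear_on_def)
  then have "bilinear_on A A (smul A) (ad A)"
    unfolding ad_def
    by (intro bilinear_onI linear_on_sweedler[OF V ad_bilinear_body] linear_on_sweedler_body[OF V])
  moreover have "ad A x y \<in> carrier A" if "x \<in> carrier A" "y \<in> carrier A" for x y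
    unfolding ad_def using that antipode_closed by (intro sweedler_closed subspace_of) simp_all
  ultimately show ?thesis by (simp add: bilinear_map_iff)
qed

text \<open>The analogues of \<open>csum_conv2\<close> for expressions in which only one argument is split by the coproduct.\<close>

lemma split_first:
  assumes C: "cocomm_coalgebra \<Delta> \<epsilon>" and X: "bialgebra X" and s: "vector_space s"
    and E: "subspace_of E" "subspace_of F" and \<beta>: "bilinear_on E F s \<beta>"
    and \<alpha>: "bilinear_map X Y E \<alpha>" and \<alpha>': "bilinear_map X Z F \<alpha>'"
    and f: "coalg_map \<Delta> \<epsilon> X f" and g: "\<And>b. g b \<in> carrier Y" and h: "\<And>b. h b \<in> carrier Z"
  shows "csum \<Delta> s c (\<lambda>u w. csum \<Delta> s w (\<lambda>v t. sweedler X s (f u) (\<lambda>x' x''. \<beta> (\<alpha> x' (g v)) (\<alpha>' x'' (h t))))) =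
    lift2 \<Delta> s \<beta> (lift2 \<Delta> (smul E) \<alpha> f g) (lift2 \<Delta> (smul F) \<alpha>' f h) c"
proof -
  interpret C: cocomm_coalgebra \<Delta> \<epsilon> by fact
  interpret X: bialgebra X by fact
  note fX = coalg_mapD(1)[OF f]
  note \<alpha>c = bilinear_mapD(1)[OF \<alpha>] and \<alpha>c' = bilinear_mapD(1)[OF \<alpha>']
  note D = bilinear_onD[OF \<beta>] bilinear_onD[OF bilinear_mapD(2)[OF \<alpha>]] bilinear_onD[OF bilinear_mapD(2)[OF \<alpha>']]
  have "sweedler X s (f u) (\<lambda>x' x''. \<beta> (\<alpha> x' (g v)) (\<alpha>' x'' (h t))) =
      csum \<Delta> s u (\<lambda>p q. \<beta> (\<alpha> (f p) (g v)) (\<alpha>' (f q) (h t)))" for u v t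
    using g h by (intro X.sweedler_coalg_map[OF f s] bilinear_onI) (auto simp: linear_on_def D \<alpha>c \<alpha>c')
  then have "csum \<Delta> s c (\<lambda>u w. csum \<Delta> s w (\<lambda>v t. sweedler X s (f u) (\<lambda>x' x''. \<beta> (\<alpha> x' (g v)) (\<alpha>' x'' (h t))))) =
      csum \<Delta> s c (\<lambda>u w. csum \<Delta> s w (\<lambda>v t. csum \<Delta> s u (\<lambda>p q. \<beta> (\<alpha> (f p) (g v)) (\<alpha>' (f q) (h t)))))"
    by simp
  also have "\<dots> = csum \<Delta> s c (\<lambda>u w. csum \<Delta> s u (\<lambda>p q. csum \<Delta> s w (\<lambda>v t. \<beta> (\<alpha> (f p) (g v)) (\<alpha>' (f q) (h t)))))"
    by (rule csum_cong, rule csum_swap[OF s])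
  also have "\<dots> = csum \<Delta> s c (\<lambda>u w. csum \<Delta> s u (\<lambda>p q. csum \<Delta> s w (\<lambda>v t. \<beta> (\<alpha> (f p) (g q)) (\<alpha>' (f v) (h t)))))"
    by (rule C.csum_middle_swap[OF s])
  also have "\<dots> = csum \<Delta> s c (\<lambda>u w. \<beta> (lift2 \<Delta> (smul E) \<alpha> f g u) (lift2 \<Delta> (smul F) \<alpha>' f h w))"
  proof (rule csum_cong)
    fix u w
    have "\<beta> (lift2 \<Delta> (smul E) \<alpha> f g u) (lift2 \<Delta> (smul F) \<alpha>' f h w) =
        csum \<Delta> s u (\<lambda>p q. \<beta> (\<alpha> (f p) (g q)) (lift2 \<Delta> (smul F) \<alpha>' f h w))"
      using lift2_closed[OF E(2) \<alpha>' fX h] \<alpha>c fX g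
      by (subst lift2_def) (intro csum_bilinear(1)[OF E s \<beta>], auto)
    also have "\<dots> = csum \<Delta> s u (\<lambda>p q. csum \<Delta> s w (\<lambda>v t. \<beta> (\<alpha> (f p) (g q)) (\<alpha>' (f v) (h t))))"
      unfolding lift2_def using \<alpha>c \<alpha>c' fX g h by (intro csum_cong csum_bilinear(2)[OF E s \<beta>]) auto
    finally show "csum \<Delta> s u (\<lambda>p q. csum \<Delta> s w (\<lambda>v t. \<beta> (\<alpha> (f p) (g q)) (\<alpha>' (f v) (h t)))) =
      \<beta> (lift2 \<Delta> (smul E) \<alpha> f g u) (lift2 \<Delta> (smul F) \<alpha>' f h w)" by simp
  qed
  finally show ?thesis by (simp add: lift2_def)
qed

lemma split_first_trilinear:
  assumes X: "bialgebra X" and s: "vector_space s" and \<beta>: "bilinear_on E F s \<beta>"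
    and \<alpha>: "bilinear_map X Y E \<alpha>" and \<alpha>': "bilinear_map X Z F \<alpha>'"
  shows "trilinear_on X Y Z s (\<lambda>x y z. sweedler X s x (\<lambda>x' x''. \<beta> (\<alpha> x' y) (\<alpha>' x'' z)))"
proof -
  interpret X: bialgebra X by fact
  note \<alpha>c = bilinear_mapD(1)[OF \<alpha>] and \<alpha>c' = bilinear_mapD(1)[OF \<alpha>']
  note D = bilinear_onD[OF \<beta>] bilinear_onD[OF bilinear_mapD(2)[OF \<alpha>]] bilinear_onD[OF bilinear_mapD(2)[OF \<alpha>']]
  show ?thesis
    unfolding trilinear_on_def
  proof (intro conjI ballI)
    fix y z assume "y \<in> carrier Y" "z \<in> carrier Z"
    then show "linear_on X s (\<lambda>x. sweedler X s x (\<lambda>x' x''. \<beta> (\<alpha> x' y) (\<alpha>' x'' z)))"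
      by (intro X.linear_on_sweedler[OF s] bilinear_onI) (auto simp: linear_on_def D \<alpha>c \<alpha>c')
  next
    fix x z assume "x \<in> carrier X" "z \<in> carrier Z"
    then show "linear_on Y s (\<lambda>y. sweedler X s x (\<lambda>x' x''. \<beta> (\<alpha> x' y) (\<alpha>' x'' z)))"
      by (intro X.linear_on_sweedler_body[OF s]) (auto simp: linear_on_def D \<alpha>c \<alpha>c')
  next
    fix x y assume "x \<in> carrier X" "y \<in> carrier Y"
    then show "linear_on Z s (\<lambda>z. sweedler X s x (\<lambda>x' x''. \<beta> (\<alpha> x' y) (\<alpha>' x'' z)))"
      by (intro X.linear_on_sweedler_body[OF s]) (auto simp: linear_on_def D \<alpha>c \<alpha>c')
  qed
qed

lemma split_second:
  assumes C: "cocomm_coalgebra \<Delta> \<epsilon>" and X: "bialgebra X" and s: "vector_space s"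
    and E: "subspace_of E" and \<beta>: "bilinear_on X E s \<beta>" and \<alpha>: "bilinear_map X Y E \<alpha>"
    and f: "coalg_map \<Delta> \<epsilon> X f" and g: "\<And>b. g b \<in> carrier Y"
  shows "csum \<Delta> s c (\<lambda>u v. sweedler X s (f u) (\<lambda>x' x''. \<beta> x' (\<alpha> x'' (g v)))) =
    lift2 \<Delta> s \<beta> f (lift2 \<Delta> (smul E) \<alpha> f g) c"
proof -
  interpret C: cocomm_coalgebra \<Delta> \<epsilon> by fact
  interpret X: bialgebra X by fact
  note fX = coalg_mapD(1)[OF f]
  note \<alpha>c = bilinear_mapD(1)[OF \<alpha>]
  note D = bilinear_onD[OF \<beta>] bilinear_onD[OF bilinear_mapD(2)[OF \<alpha>]]
  have "csum \<Delta> s c (\<lambda>u v. sweedler X s (f u) (\<lambda>x' x''. \<beta> x' (\<alpha> x'' (g v)))) =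
      csum \<Delta> s c (\<lambda>u v. csum \<Delta> s u (\<lambda>p q. \<beta> (f p) (\<alpha> (f q) (g v))))"
    using g by (intro csum_cong X.sweedler_coalg_map[OF f s] bilinear_onI) (auto simp: linear_on_def D \<alpha>c)
  also have "\<dots> = csum \<Delta> s c (\<lambda>p w. csum \<Delta> s w (\<lambda>q v. \<beta> (f p) (\<alpha> (f q) (g v))))"
    by (rule C.csum_coassoc[OF s])
  finally show ?thesis
    using fX g by (simp add: lift2_def csum_bilinear(2)[OF X.subspace_of E s \<beta>] \<alpha>c)
qed

lemma split_second_bilinear:
  assumes X: "bialgebra X" and s: "vector_space s" and \<beta>: "bilinear_on X E s \<beta>" and \<alpha>: "bilinear_map X Y E \<alpha>"
  shows "bilinear_on X Y s (\<lambda>x y. sweedler X s x (\<lambda>x' x''. \<beta> x' (\<alpha> x'' y)))"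
proof -
  interpret X: bialgebra X by fact
  note D = bilinear_onD[OF \<beta>] bilinear_onD[OF bilinear_mapD(2)[OF \<alpha>]] bilinear_mapD(1)[OF \<alpha>]
  show ?thesis
  proof (rule bilinear_onI)
    fix y assume "y \<in> carrier Y"
    then show "linear_on X s (\<lambda>x. sweedler X s x (\<lambda>x' x''. \<beta> x' (\<alpha> x'' y)))"
      by (intro X.linear_on_sweedler[OF s] bilinear_onI) (auto simp: linear_on_def D)
  next
    fix x assume "x \<in> carrier X"
    then show "linear_on Y s (\<lambda>y. sweedler X s x (\<lambda>x' x''. \<beta> x' (\<alpha> x'' y)))"
      by (intro X.linear_on_sweedler_body[OF s]) (auto simp: linear_on_def D)
  qed
qed

section \<open>Inclusions and adjoint actions\<close>

text \<open>\<open>B\<close> carries the structure inherited from \<open>A\<close>; both \<open>A\<close> itself and its sub-Hopf-algebras are instances.\<close>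

locale inclusion = B: cocommutative_hopf_algebra B + A: cocommutative_hopf_algebra A
  for B :: "('k::field, 'a::ab_group_add, 'm) hopf_scheme" and A :: "('k, 'a, 'n) hopf_scheme" +
  assumes incl: "hopf_map B A (\<lambda>x. x)" and smul_eq: "smul B = smul A"
begin

lemma carrier_incl: "x \<in> carrier B \<Longrightarrow> x \<in> carrier A"
  using hopf_mapD(1)[OF incl] .

lemma sweedler_incl:
  "x \<in> carrier B \<Longrightarrow> vector_space s \<Longrightarrow> bilinear_on A A s f \<Longrightarrow> sweedler B s x f = sweedler A s x f"
  using sweedler_hopf_map[OF B.bialgebra_axioms A.bialgebra_axioms incl] by metis

lemma ad_incl: "x \<in> carrier B \<Longrightarrow> y \<in> carrier B \<Longrightarrow> ad B x y = ad A x y"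
  using hopf_map_ad[OF B.cocommutative_hopf_algebra_axioms A.cocommutative_hopf_algebra_axioms incl] .

lemma coalg_map_incl:
  "coalg_map \<Delta> \<epsilon> B g \<longleftrightarrow> coalg_map \<Delta> \<epsilon> A g \<and> (\<forall>b. g b \<in> carrier B)"
proof (intro iffI conjI; (elim conjE)?)
  assume g: "coalg_map \<Delta> \<epsilon> B g"
  show "coalg_map \<Delta> \<epsilon> A g"
    by (rule coalg_map_hopf_map[OF B.bialgebra_axioms A.bialgebra_axioms incl g])
  show "\<forall>b. g b \<in> carrier B" using coalg_mapD(1)[OF g] by blast
next
  assume g: "coalg_map \<Delta> \<epsilon> A g" "\<forall>b. g b \<in> carrier B"
  then show "coalg_map \<Delta> \<epsilon> B g"
    using hopf_mapD(5)[OF incl] sweedler_incl[OF _ vector_space_mult functional_bilinear]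
    unfolding B.coalg_map_iff A.coalg_map_iff smul_eq by metis
qed

end

lemma inclusion_refl:
  assumes "cocommutative_hopf_algebra A"
  shows "inclusion A A"
proof -
  interpret cocommutative_hopf_algebra A by fact
  have "comult A x = tensor_class A A (sweedler A fscale x (\<lambda>u v. basis (u, v)))" if "x \<in> carrier A" for x
    using comult_eq_class[OF that comult_rep[OF that]] lsum_basis_eq[of "comult_rep A x"]
    by (simp add: sweedler_lsum case_prod_unfold)
  then show ?thesis
    by unfold_locales (auto simp: hopf_map_def linear_map_def hom_def)
qed

lemma (in sub_hopf_algebra) inclusion_M: "inclusion M A"
proof -
  interpret M: cocommutative_hopf_algebra M by (rule cocommutative_hopf_algebra_M)
  have "comult A x = tensor_class A A (sweedler M fscale x (\<lambda>u v. basis (u, v)))" if "x \<in> N" for x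
  proof -
    have xA: "x \<in> carrier A" using N_sub that by blast
    have "sweedler M fscale x (\<lambda>u v. basis (u, v)) = comult_rep M x"
      using lsum_basis_eq[of "comult_rep M x"] by (simp add: sweedler_lsum case_prod_unfold)
    then show ?thesis using comult_eq_class[OF xA comult_rep_M(1)[OF that]] by metis
  qed
  then show ?thesis
    using N_sub by unfold_locales (auto simp: hopf_map_def linear_map_def hom_def)
qed

text \<open>Compatibility with the coproducts, tested on pairs of functionals.\<close>

lemma hopf_mapI:
  assumes A: "bialgebra A" and B: "bialgebra B" and lin: "linear_map A B f" and hom: "f \<in> hom A B" "f \<one>\<^bsub>A\<^esub> = \<one>\<^bsub>B\<^esub>"
    and counit: "\<And>x. x \<in> carrier A \<Longrightarrow> counit B (f x) = counit A x"
    and *: "\<And>x \<phi> \<psi>. x \<in> carrier A \<Longrightarrow> functional (smul B) \<phi> \<Longrightarrow> functional (smul B) \<psi> \<Longrightarrow>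
      sweedler A (*) x (\<lambda>u v. \<phi> (f u) * \<psi> (f v)) = sweedler B (*) (f x) (\<lambda>u v. \<phi> u * \<psi> v)"
  shows "hopf_map A B f"
proof -
  interpret A: bialgebra A by fact
  interpret B: bialgebra B by fact
  note ms = vector_space_mult
  have fB: "f x \<in> carrier B" if "x \<in> carrier A" for x using lin that by (auto simp: linear_map_def)
  have "comult B (f x) = tensor_class B B (sweedler A fscale x (\<lambda>x' x''. basis (f x', f x'')))" (is "_ = tensor_class B B ?p")
    if x: "x \<in> carrier A" for x
  proof (rule B.comult_eq_class[OF fB[OF x]])
    show "?p \<in> comult B (f x)"
      unfolding B.mem_comult_iff[OF fB[OF x]]
    proof (intro conjI allI impI)
      show "Poly_Mapping.keys ?p \<subseteq> carrier B \<times> carrier B"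
        unfolding sweedler_lsum using A.comult_rep_keys[OF x] fB by (intro keys_lsum) auto
      fix \<phi> \<psi> assume "functional (smul B) \<phi>" "functional (smul B) \<psi>"
      from *[OF x this] show "pairing \<phi> \<psi> ?p = sweedler B (*) (f x) (\<lambda>u v. \<phi> u * \<psi> v)"
        by (simp add: pairing_def sweedler_lsum vector_space.lsum_bind[OF ms] vector_space.lsum_basis[OF ms] case_prod_unfold)
    qed
  qed
  then show ?thesis using lin hom counit by (simp add: hopf_map_def)
qed

lemma functional_pullback_bilinear:
  assumes "linear_on A (smul B) f" "functional (smul B) \<phi>" "functional (smul B) \<psi>"
  shows "bilinear_on A A (*) (\<lambda>u v. \<phi> (f u) * \<psi> (f v))"
  using assms by (auto simp: functional_def bilinear_on_def linear_on_def algebra_simps)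

lemma hopf_map_comp:
  assumes A: "bialgebra A" and B: "bialgebra B" and D: "bialgebra D" and f: "hopf_map A B f" and g: "hopf_map B D g"
  shows "hopf_map A D (\<lambda>x. g (f x))"
proof (rule hopf_mapI[OF A D])
  show "linear_map A D (\<lambda>x. g (f x))"
    by (rule linear_map_comp[OF hopf_map_linear[OF f] hopf_map_linear[OF g]])
  show "(\<lambda>x. g (f x)) \<in> hom A D" "g (f \<one>\<^bsub>A\<^esub>) = \<one>\<^bsub>D\<^esub>"
    using f g by (auto simp: hopf_map_def hom_def Pi_iff)
  show "counit D (g (f x)) = counit A x" if "x \<in> carrier A" for x
    using f g that by (auto simp: hopf_map_def hom_def Pi_iff)
  fix x \<phi> \<psi> assume x: "x \<in> carrier A" and \<phi>: "functional (smul D) \<phi>" and \<psi>: "functional (smul D) \<psi>"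
  show "sweedler A (*) x (\<lambda>u v. \<phi> (g (f u)) * \<psi> (g (f v))) = sweedler D (*) (g (f x)) (\<lambda>u v. \<phi> u * \<psi> v)"
    by (simp add: sweedler_hopf_map[OF B D g hopf_mapD(1)[OF f x] vector_space_mult functional_bilinear[OF \<phi> \<psi>]]
      sweedler_hopf_map[OF A B f x vector_space_mult functional_pullback_bilinear[OF hopf_mapD(2)[OF g] \<phi> \<psi>]])
qed

lemma hopf_map_restrict:
  assumes X: "inclusion X A" and Y: "inclusion Y B" and f: "hopf_map A B f"
    and XY: "\<And>x. x \<in> carrier X \<Longrightarrow> f x \<in> carrier Y"
  shows "hopf_map X Y f"
proof -
  interpret X: inclusion X A by fact
  interpret Y: inclusion Y B by fact
  note ms = vector_space_mult
  show ?thesis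
  proof (rule hopf_mapI[OF X.B.bialgebra_axioms Y.B.bialgebra_axioms])
    show "linear_map X Y f"
      using hopf_mapD(2)[OF f] X.carrier_incl XY by (auto simp: linear_map_def linear_on_def X.smul_eq Y.smul_eq)
    show "f \<in> hom X Y"
      using hopf_mapD(3)[OF X.incl] hopf_mapD(3)[OF Y.incl] hopf_mapD(3)[OF f] X.carrier_incl XY by (simp add: hom_def)
    show "f \<one>\<^bsub>X\<^esub> = \<one>\<^bsub>Y\<^esub>"
      using hopf_mapD(4)[OF X.incl] hopf_mapD(4)[OF Y.incl] hopf_mapD(4)[OF f] by simp
    show "counit Y (f x) = counit X x" if "x \<in> carrier X" for x
      using that hopf_mapD(5)[OF X.incl] hopf_mapD(5)[OF Y.incl] hopf_mapD(5)[OF f] X.carrier_incl XY by metis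
    fix x \<phi> \<psi> assume x: "x \<in> carrier X" and "functional (smul Y) \<phi>" "functional (smul Y) \<psi>"
    then have \<phi>: "functional (smul B) \<phi>" and \<psi>: "functional (smul B) \<psi>" by (simp_all add: Y.smul_eq)
    have "sweedler X (*) x (\<lambda>u v. \<phi> (f u) * \<psi> (f v)) = sweedler A (*) x (\<lambda>u v. \<phi> (f u) * \<psi> (f v))"
      by (rule X.sweedler_incl[OF x ms functional_pullback_bilinear[OF hopf_mapD(2)[OF f] \<phi> \<psi>]])
    also have "\<dots> = sweedler B (*) (f x) (\<lambda>u v. \<phi> u * \<psi> v)"
      by (rule sweedler_hopf_map[OF X.A.bialgebra_axioms Y.A.bialgebra_axioms f X.carrier_incl[OF x] ms
          functional_bilinear[OF \<phi> \<psi>], symmetric])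
    also have "\<dots> = sweedler Y (*) (f x) (\<lambda>u v. \<phi> u * \<psi> v)"
      by (rule Y.sweedler_incl[OF XY[OF x] ms functional_bilinear[OF \<phi> \<psi>], symmetric])
    finally show "sweedler X (*) x (\<lambda>u v. \<phi> (f u) * \<psi> (f v)) = sweedler Y (*) (f x) (\<lambda>u v. \<phi> u * \<psi> v)" .
  qed
qed

text \<open>The adjoint action of \<open>A\<close>, pulled back along a Hopf map and restricted to an invariant part.\<close>

locale adjoint_module = inclusion B A + H: cocommutative_hopf_algebra H
  for B :: "('k::field, 'a::ab_group_add, 'm) hopf_scheme" and A :: "('k, 'a, 'n) hopf_scheme"
    and H :: "('k, 'h::ab_group_add, 'o) hopf_scheme" +
  fixes \<phi> :: "'h \<Rightarrow> 'a"
  assumes hopf_map_\<phi>: "hopf_map H A \<phi>"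
    and invariant: "x \<in> carrier H \<Longrightarrow> v \<in> carrier B \<Longrightarrow> ad A (\<phi> x) v \<in> carrier B"
begin

abbreviation "act x v \<equiv> ad A (\<phi> x) v"

lemma act_bilinear: "bilinear_map H B B act"
proof -
  have "bilinear_map H B A act"
    by (rule bilinear_map_compose[OF A.ad_bilinear hopf_map_linear[OF hopf_map_\<phi>] hopf_map_linear[OF incl]])
  then show ?thesis using invariant by (simp add: bilinear_map_iff smul_eq)
qed

lemma \<phi>_coalg_map: "coalg_map \<Delta> \<epsilon> H f \<Longrightarrow> coalg_map \<Delta> \<epsilon> A (\<lambda>b. \<phi> (f b))"
  by (rule coalg_map_hopf_map[OF H.bialgebra_axioms A.bialgebra_axioms hopf_map_\<phi>])

lemma lift_act:
  assumes C: "cocomm_coalgebra \<Delta> \<epsilon>" and f: "coalg_map \<Delta> \<epsilon> H f" and g: "coalg_map \<Delta> \<epsilon> B g"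
  shows "lift2 \<Delta> (smul A) act f g =
    (\<lambda>b. \<phi> (f b)) \<otimes>\<^bsub>conv_group \<Delta> \<epsilon> A\<^esub> g \<otimes>\<^bsub>conv_group \<Delta> \<epsilon> A\<^esub> inv\<^bsub>conv_group \<Delta> \<epsilon> A\<^esub> (\<lambda>b. \<phi> (f b))"
proof -
  interpret convolution \<Delta> \<epsilon> A
    using C A.cocommutative_hopf_algebra_axioms by (simp add: convolution_def)
  show ?thesis
    unfolding lift2_def using g by (intro ext csum_ad \<phi>_coalg_map f) (simp add: coalg_map_incl)
qed

lemma lift_act_coalg_map:
  assumes C: "cocomm_coalgebra \<Delta> \<epsilon>" and f: "coalg_map \<Delta> \<epsilon> H f" and g: "coalg_map \<Delta> \<epsilon> B g"
  shows "coalg_map \<Delta> \<epsilon> B (lift2 \<Delta> (smul B) act f g)"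
proof -
  interpret convolution \<Delta> \<epsilon> A
    using C A.cocommutative_hopf_algebra_axioms by (simp add: convolution_def)
  interpret G: group "conv_group \<Delta> \<epsilon> A" by (rule group_conv)
  have "g \<in> carrier (conv_group \<Delta> \<epsilon> A)" "(\<lambda>b. \<phi> (f b)) \<in> carrier (conv_group \<Delta> \<epsilon> A)"
    using g \<phi>_coalg_map[OF f] by (auto simp: coalg_map_incl)
  then have "lift2 \<Delta> (smul A) act f g \<in> carrier (conv_group \<Delta> \<epsilon> A)"
    unfolding lift_act[OF assms] by (intro G.m_closed G.inv_closed)
  moreover have "lift2 \<Delta> (smul B) act f g b \<in> carrier B" for b
    using f g by (intro lift2_closed[OF B.subspace_of act_bilinear]) (auto simp: coalg_map_def)
  ultimately show ?thesis by (simp add: coalg_map_incl smul_eq)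
qed

text \<open>At points, the module axioms become the laws of conjugation in a group.\<close>

lemma act_mult_left:
  assumes "x \<in> carrier H" "y \<in> carrier H" "v \<in> carrier B"
  shows "act (x \<otimes>\<^bsub>H\<^esub> y) v = act x (act y v)"
proof (rule generic_points3_eq[OF H.cocommutative_hopf_algebra_axioms H.cocommutative_hopf_algebra_axioms
      B.cocommutative_hopf_algebra_axioms B.vector_space_smul _ _ _ assms])
  note act = act_bilinear bilinear_mapD(2)[OF act_bilinear]
  show "trilinear_on H H B (smul B) (\<lambda>x y v. act (x \<otimes>\<^bsub>H\<^esub> y) v)"
    by (rule trilinear_comp[OF H.mult_bilinear_map act(2)])
  show "trilinear_on H H B (smul B) (\<lambda>x y v. act x (act y v))"
    by (rule trilinear_comp'[OF act])
  fix \<Delta> :: "'h \<times> 'h \<times> 'a \<Rightarrow> _" and \<epsilon> f g h c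
  assume C: "cocomm_coalgebra \<Delta> \<epsilon>" and f: "coalg_map \<Delta> \<epsilon> H f" and g: "coalg_map \<Delta> \<epsilon> H g"
    and h: "coalg_map \<Delta> \<epsilon> B h"
  interpret C: cocomm_coalgebra \<Delta> \<epsilon> by fact
  interpret CA: convolution \<Delta> \<epsilon> A using C A.cocommutative_hopf_algebra_axioms by (simp add: convolution_def)
  interpret CH: convolution \<Delta> \<epsilon> H using C H.cocommutative_hopf_algebra_axioms by (simp add: convolution_def)
  interpret G: group "conv_group \<Delta> \<epsilon> A" by (rule CA.group_conv)
  interpret G': group "conv_group \<Delta> \<epsilon> H" by (rule CH.group_conv)
  have fgh: "f \<in> carrier (conv_group \<Delta> \<epsilon> H)" "g \<in> carrier (conv_group \<Delta> \<epsilon> H)" "h \<in> carrier (conv_group \<Delta> \<epsilon> A)"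
    "(\<lambda>b. \<phi> (f b)) \<in> carrier (conv_group \<Delta> \<epsilon> A)" "(\<lambda>b. \<phi> (g b)) \<in> carrier (conv_group \<Delta> \<epsilon> A)"
    using f g h \<phi>_coalg_map by (auto simp: coalg_map_incl)
  have fg: "lift2 \<Delta> (smul H) (mult H) f g = f \<otimes>\<^bsub>conv_group \<Delta> \<epsilon> H\<^esub> g"
    by (simp add: lift2_def conv_def)
  have hom: "(\<lambda>b. \<phi> ((f \<otimes>\<^bsub>conv_group \<Delta> \<epsilon> H\<^esub> g) b)) = (\<lambda>b. \<phi> (f b)) \<otimes>\<^bsub>conv_group \<Delta> \<epsilon> A\<^esub> (\<lambda>b. \<phi> (g b))"
    using hom_mult[OF hopf_map_conv_hom[OF H.cocommutative_hopf_algebra_axioms A.cocommutative_hopf_algebra_axioms hopf_map_\<phi>] fgh(1,2)] .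
  have fg': "coalg_map \<Delta> \<epsilon> H (f \<otimes>\<^bsub>conv_group \<Delta> \<epsilon> H\<^esub> g)"
    using G'.m_closed[OF fgh(1,2)] by (simp only: conv_group_simps)
  have "csum \<Delta> (smul B) c (\<lambda>u w. csum \<Delta> (smul B) w (\<lambda>v t. act (f u \<otimes>\<^bsub>H\<^esub> g v) (h t))) =
      lift2 \<Delta> (smul B) act (f \<otimes>\<^bsub>conv_group \<Delta> \<epsilon> H\<^esub> g) h c"
    unfolding fg[symmetric]
    by (rule C.csum3_comp[OF coalg_mapD(1)[OF f] coalg_mapD(1)[OF g] coalg_mapD(1)[OF h] H.subspace_of B.subspace_of
      B.vector_space_smul H.mult_bilinear_map act(2)])
  also have "\<dots> = lift2 \<Delta> (smul B) act f (lift2 \<Delta> (smul B) act g h) c"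
    unfolding smul_eq lift_act[OF C fg' h] lift_act[OF C f lift_act_coalg_map[OF C g h, unfolded smul_eq]]
    unfolding lift_act[OF C g h] hom
    using fgh by (simp add: G.m_assoc G.inv_mult_group del: conv_group_simps)
  also have "\<dots> = csum \<Delta> (smul B) c (\<lambda>u w. csum \<Delta> (smul B) w (\<lambda>v t. act (f u) (act (g v) (h t))))"
    by (rule C.csum3_comp'[OF coalg_mapD(1)[OF f] coalg_mapD(1)[OF g] coalg_mapD(1)[OF h] H.subspace_of B.subspace_of
      B.vector_space_smul act, symmetric])
  finally show "csum \<Delta> (smul B) c (\<lambda>u w. csum \<Delta> (smul B) w (\<lambda>v t. act (f u \<otimes>\<^bsub>H\<^esub> g v) (h t))) =
      csum \<Delta> (smul B) c (\<lambda>u w. csum \<Delta> (smul B) w (\<lambda>v t. act (f u) (act (g v) (h t))))" .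
qed

lemma act_mult:
  assumes "x \<in> carrier H" "y \<in> carrier B" "z \<in> carrier B"
  shows "act x (y \<otimes>\<^bsub>B\<^esub> z) = sweedler H (smul B) x (\<lambda>x' x''. act x' y \<otimes>\<^bsub>B\<^esub> act x'' z)"
proof (rule generic_points3_eq[OF H.cocommutative_hopf_algebra_axioms B.cocommutative_hopf_algebra_axioms
      B.cocommutative_hopf_algebra_axioms B.vector_space_smul _ _ _ assms])
  note act = act_bilinear bilinear_mapD(2)[OF act_bilinear]
  show "trilinear_on H B B (smul B) (\<lambda>x y z. act x (y \<otimes>\<^bsub>B\<^esub> z))"
    by (rule trilinear_comp'[OF B.mult_bilinear_map act(2)])
  show "trilinear_on H B B (smul B) (\<lambda>x y z. sweedler H (smul B) x (\<lambda>x' x''. act x' y \<otimes>\<^bsub>B\<^esub> act x'' z))"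
    by (rule split_first_trilinear[OF H.bialgebra_axioms B.vector_space_smul B.mult_bilinear act(1,1)])
  fix \<Delta> :: "'h \<times> 'a \<times> 'a \<Rightarrow> _" and \<epsilon> f g h c
  assume C: "cocomm_coalgebra \<Delta> \<epsilon>" and f: "coalg_map \<Delta> \<epsilon> H f" and g: "coalg_map \<Delta> \<epsilon> B g"
    and h: "coalg_map \<Delta> \<epsilon> B h"
  interpret C: cocomm_coalgebra \<Delta> \<epsilon> by fact
  interpret CA: convolution \<Delta> \<epsilon> A using C A.cocommutative_hopf_algebra_axioms by (simp add: convolution_def)
  interpret CB: convolution \<Delta> \<epsilon> B using C B.cocommutative_hopf_algebra_axioms by (simp add: convolution_def)
  interpret G: group "conv_group \<Delta> \<epsilon> A" by (rule CA.group_conv)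
  have fgh: "g \<in> carrier (conv_group \<Delta> \<epsilon> A)" "h \<in> carrier (conv_group \<Delta> \<epsilon> A)" "(\<lambda>b. \<phi> (f b)) \<in> carrier (conv_group \<Delta> \<epsilon> A)"
    using f g h \<phi>_coalg_map by (auto simp: coalg_map_incl)
  have mlt: "lift2 \<Delta> (smul B) (mult B) p q = p \<otimes>\<^bsub>conv_group \<Delta> \<epsilon> A\<^esub> q"
    if "coalg_map \<Delta> \<epsilon> B p" "coalg_map \<Delta> \<epsilon> B q" for p q
    using that hopf_mapD(3)[OF incl] by (simp add: lift2_def conv_def smul_eq coalg_mapD(1)[of \<Delta> \<epsilon> B])
  have gh: "coalg_map \<Delta> \<epsilon> B (lift2 \<Delta> (smul B) (mult B) g h)"
    using CB.conv_closed[OF g h] by (simp add: lift2_def conv_def)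
  have "csum \<Delta> (smul B) c (\<lambda>u w. csum \<Delta> (smul B) w (\<lambda>v t. act (f u) (g v \<otimes>\<^bsub>B\<^esub> h t))) =
      lift2 \<Delta> (smul B) act f (lift2 \<Delta> (smul B) (mult B) g h) c"
    by (rule C.csum3_comp'[OF coalg_mapD(1)[OF f] coalg_mapD(1)[OF g] coalg_mapD(1)[OF h] H.subspace_of B.subspace_of
      B.vector_space_smul B.mult_bilinear_map act(2)])
  also have "\<dots> = lift2 \<Delta> (smul B) (mult B) (lift2 \<Delta> (smul B) act f g) (lift2 \<Delta> (smul B) act f h) c"
    unfolding mlt[OF lift_act_coalg_map[OF C f g] lift_act_coalg_map[OF C f h]]
    unfolding smul_eq lift_act[OF C f g] lift_act[OF C f h] lift_act[OF C f gh, unfolded smul_eq]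
    unfolding mlt[OF g h, unfolded smul_eq]
    using fgh by (simp add: G.m_assoc G.inv_mult_group del: conv_group_simps)
  also have "\<dots> = csum \<Delta> (smul B) c (\<lambda>u w. csum \<Delta> (smul B) w (\<lambda>v t.
      sweedler H (smul B) (f u) (\<lambda>x' x''. act x' (g v) \<otimes>\<^bsub>B\<^esub> act x'' (h t))))"
    by (rule split_first[OF C H.bialgebra_axioms B.vector_space_smul B.subspace_of B.subspace_of B.mult_bilinear
      act(1,1) f coalg_mapD(1)[OF g] coalg_mapD(1)[OF h], symmetric])
  finally show "csum \<Delta> (smul B) c (\<lambda>u w. csum \<Delta> (smul B) w (\<lambda>v t. act (f u) (g v \<otimes>\<^bsub>B\<^esub> h t))) = \<dots>" .
qed

lemma counit_act:
  assumes "x \<in> carrier H" "v \<in> carrier B"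
  shows "counit B (act x v) = counit H x * counit B v"
proof (rule generic_points2_eq[OF H.cocommutative_hopf_algebra_axioms B.cocommutative_hopf_algebra_axioms
      vector_space_mult _ _ _ assms])
  note ms = vector_space_mult
  show "bilinear_on H B (*) (\<lambda>x v. counit B (act x v))"
    using act_bilinear B.linear_on_counit by (auto simp: bilinear_map_iff bilinear_on_def linear_on_def)
  show "bilinear_on H B (*) (\<lambda>x v. counit H x * counit B v)"
    using H.linear_on_counit B.linear_on_counit by (auto simp: bilinear_on_def linear_on_def algebra_simps)
  fix \<Delta> :: "'h \<times> 'a \<Rightarrow> _" and \<epsilon> f g c
  assume C: "cocomm_coalgebra \<Delta> \<epsilon>" and f: "coalg_map \<Delta> \<epsilon> H f" and g: "coalg_map \<Delta> \<epsilon> B g"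
  have "csum \<Delta> (*) c (\<lambda>u v. counit B (act (f u) (g v))) = counit B (lift2 \<Delta> (smul B) act f g c)"
    unfolding lift2_def using f g
    by (intro linear_on_csum[OF B.subspace_of ms B.linear_on_counit, symmetric] invariant) (auto simp: coalg_map_def)
  also have "\<dots> = csum \<Delta> (*) c (\<lambda>u v. \<epsilon> u * \<epsilon> v)"
    by (simp add: coalg_mapD(2)[OF lift_act_coalg_map[OF C f g]] cocomm_coalgebra.csum_counit(1)[OF C ms])
  finally show "csum \<Delta> (*) c (\<lambda>u v. counit B (act (f u) (g v))) =
      csum \<Delta> (*) c (\<lambda>u v. counit H (f u) * counit B (g v))"
    by (simp add: coalg_mapD(2)[OF f] coalg_mapD(2)[OF g])
qed

text \<open>The lift of the action to two points is a conjugate of points, hence itself a coalgebra map.\<close>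

lemma sweedler_act:
  assumes "x \<in> carrier H" "v \<in> carrier B" and \<chi>: "functional (smul B) \<chi>" and \<psi>: "functional (smul B) \<psi>"
  shows "sweedler B (*) (act x v) (\<lambda>p q. \<chi> p * \<psi> q) =
    sweedler H (*) x (\<lambda>x' x''. sweedler B (*) v (\<lambda>v' v''. \<chi> (act x' v') * \<psi> (act x'' v'')))"
proof -
  note ms = vector_space_mult
  note bil = functional_bilinear[OF \<chi> \<psi>]
  have lin: "linear_on B (*) (\<lambda>y. sweedler B (*) y (\<lambda>p q. \<chi> p * \<psi> q))"
    by (rule B.linear_on_sweedler[OF ms bil])
  have "sweedler B (*) (act x v) (\<lambda>p q. \<chi> p * \<psi> q) = conv2 H B (*) (\<lambda>p q. \<chi> p * \<psi> q) act act x v"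
  proof (rule generic_points2_eq[OF H.cocommutative_hopf_algebra_axioms B.cocommutative_hopf_algebra_axioms
      ms _ _ _ assms(1,2)])
    show "bilinear_on H B (*) (\<lambda>x v. sweedler B (*) (act x v) (\<lambda>p q. \<chi> p * \<psi> q))"
      using act_bilinear lin by (auto simp: bilinear_map_iff bilinear_on_def linear_on_def)
    show "bilinear_on H B (*) (conv2 H B (*) (\<lambda>p q. \<chi> p * \<psi> q) act act)"
      by (rule conv2_bilinear[OF H.bialgebra_axioms B.bialgebra_axioms ms bil act_bilinear act_bilinear])
    fix \<Delta> :: "'h \<times> 'a \<Rightarrow> _" and \<epsilon> f g c
    assume C: "cocomm_coalgebra \<Delta> \<epsilon>" and f: "coalg_map \<Delta> \<epsilon> H f" and g: "coalg_map \<Delta> \<epsilon> B g"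
    note fH = coalg_mapD(1)[OF f] and gB = coalg_mapD(1)[OF g]
    have "csum \<Delta> (*) c (\<lambda>u v. sweedler B (*) (act (f u) (g v)) (\<lambda>p q. \<chi> p * \<psi> q)) =
        sweedler B (*) (lift2 \<Delta> (smul B) act f g c) (\<lambda>p q. \<chi> p * \<psi> q)"
      unfolding lift2_def using fH gB
      by (intro linear_on_csum[OF B.subspace_of ms lin, symmetric] invariant)
    also have "\<dots> = csum \<Delta> (*) c (\<lambda>u v. \<chi> (lift2 \<Delta> (smul B) act f g u) * \<psi> (lift2 \<Delta> (smul B) act f g v))"
      by (rule B.sweedler_coalg_map[OF lift_act_coalg_map[OF C f g] ms bil])
    also have "\<dots> = csum \<Delta> (*) c (\<lambda>u v. conv2 H B (*) (\<lambda>p q. \<chi> p * \<psi> q) act act (f u) (g v))"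
      by (rule csum_conv2[OF C H.bialgebra_axioms B.bialgebra_axioms ms B.subspace_of B.subspace_of bil
          act_bilinear act_bilinear f g, symmetric])
    finally show "csum \<Delta> (*) c (\<lambda>u v. sweedler B (*) (act (f u) (g v)) (\<lambda>p q. \<chi> p * \<psi> q)) = \<dots>" .
  qed
  then show ?thesis by (simp add: conv2_def)
qed

theorem module_bialgebra_act: "module_bialgebra H B act"
proof
  note ms = vector_space_mult
  show "bilinear_map H B B act" by (rule act_bilinear)
  have \<phi>1: "\<phi> \<one>\<^bsub>H\<^esub> = \<one>\<^bsub>A\<^esub>" by (rule hopf_mapD(4)[OF hopf_map_\<phi>])
  fix v assume v: "v \<in> carrier B"
  note vA = carrier_incl[OF v]
  show "act \<one>\<^bsub>H\<^esub> v = v"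
    using A.sweedler_one[OF A.vector_space_smul A.ad_bilinear_body[OF vA]] vA
    by (simp add: ad_def \<phi>1 A.antipode_one)
  fix x assume x: "x \<in> carrier H"
  note \<phi>x = hopf_mapD(1)[OF hopf_map_\<phi> x]
  show "act (y \<otimes>\<^bsub>H\<^esub> x) v = act y (act x v)" if "y \<in> carrier H" for y
    by (rule act_mult_left[OF that x v])
  show "act x (u \<otimes>\<^bsub>B\<^esub> v) = sweedler H (smul B) x (\<lambda>x' x''. act x' u \<otimes>\<^bsub>B\<^esub> act x'' v)" if "u \<in> carrier B" for u
    by (rule act_mult[OF x that v])
  show "counit B (act x v) = counit H x * counit B v"
    by (rule counit_act[OF x v])
  show "comult B (act x v) = tensor_class B B
      (sweedler H fscale x (\<lambda>x' x''. sweedler B fscale v (\<lambda>v' v''. basis (act x' v', act x'' v''))))"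
    (is "_ = tensor_class B B ?p")
  proof (rule B.comult_eq_class[OF invariant[OF x v]])
    show "?p \<in> comult B (act x v)"
      unfolding B.mem_comult_iff[OF invariant[OF x v]]
    proof (intro conjI allI impI)
      show "Poly_Mapping.keys ?p \<subseteq> carrier B \<times> carrier B"
        unfolding sweedler_lsum
      proof (rule keys_lsum)
        fix z assume z: "z \<in> Poly_Mapping.keys (comult_rep H x)"
        obtain p q where pq: "z = (p, q)" by (cases z)
        show "Poly_Mapping.keys (case z of (x', x'') \<Rightarrow>
            lsum fscale (comult_rep B v) (\<lambda>(v', v''). basis (act x' v', act x'' v''))) \<subseteq> carrier B \<times> carrier B"
          unfolding pq prod.case using H.comult_rep_keys[OF x] z pq B.comult_rep_keys[OF v] invariant
          by (intro keys_lsum) auto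
      qed
      fix \<chi> \<psi> assume "functional (smul B) \<chi>" "functional (smul B) \<psi>"
      from sweedler_act[OF x v this]
      show "pairing \<chi> \<psi> ?p = sweedler B (*) (act x v) (\<lambda>p q. \<chi> p * \<psi> q)"
        by (simp add: pairing_def sweedler_lsum vector_space.lsum_bind[OF ms] vector_space.lsum_basis[OF ms] case_prod_unfold)
    qed
  qed
next
  fix x assume x: "x \<in> carrier H"
  note \<phi>x = hopf_mapD(1)[OF hopf_map_\<phi> x]
  have "act x \<one>\<^bsub>A\<^esub> = smul A (counit A (\<phi> x)) \<one>\<^bsub>A\<^esub>"
    unfolding ad_def A.antipode_right[OF \<phi>x, symmetric] by (rule A.sweedler_cong[OF \<phi>x]) simp
  then show "act x \<one>\<^bsub>B\<^esub> = smul B (counit H x) \<one>\<^bsub>B\<^esub>"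
    by (simp add: hopf_mapD(4)[OF incl] hopf_mapD(5)[OF hopf_map_\<phi> x] smul_eq)
qed

end

lemma module_bialgebra_cong:
  assumes "module_bialgebra H B act" and eq: "\<And>x v. x \<in> carrier H \<Longrightarrow> v \<in> carrier B \<Longrightarrow> act' x v = act x v"
  shows "module_bialgebra H B act'"
proof -
  interpret M: module_bialgebra H B act by fact
  have closed: "act x v \<in> carrier B" if "x \<in> carrier H" "v \<in> carrier B" for x v
    using bilinear_mapD(1)[OF M.bilinear_act that] .
  show ?thesis
  proof
    show "bilinear_map H B B act'"
      using M.bilinear_act eq subspace_ofD(4,6)[OF M.H.subspace_of] subspace_ofD(4,6)[OF M.I.subspace_of]
      by (simp add: bilinear_map_iff bilinear_on_def linear_on_def)
    fix x u v assume x: "x \<in> carrier H" and u: "u \<in> carrier B" and v: "v \<in> carrier B"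
    show "act' x (u \<otimes>\<^bsub>B\<^esub> v) = sweedler H (smul B) x (\<lambda>x' x''. act' x' u \<otimes>\<^bsub>B\<^esub> act' x'' v)"
      unfolding eq[OF x M.I.m_closed[OF u v]] M.act_mult[OF x u v]
      by (rule M.H.sweedler_cong[OF x]) (simp add: eq u v)
  next
    fix x v assume x: "x \<in> carrier H" and v: "v \<in> carrier B"
    have "sweedler H fscale x (\<lambda>x' x''. sweedler B fscale v (\<lambda>v' v''. basis (act' x' v', act' x'' v''))) =
      sweedler H fscale x (\<lambda>x' x''. sweedler B fscale v (\<lambda>v' v''. basis (act x' v', act x'' v'')))"
      using eq by (intro M.H.sweedler_cong[OF x] M.I.sweedler_cong[OF v]) auto
    then show "comult B (act' x v) = tensor_class B B
      (sweedler H fscale x (\<lambda>x' x''. sweedler B fscale v (\<lambda>v' v''. basis (act' x' v', act' x'' v''))))"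
      using x v by (simp add: eq M.comult_act)
  qed (simp_all add: eq closed M.act_one_left M.act_mult_left M.act_one M.counit_act)
qed

section \<open>The Moore complex of length two\<close>

locale length_two = simplicial_hopf_algebra H d s
  for H :: "nat \<Rightarrow> ('k::field, 'a::ab_group_add) hopf" and d s :: "nat \<Rightarrow> nat \<Rightarrow> 'a \<Rightarrow> 'a" +
  assumes length_two: "moore_length H d 2"
begin

declare One_nat_def [simp del]

abbreviation "I \<equiv> moore H d 1"
abbreviation "K \<equiv> moore H d 2"
abbreviation "act_I n m \<equiv> ad (H 1) (s 0 0 n) m"
abbreviation "act_K n l \<equiv> ad (H 2) (s 1 1 (s 0 0 n)) l"

definition pl :: "'a \<Rightarrow> 'a \<Rightarrow> 'a" where
  "pl x y = sweedler (H 1) (smul (H 2)) x (\<lambda>x' x''. sweedler (H 1) (smul (H 2)) y (\<lambda>y' y''.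
     ad (H 2) (s 1 1 x') (s 1 1 y') \<otimes>\<^bsub>H 2\<^esub> antipode (H 2) (ad (H 2) (s 1 0 x'') (s 1 1 y''))))"

lemma bialg: "bialgebra (H n)"
  using hopf[of n] by (simp add: cocommutative_hopf_algebra_def)

lemma maps:
  "hopf_map (H 1) (H 0) (d 1 0)" "hopf_map (H 1) (H 0) (d 1 1)"
  "hopf_map (H 2) (H 1) (d 2 0)" "hopf_map (H 2) (H 1) (d 2 1)" "hopf_map (H 2) (H 1) (d 2 2)"
  "hopf_map (H 3) (H 2) (d 3 0)" "hopf_map (H 3) (H 2) (d 3 1)" "hopf_map (H 3) (H 2) (d 3 2)"
  "hopf_map (H 0) (H 1) (s 0 0)" "hopf_map (H 1) (H 2) (s 1 0)" "hopf_map (H 1) (H 2) (s 1 1)"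
  using face[of _ 0] face[of _ 1] face[of _ 2] degeneracy[of _ 0] degeneracy[of _ 1]
  by (simp_all add: eval_nat_numeral One_nat_def)

lemma kernels:
  "hopf_kernel (H 1) (H 0) (d 1 0)" "hopf_kernel (H 2) (H 1) (d 2 0)" "hopf_kernel (H 2) (H 1) (d 2 1)"
  "hopf_kernel (H 3) (H 2) (d 3 0)" "hopf_kernel (H 3) (H 2) (d 3 1)" "hopf_kernel (H 3) (H 2) (d 3 2)"
  using maps by (simp_all add: hopf_kernel_def hopf_kernel_axioms_def hopf)

lemma I_eq: "I = restrict_hopf (H 1) (HKer (H 1) (H 0) (d 1 0))"
  by (simp add: moore_def lessThan_Suc One_nat_def)

lemma K_eq: "K = restrict_hopf (H 2) (HKer (H 2) (H 1) (d 2 0) \<inter> HKer (H 2) (H 1) (d 2 1))"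
  by (simp add: moore_def lessThan_Suc eval_nat_numeral One_nat_def Int_commute)

lemma sub_I: "sub_hopf_algebra (H 1) (HKer (H 1) (H 0) (d 1 0))"
  using sub_hopf_algebra_HKers[of "{0}" "H 1" "H 0" "d 1"] kernels by simp

lemma sub_K: "sub_hopf_algebra (H 2) (HKer (H 2) (H 1) (d 2 0) \<inter> HKer (H 2) (H 1) (d 2 1))"
  using sub_hopf_algebra_HKers[of "{0, 1}" "H 2" "H 1" "d 2"] kernels by auto

lemma I_simps [simp]:
  "carrier I = HKer (H 1) (H 0) (d 1 0)" "smul I = smul (H 1)" "mult I = mult (H 1)" "one I = one (H 1)"
  "counit I = counit (H 1)" "antipode I = antipode (H 1)"
  by (simp_all add: I_eq)

lemma K_simps [simp]:
  "carrier K = HKer (H 2) (H 1) (d 2 0) \<inter> HKer (H 2) (H 1) (d 2 1)" "smul K = smul (H 2)" "mult K = mult (H 2)"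
  "one K = one (H 2)" "counit K = counit (H 2)" "antipode K = antipode (H 2)"
  by (simp_all add: K_eq)

sublocale I: inclusion I "H 1"
  unfolding I_eq by (rule sub_hopf_algebra.inclusion_M[OF sub_I])

sublocale K: inclusion K "H 2"
  unfolding K_eq by (rule sub_hopf_algebra.inclusion_M[OF sub_K])

end

locale length_two_points = length_two H d s + C: cocomm_coalgebra \<Delta> \<epsilon>
  for H :: "nat \<Rightarrow> ('k::field, 'a::ab_group_add) hopf" and d s :: "nat \<Rightarrow> nat \<Rightarrow> 'a \<Rightarrow> 'a"
    and \<Delta> :: "'c \<Rightarrow> ('c \<times> 'c \<Rightarrow>\<^sub>0 'k)" and \<epsilon> :: "'c \<Rightarrow> 'k"
begin

abbreviation "gr n \<equiv> conv_group \<Delta> \<epsilon> (H n)"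

declare conv_group_simps [simp del]

lemma convolution: "convolution \<Delta> \<epsilon> (H n)"
  using hopf C.cocomm_coalgebra_axioms by (simp add: convolution_def)

text \<open>
  A point of \<open>H 3\<close> that the first three faces send to the trivial point takes values in the third
  Moore term, which is the ground field; so it is trivial.
\<close>

lemma moore3_trivial:
  assumes g: "coalg_map \<Delta> \<epsilon> (H 3) g"
    and *: "(\<lambda>b. d 3 0 (g b)) = \<one>\<^bsub>gr 2\<^esub>" "(\<lambda>b. d 3 1 (g b)) = \<one>\<^bsub>gr 2\<^esub>" "(\<lambda>b. d 3 2 (g b)) = \<one>\<^bsub>gr 2\<^esub>"
  shows "g = \<one>\<^bsub>gr 3\<^esub>"
proof
  fix b
  interpret H3: cocommutative_hopf_algebra "H 3" by (rule hopf)
  have k: "(\<forall>b. g b \<in> HKer (H 3) (H 2) (d 3 i)) \<longleftrightarrow> (\<forall>b. d 3 i (g b) = smul (H 2) (\<epsilon> b) \<one>\<^bsub>H 2\<^esub>)" if "i < 3" for i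
    using that kernels(4-6)
    by (intro hopf_kernel.coalg_map_HKer[OF _ g C.cocomm_coalgebra_axioms])
      (auto simp: numeral_3_eq_3 less_Suc_eq numeral_2_eq_2 One_nat_def)
  have "g b \<in> HKer (H 3) (H 2) (d 3 i)" if "i < 3" for i
    using that k[of 0] k[of 1] k[of 2] * unfolding conv_group_simps(3) fun_eq_iff
    by (auto simp: numeral_3_eq_3 less_Suc_eq numeral_2_eq_2 One_nat_def)
  then have "g b \<in> carrier (moore H d 3)"
    by (simp add: moore_def)
  moreover have "is_zero_object (moore H d 3)"
    using length_two by (simp add: moore_length_def)
  then have "carrier (moore H d 3) = range (\<lambda>c. smul (H 3) c \<one>\<^bsub>H 3\<^esub>)"
    by (simp add: is_zero_object_def moore_def)
  ultimately obtain c where "g b = smul (H 3) c \<one>\<^bsub>H 3\<^esub>"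
    by auto
  then show "g b = \<one>\<^bsub>gr 3\<^esub> b"
    using coalg_mapD(2)[OF g, of b] by (simp add: conv_group_simps(3) H3.counit_smul H3.counit_one)
qed

sublocale G: simplicial_group_length_two gr "\<lambda>n i g b. d n i (g b)" "\<lambda>n j g b. s n j (g b)"
proof (rule simplicial_group_length_two.intro)
  show "group (gr n)" for n by (rule convolution.group_conv[OF convolution])
next
  fix i n assume "i \<le> Suc n"
  then show "(\<lambda>g b. d (Suc n) i (g b)) \<in> hom (gr (Suc n)) (gr n)"
    by (intro hopf_map_conv_hom hopf face)
next
  fix j n :: nat assume "j \<le> n"
  then show "(\<lambda>g b. s n j (g b)) \<in> hom (gr n) (gr (Suc n))"
    by (intro hopf_map_conv_hom hopf degeneracy)
qed (auto simp: conv_group_simps(1) face_face degeneracy_degeneracy face_degeneracy_less face_degeneracy_same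
    face_degeneracy_Suc face_degeneracy_greater coalg_mapD(1) intro: moore3_trivial)

lemma points_I: "coalg_map \<Delta> \<epsilon> I f \<longleftrightarrow> f \<in> G.N1"
  using hopf_kernel.coalg_map_HKer[OF kernels(1) _ C.cocomm_coalgebra_axioms]
  by (auto simp: I.coalg_map_incl G.N1_def conv_group_simps(1,3) fun_eq_iff)

lemma points_K: "coalg_map \<Delta> \<epsilon> K f \<longleftrightarrow> f \<in> G.N2"
proof (cases "coalg_map \<Delta> \<epsilon> (H 2) f")
  case True
  then show ?thesis
    using hopf_kernel.coalg_map_HKer[OF kernels(2) True C.cocomm_coalgebra_axioms]
      hopf_kernel.coalg_map_HKer[OF kernels(3) True C.cocomm_coalgebra_axioms]
    by (simp add: K.coalg_map_incl G.N2_def conv_group_simps(1,3) fun_eq_iff all_conj_distrib)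
qed (simp add: K.coalg_map_incl G.N2_def conv_group_simps(1))

lemma lift_mult: "lift2 \<Delta> (smul (H n)) (mult (H n)) f g = f \<otimes>\<^bsub>gr n\<^esub> g"
  by (simp add: lift2_def conv_group_simps(2) conv_def)

lemma antipode_inv: "coalg_map \<Delta> \<epsilon> (H n) f \<Longrightarrow> (\<lambda>b. antipode (H n) (f b)) = inv\<^bsub>gr n\<^esub> f"
  using convolution.inv_conv[OF convolution] by simp

lemma lift_ad:
  assumes "coalg_map \<Delta> \<epsilon> (H n) f" "coalg_map \<Delta> \<epsilon> (H n) g"
  shows "lift2 \<Delta> (smul (H n)) (ad (H n)) f g = f \<otimes>\<^bsub>gr n\<^esub> g \<otimes>\<^bsub>gr n\<^esub> inv\<^bsub>gr n\<^esub> f"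
  unfolding lift2_def by (rule ext) (rule convolution.csum_ad[OF convolution assms])

lemma lift2_compose: "lift2 \<Delta> t (\<lambda>x y. \<beta> (p x) (q y)) f g = lift2 \<Delta> t \<beta> (\<lambda>b. p (f b)) (\<lambda>b. q (g b))"
  by (simp add: lift2_def)

lemma face_points: "coalg_map \<Delta> \<epsilon> (H 1) f \<Longrightarrow> coalg_map \<Delta> \<epsilon> (H 0) (\<lambda>b. d 1 1 (f b))"
  "coalg_map \<Delta> \<epsilon> (H 1) f \<Longrightarrow> coalg_map \<Delta> \<epsilon> (H 2) (\<lambda>b. s 1 1 (f b))"
  "coalg_map \<Delta> \<epsilon> (H 1) f \<Longrightarrow> coalg_map \<Delta> \<epsilon> (H 2) (\<lambda>b. s 1 0 (f b))"
  "coalg_map \<Delta> \<epsilon> (H 0) g \<Longrightarrow> coalg_map \<Delta> \<epsilon> (H 1) (\<lambda>b. s 0 0 (g b))"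
  "coalg_map \<Delta> \<epsilon> (H 2) h \<Longrightarrow> coalg_map \<Delta> \<epsilon> (H 1) (\<lambda>b. d 2 2 (h b))"
  by (rule coalg_map_hopf_map[OF bialg bialg maps(2)] coalg_map_hopf_map[OF bialg bialg maps(11)]
    coalg_map_hopf_map[OF bialg bialg maps(10)] coalg_map_hopf_map[OF bialg bialg maps(9)]
    coalg_map_hopf_map[OF bialg bialg maps(5)]; assumption)+

lemma lift_act_I:
  assumes "coalg_map \<Delta> \<epsilon> (H 0) a" "coalg_map \<Delta> \<epsilon> (H 1) x"
  shows "lift2 \<Delta> (smul (H 1)) act_I a x = (\<lambda>b. s 0 0 (a b)) \<otimes>\<^bsub>gr 1\<^esub> x \<otimes>\<^bsub>gr 1\<^esub> inv\<^bsub>gr 1\<^esub> (\<lambda>b. s 0 0 (a b))"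
  unfolding lift2_compose[where \<beta> = "ad (H 1)" and p = "s 0 0" and q = "\<lambda>x. x"]
  by (rule lift_ad[OF face_points(4)[OF assms(1)] assms(2)])

lemma lift_s11:
  assumes "coalg_map \<Delta> \<epsilon> (H 1) x" "coalg_map \<Delta> \<epsilon> (H 2) k"
  shows "lift2 \<Delta> (smul (H 2)) (\<lambda>x k. ad (H 2) (s 1 1 x) k) x k =
    (\<lambda>b. s 1 1 (x b)) \<otimes>\<^bsub>gr 2\<^esub> k \<otimes>\<^bsub>gr 2\<^esub> inv\<^bsub>gr 2\<^esub> (\<lambda>b. s 1 1 (x b))"
  unfolding lift2_compose[where \<beta> = "ad (H 2)" and p = "s 1 1" and q = "\<lambda>x. x"]
  by (rule lift_ad[OF face_points(2)[OF assms(1)] assms(2)])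

lemma lift_act_K:
  assumes "coalg_map \<Delta> \<epsilon> (H 0) a" "coalg_map \<Delta> \<epsilon> (H 2) k"
  shows "lift2 \<Delta> (smul (H 2)) act_K a k =
    (\<lambda>b. s 1 1 (s 0 0 (a b))) \<otimes>\<^bsub>gr 2\<^esub> k \<otimes>\<^bsub>gr 2\<^esub> inv\<^bsub>gr 2\<^esub> (\<lambda>b. s 1 1 (s 0 0 (a b)))"
  unfolding lift2_compose[where \<beta> = "ad (H 2)" and p = "\<lambda>a. s 1 1 (s 0 0 a)" and q = "\<lambda>x. x"]
  by (rule lift_ad[OF face_points(2)[OF face_points(4)[OF assms(1)]] assms(2)])

lemma lift_ad_I:
  assumes "coalg_map \<Delta> \<epsilon> I f" "coalg_map \<Delta> \<epsilon> I g"
  shows "lift2 \<Delta> (smul (H 1)) (ad I) f g = f \<otimes>\<^bsub>gr 1\<^esub> g \<otimes>\<^bsub>gr 1\<^esub> inv\<^bsub>gr 1\<^esub> f"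
proof -
  have "lift2 \<Delta> (smul (H 1)) (ad I) f g = lift2 \<Delta> (smul (H 1)) (ad (H 1)) f g"
    using coalg_mapD(1)[OF assms(1)] coalg_mapD(1)[OF assms(2)] by (simp add: lift2_def I.ad_incl)
  then show ?thesis using assms by (simp add: lift_ad I.coalg_map_incl)
qed

lemma lift_ad_K:
  assumes "coalg_map \<Delta> \<epsilon> K f" "coalg_map \<Delta> \<epsilon> K g"
  shows "lift2 \<Delta> (smul (H 2)) (ad K) f g = f \<otimes>\<^bsub>gr 2\<^esub> g \<otimes>\<^bsub>gr 2\<^esub> inv\<^bsub>gr 2\<^esub> f"
proof -
  have "lift2 \<Delta> (smul (H 2)) (ad K) f g = lift2 \<Delta> (smul (H 2)) (ad (H 2)) f g"
    using coalg_mapD(1)[OF assms(1)] coalg_mapD(1)[OF assms(2)] by (simp add: lift2_def K.ad_incl)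
  then show ?thesis using assms by (simp add: lift_ad K.coalg_map_incl)
qed

end

context length_two begin

lemma H_linear: "linear_map (H 1) (H 2) (s 1 1)" "linear_map (H 1) (H 2) (s 1 0)"
  using maps(10,11) by (auto simp: hopf_map_def)

lemma pl_parts:
  "bilinear_map (H 1) (H 1) (H 2) (\<lambda>x y. ad (H 2) (s 1 1 x) (s 1 1 y))"
  "bilinear_map (H 1) (H 1) (H 2) (\<lambda>x y. antipode (H 2) (ad (H 2) (s 1 0 x) (s 1 1 y)))"
  by (intro bilinear_map_compose[OF cocommutative_hopf_algebra.ad_bilinear[OF hopf]]
      linear_map_bilinear[OF cocommutative_hopf_algebra.linear_antipode[OF hopf]] H_linear)+

lemma pl_conv2: "pl = conv2 (H 1) (H 1) (smul (H 2)) (mult (H 2)) (\<lambda>x y. ad (H 2) (s 1 1 x) (s 1 1 y))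
    (\<lambda>x y. antipode (H 2) (ad (H 2) (s 1 0 x) (s 1 1 y)))"
  by (intro ext) (simp add: pl_def conv2_def)

lemma pl_bilinear_on: "bilinear_on (H 1) (H 1) (smul (H 2)) pl"
  unfolding pl_conv2
  by (rule conv2_bilinear[OF bialg bialg bialgebra.vector_space_smul[OF bialg] bialgebra.mult_bilinear[OF bialg] pl_parts])

end

context length_two_points begin

lemma lift_pl:
  assumes f: "coalg_map \<Delta> \<epsilon> (H 1) f" and g: "coalg_map \<Delta> \<epsilon> (H 1) g"
  shows "lift2 \<Delta> (smul (H 2)) pl f g = G.peiffer f g"
proof -
  have fg: "f \<in> carrier (gr 1)" "g \<in> carrier (gr 1)" using f g by (simp_all add: conv_group_simps(1))
  let ?P = "\<lambda>x y. ad (H 2) (s 1 1 x) (s 1 1 y)" and ?Q = "\<lambda>x y. ad (H 2) (s 1 0 x) (s 1 1 y)"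
  let ?SQ = "\<lambda>x y. antipode (H 2) (?Q x y)"
  have P: "lift2 \<Delta> (smul (H 2)) ?P f g =
      (\<lambda>b. s 1 1 (f b)) \<otimes>\<^bsub>gr 2\<^esub> (\<lambda>b. s 1 1 (g b)) \<otimes>\<^bsub>gr 2\<^esub> inv\<^bsub>gr 2\<^esub> (\<lambda>b. s 1 1 (f b))"
    unfolding lift2_compose[where \<beta> = "ad (H 2)" and p = "s 1 1" and q = "s 1 1"] by (rule lift_ad[OF face_points(2)[OF f] face_points(2)[OF g]])
  have Q: "lift2 \<Delta> (smul (H 2)) ?Q f g =
      (\<lambda>b. s 1 0 (f b)) \<otimes>\<^bsub>gr 2\<^esub> (\<lambda>b. s 1 1 (g b)) \<otimes>\<^bsub>gr 2\<^esub> inv\<^bsub>gr 2\<^esub> (\<lambda>b. s 1 0 (f b))" (is "_ = ?w")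
    unfolding lift2_compose[where \<beta> = "ad (H 2)" and p = "s 1 0" and q = "s 1 1"] by (rule lift_ad[OF face_points(3)[OF f] face_points(2)[OF g]])
  have w: "?w \<in> carrier (gr 2)" using fg by simp
  have Qc: "?Q (f u) (g v) \<in> carrier (H 2)" for u v
    using bilinear_mapD(1)[OF K.A.ad_bilinear] coalg_mapD(1)[OF face_points(3)[OF f]] coalg_mapD(1)[OF face_points(2)[OF g]] .
  have "lift2 \<Delta> (smul (H 2)) ?SQ f g = (\<lambda>c. antipode (H 2) (lift2 \<Delta> (smul (H 2)) ?Q f g c))"
    unfolding lift2_def
    by (rule ext) (rule linear_on_csum[OF K.A.subspace_of K.A.vector_space_smul K.A.antipode_linear Qc, symmetric])
  also have "\<dots> = inv\<^bsub>gr 2\<^esub> ?w"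
    unfolding Q by (rule antipode_inv) (use w in \<open>simp add: conv_group_simps(1)\<close>)
  finally have SQ: "lift2 \<Delta> (smul (H 2)) ?SQ f g = inv\<^bsub>gr 2\<^esub> ?w" .
  have "lift2 \<Delta> (smul (H 2)) pl f g = lift2 \<Delta> (smul (H 2)) (mult (H 2)) (lift2 \<Delta> (smul (H 2)) ?P f g) (lift2 \<Delta> (smul (H 2)) ?SQ f g)"
    unfolding pl_conv2 lift2_def[of _ _ "conv2 _ _ _ _ _ _"] lift2_def[of _ _ "mult (H 2)"]
    by (rule ext) (rule csum_conv2[OF C.cocomm_coalgebra_axioms bialg bialg K.A.vector_space_smul K.A.subspace_of K.A.subspace_of
      K.A.mult_bilinear pl_parts f g])
  then show ?thesis
    by (simp only: P SQ lift_mult G.peiffer_def)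
qed

end

context length_two begin

lemma points: "cocomm_coalgebra \<Delta> \<epsilon> \<Longrightarrow> length_two_points H d s \<Delta> \<epsilon>"
  by (simp add: length_two_points_def length_two_axioms)

lemma hopf_I: "cocommutative_hopf_algebra I" and hopf_K: "cocommutative_hopf_algebra K"
  by (rule I.B.cocommutative_hopf_algebra_axioms K.B.cocommutative_hopf_algebra_axioms)+

lemmas V1 = I.A.vector_space_smul and V2 = K.A.vector_space_smul

lemmas W_I = I.B.subspace_carrier[unfolded I_simps(2)] and W_K = K.B.subspace_carrier[unfolded K_simps(2)]

lemma linear_I: "linear_map I (H 1) (\<lambda>x. x)" and linear_K: "linear_map K (H 2) (\<lambda>x. x)"
  using I.incl K.incl by (auto simp: hopf_map_def)

lemma restrict_bilinear:
  assumes "bilinear_map X Y (H n) \<beta>" "J = I \<and> n = 1 \<or> J = K \<and> n = 2"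
    and "\<And>x y. x \<in> carrier X \<Longrightarrow> y \<in> carrier Y \<Longrightarrow> \<beta> x y \<in> carrier J"
  shows "bilinear_map X Y J \<beta>"
  using assms by (auto simp: bilinear_map_iff)

text \<open>Closure of the Moore complex under the operations follows from closure at generic points.\<close>

lemma act_I_bilinear: "bilinear_map (H 0) I I act_I"
proof -
  have bil: "bilinear_map (H 0) I (H 1) act_I"
    by (rule bilinear_map_compose[OF I.A.ad_bilinear hopf_map_linear[OF maps(9)] linear_I])
  have "act_I a x \<in> carrier I" if "a \<in> carrier (H 0)" "x \<in> carrier I" for a x
  proof (rule generic_points2[OF hopf hopf_I V1 W_I bilinear_mapD(2)[OF bil] _ that])
    fix \<Delta> :: "'a \<times> 'a \<Rightarrow> _" and \<epsilon> f g c
    assume C: "cocomm_coalgebra \<Delta> \<epsilon>" and f: "coalg_map \<Delta> \<epsilon> (H 0) f" and g: "coalg_map \<Delta> \<epsilon> I g"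
    interpret length_two_points H d s \<Delta> \<epsilon> by (rule points[OF C])
    have g1: "coalg_map \<Delta> \<epsilon> (H 1) g" using g by (simp add: I.coalg_map_incl)
    have "lift2 \<Delta> (smul (H 1)) act_I f g \<in> G.N1"
      unfolding lift_act_I[OF f g1] by (rule G.conj_N1) (use f g in \<open>simp_all add: points_I conv_group_simps(1)\<close>)
    then have "coalg_map \<Delta> \<epsilon> I (lift2 \<Delta> (smul (H 1)) act_I f g)" by (simp add: points_I)
    then show "csum \<Delta> (smul (H 1)) c (\<lambda>u v. act_I (f u) (g v)) \<in> carrier I"
      using coalg_mapD(1) by (force simp: lift2_def)
  qed
  with bil show ?thesis by (auto intro: restrict_bilinear)
qed

lemma s11_bilinear: "bilinear_map (H 1) K K (\<lambda>x k. ad (H 2) (s 1 1 x) k)"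
proof -
  have bil: "bilinear_map (H 1) K (H 2) (\<lambda>x k. ad (H 2) (s 1 1 x) k)"
    by (rule bilinear_map_compose[OF K.A.ad_bilinear hopf_map_linear[OF maps(11)] linear_K])
  have "ad (H 2) (s 1 1 x) k \<in> carrier K" if "x \<in> carrier (H 1)" "k \<in> carrier K" for x k
  proof (rule generic_points2[OF hopf hopf_K V2 W_K bilinear_mapD(2)[OF bil] _ that])
    fix \<Delta> :: "'a \<times> 'a \<Rightarrow> _" and \<epsilon> f g c
    assume C: "cocomm_coalgebra \<Delta> \<epsilon>" and f: "coalg_map \<Delta> \<epsilon> (H 1) f" and g: "coalg_map \<Delta> \<epsilon> K g"
    interpret length_two_points H d s \<Delta> \<epsilon> by (rule points[OF C])
    have g2: "coalg_map \<Delta> \<epsilon> (H 2) g" using g by (simp add: K.coalg_map_incl)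
    have "lift2 \<Delta> (smul (H 2)) (\<lambda>x k. ad (H 2) (s 1 1 x) k) f g \<in> G.N2"
      unfolding lift_s11[OF f g2] by (rule G.conj_N2) (use f g in \<open>simp_all add: points_K conv_group_simps(1)\<close>)
    then have "coalg_map \<Delta> \<epsilon> K (lift2 \<Delta> (smul (H 2)) (\<lambda>x k. ad (H 2) (s 1 1 x) k) f g)" by (simp add: points_K)
    then show "csum \<Delta> (smul (H 2)) c (\<lambda>u v. ad (H 2) (s 1 1 (f u)) (g v)) \<in> carrier K"
      using coalg_mapD(1) by (force simp: lift2_def)
  qed
  with bil show ?thesis by (auto intro: restrict_bilinear)
qed

lemma s11_bilinear_I: "bilinear_map I K K (\<lambda>x k. ad (H 2) (s 1 1 x) k)"
  by (rule bilinear_map_compose[OF s11_bilinear linear_I linear_map_id])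

lemma act_K_bilinear: "bilinear_map (H 0) K K act_K"
  by (rule bilinear_map_compose[OF s11_bilinear hopf_map_linear[OF maps(9)] linear_map_id])

lemma pl_bilinear: "bilinear_map I I K pl"
proof -
  have bil: "bilinear_on I I (smul (H 2)) pl"
    using pl_bilinear_on I.carrier_incl by (auto simp: bilinear_on_def linear_on_def)
  have "pl x y \<in> carrier K" if "x \<in> carrier I" "y \<in> carrier I" for x y
  proof (rule generic_points2[OF hopf_I hopf_I V2 W_K bil _ that])
    fix \<Delta> :: "'a \<times> 'a \<Rightarrow> _" and \<epsilon> f g c
    assume C: "cocomm_coalgebra \<Delta> \<epsilon>" and f: "coalg_map \<Delta> \<epsilon> I f" and g: "coalg_map \<Delta> \<epsilon> I g"
    interpret length_two_points H d s \<Delta> \<epsilon> by (rule points[OF C])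
    have "lift2 \<Delta> (smul (H 2)) pl f g = G.peiffer f g"
      using f g by (simp add: I.coalg_map_incl lift_pl)
    then have "coalg_map \<Delta> \<epsilon> K (lift2 \<Delta> (smul (H 2)) pl f g)"
      using f g by (simp add: points_K points_I G.peiffer_N2)
    then show "csum \<Delta> (smul (H 2)) c (\<lambda>u v. pl (f u) (g v)) \<in> carrier K"
      using coalg_mapD(1) by (force simp: lift2_def)
  qed
  with bil show ?thesis by (simp add: bilinear_map_iff)
qed

text \<open>Since \<open>d\<^sub>0 d\<^sub>2 = d\<^sub>1 d\<^sub>0\<close>, the kernel condition on \<open>k\<close> for \<open>d\<^sub>0\<close> passes to \<open>d\<^sub>2 k\<close>.\<close>

lemma d2_closed:
  assumes k: "k \<in> carrier K"
  shows "d 2 2 k \<in> carrier I"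
proof -
  note ms = vector_space_mult
  have kH: "k \<in> carrier (H 2)" by (rule K.carrier_incl[OF k])
  have dd: "d 1 0 (d 2 2 v) = d 1 1 (d 2 0 v)" if "v \<in> carrier (H 2)" for v
    using face_face[of 0 1 0 v] that by (simp add: eval_nat_numeral One_nat_def)
  have "d 2 2 k \<in> HKer (H 1) (H 0) (d 1 0)"
  proof (rule hopf_kernel.HKerI[OF kernels(1) hopf_mapD(1)[OF maps(5) kH]])
    fix \<phi> \<psi> assume \<phi>: "functional (smul (H 1)) \<phi>" and \<psi>: "functional (smul (H 0)) \<psi>"
    have bil: "bilinear_on (H 2) (H 1) (*) (\<lambda>u v. \<phi> (d 2 2 u) * \<psi> (d 1 1 v))"
      using \<phi> \<psi> hopf_mapD(2)[OF maps(5)] hopf_mapD(2)[OF maps(2)]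
      by (auto simp: bilinear_on_def linear_on_def functional_def algebra_simps)
    have "sweedler (H 1) (*) (d 2 2 k) (\<lambda>u v. \<phi> u * \<psi> (d 1 0 v)) =
        sweedler (H 2) (*) k (\<lambda>u v. \<phi> (d 2 2 u) * \<psi> (d 1 0 (d 2 2 v)))"
      by (rule sweedler_hopf_map[OF bialg bialg maps(5) kH ms hopf_kernel.bilinear_pullback[OF kernels(1) \<phi> \<psi>]])
    also have "\<dots> = sweedler (H 2) (*) k (\<lambda>u v. \<phi> (d 2 2 u) * \<psi> (d 1 1 (d 2 0 v)))"
      by (rule bialgebra.sweedler_cong[OF bialg kH]) (simp add: dd)
    also have "\<dots> = \<phi> (d 2 2 k) * \<psi> (d 1 1 \<one>\<^bsub>H 1\<^esub>)"
      using k by (intro hopf_kernel.HKer_bilinear[OF kernels(2) _ ms bil]) simp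
    finally show "sweedler (H 1) (*) (d 2 2 k) (\<lambda>u v. \<phi> u * \<psi> (d 1 0 v)) = \<phi> (d 2 2 k) * \<psi> \<one>\<^bsub>H 0\<^esub>"
      by (simp add: hopf_mapD(4)[OF maps(2)])
  qed
  then show ?thesis by simp
qed

lemma hopf_map_bd: "hopf_map K I (d 2 2)" "hopf_map I (H 0) (d 1 1)"
  using d2_closed by (auto intro!: hopf_map_restrict[OF K.inclusion_axioms I.inclusion_axioms maps(5)]
    hopf_map_restrict[OF I.inclusion_axioms inclusion_refl[OF hopf] maps(2)] hopf_mapD(1)[OF maps(2)] I.carrier_incl
    simp del: I_simps K_simps)

end

section \<open>The axioms of a 2-crossed module\<close>

context length_two_points begin

lemma lift_S: "coalg_map \<Delta> \<epsilon> (H n) f \<Longrightarrow> coalg_map \<Delta> \<epsilon> (H n) (inv\<^bsub>gr n\<^esub> f)"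
  using group.inv_closed[OF convolution.group_conv[OF convolution, of n], of f] by (simp add: conv_group_simps(1))

lemma coalg_map_HI: "coalg_map \<Delta> \<epsilon> I f \<Longrightarrow> coalg_map \<Delta> \<epsilon> (H 1) f"
  and coalg_map_HK: "coalg_map \<Delta> \<epsilon> K g \<Longrightarrow> coalg_map \<Delta> \<epsilon> (H 2) g"
  by (simp_all add: I.coalg_map_incl K.coalg_map_incl)

lemma conv_mult: "(p \<otimes>\<^bsub>gr n\<^esub> q) c = csum \<Delta> (smul (H n)) c (\<lambda>u v. p u \<otimes>\<^bsub>H n\<^esub> q v)"
  by (simp add: conv_group_simps(2) conv_def)

lemma points_d2: "coalg_map \<Delta> \<epsilon> K g \<Longrightarrow> coalg_map \<Delta> \<epsilon> I (\<lambda>b. d 2 2 (g b))"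
  using G.d2_N2[of g] by (simp add: points_I points_K)

lemma lift_pl_I: "coalg_map \<Delta> \<epsilon> I f \<Longrightarrow> coalg_map \<Delta> \<epsilon> I g \<Longrightarrow> lift2 \<Delta> (smul (H 2)) pl f g = G.peiffer f g"
  by (intro lift_pl coalg_map_HI)

end

context length_two begin

lemma linear_bd: "linear_map K I (d 2 2)" "linear_map I (H 0) (d 1 1)"
  by (rule hopf_map_linear[OF hopf_map_bd(1)] hopf_map_linear[OF hopf_map_bd(2)])+

lemma linear_S: "linear_map I I (antipode (H 1))" "linear_map K K (antipode (H 2))"
  using I.B.linear_antipode K.B.linear_antipode by simp_all

text \<open>
  This is \<open>peiffer_lifting_act\<close> at points.  It makes the action derived from the lifting an adjoint
  action, so that the general theory of adjoint actions applies to it.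
\<close>

lemma lifting_act_eq:
  assumes x: "x \<in> carrier I" and k: "k \<in> carrier K"
  shows "lifting_act K (d 2 2) pl x k = ad (H 2) (s 1 1 x) k"
proof -
  let ?\<alpha> = "\<lambda>k x. pl (d 2 2 (antipode (H 2) k)) x"
  have \<alpha>: "bilinear_map K I K ?\<alpha>"
    by (rule bilinear_map_compose[OF pl_bilinear linear_map_comp[OF linear_S(2) linear_bd(1)] linear_map_id])
  have mK: "bilinear_on K K (smul (H 2)) (mult (H 2))" using K.B.mult_bilinear by simp
  have "sweedler K (smul (H 2)) k (\<lambda>k' k''. k' \<otimes>\<^bsub>H 2\<^esub> ?\<alpha> k'' x) = (\<lambda>k x. ad (H 2) (s 1 1 x) k) k x"
  proof (rule generic_points2_eq[OF hopf_K hopf_I V2 _ _ _ k x])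
    show "bilinear_on K I (smul (H 2)) (\<lambda>k x. sweedler K (smul (H 2)) k (\<lambda>k' k''. k' \<otimes>\<^bsub>H 2\<^esub> ?\<alpha> k'' x))"
      by (rule split_second_bilinear[OF K.B.bialgebra_axioms V2 mK \<alpha>])
    show "bilinear_on K I (smul (H 2)) (\<lambda>k x. ad (H 2) (s 1 1 x) k)"
      using bilinear_mapD(2)[OF bilinear_map_flip[OF s11_bilinear_I]] by simp
    fix \<Delta> :: "'a \<times> 'a \<Rightarrow> _" and \<epsilon> f g c
    assume C: "cocomm_coalgebra \<Delta> \<epsilon>" and f: "coalg_map \<Delta> \<epsilon> K f" and g: "coalg_map \<Delta> \<epsilon> I g"
    interpret length_two_points H d s \<Delta> \<epsilon> by (rule points[OF C])
    note f2 = coalg_map_HK[OF f] and g1 = coalg_map_HI[OF g]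
    have fN: "f \<in> G.N2" and gN: "g \<in> G.N1" using f g by (simp_all add: points_I points_K)
    have iN: "coalg_map \<Delta> \<epsilon> K (inv\<^bsub>gr 2\<^esub> f)" using G.N2_closed(2)[OF fN] by (simp add: points_K)
    have "lift2 \<Delta> (smul (H 2)) ?\<alpha> f g = lift2 \<Delta> (smul (H 2)) pl (\<lambda>b. d 2 2 ((inv\<^bsub>gr 2\<^esub> f) b)) g"
      using fun_cong[OF antipode_inv[OF f2]] by (simp add: lift2_def)
    also have "\<dots> = G.peiffer (\<lambda>b. d 2 2 ((inv\<^bsub>gr 2\<^esub> f) b)) g"
      by (rule lift_pl_I[OF points_d2[OF iN] g])
    finally have a: "lift2 \<Delta> (smul (H 2)) ?\<alpha> f g = G.peiffer (\<lambda>b. d 2 2 ((inv\<^bsub>gr 2\<^esub> f) b)) g" .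
    have "csum \<Delta> (smul (H 2)) c (\<lambda>u v. sweedler K (smul (H 2)) (f u) (\<lambda>k' k''. k' \<otimes>\<^bsub>H 2\<^esub> ?\<alpha> k'' (g v))) =
        (f \<otimes>\<^bsub>gr 2\<^esub> lift2 \<Delta> (smul (H 2)) ?\<alpha> f g) c"
      using split_second[OF C K.B.bialgebra_axioms V2 K.B.subspace_of mK \<alpha> f coalg_mapD(1)[OF g]]
      by (simp add: lift_mult)
    also have "\<dots> = lift2 \<Delta> (smul (H 2)) (\<lambda>x k. ad (H 2) (s 1 1 x) k) g f c"
      unfolding a G.peiffer_lifting_act[OF fN gN] lift_s11[OF g1 f2] ..
    also have "\<dots> = csum \<Delta> (smul (H 2)) c (\<lambda>u v. ad (H 2) (s 1 1 (g v)) (f u))"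
      unfolding lift2_def by (rule C.csum_cocomm[OF V2])
    finally show "csum \<Delta> (smul (H 2)) c (\<lambda>u v. sweedler K (smul (H 2)) (f u) (\<lambda>k' k''. k' \<otimes>\<^bsub>H 2\<^esub> ?\<alpha> k'' (g v))) = \<dots>" .
  qed
  then show ?thesis by (simp add: lifting_act_def)
qed

text \<open>
  The proofs of the axioms for the lifting have a common form: the two sides are
  multilinear, and at points they are the two sides of an identity for \<open>G.peiffer\<close>.
\<close>

lemma pl_equivariant:
  assumes a: "a \<in> carrier (H 0)" and x: "x \<in> carrier I" and y: "y \<in> carrier I"
  shows "act_K a (pl x y) = sweedler (H 0) (smul (H 2)) a (\<lambda>a' a''. pl (act_I a' x) (act_I a'' y))"
proof (rule generic_points3_eq[OF hopf hopf_I hopf_I V2 _ _ _ a x y])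
  have plK: "bilinear_on I I (smul (H 2)) pl" and actK: "bilinear_on (H 0) K (smul (H 2)) act_K"
    using bilinear_mapD(2)[OF pl_bilinear] bilinear_mapD(2)[OF act_K_bilinear] by simp_all
  show "trilinear_on (H 0) I I (smul (H 2)) (\<lambda>a x y. act_K a (pl x y))"
    by (rule trilinear_comp'[OF pl_bilinear actK])
  show "trilinear_on (H 0) I I (smul (H 2)) (\<lambda>a x y. sweedler (H 0) (smul (H 2)) a (\<lambda>a' a''. pl (act_I a' x) (act_I a'' y)))"
    by (rule split_first_trilinear[OF bialg V2 plK act_I_bilinear act_I_bilinear])
  fix \<Delta> :: "'a \<times> 'a \<times> 'a \<Rightarrow> _" and \<epsilon> f g h c
  assume C: "cocomm_coalgebra \<Delta> \<epsilon>" and f: "coalg_map \<Delta> \<epsilon> (H 0) f" and g: "coalg_map \<Delta> \<epsilon> I g"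
    and h: "coalg_map \<Delta> \<epsilon> I h"
  interpret length_two_points H d s \<Delta> \<epsilon> by (rule points[OF C])
  interpret H0: cocommutative_hopf_algebra "H 0" by (rule hopf)
  have fG: "f \<in> carrier (gr 0)" using f by (simp add: conv_group_simps(1))
  have gN: "g \<in> G.N1" and hN: "h \<in> G.N1" using g h by (simp_all add: points_I)
  note cl = coalg_mapD(1)[OF f] coalg_mapD(1)[OF g] coalg_mapD(1)[OF h]
  have lI: "coalg_map \<Delta> \<epsilon> I (lift2 \<Delta> (smul (H 1)) act_I f k)" if "coalg_map \<Delta> \<epsilon> I k" for k
    unfolding lift_act_I[OF f coalg_map_HI[OF that]] points_I
    by (rule G.conj_N1) (use fG that in \<open>simp_all add: points_I\<close>)
  have pK: "coalg_map \<Delta> \<epsilon> (H 2) (G.peiffer g h)"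
    using G.N2_D(1)[OF G.peiffer_N2[OF gN hN]] by (simp add: conv_group_simps(1))
  have "csum \<Delta> (smul (H 2)) c (\<lambda>u w. csum \<Delta> (smul (H 2)) w (\<lambda>v t. act_K (f u) (pl (g v) (h t)))) =
      lift2 \<Delta> (smul (H 2)) act_K f (lift2 \<Delta> (smul (H 2)) pl g h) c"
    using C.csum3_comp'[where f = f and g = g and h = h, OF cl H0.subspace_of K.B.subspace_of V2 pl_bilinear actK] by simp
  also have "\<dots> = lift2 \<Delta> (smul (H 2)) pl (lift2 \<Delta> (smul (H 1)) act_I f g) (lift2 \<Delta> (smul (H 1)) act_I f h) c"
    unfolding lift_pl_I[OF g h] lift_pl_I[OF lI[OF g] lI[OF h]] lift_act_K[OF f pK]
    unfolding lift_act_I[OF f coalg_map_HI[OF g]] lift_act_I[OF f coalg_map_HI[OF h]]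
    by (rule fun_cong[OF G.peiffer_equivariant[OF fG gN hN, symmetric]])
  also have "\<dots> = csum \<Delta> (smul (H 2)) c (\<lambda>u w. csum \<Delta> (smul (H 2)) w (\<lambda>v t.
      sweedler (H 0) (smul (H 2)) (f u) (\<lambda>a' a''. pl (act_I a' (g v)) (act_I a'' (h t)))))"
    using split_first[OF C bialg V2 I.B.subspace_of I.B.subspace_of plK act_I_bilinear act_I_bilinear f cl(2,3)] by simp
  finally show "csum \<Delta> (smul (H 2)) c (\<lambda>u w. csum \<Delta> (smul (H 2)) w (\<lambda>v t. act_K (f u) (pl (g v) (h t)))) = \<dots>" .
qed

lemma d2_pl:
  assumes x: "x \<in> carrier I" and y: "y \<in> carrier I"
  shows "d 2 2 (pl x y) = sweedler I (smul (H 1)) x (\<lambda>x' x''. sweedler I (smul (H 1)) y (\<lambda>y' y''.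
    ad I x' y' \<otimes>\<^bsub>H 1\<^esub> act_I (d 1 1 x'') (antipode (H 1) y'')))"
proof -
  let ?Q = "\<lambda>x y. act_I (d 1 1 x) (antipode (H 1) y)"
  have Q: "bilinear_map I I I ?Q"
    by (rule bilinear_map_compose[OF act_I_bilinear linear_bd(2) linear_S(1)])
  have mI: "bilinear_on I I (smul (H 1)) (mult (H 1))" using I.B.mult_bilinear by simp
  have "d 2 2 (pl x y) = conv2 I I (smul (H 1)) (mult (H 1)) (ad I) ?Q x y"
  proof (rule generic_points2_eq[OF hopf_I hopf_I V1 _ _ _ x y])
    show "bilinear_on I I (smul (H 1)) (\<lambda>x y. d 2 2 (pl x y))"
      using bilinear_mapD(2)[OF linear_map_bilinear[OF linear_bd(1) pl_bilinear]] by simp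
    show "bilinear_on I I (smul (H 1)) (conv2 I I (smul (H 1)) (mult (H 1)) (ad I) ?Q)"
      by (rule conv2_bilinear[OF I.B.bialgebra_axioms I.B.bialgebra_axioms V1 mI I.B.ad_bilinear Q])
    fix \<Delta> :: "'a \<times> 'a \<Rightarrow> _" and \<epsilon> f g c
    assume C: "cocomm_coalgebra \<Delta> \<epsilon>" and f: "coalg_map \<Delta> \<epsilon> I f" and g: "coalg_map \<Delta> \<epsilon> I g"
    interpret length_two_points H d s \<Delta> \<epsilon> by (rule points[OF C])
    note f1 = coalg_map_HI[OF f] and g1 = coalg_map_HI[OF g]
    have fN: "f \<in> G.N1" and gN: "g \<in> G.N1" using f g by (simp_all add: points_I)
    have plc: "pl (f u) (g v) \<in> carrier (H 2)" for u v
      by (rule K.carrier_incl[OF bilinear_mapD(1)[OF pl_bilinear coalg_mapD(1)[OF f] coalg_mapD(1)[OF g]]])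
    have LQ: "lift2 \<Delta> (smul (H 1)) ?Q f g = (\<lambda>b. s 0 0 (d 1 1 (f b))) \<otimes>\<^bsub>gr 1\<^esub> inv\<^bsub>gr 1\<^esub> g \<otimes>\<^bsub>gr 1\<^esub>
        inv\<^bsub>gr 1\<^esub> (\<lambda>b. s 0 0 (d 1 1 (f b)))"
      using lift_act_I[OF face_points(1)[OF f1] lift_S[OF g1]] fun_cong[OF antipode_inv[OF g1]]
      by (simp add: lift2_def)
    have "csum \<Delta> (smul (H 1)) c (\<lambda>u v. d 2 2 (pl (f u) (g v))) = d 2 2 (lift2 \<Delta> (smul (H 2)) pl f g c)"
      unfolding lift2_def by (rule linear_on_csum[OF K.A.subspace_of V1 hopf_mapD(2)[OF maps(5)] plc, symmetric])
    also have "\<dots> = (lift2 \<Delta> (smul (H 1)) (ad I) f g \<otimes>\<^bsub>gr 1\<^esub> lift2 \<Delta> (smul (H 1)) ?Q f g) c"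
      unfolding lift_pl_I[OF f g] lift_ad_I[OF f g] LQ by (rule fun_cong[OF G.d2_peiffer[OF fN gN]])
    also have "\<dots> = csum \<Delta> (smul (H 1)) c (\<lambda>u v. conv2 I I (smul (H 1)) (mult (H 1)) (ad I) ?Q (f u) (g v))"
      using csum_conv2[OF C I.B.bialgebra_axioms I.B.bialgebra_axioms V1 I.B.subspace_of I.B.subspace_of mI I.B.ad_bilinear Q f g]
      by (simp add: conv_group_simps(2) conv_def)
    finally show "csum \<Delta> (smul (H 1)) c (\<lambda>u v. d 2 2 (pl (f u) (g v))) = \<dots>" .
  qed
  then show ?thesis by (simp add: conv2_def)
qed

lemma pl_d2_d2:
  assumes k: "k \<in> carrier K" and l: "l \<in> carrier K"
  shows "pl (d 2 2 k) (d 2 2 l) = sweedler K (smul (H 2)) l (\<lambda>l' l''. ad K k l' \<otimes>\<^bsub>H 2\<^esub> antipode (H 2) l'')"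
proof (rule generic_points2_eq[OF hopf_K hopf_K V2 _ _ _ k l])
  let ?R = "\<lambda>k l. sweedler K (smul (H 2)) l (\<lambda>l' l''. ad K k l' \<otimes>\<^bsub>H 2\<^esub> antipode (H 2) l'')"
  note adD = bilinear_mapD(1)[OF K.B.ad_bilinear] bilinear_onD[OF bilinear_mapD(2)[OF K.B.ad_bilinear], unfolded K_simps(2)]
  have mK: "bilinear_on K K (smul (H 2)) (mult (H 2))" using K.B.mult_bilinear by simp
  note mD = bilinear_onD[OF mK, unfolded K_simps(2)]
  have S: "linear_on K (smul (H 2)) (antipode (H 2))" "\<And>x. x \<in> carrier K \<Longrightarrow> antipode (H 2) x \<in> carrier K"
    using K.B.antipode_linear K.B.antipode_closed by (simp_all add: K_simps(2-) del: K_simps(1))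
  have body: "bilinear_on K K (smul (H 2)) (\<lambda>l' l''. ad K k l' \<otimes>\<^bsub>H 2\<^esub> antipode (H 2) l'')" if "k \<in> carrier K" for k
    using that S by (intro bilinear_onI) (simp_all add: linear_on_def adD mD K_simps(2) del: K_simps(1))
  have lin: "linear_on K (smul (H 2)) (\<lambda>k. ad K k l' \<otimes>\<^bsub>H 2\<^esub> antipode (H 2) l'')" if "l' \<in> carrier K" "l'' \<in> carrier K" for l' l''
    using that S by (simp add: linear_on_def adD mD K_simps(2) del: K_simps(1))
  show "bilinear_on K K (smul (H 2)) (\<lambda>k l. pl (d 2 2 k) (d 2 2 l))"
    using bilinear_mapD(2)[OF bilinear_map_compose[OF pl_bilinear linear_bd(1) linear_bd(1)]] by simp
  show "bilinear_on K K (smul (H 2)) ?R"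
    by (intro bilinear_onI K.B.linear_on_sweedler[OF V2 body] K.B.linear_on_sweedler_body[OF V2] lin)
  fix \<Delta> :: "'a \<times> 'a \<Rightarrow> _" and \<epsilon> f g c
  assume C: "cocomm_coalgebra \<Delta> \<epsilon>" and f: "coalg_map \<Delta> \<epsilon> K f" and g: "coalg_map \<Delta> \<epsilon> K g"
  interpret length_two_points H d s \<Delta> \<epsilon> by (rule points[OF C])
  have fN: "f \<in> G.N2" and gN: "g \<in> G.N2" using f g by (simp_all add: points_K)
  note fc = coalg_mapD(1)[OF f] and gc = coalg_mapD(1)[OF g]
  have "csum \<Delta> (smul (H 2)) c (\<lambda>u v. pl (d 2 2 (f u)) (d 2 2 (g v))) =
      G.peiffer (\<lambda>b. d 2 2 (f b)) (\<lambda>b. d 2 2 (g b)) c"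
    unfolding lift_pl_I[OF points_d2[OF f] points_d2[OF g], symmetric] by (simp add: lift2_def)
  also have "\<dots> = (lift2 \<Delta> (smul (H 2)) (ad K) f g \<otimes>\<^bsub>gr 2\<^esub> inv\<^bsub>gr 2\<^esub> g) c"
    unfolding lift_ad_K[OF f g] by (rule fun_cong[OF G.peiffer_d2_d2[OF fN gN]])
  also have "\<dots> = csum \<Delta> (smul (H 2)) c (\<lambda>w q. csum \<Delta> (smul (H 2)) w (\<lambda>u p. ad K (f u) (g p)) \<otimes>\<^bsub>H 2\<^esub> antipode (H 2) (g q))"
    unfolding antipode_inv[OF coalg_map_HK[OF g], symmetric]
    by (simp add: conv_group_simps(2) conv_def lift2_def)
  also have "\<dots> = csum \<Delta> (smul (H 2)) c (\<lambda>w q. csum \<Delta> (smul (H 2)) w (\<lambda>u p. ad K (f u) (g p) \<otimes>\<^bsub>H 2\<^esub> antipode (H 2) (g q)))"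
    by (rule csum_cong, rule csum_bilinear(1)[OF K.B.subspace_of K.B.subspace_of V2 mK, unfolded K_simps(2)])
      (rule adD(1)[OF fc gc], rule S(2)[OF gc])
  also have "\<dots> = csum \<Delta> (smul (H 2)) c (\<lambda>u v. csum \<Delta> (smul (H 2)) v (\<lambda>p q. ad K (f u) (g p) \<otimes>\<^bsub>H 2\<^esub> antipode (H 2) (g q)))"
    by (rule C.csum_coassoc[OF V2])
  also have "\<dots> = csum \<Delta> (smul (H 2)) c (\<lambda>u v. ?R (f u) (g v))"
    by (intro csum_cong K.B.sweedler_coalg_map[OF g V2 body[OF fc], symmetric])
  finally show "csum \<Delta> (smul (H 2)) c (\<lambda>u v. pl (d 2 2 (f u)) (d 2 2 (g v))) = \<dots>" .
qed

lemma pl_mult_left: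
  assumes x: "x \<in> carrier I" and y: "y \<in> carrier I" and z: "z \<in> carrier I"
  shows "pl (x \<otimes>\<^bsub>H 1\<^esub> y) z = sweedler I (smul (H 2)) x (\<lambda>x' x''. sweedler I (smul (H 2)) y (\<lambda>y' y''.
    sweedler I (smul (H 2)) z (\<lambda>z' z''. pl x' (ad I y' z') \<otimes>\<^bsub>H 2\<^esub> act_K (d 1 1 x'') (pl y'' z''))))"
proof -
  let ?P = "\<lambda>x y z. pl x (ad I y z)" and ?Q = "\<lambda>x y z. act_K (d 1 1 x) (pl y z)"
  note BI = I.B.bialgebra_axioms
  have Qm: "bilinear_map I K K (\<lambda>x k. act_K (d 1 1 x) k)"
    by (rule bilinear_map_compose[OF act_K_bilinear linear_bd(2) linear_map_id])
  have plK: "bilinear_on I I (smul K) pl" and QK: "bilinear_on I K (smul K) (\<lambda>x k. act_K (d 1 1 x) k)"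
    using bilinear_mapD(2)[OF pl_bilinear] bilinear_mapD(2)[OF Qm] .
  note plK' = plK[unfolded K_simps(2)] and QK' = QK[unfolded K_simps(2)]
  have P: "trilinear_on I I I (smul K) ?P" "\<And>x y z. x \<in> carrier I \<Longrightarrow> y \<in> carrier I \<Longrightarrow> z \<in> carrier I \<Longrightarrow> ?P x y z \<in> carrier K"
    by (rule trilinear_comp'[OF I.B.ad_bilinear plK], intro bilinear_mapD(1)[OF pl_bilinear] bilinear_mapD(1)[OF I.B.ad_bilinear])
  have Q: "trilinear_on I I I (smul K) ?Q" "\<And>x y z. x \<in> carrier I \<Longrightarrow> y \<in> carrier I \<Longrightarrow> z \<in> carrier I \<Longrightarrow> ?Q x y z \<in> carrier K"
    by (rule trilinear_comp'[OF pl_bilinear QK], intro bilinear_mapD(1)[OF Qm] bilinear_mapD(1)[OF pl_bilinear])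
  have mK: "bilinear_on K K (smul (H 2)) (mult (H 2))" using K.B.mult_bilinear by simp
  have mI: "bilinear_map I I I (mult (H 1))" using I.B.mult_bilinear_map by simp
  have "pl (x \<otimes>\<^bsub>H 1\<^esub> y) z = conv3 I I I (smul (H 2)) (mult (H 2)) ?P ?Q x y z"
  proof (rule generic_points3_eq[OF hopf_I hopf_I hopf_I V2 _ _ _ x y z])
    show "trilinear_on I I I (smul (H 2)) (\<lambda>x y z. pl (x \<otimes>\<^bsub>H 1\<^esub> y) z)"
      by (rule trilinear_comp[OF mI plK'])
    show "trilinear_on I I I (smul (H 2)) (conv3 I I I (smul (H 2)) (mult (H 2)) ?P ?Q)"
      by (rule conv3_trilinear[OF BI BI BI V2 mK P Q])
    fix \<Delta> :: "'a \<times> 'a \<times> 'a \<Rightarrow> _" and \<epsilon> f g h c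
    assume C: "cocomm_coalgebra \<Delta> \<epsilon>" and f: "coalg_map \<Delta> \<epsilon> I f" and g: "coalg_map \<Delta> \<epsilon> I g"
      and h: "coalg_map \<Delta> \<epsilon> I h"
    interpret length_two_points H d s \<Delta> \<epsilon> by (rule points[OF C])
    have fN: "f \<in> G.N1" and gN: "g \<in> G.N1" and hN: "h \<in> G.N1" using f g h by (simp_all add: points_I)
    note cl = coalg_mapD(1)[OF f] coalg_mapD(1)[OF g] coalg_mapD(1)[OF h]
    have fg: "coalg_map \<Delta> \<epsilon> I (f \<otimes>\<^bsub>gr 1\<^esub> g)" using G.N1_closed(1)[OF fN gN] by (simp add: points_I)
    have adgh: "coalg_map \<Delta> \<epsilon> I (g \<otimes>\<^bsub>gr 1\<^esub> h \<otimes>\<^bsub>gr 1\<^esub> inv\<^bsub>gr 1\<^esub> g)"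
      using G.N1_closed(1)[OF G.N1_closed(1)[OF gN hN] G.N1_closed(2)[OF gN]] by (simp add: points_I)
    have pgh: "coalg_map \<Delta> \<epsilon> (H 2) (G.peiffer g h)"
      using G.peiffer_N2[OF gN hN] by (intro coalg_map_HK) (simp add: points_K)
    have LQ: "lift2 \<Delta> (smul (H 2)) (\<lambda>x k. act_K (d 1 1 x) k) f (G.peiffer g h) =
        lift2 \<Delta> (smul (H 2)) act_K (\<lambda>b. d 1 1 (f b)) (G.peiffer g h)"
      by (simp add: lift2_def)
    have "csum \<Delta> (smul (H 2)) c (\<lambda>u w. csum \<Delta> (smul (H 2)) w (\<lambda>v t. pl (f u \<otimes>\<^bsub>H 1\<^esub> g v) (h t))) =
        G.peiffer (f \<otimes>\<^bsub>gr 1\<^esub> g) h c"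
      using C.csum3_comp[where f = f and g = g and h = h, OF cl I.B.subspace_of I.B.subspace_of V2 mI plK', of c]
      unfolding I_simps(2) lift_mult lift_pl_I[OF fg h] .
    also have "\<dots> = (lift2 \<Delta> (smul (H 2)) pl f (lift2 \<Delta> (smul (H 1)) (ad I) g h) \<otimes>\<^bsub>gr 2\<^esub>
        lift2 \<Delta> (smul (H 2)) (\<lambda>x k. act_K (d 1 1 x) k) f (lift2 \<Delta> (smul (H 2)) pl g h)) c"
      unfolding lift_ad_I[OF g h] lift_pl_I[OF f adgh] lift_pl_I[OF g h] LQ
        lift_act_K[OF face_points(1)[OF coalg_map_HI[OF f]] pgh]
      by (rule fun_cong[OF G.peiffer_mult_left[OF fN gN hN]])
    also have "\<dots> = csum \<Delta> (smul (H 2)) c (\<lambda>u v.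
        lift2 \<Delta> (smul (H 2)) pl f (lift2 \<Delta> (smul (H 1)) (ad I) g h) u \<otimes>\<^bsub>H 2\<^esub>
        lift2 \<Delta> (smul (H 2)) (\<lambda>x k. act_K (d 1 1 x) k) f (lift2 \<Delta> (smul (H 2)) pl g h) v)"
      by (rule conv_mult)
    also have "\<dots> = csum \<Delta> (smul (H 2)) c (\<lambda>u w. csum \<Delta> (smul (H 2)) w (\<lambda>v t.
        conv3 I I I (smul (H 2)) (mult (H 2)) ?P ?Q (f u) (g v) (h t)))"
      using csum_conv3[OF C BI BI BI V2 K.B.subspace_of K.B.subspace_of mK P Q f g h, of c]
        C.csum3_comp'[where f = f and g = g and h = h, OF cl I.B.subspace_of I.B.subspace_of V2 I.B.ad_bilinear plK']
        C.csum3_comp'[where f = f and g = g and h = h, OF cl I.B.subspace_of K.B.subspace_of V2 pl_bilinear QK']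
      by simp
    finally show "csum \<Delta> (smul (H 2)) c (\<lambda>u w. csum \<Delta> (smul (H 2)) w (\<lambda>v t. pl (f u \<otimes>\<^bsub>H 1\<^esub> g v) (h t))) = \<dots>" .
  qed
  then show ?thesis by (simp add: conv3_def conv2_def)
qed

text \<open>
  The argument \<open>z\<close> occurs in one factor only.  Multiplying the other factor by the counit of \<open>z\<close>
  brings the right-hand side into the form \<open>conv3\<close>, and the counit disappears again when the
  coproduct of \<open>z\<close> is contracted.
\<close>

lemma pl_mult_right:
  assumes x: "x \<in> carrier I" and y: "y \<in> carrier I" and z: "z \<in> carrier I"
  shows "pl x (y \<otimes>\<^bsub>H 1\<^esub> z) = sweedler I (smul (H 2)) x (\<lambda>x' w. sweedler I (smul (H 2)) w (\<lambda>x'' x'''.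
    sweedler I (smul (H 2)) y (\<lambda>y' y''. pl x' y' \<otimes>\<^bsub>H 2\<^esub>
      lifting_act K (d 2 2) pl (act_I (d 1 1 x'') y'') (pl x''' z))))"
proof -
  note BI = I.B.bialgebra_axioms
  let ?ad = "\<lambda>u k. ad (H 2) (s 1 1 u) k" and ?\<alpha> = "\<lambda>x y. act_I (d 1 1 x) y"
  let ?B = "\<lambda>x y z. sweedler I (smul (H 2)) x (\<lambda>x'' x'''. ?ad (?\<alpha> x'' y) (pl x''' z))"
  let ?P = "\<lambda>x y z. smul (H 2) (counit (H 1) z) (pl x y)"
  have \<alpha>: "bilinear_map I I I ?\<alpha>"
    by (rule bilinear_map_compose[OF act_I_bilinear linear_bd(2) linear_map_id])
  have adK: "bilinear_on I K (smul (H 2)) ?ad" and plK: "bilinear_on I I (smul (H 2)) pl"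
    using bilinear_mapD(2)[OF s11_bilinear_I] bilinear_mapD(2)[OF pl_bilinear] by simp_all
  have mK: "bilinear_on K K (smul (H 2)) (mult (H 2))" using K.B.mult_bilinear by simp
  have mI: "bilinear_map I I I (mult (H 1))" using I.B.mult_bilinear_map by simp
  note adc = bilinear_mapD(1)[OF s11_bilinear_I] and \<alpha>c = bilinear_mapD(1)[OF \<alpha>] and plc = bilinear_mapD(1)[OF pl_bilinear]
  have Bt: "trilinear_on I I I (smul (H 2)) ?B"
    by (rule split_first_trilinear[OF BI V2 adK \<alpha> pl_bilinear])
  have Bc: "?B x y z \<in> carrier K" if "x \<in> carrier I" "y \<in> carrier I" "z \<in> carrier I" for x y z
    using I.B.sweedler_closed[OF that(1) K.B.subspace_of, of "\<lambda>x'' x'''. ?ad (?\<alpha> x'' y) (pl x''' z)"]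
      adc[OF \<alpha>c[OF _ that(2)] plc[OF _ that(3)]] by simp
  have cu: "linear_on I (*) (counit (H 1))" using I.B.linear_on_counit by simp
  have Pt: "trilinear_on I I I (smul (H 2)) ?P"
    using plK cu V2 by (auto simp: trilinear_on_def bilinear_on_def linear_on_def vector_space_def mult.commute)
  have Pc: "?P x y z \<in> carrier K" if "x \<in> carrier I" "y \<in> carrier I" "z \<in> carrier I" for x y z
    using K.B.carrier_smul[OF plc[OF that(1,2)]] by simp
  have PtK: "trilinear_on I I I (smul K) ?P" unfolding K_simps(2) by (rule Pt)
  have BtK: "trilinear_on I I I (smul K) ?B" unfolding K_simps(2) by (rule Bt)
  note PQ = PtK Pc BtK Bc
  have "pl x (y \<otimes>\<^bsub>H 1\<^esub> z) = conv3 I I I (smul (H 2)) (mult (H 2)) ?P ?B x y z"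
  proof (rule generic_points3_eq[OF hopf_I hopf_I hopf_I V2 _ _ _ x y z])
    show "trilinear_on I I I (smul (H 2)) (\<lambda>x y z. pl x (y \<otimes>\<^bsub>H 1\<^esub> z))"
      by (rule trilinear_comp'[OF mI plK])
    show "trilinear_on I I I (smul (H 2)) (conv3 I I I (smul (H 2)) (mult (H 2)) ?P ?B)"
      by (rule conv3_trilinear[OF BI BI BI V2 mK PQ])
    fix \<Delta> :: "'a \<times> 'a \<times> 'a \<Rightarrow> _" and \<epsilon> f g h c
    assume C: "cocomm_coalgebra \<Delta> \<epsilon>" and f: "coalg_map \<Delta> \<epsilon> I f" and g: "coalg_map \<Delta> \<epsilon> I g"
      and h: "coalg_map \<Delta> \<epsilon> I h"
    interpret length_two_points H d s \<Delta> \<epsilon> by (rule points[OF C])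
    have fN: "f \<in> G.N1" and gN: "g \<in> G.N1" and hN: "h \<in> G.N1" using f g h by (simp_all add: points_I)
    note cl = coalg_mapD(1)[OF f] coalg_mapD(1)[OF g] coalg_mapD(1)[OF h]
    have gh: "coalg_map \<Delta> \<epsilon> I (g \<otimes>\<^bsub>gr 1\<^esub> h)" using G.N1_closed(1)[OF gN hN] by (simp add: points_I)
    have pfh: "coalg_map \<Delta> \<epsilon> (H 2) (G.peiffer f h)"
      using G.peiffer_N2[OF fN hN] by (intro coalg_map_HK) (simp add: points_K)
    have df: "coalg_map \<Delta> \<epsilon> (H 0) (\<lambda>b. d 1 1 (f b))" by (rule face_points(1)[OF coalg_map_HI[OF f]])
    let ?w = "(\<lambda>b. s 0 0 (d 1 1 (f b))) \<otimes>\<^bsub>gr 1\<^esub> g \<otimes>\<^bsub>gr 1\<^esub> inv\<^bsub>gr 1\<^esub> (\<lambda>b. s 0 0 (d 1 1 (f b)))"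
    have L\<alpha>: "lift2 \<Delta> (smul (H 1)) ?\<alpha> f g = ?w"
      using lift_act_I[OF df coalg_map_HI[OF g]] by (simp add: lift2_def)
    have w: "coalg_map \<Delta> \<epsilon> (H 1) ?w"
      using G.conj_N1[OF _ gN, of "\<lambda>b. d 1 1 (f b)"] df by (intro coalg_map_HI) (simp add: points_I conv_group_simps(1))
    have LP: "csum \<Delta> (smul (H 2)) u (\<lambda>p w. csum \<Delta> (smul (H 2)) w (\<lambda>q r. ?P (f p) (g q) (h r))) =
        lift2 \<Delta> (smul (H 2)) pl f g u" for u
      using coalg_mapD(2)[OF h] by (simp add: lift2_def C.csum_counit(2)[OF V2])
    have "csum \<Delta> (smul (H 2)) c (\<lambda>u w. csum \<Delta> (smul (H 2)) w (\<lambda>v t. pl (f u) (g v \<otimes>\<^bsub>H 1\<^esub> h t))) =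
        G.peiffer f (g \<otimes>\<^bsub>gr 1\<^esub> h) c"
      using C.csum3_comp'[where f = f and g = g and h = h, OF cl I.B.subspace_of I.B.subspace_of V2 mI plK, of c]
      unfolding I_simps(2) lift_mult lift_pl_I[OF f gh] .
    also have "\<dots> = (lift2 \<Delta> (smul (H 2)) pl f g \<otimes>\<^bsub>gr 2\<^esub>
        lift2 \<Delta> (smul (H 2)) ?ad (lift2 \<Delta> (smul (H 1)) ?\<alpha> f g) (lift2 \<Delta> (smul (H 2)) pl f h)) c"
      unfolding L\<alpha> lift_pl_I[OF f g] lift_pl_I[OF f h] lift_s11[OF w pfh]
      by (rule fun_cong[OF G.peiffer_mult_right[OF fN gN hN]])
    also have "\<dots> = csum \<Delta> (smul (H 2)) c (\<lambda>u v. lift2 \<Delta> (smul (H 2)) pl f g u \<otimes>\<^bsub>H 2\<^esub>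
        lift2 \<Delta> (smul (H 2)) ?ad (lift2 \<Delta> (smul (H 1)) ?\<alpha> f g) (lift2 \<Delta> (smul (H 2)) pl f h) v)"
      by (rule conv_mult)
    also have "\<dots> = csum \<Delta> (smul (H 2)) c (\<lambda>u w. csum \<Delta> (smul (H 2)) w (\<lambda>v t.
        conv3 I I I (smul (H 2)) (mult (H 2)) ?P ?B (f u) (g v) (h t)))"
      using csum_conv3[OF C BI BI BI V2 K.B.subspace_of K.B.subspace_of mK PQ f g h, of c]
        split_first[where f = f and g = g and h = h, OF C BI V2 I.B.subspace_of K.B.subspace_of adK \<alpha> pl_bilinear f cl(2,3)] LP
      by simp
    finally show "csum \<Delta> (smul (H 2)) c (\<lambda>u w. csum \<Delta> (smul (H 2)) w (\<lambda>v t. pl (f u) (g v \<otimes>\<^bsub>H 1\<^esub> h t))) = \<dots>" .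
  qed
  also have "\<dots> = sweedler I (smul (H 2)) x (\<lambda>x' w. sweedler I (smul (H 2)) y (\<lambda>y' y''. pl x' y' \<otimes>\<^bsub>H 2\<^esub> ?B w y'' z))"
    unfolding conv3_def conv2_def
  proof (intro I.B.sweedler_cong[OF x] I.B.sweedler_cong[OF y])
    fix x' w y' y'' assume c: "x' \<in> carrier I" "w \<in> carrier I" "y' \<in> carrier I" "y'' \<in> carrier I"
    note mD = bilinear_onD[OF mK, unfolded K_simps(2)]
    have "sweedler I (smul (H 2)) z (\<lambda>z' z''. ?P x' y' z' \<otimes>\<^bsub>H 2\<^esub> ?B w y'' z'') =
      sweedler I (smul (H 2)) z (\<lambda>z' z''. smul (H 2) (counit I z') (pl x' y' \<otimes>\<^bsub>H 2\<^esub> ?B w y'' z''))"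
      using mD(3)[OF plc[OF c(1,3)] Bc[OF c(2,4)]] by (intro I.B.sweedler_cong[OF z]) simp
    also have "\<dots> = pl x' y' \<otimes>\<^bsub>H 2\<^esub> ?B w y'' z"
      using Bt c mD(2,4)[OF plc[OF c(1,3)]] Bc[OF c(2,4)]
      by (intro I.B.sweedler_counit(1)[OF z V2]) (simp add: trilinear_on_def linear_on_def del: I_simps(1) K_simps(1))
    finally show "sweedler I (smul (H 2)) z (\<lambda>z' z''. ?P x' y' z' \<otimes>\<^bsub>H 2\<^esub> ?B w y'' z'') = pl x' y' \<otimes>\<^bsub>H 2\<^esub> ?B w y'' z" .
  qed
  \<comment> \<open>It remains to exchange the sums over the coproducts of \<open>w\<close> and \<open>y\<close>.\<close>
  also have "\<dots> = sweedler I (smul (H 2)) x (\<lambda>x' w. sweedler I (smul (H 2)) w (\<lambda>x'' x'''.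
    sweedler I (smul (H 2)) y (\<lambda>y' y''. pl x' y' \<otimes>\<^bsub>H 2\<^esub> lifting_act K (d 2 2) pl (?\<alpha> x'' y'') (pl x''' z))))"
  proof (rule I.B.sweedler_cong[OF x])
    fix x' w assume x': "x' \<in> carrier I" and w: "w \<in> carrier I"
    have "sweedler I (smul (H 2)) y (\<lambda>y' y''. pl x' y' \<otimes>\<^bsub>H 2\<^esub> ?B w y'' z) =
      sweedler I (smul (H 2)) y (\<lambda>y' y''. sweedler I (smul (H 2)) w (\<lambda>x'' x'''.
        pl x' y' \<otimes>\<^bsub>H 2\<^esub> lifting_act K (d 2 2) pl (?\<alpha> x'' y'') (pl x''' z)))"
    proof (rule I.B.sweedler_cong[OF y])
      fix y' y'' assume y': "y' \<in> carrier I" and y'': "y'' \<in> carrier I"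
      have "linear_on K (smul (H 2)) (\<lambda>k. pl x' y' \<otimes>\<^bsub>H 2\<^esub> k)"
        using mK plc[OF x' y'] by (simp add: bilinear_on_def del: K_simps(1))
      from I.B.linear_on_of_sweedler[OF K.B.subspace_of V2 this w, of "\<lambda>x'' x'''. ?ad (?\<alpha> x'' y'') (pl x''' z)"]
      have "pl x' y' \<otimes>\<^bsub>H 2\<^esub> ?B w y'' z =
          sweedler I (smul (H 2)) w (\<lambda>x'' x'''. pl x' y' \<otimes>\<^bsub>H 2\<^esub> ?ad (?\<alpha> x'' y'') (pl x''' z))"
        using adc[OF \<alpha>c[OF _ y''] plc[OF _ z]] by (simp del: K_simps(1) I_simps(1))
      also have "\<dots> = sweedler I (smul (H 2)) w (\<lambda>x'' x'''. pl x' y' \<otimes>\<^bsub>H 2\<^esub> lifting_act K (d 2 2) pl (?\<alpha> x'' y'') (pl x''' z))"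
        by (rule I.B.sweedler_cong[OF w]) (simp only: lifting_act_eq[OF \<alpha>c[OF _ y''] plc[OF _ z]])
      finally show "pl x' y' \<otimes>\<^bsub>H 2\<^esub> ?B w y'' z = \<dots>" .
    qed
    also have "\<dots> = sweedler I (smul (H 2)) w (\<lambda>x'' x'''. sweedler I (smul (H 2)) y (\<lambda>y' y''.
        pl x' y' \<otimes>\<^bsub>H 2\<^esub> lifting_act K (d 2 2) pl (?\<alpha> x'' y'') (pl x''' z)))"
      unfolding sweedler_lsum case_prod_unfold by (rule vector_space.lsum_swap[OF V2])
    finally show "sweedler I (smul (H 2)) y (\<lambda>y' y''. pl x' y' \<otimes>\<^bsub>H 2\<^esub> ?B w y'' z) = \<dots>" .
  qed
  finally show ?thesis .
qed

lemma pl_d2_mixed: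
  assumes k: "k \<in> carrier K" and x: "x \<in> carrier I"
  shows "sweedler K (smul (H 2)) k (\<lambda>k' k''. sweedler I (smul (H 2)) x (\<lambda>x' x''.
      pl (d 2 2 k') x' \<otimes>\<^bsub>H 2\<^esub> pl x'' (d 2 2 k''))) =
    sweedler K (smul (H 2)) k (\<lambda>k' k''. k' \<otimes>\<^bsub>H 2\<^esub> act_K (d 1 1 x) (antipode (H 2) k''))"
proof -
  note BI = I.B.bialgebra_axioms and BK = K.B.bialgebra_axioms
  let ?P = "\<lambda>k x. pl (d 2 2 k) x" and ?Q = "\<lambda>k x. pl x (d 2 2 k)"
  let ?\<alpha> = "\<lambda>k x. act_K (d 1 1 x) (antipode (H 2) k)"
  have P: "bilinear_map K I K ?P"
    by (rule bilinear_map_compose[OF pl_bilinear linear_bd(1) linear_map_id])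
  have Q: "bilinear_map K I K ?Q"
    by (rule bilinear_map_flip[OF bilinear_map_compose[OF pl_bilinear linear_map_id linear_bd(1)]])
  have \<alpha>: "bilinear_map K I K ?\<alpha>"
    by (rule bilinear_map_flip[OF bilinear_map_compose[OF act_K_bilinear linear_bd(2) linear_S(2)]])
  have mK: "bilinear_on K K (smul (H 2)) (mult (H 2))" using K.B.mult_bilinear by simp
  have "conv2 K I (smul (H 2)) (mult (H 2)) ?P ?Q k x =
      (\<lambda>k x. sweedler K (smul (H 2)) k (\<lambda>k' k''. k' \<otimes>\<^bsub>H 2\<^esub> ?\<alpha> k'' x)) k x"
  proof (rule generic_points2_eq[OF hopf_K hopf_I V2 _ _ _ k x])
    show "bilinear_on K I (smul (H 2)) (conv2 K I (smul (H 2)) (mult (H 2)) ?P ?Q)"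
      by (rule conv2_bilinear[OF BK BI V2 mK P Q])
    show "bilinear_on K I (smul (H 2)) (\<lambda>k x. sweedler K (smul (H 2)) k (\<lambda>k' k''. k' \<otimes>\<^bsub>H 2\<^esub> ?\<alpha> k'' x))"
      by (rule split_second_bilinear[OF BK V2 mK \<alpha>])
    fix \<Delta> :: "'a \<times> 'a \<Rightarrow> _" and \<epsilon> f g c
    assume C: "cocomm_coalgebra \<Delta> \<epsilon>" and f: "coalg_map \<Delta> \<epsilon> K f" and g: "coalg_map \<Delta> \<epsilon> I g"
    interpret length_two_points H d s \<Delta> \<epsilon> by (rule points[OF C])
    note f2 = coalg_map_HK[OF f] and g1 = coalg_map_HI[OF g]
    have fN: "f \<in> G.N2" and gN: "g \<in> G.N1" using f g by (simp_all add: points_I points_K)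
    have flip: "lift2 \<Delta> (smul (H 2)) (\<lambda>k x. \<beta> x k) f g = lift2 \<Delta> (smul (H 2)) \<beta> g f" for \<beta>
      unfolding lift2_def by (rule ext) (rule C.csum_cocomm[OF V2])
    have LP: "lift2 \<Delta> (smul (H 2)) ?P f g = G.peiffer (\<lambda>b. d 2 2 (f b)) g"
      using lift_pl_I[OF points_d2[OF f] g] by (simp add: lift2_def)
    have LQ: "lift2 \<Delta> (smul (H 2)) ?Q f g = G.peiffer g (\<lambda>b. d 2 2 (f b))"
      using lift_pl_I[OF g points_d2[OF f]] flip[of "\<lambda>x k. pl x (d 2 2 k)"] by (simp add: lift2_def)
    have L\<alpha>: "lift2 \<Delta> (smul (H 2)) ?\<alpha> f g = (\<lambda>b. s 1 1 (s 0 0 (d 1 1 (g b)))) \<otimes>\<^bsub>gr 2\<^esub> inv\<^bsub>gr 2\<^esub> f \<otimes>\<^bsub>gr 2\<^esub>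
        inv\<^bsub>gr 2\<^esub> (\<lambda>b. s 1 1 (s 0 0 (d 1 1 (g b))))"
      using lift_act_K[OF face_points(1)[OF g1] lift_S[OF f2]] fun_cong[OF antipode_inv[OF f2]]
        flip[of "\<lambda>x k. act_K (d 1 1 x) (antipode (H 2) k)"] by (simp add: lift2_def)
    have "csum \<Delta> (smul (H 2)) c (\<lambda>u v. conv2 K I (smul (H 2)) (mult (H 2)) ?P ?Q (f u) (g v)) =
        (lift2 \<Delta> (smul (H 2)) ?P f g \<otimes>\<^bsub>gr 2\<^esub> lift2 \<Delta> (smul (H 2)) ?Q f g) c"
      using csum_conv2[OF C BK BI V2 K.B.subspace_of K.B.subspace_of mK P Q f g] by (simp add: conv_mult)
    also have "\<dots> = (f \<otimes>\<^bsub>gr 2\<^esub> lift2 \<Delta> (smul (H 2)) ?\<alpha> f g) c"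
      unfolding LP LQ L\<alpha> by (rule fun_cong[OF G.peiffer_d2_mixed[OF fN gN]])
    also have "\<dots> = csum \<Delta> (smul (H 2)) c (\<lambda>u v. sweedler K (smul (H 2)) (f u) (\<lambda>k' k''. k' \<otimes>\<^bsub>H 2\<^esub> ?\<alpha> k'' (g v)))"
      using split_second[OF C BK V2 K.B.subspace_of mK \<alpha> f coalg_mapD(1)[OF g]] by (simp add: lift_mult)
    finally show "csum \<Delta> (smul (H 2)) c (\<lambda>u v. conv2 K I (smul (H 2)) (mult (H 2)) ?P ?Q (f u) (g v)) = \<dots>" .
  qed
  then show ?thesis by (simp add: conv2_def)
qed

text \<open>The Peiffer identity of the crossed module \<open>d\<^sub>2\<close>, an instance of \<open>conj_d2\<close> at points.\<close>

lemma s11_d2: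
  assumes k: "k \<in> carrier K" and l: "l \<in> carrier K"
  shows "ad (H 2) (s 1 1 (d 2 2 k)) l = ad K k l"
proof (rule generic_points2_eq[OF hopf_K hopf_K V2 _ _ _ k l])
  show "bilinear_on K K (smul (H 2)) (\<lambda>k l. ad (H 2) (s 1 1 (d 2 2 k)) l)"
    using bilinear_mapD(2)[OF bilinear_map_compose[OF s11_bilinear_I linear_bd(1) linear_map_id]] by simp
  show "bilinear_on K K (smul (H 2)) (ad K)"
    using bilinear_mapD(2)[OF K.B.ad_bilinear] by simp
  fix \<Delta> :: "'a \<times> 'a \<Rightarrow> _" and \<epsilon> f g c
  assume C: "cocomm_coalgebra \<Delta> \<epsilon>" and f: "coalg_map \<Delta> \<epsilon> K f" and g: "coalg_map \<Delta> \<epsilon> K g"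
  interpret length_two_points H d s \<Delta> \<epsilon> by (rule points[OF C])
  have fN: "f \<in> G.N2" and gN: "g \<in> G.N2" using f g by (simp_all add: points_K)
  have "lift2 \<Delta> (smul (H 2)) (\<lambda>x k. ad (H 2) (s 1 1 x) k) (\<lambda>b. d 2 2 (f b)) g = lift2 \<Delta> (smul (H 2)) (ad K) f g"
    unfolding lift_s11[OF coalg_map_HI[OF points_d2[OF f]] coalg_map_HK[OF g]] lift_ad_K[OF f g]
    by (rule G.conj_d2[OF fN gN])
  from fun_cong[OF this, of c]
  show "csum \<Delta> (smul (H 2)) c (\<lambda>u v. ad (H 2) (s 1 1 (d 2 2 (f u))) (g v)) = csum \<Delta> (smul (H 2)) c (\<lambda>u v. ad K (f u) (g v))"
    by (simp add: lift2_def)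
qed

lemma hopf_map_s11_I: "hopf_map I (H 2) (s 1 1)"
  by (rule hopf_map_comp[OF I.B.bialgebra_axioms bialg bialg I.incl maps(11)])

lemma hopf_map_s11_s00: "hopf_map (H 0) (H 2) (\<lambda>a. s 1 1 (s 0 0 a))"
  by (rule hopf_map_comp[OF bialg bialg bialg maps(9) maps(11)])

lemma module_act_K: "module_bialgebra (H 0) K act_K"
proof -
  interpret adjoint_module K "H 2" "H 0" "\<lambda>a. s 1 1 (s 0 0 a)"
    by (intro adjoint_module.intro adjoint_module_axioms.intro K.inclusion_axioms hopf hopf_map_s11_s00
        bilinear_mapD(1)[OF act_K_bilinear])
  show ?thesis by (rule module_bialgebra_act)
qed

lemma module_act_I: "module_bialgebra (H 0) I act_I"
proof -
  interpret adjoint_module I "H 1" "H 0" "s 0 0"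
    by (intro adjoint_module.intro adjoint_module_axioms.intro I.inclusion_axioms hopf maps(9)
        bilinear_mapD(1)[OF act_I_bilinear])
  show ?thesis by (rule module_bialgebra_act)
qed

lemma module_ad: "module_bialgebra (H 0) (H 0) (ad (H 0))"
proof -
  interpret adjoint_module "H 0" "H 0" "H 0" "\<lambda>x. x"
    by (intro adjoint_module.intro adjoint_module_axioms.intro inclusion_refl[OF hopf] hopf
        inclusion.incl[OF inclusion_refl[OF hopf]] bilinear_mapD(1)[OF cocommutative_hopf_algebra.ad_bilinear[OF hopf]])
  show ?thesis by (rule module_bialgebra_act)
qed

lemma module_lifting_act: "module_bialgebra I K (lifting_act K (d 2 2) pl)"
proof -
  interpret adjoint_module K "H 2" I "s 1 1"
    by (intro adjoint_module.intro adjoint_module_axioms.intro K.inclusion_axioms hopf_I hopf_map_s11_I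
        bilinear_mapD(1)[OF s11_bilinear_I])
  show ?thesis by (rule module_bialgebra_cong[OF module_bialgebra_act lifting_act_eq])
qed

lemma d2_s11:
  assumes x: "x \<in> carrier I" and k: "k \<in> carrier K"
  shows "d 2 2 (ad (H 2) (s 1 1 x) k) = ad I x (d 2 2 k)"
proof -
  have x1: "x \<in> carrier (H 1)" and k2: "k \<in> carrier (H 2)"
    by (rule I.carrier_incl[OF x] K.carrier_incl[OF k])+
  have "d 2 2 (s 1 1 x) = x"
    using face_degeneracy_Suc[of 1 1 x] x1 by (simp add: eval_nat_numeral One_nat_def)
  then show ?thesis
    by (simp add: hopf_map_ad[OF hopf hopf maps(5) hopf_mapD(1)[OF maps(11) x1] k2] I.ad_incl[OF x d2_closed[OF k]])
qed

theorem hopf_crossed_module_lifting: "hopf_crossed_module K I (d 2 2) (lifting_act K (d 2 2) pl)"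
proof (intro hopf_crossed_module.intro hopf_crossed_module_axioms.intro hopf_K hopf_I module_lifting_act hopf_map_bd)
  show "d 2 2 (lifting_act K (d 2 2) pl x v) = ad I x (d 2 2 v)" if "x \<in> carrier I" "v \<in> carrier K" for x v
    unfolding lifting_act_eq[OF that] by (rule d2_s11[OF that])
  show "lifting_act K (d 2 2) pl (d 2 2 u) v = ad K u v" if "u \<in> carrier K" "v \<in> carrier K" for u v
    unfolding lifting_act_eq[OF d2_closed[OF that(1)] that(2)] by (rule s11_d2[OF that])
qed

lemma d1_d2:
  assumes k: "k \<in> carrier K"
  shows "d 1 1 (d 2 2 k) = smul (H 0) (counit K k) \<one>\<^bsub>H 0\<^esub>"
proof -
  have "d 1 1 (d 2 2 k) = d 1 1 (d 2 1 k)"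
    using face_face[of 1 1 0 k] K.carrier_incl[OF k] by (simp add: eval_nat_numeral One_nat_def)
  also have "d 2 1 k = smul (H 1) (counit (H 2) k) \<one>\<^bsub>H 1\<^esub>"
    using k by (intro hopf_kernel.HKer_eval[OF kernels(3)]) simp
  finally show ?thesis
    using hopf_mapD(2,4)[OF maps(2)] I.A.one_closed by (simp add: linear_on_def)
qed

lemma d2_act_K:
  assumes a: "a \<in> carrier (H 0)" and k: "k \<in> carrier K"
  shows "d 2 2 (act_K a k) = act_I a (d 2 2 k)"
proof -
  have a1: "s 0 0 a \<in> carrier (H 1)" by (rule hopf_mapD(1)[OF maps(9) a])
  have "d 2 2 (s 1 1 (s 0 0 a)) = s 0 0 a"
    using face_degeneracy_Suc[of 1 1 "s 0 0 a"] a1 by (simp add: eval_nat_numeral One_nat_def)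
  then show ?thesis
    by (simp add: hopf_map_ad[OF hopf hopf maps(5) hopf_mapD(1)[OF maps(11) a1] K.carrier_incl[OF k]])
qed

lemma d1_act_I:
  assumes a: "a \<in> carrier (H 0)" and x: "x \<in> carrier I"
  shows "d 1 1 (act_I a x) = ad (H 0) a (d 1 1 x)"
proof -
  have "d 1 1 (s 0 0 a) = a"
    using face_degeneracy_Suc[of 0 0 a] a by (simp add: One_nat_def)
  then show ?thesis
    by (simp add: hopf_map_ad[OF hopf hopf maps(2) hopf_mapD(1)[OF maps(9) a] I.carrier_incl[OF x]])
qed

theorem two_crossed_module: "hopf_two_crossed_module K I (H 0) (d 2 2) (d 1 1) act_K act_I pl"
proof (intro hopf_two_crossed_module.intro hopf_two_crossed_module_axioms.intro hopf_K hopf_I hopf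
    module_act_K module_act_I module_ad hopf_map_bd d1_d2 pl_bilinear d2_act_K d1_act_I hopf_crossed_module_lifting)
qed (simp_all only: I_simps(2-) K_simps(2-) pl_equivariant d2_pl pl_d2_d2 pl_mult_right pl_mult_left pl_d2_mixed)

end

theorem theorem6p14:
  fixes H :: "nat \<Rightarrow> ('k::field, 'a::ab_group_add) hopf"
    and d s :: "nat \<Rightarrow> nat \<Rightarrow> 'a \<Rightarrow> 'a"
  assumes "simplicial_hopf_algebra H d s"
    and "moore_length H d 2"
  shows "hopf_two_crossed_module (moore H d 2) (moore H d 1) (H 0) (d 2 2) (d 1 1)
    (\<lambda>n l. ad (H 2) (s 1 1 (s 0 0 n)) l)
    (\<lambda>n m. ad (H 1) (s 0 0 n) m)
    (\<lambda>x y. sweedler (H 1) (smul (H 2)) x (\<lambda>x' x''. sweedler (H 1) (smul (H 2)) y (\<lambda>y' y''.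
       ad (H 2) (s 1 1 x') (s 1 1 y') \<otimes>\<^bsub>H 2\<^esub>
       antipode (H 2) (ad (H 2) (s 1 0 x'') (s 1 1 y'')))))"
proof -
  interpret length_two H d s
    using assms by (simp add: length_two_def length_two_axioms_def)
  show ?thesis
    using two_crossed_module unfolding pl_def .
qed

end
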